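(* Let $\mathfrak g$ be either $G(3)$ or $F(4)$ (over $\mathbb C$). Let $\Xi$ be any of the systems of simple roots of $\mathfrak g$ listed in the context, let $N$ be its index set ($N=\{1,2,3\}$ for $G(3)$, $N=\{1,2,3,4\}$ for $F(4)$), and let $S\subseteq N$ be nonempty. Let $\mathfrak g=\bigoplus_{k=-\mu}^{\mu}\mathfrak g_k$ be the associated grading, $\mathfrak m^{\Xi}_S=\bigoplus_{k<0}\mathfrak g_k$ and $\mathfrak g^{\Xi,S}_0$ the degree-zero part. (a) If $(\Xi,S)$ is not one of the exceptional pairs listed below, then the Tanaka–Weisfeiler prolongation satisfies $\operatorname{pr}(\mathfrak m^{\Xi}_S)=\mathfrak g$ (i.e. the natural graded embedding $\mathfrak g\hookrightarrow \operatorname{pr}(\mathfrak m^\Xi_S)$ is an isomorphism). (b) If $(\Xi,S)$ is one of the exceptional pairs, then $\operatorname{pr}(\mathfrak m^{\Xi}_S)$ is infinite-dimensional, while $\operatorname{pr}(\mathfrak m^{\Xi}_S,\mathfrak g^{\Xi,S}_0)=\mathfrak g$. The exceptional pairs are: for $G(3)$: $(\mathrm I,\{1\})$, $(\mathrm{III},\{1\})$, $(\mathrm{IV},\{1\})$ (the odd and the mixed contact gradings); for $F(4)$: $(\mathrm I,\{1\})$; $(\mathrm I,\{4\}),(\mathrm{II},\{4\}),(\mathrm{III},\{1\}),(\mathrm{IV},\{1\}),(\mathrm V,\{1\})$ (the depth-one grading); $(\mathrm{III},\{3\}),(\mathrm{IV},\{4\}),(\mathrm V,\{4\}),(\mathr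m{VI},\{4\})$.
   Context: $G(3)$ is the exceptional complex simple Lie superalgebra of superdimension $(17|14)$ with Cartan subalgebra $\mathfrak h\subset\mathfrak g_{\bar 0}$, $\dim\mathfrak h=3$; $\mathfrak h^*$ is spanned by $\delta,\varepsilon_1,\varepsilon_2,\varepsilon_3$ subject only to $\varepsilon_1+\varepsilon_2+\varepsilon_3=0$. Even roots: $\pm2\delta,\pm\varepsilon_i,\varepsilon_i-\varepsilon_j$ ($i\neq j$); odd roots: $\pm\delta,\pm\delta\pm\varepsilon_i$; root spaces are one-dimensional. Systems of simple roots $\Pi_\Xi=(\alpha_1,\alpha_2,\alpha_3)$: I: $(\delta-\varepsilon_1-\varepsilon_2,\ \varepsilon_1,\ \varepsilon_2-\varepsilon_1)$; II: $(\varepsilon_1+\varepsilon_2-\delta,\ \delta-\varepsilon_2,\ \varepsilon_2-\varepsilon_1)$; III: $(\varepsilon_2-\delta,\ \delta-\varepsilon_1,\ \varepsilon_1)$; IV: $(\varepsilon_2-\varepsilon_1,\ \varepsilon_1-\delta,\ \delta)$. $F(4)$ is the exceptional complex simple Lie superalgebra of superdimension $(24|16)$ with Cartan subalgebra $\mathfrak h\subset\mathfrak g_{\bar0}$, $\dim\mathfrak h=4$, $\mathfrak h^*$ having basis $\delta,\varepsilon_1,\varepsilon_2,\varepsilon_3$. Even roots: $\pm\delta,\pm\varepsilon_i,\pm\varepsilon_i\pm\varepsilon_j$ ($i<j$); odd roots: $\tfrac12(\pm\delta\pm\varepsilon_1\pm\varepsilon_2\pm\varepsilon_3)$; root spaces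 one-dimensional. Systems of simple roots $\Pi_\Xi=(\alpha_1,\alpha_2,\alpha_3,\alpha_4)$: I: $(\tfrac12(\delta-\varepsilon_1-\varepsilon_2-\varepsilon_3),\varepsilon_3,\varepsilon_2-\varepsilon_3,\varepsilon_1-\varepsilon_2)$; II: $(\tfrac12(-\delta+\varepsilon_1+\varepsilon_2+\varepsilon_3),\tfrac12(\delta-\varepsilon_1-\varepsilon_2+\varepsilon_3),\varepsilon_2-\varepsilon_3,\varepsilon_1-\varepsilon_2)$; III: $(\varepsilon_1-\varepsilon_2,\tfrac12(\delta-\varepsilon_1+\varepsilon_2-\varepsilon_3),\tfrac12(-\delta+\varepsilon_1+\varepsilon_2-\varepsilon_3),\varepsilon_3)$; IV: $(\tfrac12(\delta+\varepsilon_1-\varepsilon_2-\varepsilon_3),\tfrac12(\delta-\varepsilon_1+\varepsilon_2+\varepsilon_3),\tfrac12(-\delta+\varepsilon_1-\varepsilon_2+\varepsilon_3),\varepsilon_2-\varepsilon_3)$; V: $(\delta,\tfrac12(-\delta+\varepsilon_1-\varepsilon_2-\varepsilon_3),\varepsilon_3,\varepsilon_2-\varepsilon_3)$; VI: $(\delta,\tfrac12(-\delta-\varepsilon_1+\varepsilon_2+\varepsilon_3),\varepsilon_1-\varepsilon_2,\varepsilon_2-\varepsilon_3)$. Grading: for a fixed $\Xi$ every root is $\alpha=\sum_i m_i\alpha_i$ with integers $m_i$ all $\ge0$ or all $\le0$. For nonempty $S\subseteq N$, the root space of $\alpha$ is put in degree $\sum_{i\in S}m_i$ and $\mathfrak h$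 in degree $0$; this gives a $\mathbb Z$-grading $\mathfrak g=\bigoplus_{k=-\mu}^{\mu}\mathfrak g_k$ (the grading of the parabolic $\mathfrak p^\Xi_S=\bigoplus_{k\ge0}\mathfrak g_k$), and $\mathfrak m^\Xi_S=\bigoplus_{k<0}\mathfrak g_k$ is generated by $\mathfrak g_{-1}$. Tanaka–Weisfeiler prolongation: for a negatively graded Lie superalgebra $\mathfrak m=\bigoplus_{k=-\mu}^{-1}\mathfrak g_k$, $\operatorname{pr}(\mathfrak m)=\bigoplus_{k\ge-\mu}\mathfrak g_k$ is the maximal $\mathbb Z$-graded Lie superalgebra whose negative part is $\mathfrak m$ and which is transitive (if $X\in\mathfrak g_k$, $k\ge0$, and $[X,\mathfrak g_{-1}]=0$ then $X=0$). For a subalgebra $\mathfrak g_0$ of the grade-preserving derivations of $\mathfrak m$, $\operatorname{pr}(\mathfrak m,\mathfrak g_0)$ is defined in the same way but with degree-zero part required to be $\mathfrak g_0$. *)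

theory Defs
  imports Complex_Main "HOL-Library.Function_Algebras"
begin

text \<open>A super vector space is given by a scalar multiplication sc and the even (P False)
and odd (P True) subspaces; its carrier is their sum.\<close>

definition car :: "(bool \<Rightarrow> 'a::ab_group_add set) \<Rightarrow> 'a set" where
  "car P = {x + y | x y. x \<in> P False \<and> y \<in> P True}"

definition sgnp :: "bool \<Rightarrow> bool \<Rightarrow> complex" where
  "sgnp p q = (if p \<and> q then -1 else 1)"

definition lie_superalgebra ::
  "(complex \<Rightarrow> 'a::ab_group_add \<Rightarrow> 'a) \<Rightarrow> (bool \<Rightarrow> 'a set) \<Rightarrow> ('a \<Rightarrow> 'a \<Rightarrow> 'a) \<Rightarrow> bool" where
  "lie_superalgebra sc P br \<longleftrightarrow>
     vector_space sc \<and> (\<forall>p. module.subspace sc (P p)) \<and> P False \<inter> P True = {0} \<and>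
     (\<forall>x\<in>car P. \<forall>y\<in>car P. \<forall>z\<in>car P. \<forall>a.
        br (sc a x + y) z = sc a (br x z) + br y z \<and> br z (sc a x + y) = sc a (br z x) + br z y) \<and>
     (\<forall>p q. \<forall>x\<in>P p. \<forall>y\<in>P q. br x y \<in> P (p \<noteq> q)) \<and>
     (\<forall>p q. \<forall>x\<in>P p. \<forall>y\<in>P q. br x y = - sc (sgnp p q) (br y x)) \<and>
     (\<forall>p q r. \<forall>x\<in>P p. \<forall>y\<in>P q. \<forall>z\<in>P r.
        br x (br y z) = br (br x y) z + sc (sgnp p q) (br y (br x z)))"

definition simple_lsa ::
  "(complex \<Rightarrow> 'a::ab_group_add \<Rightarrow> 'a) \<Rightarrow> (bool \<Rightarrow> 'a set) \<Rightarrow> ('a \<Rightarrow> 'a \<Rightarrow> 'a) \<Rightarrow> bool" where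
  "simple_lsa sc P br \<longleftrightarrow>
     (\<exists>x\<in>car P. \<exists>y\<in>car P. br x y \<noteq> 0) \<and>
     (\<forall>I. module.subspace sc I \<and> I \<subseteq> car P \<and>
          (\<forall>x\<in>I. \<exists>a\<in>I \<inter> P False. \<exists>b\<in>I \<inter> P True. x = a + b) \<and>
          (\<forall>x\<in>car P. \<forall>y\<in>I. br x y \<in> I)
          \<longrightarrow> I = {0} \<or> I = car P)"

definition graded_lsa ::
  "(complex \<Rightarrow> 'a::ab_group_add \<Rightarrow> 'a) \<Rightarrow> (bool \<Rightarrow> 'a set) \<Rightarrow> ('a \<Rightarrow> 'a \<Rightarrow> 'a) \<Rightarrow> (int \<Rightarrow> 'a set) \<Rightarrow> bool" where
  "graded_lsa sc P br G \<longleftrightarrow>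
     lie_superalgebra sc P br \<and>
     (\<forall>k. module.subspace sc (G k) \<and> G k \<subseteq> car P \<and>
          (\<forall>x\<in>G k. \<exists>a\<in>G k \<inter> P False. \<exists>b\<in>G k \<inter> P True. x = a + b)) \<and>
     car P \<subseteq> module.span sc (\<Union>k. G k) \<and>
     (\<forall>F f. finite F \<and> (\<forall>k\<in>F. f k \<in> G k) \<and> sum f F = 0 \<longrightarrow> (\<forall>k\<in>F. f k = 0)) \<and>
     (\<forall>i j. \<forall>x\<in>G i. \<forall>y\<in>G j. br x y \<in> G (i + j))"

definition transitive_gr :: "('a::ab_group_add \<Rightarrow> 'a \<Rightarrow> 'a) \<Rightarrow> (int \<Rightarrow> 'a set) \<Rightarrow> bool" where
  "transitive_gr br G \<longleftrightarrow>
     (\<forall>k\<ge>0. \<forall>x\<in>G k. (\<forall>y\<in>G (-1). br x y = 0) \<longrightarrow> x = 0)"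

definition negpart :: "(complex \<Rightarrow> 'a::ab_group_add \<Rightarrow> 'a) \<Rightarrow> (int \<Rightarrow> 'a set) \<Rightarrow> 'a set" where
  "negpart sc G = module.span sc (\<Union>k\<in>{k. k < 0}. G k)"

definition trans_ext ::
  "(complex \<Rightarrow> 'a::ab_group_add \<Rightarrow> 'a) \<Rightarrow> (bool \<Rightarrow> 'a set) \<Rightarrow> ('a \<Rightarrow> 'a \<Rightarrow> 'a) \<Rightarrow> (int \<Rightarrow> 'a set) \<Rightarrow>
   (complex \<Rightarrow> 'b::ab_group_add \<Rightarrow> 'b) \<Rightarrow> (bool \<Rightarrow> 'b set) \<Rightarrow> ('b \<Rightarrow> 'b \<Rightarrow> 'b) \<Rightarrow> (int \<Rightarrow> 'b set) \<Rightarrow>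
   ('a \<Rightarrow> 'b) \<Rightarrow> bool" where
  "trans_ext sc P br G sc' P' br' G' \<phi> \<longleftrightarrow>
     graded_lsa sc' P' br' G' \<and> transitive_gr br' G' \<and>
     (\<forall>k<0. bij_betw \<phi> (G k) (G' k) \<and> (\<forall>p. \<phi> ` (G k \<inter> P p) = G' k \<inter> P' p)) \<and>
     (\<forall>x\<in>negpart sc G. \<forall>y\<in>negpart sc G. \<forall>a. \<phi> (sc a x + y) = sc' a (\<phi> x) + \<phi> y) \<and>
     (\<forall>x\<in>negpart sc G. \<forall>y\<in>negpart sc G. \<phi> (br x y) = br' (\<phi> x) (\<phi> y))"

definition embeds_into ::
  "(complex \<Rightarrow> 'a::ab_group_add \<Rightarrow> 'a) \<Rightarrow> (bool \<Rightarrow> 'a set) \<Rightarrow> ('a \<Rightarrow> 'a \<Rightarrow> 'a) \<Rightarrow> (int \<Rightarrow> 'a set) \<Rightarrow>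
   (complex \<Rightarrow> 'b::ab_group_add \<Rightarrow> 'b) \<Rightarrow> (bool \<Rightarrow> 'b set) \<Rightarrow> ('b \<Rightarrow> 'b \<Rightarrow> 'b) \<Rightarrow> (int \<Rightarrow> 'b set) \<Rightarrow>
   ('a \<Rightarrow> 'b) \<Rightarrow> bool" where
  "embeds_into sc P br G sc' P' br' G' \<phi> \<longleftrightarrow>
     (\<exists>\<psi>. (\<forall>x\<in>car P'. \<forall>y\<in>car P'. \<forall>a. \<psi> (sc' a x + y) = sc a (\<psi> x) + \<psi> y) \<and>
          inj_on \<psi> (car P') \<and>
          (\<forall>k. \<psi> ` G' k \<subseteq> G k) \<and> (\<forall>p. \<psi> ` P' p \<subseteq> P p) \<and>
          (\<forall>x\<in>car P'. \<forall>y\<in>car P'. \<psi> (br' x y) = br (\<psi> x) (\<psi> y)) \<and>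
          (\<forall>x\<in>negpart sc G. \<psi> (\<phi> x) = x))"

definition same_zero_part ::
  "(complex \<Rightarrow> 'a::ab_group_add \<Rightarrow> 'a) \<Rightarrow> ('a \<Rightarrow> 'a \<Rightarrow> 'a) \<Rightarrow> (int \<Rightarrow> 'a set) \<Rightarrow>
   ('b::ab_group_add \<Rightarrow> 'b \<Rightarrow> 'b) \<Rightarrow> (int \<Rightarrow> 'b set) \<Rightarrow> ('a \<Rightarrow> 'b) \<Rightarrow> bool" where
  "same_zero_part sc br G br' G' \<phi> \<longleftrightarrow>
     (\<forall>X'\<in>G' 0. \<exists>X\<in>G 0. \<forall>y\<in>negpart sc G. br' X' (\<phi> y) = \<phi> (br X y)) \<and>
     (\<forall>X\<in>G 0. \<exists>X'\<in>G' 0. \<forall>y\<in>negpart sc G. br' X' (\<phi> y) = \<phi> (br X y))"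

text \<open>pr(m) = g: g (with the identity on m) is a transitive extension of m, and it is maximal:
every transitive graded Lie superalgebra with negative part m (on any carrier type 'w)
embeds into g over m.\<close>
definition pr_equals ::
  "'w::ab_group_add itself \<Rightarrow> (complex \<Rightarrow> 'a::ab_group_add \<Rightarrow> 'a) \<Rightarrow> (bool \<Rightarrow> 'a set) \<Rightarrow>
   ('a \<Rightarrow> 'a \<Rightarrow> 'a) \<Rightarrow> (int \<Rightarrow> 'a set) \<Rightarrow> bool" where
  "pr_equals _ sc P br G \<longleftrightarrow>
     trans_ext sc P br G sc P br G id \<and>
     (\<forall>(sc' :: complex \<Rightarrow> 'w \<Rightarrow> 'w) P' br' G' \<phi>.
        trans_ext sc P br G sc' P' br' G' \<phi> \<longrightarrow> embeds_into sc P br G sc' P' br' G' \<phi>)"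

definition pr0_equals ::
  "'w::ab_group_add itself \<Rightarrow> (complex \<Rightarrow> 'a::ab_group_add \<Rightarrow> 'a) \<Rightarrow> (bool \<Rightarrow> 'a set) \<Rightarrow>
   ('a \<Rightarrow> 'a \<Rightarrow> 'a) \<Rightarrow> (int \<Rightarrow> 'a set) \<Rightarrow> bool" where
  "pr0_equals _ sc P br G \<longleftrightarrow>
     trans_ext sc P br G sc P br G id \<and>
     (\<forall>(sc' :: complex \<Rightarrow> 'w \<Rightarrow> 'w) P' br' G' \<phi>.
        trans_ext sc P br G sc' P' br' G' \<phi> \<and> same_zero_part sc br G br' G' \<phi>
          \<longrightarrow> embeds_into sc P br G sc' P' br' G' \<phi>)"

definition fin_dim :: "(complex \<Rightarrow> 'a::ab_group_add \<Rightarrow> 'a) \<Rightarrow> (bool \<Rightarrow> 'a set) \<Rightarrow> bool" where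
  "fin_dim sc P \<longleftrightarrow> (\<exists>B. finite B \<and> car P \<subseteq> module.span sc B)"

text \<open>pr(m) is infinite-dimensional: some transitive extension of m is infinite-dimensional
(equivalently, since every transitive extension embeds into pr(m) and pr(m) has countable
dimension, realised on a carrier inside the type nat => complex).\<close>
definition pr_infinite ::
  "(complex \<Rightarrow> 'a::ab_group_add \<Rightarrow> 'a) \<Rightarrow> (bool \<Rightarrow> 'a set) \<Rightarrow> ('a \<Rightarrow> 'a \<Rightarrow> 'a) \<Rightarrow> (int \<Rightarrow> 'a set) \<Rightarrow> bool" where
  "pr_infinite sc P br G \<longleftrightarrow>
     (\<exists>(sc' :: complex \<Rightarrow> (nat \<Rightarrow> complex) \<Rightarrow> (nat \<Rightarrow> complex)) P' br' G' \<phi>.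
        trans_ext sc P br G sc' P' br' G' \<phi> \<and> \<not> fin_dim sc' P')"

datatype algtype = G3 | F4

text \<open>Coefficient vectors c : nat => complex encode c 0 * delta + c 1 * eps1 + c 2 * eps2 + c 3 * eps3.\<close>
definition ev :: "nat \<Rightarrow> nat \<Rightarrow> complex" where
  "ev i = (\<lambda>n. if n = i then 1 else 0)"

definition cv :: "complex \<Rightarrow> complex \<Rightarrow> complex \<Rightarrow> complex \<Rightarrow> nat \<Rightarrow> complex" where
  "cv d a b c = (\<lambda>n. if n = 0 then d else if n = 1 then a else if n = 2 then b else if n = 3 then c else 0)"

definition fnl :: "('v \<Rightarrow> complex) \<Rightarrow> (nat \<Rightarrow> 'v \<Rightarrow> complex) \<Rightarrow> (nat \<Rightarrow> complex) \<Rightarrow> 'v \<Rightarrow> complex" where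
  "fnl \<delta> \<epsilon> c = (\<lambda>H. c 0 * \<delta> H + c 1 * \<epsilon> 1 H + c 2 * \<epsilon> 2 H + c 3 * \<epsilon> 3 H)"

definition even_roots :: "algtype \<Rightarrow> (nat \<Rightarrow> complex) set" where
  "even_roots T = (case T of
     G3 \<Rightarrow> {(\<lambda>n. s * ev 0 n) | s. s \<in> {2, -2}}
         \<union> {(\<lambda>n. s * ev i n) | s i. s \<in> {1, -1} \<and> i \<in> {1, 2, 3}}
         \<union> {(\<lambda>n. ev i n - ev j n) | i j. i \<in> {1, 2, 3} \<and> j \<in> {1, 2, 3} \<and> i \<noteq> j}
   | F4 \<Rightarrow> {(\<lambda>n. s * ev 0 n) | s. s \<in> {1, -1}}
         \<union> {(\<lambda>n. s * ev i n) | s i. s \<in> {1, -1} \<and> i \<in> {1, 2, 3}}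
         \<union> {(\<lambda>n. s * ev i n + t * ev j n) | s t i j. s \<in> {1, -1} \<and> t \<in> {1, -1} \<and>
                i \<in> {1, 2, 3} \<and> j \<in> {1, 2, 3} \<and> i < j})"

definition odd_roots :: "algtype \<Rightarrow> (nat \<Rightarrow> complex) set" where
  "odd_roots T = (case T of
     G3 \<Rightarrow> {(\<lambda>n. s * ev 0 n) | s. s \<in> {1, -1}}
         \<union> {(\<lambda>n. s * ev 0 n + t * ev i n) | s t i. s \<in> {1, -1} \<and> t \<in> {1, -1} \<and> i \<in> {1, 2, 3}}
   | F4 \<Rightarrow> {(\<lambda>n. (1/2) * (s0 * ev 0 n + s1 * ev 1 n + s2 * ev 2 n + s3 * ev 3 n)) | s0 s1 s2 s3.
              s0 \<in> {1, -1} \<and> s1 \<in> {1, -1} \<and> s2 \<in> {1, -1} \<and> s3 \<in> {1, -1}})"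

definition roots :: "algtype \<Rightarrow> (nat \<Rightarrow> complex) set" where
  "roots T = even_roots T \<union> odd_roots T"

definition Nset :: "algtype \<Rightarrow> nat set" where
  "Nset T = (case T of G3 \<Rightarrow> {1, 2, 3} | F4 \<Rightarrow> {1, 2, 3, 4})"

text \<open>Labels of the systems of simple roots: I..IV (G(3)), I..VI (F(4)) as 1..4, 1..6.\<close>
definition Xis :: "algtype \<Rightarrow> nat set" where
  "Xis T = (case T of G3 \<Rightarrow> {1, 2, 3, 4} | F4 \<Rightarrow> {1, 2, 3, 4, 5, 6})"

definition simple_roots :: "algtype \<Rightarrow> nat \<Rightarrow> (nat \<Rightarrow> complex) list" where
  "simple_roots T \<Xi> = (let h = (1/2 :: complex) in case T of
     G3 \<Rightarrow> (if \<Xi> = 1 then [cv 1 (-1) (-1) 0, cv 0 1 0 0, cv 0 (-1) 1 0]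
           else if \<Xi> = 2 then [cv (-1) 1 1 0, cv 1 0 (-1) 0, cv 0 (-1) 1 0]
           else if \<Xi> = 3 then [cv (-1) 0 1 0, cv 1 (-1) 0 0, cv 0 1 0 0]
           else [cv 0 (-1) 1 0, cv (-1) 1 0 0, cv 1 0 0 0])
   | F4 \<Rightarrow> (if \<Xi> = 1 then [cv h (-h) (-h) (-h), cv 0 0 0 1, cv 0 0 1 (-1), cv 0 1 (-1) 0]
           else if \<Xi> = 2 then [cv (-h) h h h, cv h (-h) (-h) h, cv 0 0 1 (-1), cv 0 1 (-1) 0]
           else if \<Xi> = 3 then [cv 0 1 (-1) 0, cv h (-h) h (-h), cv (-h) h h (-h), cv 0 0 0 1]
           else if \<Xi> = 4 then [cv h h (-h) (-h), cv h (-h) h h, cv (-h) h (-h) h, cv 0 0 1 (-1)]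
           else if \<Xi> = 5 then [cv 1 0 0 0, cv (-h) h (-h) (-h), cv 0 0 0 1, cv 0 0 1 (-1)]
           else [cv 1 0 0 0, cv (-h) (-h) h h, cv 0 1 (-1) 0, cv 0 0 1 (-1)]))"

definition simple_root :: "algtype \<Rightarrow> nat \<Rightarrow> nat \<Rightarrow> nat \<Rightarrow> complex" where
  "simple_root T \<Xi> i = simple_roots T \<Xi> ! (i - 1)"

definition root_space ::
  "(complex \<Rightarrow> 'v::ab_group_add \<Rightarrow> 'v) \<Rightarrow> (bool \<Rightarrow> 'v set) \<Rightarrow> ('v \<Rightarrow> 'v \<Rightarrow> 'v) \<Rightarrow> 'v set \<Rightarrow>
   ('v \<Rightarrow> complex) \<Rightarrow> 'v set" where
  "root_space sc P br h \<alpha> = {x \<in> car P. \<forall>H\<in>h. br H x = sc (\<alpha> H) x}"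

definition lin_on :: "(complex \<Rightarrow> 'v::ab_group_add \<Rightarrow> 'v) \<Rightarrow> 'v set \<Rightarrow> ('v \<Rightarrow> complex) \<Rightarrow> bool" where
  "lin_on sc h f \<longleftrightarrow> (\<forall>x\<in>h. \<forall>y\<in>h. \<forall>a. f (sc a x + y) = a * f x + f y)"

text \<open>(sc,P,br) is the Lie superalgebra T (= G(3) or F(4)) with Cartan subalgebra h and
delta, eps_1, eps_2, eps_3 in h^* as in the context: a simple complex Lie superalgebra of the
stated superdimension whose root decomposition with respect to h is the listed one.\<close>
definition is_alg ::
  "algtype \<Rightarrow> (complex \<Rightarrow> 'v::ab_group_add \<Rightarrow> 'v) \<Rightarrow> (bool \<Rightarrow> 'v set) \<Rightarrow> ('v \<Rightarrow> 'v \<Rightarrow> 'v) \<Rightarrow>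
   'v set \<Rightarrow> ('v \<Rightarrow> complex) \<Rightarrow> (nat \<Rightarrow> 'v \<Rightarrow> complex) \<Rightarrow> bool" where
  "is_alg T sc P br h \<delta> \<epsilon> \<longleftrightarrow>
     lie_superalgebra sc P br \<and> simple_lsa sc P br \<and>
     vector_space.dim sc (P False) = (case T of G3 \<Rightarrow> 17 | F4 \<Rightarrow> 24) \<and>
     vector_space.dim sc (P True) = (case T of G3 \<Rightarrow> 14 | F4 \<Rightarrow> 16) \<and>
     module.subspace sc h \<and> h \<subseteq> P False \<and>
     vector_space.dim sc h = (case T of G3 \<Rightarrow> 3 | F4 \<Rightarrow> 4) \<and>
     (\<forall>H1\<in>h. \<forall>H2\<in>h. br H1 H2 = 0) \<and>
     lin_on sc h \<delta> \<and> (\<forall>i\<in>{1,2,3}. lin_on sc h (\<epsilon> i)) \<and>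
     (case T of
        G3 \<Rightarrow> (\<forall>H\<in>h. \<epsilon> 1 H + \<epsilon> 2 H + \<epsilon> 3 H = 0) \<and>
              (\<forall>a b c. (\<forall>H\<in>h. a * \<delta> H + b * \<epsilon> 1 H + c * \<epsilon> 2 H = 0) \<longrightarrow> a = 0 \<and> b = 0 \<and> c = 0)
      | F4 \<Rightarrow> (\<forall>a b c d. (\<forall>H\<in>h. a * \<delta> H + b * \<epsilon> 1 H + c * \<epsilon> 2 H + d * \<epsilon> 3 H = 0)
                 \<longrightarrow> a = 0 \<and> b = 0 \<and> c = 0 \<and> d = 0)) \<and>
     (\<forall>c\<in>even_roots T. vector_space.dim sc (root_space sc P br h (fnl \<delta> \<epsilon> c)) = 1 \<and>
                        root_space sc P br h (fnl \<delta> \<epsilon> c) \<subseteq> P False) \<and>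
     (\<forall>c\<in>odd_roots T. vector_space.dim sc (root_space sc P br h (fnl \<delta> \<epsilon> c)) = 1 \<and>
                        root_space sc P br h (fnl \<delta> \<epsilon> c) \<subseteq> P True) \<and>
     car P = module.span sc (h \<union> (\<Union>c\<in>roots T. root_space sc P br h (fnl \<delta> \<epsilon> c)))"

definition grading ::
  "algtype \<Rightarrow> (complex \<Rightarrow> 'v::ab_group_add \<Rightarrow> 'v) \<Rightarrow> (bool \<Rightarrow> 'v set) \<Rightarrow> ('v \<Rightarrow> 'v \<Rightarrow> 'v) \<Rightarrow>
   'v set \<Rightarrow> ('v \<Rightarrow> complex) \<Rightarrow> (nat \<Rightarrow> 'v \<Rightarrow> complex) \<Rightarrow> nat \<Rightarrow> nat set \<Rightarrow> int \<Rightarrow> 'v set" where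
  "grading T sc P br h \<delta> \<epsilon> \<Xi> S k = module.span sc
     ((if k = 0 then h else {}) \<union>
      \<Union>{root_space sc P br h (fnl \<delta> \<epsilon> c) | c. c \<in> roots T \<and>
          (\<exists>m :: nat \<Rightarrow> int.
             (\<forall>H\<in>h. fnl \<delta> \<epsilon> c H = (\<Sum>i\<in>Nset T. of_int (m i) * fnl \<delta> \<epsilon> (simple_root T \<Xi> i) H)) \<and>
             (\<Sum>i\<in>S. m i) = k)})"

definition exceptional :: "algtype \<Rightarrow> nat \<Rightarrow> nat set \<Rightarrow> bool" where
  "exceptional T \<Xi> S \<longleftrightarrow> (case T of
     G3 \<Rightarrow> (\<Xi>, S) \<in> {(1, {1}), (3, {1}), (4, {1})}
   | F4 \<Rightarrow> (\<Xi>, S) \<in> {(1, {1}),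
                      (1, {4}), (2, {4}), (3, {1}), (4, {1}), (5, {1}),
                      (3, {3}), (4, {4}), (5, {4}), (6, {4})})"

end

theory Submission
  imports Defs "HOL-Library.Product_Plus" "HOL-Computational_Algebra.Polynomial"
begin

text \<open>Invariance of the supertrace form determines, up to scale, the coroot \<open>[x, y]\<close> of root vectors of
opposite weights; with root strings this shows that brackets of root spaces are nonzero whenever
the sum of the weights is a root. A transitive extension of \<open>m\<close> embeds into \<open>g\<close> as soon as every
derivation of \<open>m\<close> into \<open>g\<close> of nonnegative degree is inner, and for this it is enough to treat
derivations of the full nilpotent radical that are homogeneous for the weights. For almost all
weights such a derivation is inner because its values on root vectors propagate along nonzero
brackets; this is a finite computation with roots. The weights where it fails have degree zero and
occur only in the exceptional gradings.

In the exceptional gradings infinite transitive extensions are written down. In the odd contact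
gradings \<open>m\<close> is a Heisenberg superalgebra with odd \<open>g\<^sub>-\<^sub>1\<close>, which extends to a contact superalgebra
\<open>K(1|n)\<close>. In the other ones there are root vectors \<open>e\<close> and \<open>u\<close> of degree \<open>-1\<close> with \<open>u\<close> even, such
that \<open>e\<close> commutes with all other root vectors of \<open>m\<close>; with \<open>l\<close> the coordinate of \<open>u\<close>, the
derivation \<open>x \<mapsto> l(x) e\<close> generates an infinite abelian ideal, the analogue of the vector fields
\<open>f(l) \<partial>\<^sub>e\<close>.\<close>

section \<open>Lie superalgebras with root decompositions\<close>

text \<open>The hypotheses give only simplicity, dimensions and weights. No structure constants are
  available, so the arguments rest on the Jacobi identity and on which brackets of root lines
  vanish. The form used for this is not assumed: for G(3) and F(4) the supertrace form of the
  adjoint representation is nondegenerate on the Cartan subalgebra, and its values follow from the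
  list of roots. The prolongation is characterised by a universal property over arbitrary carriers,
  so an extension is compared with \<open>g\<close> by a relation between elements of equal degree
  and not by a constructed model. Passing from \<open>m\<close> to the full nilpotent radical makes
  the finite computation depend on \<Xi> alone: ten root systems replace all pairs (\<Xi>, S), and
  \<open>S\<close> survives only in the question which weights can have nonnegative degree. For the
  computation weights are integer tuples: \<epsilon>3 is eliminated for G(3), and all coefficients
  are doubled for F(4), which is why degrees carry a factor \<open>q\<close> equal to 1 or
  2.\<close>

locale lsa =
  fixes sc :: "complex \<Rightarrow> 'v::ab_group_add \<Rightarrow> 'v" and P :: "bool \<Rightarrow> 'v set"
    and br :: "'v \<Rightarrow> 'v \<Rightarrow> 'v"
  assumes lie: "lie_superalgebra sc P br"
begin

sublocale vector_space sc
  using lie by (simp add: lie_superalgebra_def)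

lemma subspace_P: "subspace (P p)"
  using lie by (simp add: lie_superalgebra_def)

lemma P_disjoint: "x \<in> P False \<Longrightarrow> x \<in> P True \<Longrightarrow> x = 0"
  using lie unfolding lie_superalgebra_def by blast

lemma P_other: "x \<in> P p \<Longrightarrow> x \<in> P q \<Longrightarrow> p \<noteq> q \<Longrightarrow> x = 0"
  using P_disjoint by (cases p; cases q) auto

lemma zero_P [simp]: "0 \<in> P p"
  using subspace_P subspace_0 by blast

lemma P_car: "x \<in> P p \<Longrightarrow> x \<in> car P"
proof -
  assume x: "x \<in> P p"
  show "x \<in> car P"
  proof (cases p)
    case True
    then have "x = 0 + x \<and> 0 \<in> P False \<and> x \<in> P True" using x by simp
    then show ?thesis unfolding car_def by blast
  next
    case False
    then have "x = x + 0 \<and> x \<in> P False \<and> 0 \<in> P True" using x by simp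
    then show ?thesis unfolding car_def by blast
  qed
qed

lemma carE:
  assumes "x \<in> car P"
  obtains a b where "a \<in> P False" "b \<in> P True" "x = a + b"
  using assms by (auto simp: car_def)

lemma subspace_car: "subspace (car P)"
proof (rule subspaceI)
  show "0 \<in> car P" using P_car zero_P by blast
next
  fix x y assume "x \<in> car P" "y \<in> car P"
  then obtain a b c d where "a \<in> P False" "b \<in> P True" "x = a + b"
    "c \<in> P False" "d \<in> P True" "y = c + d" by (metis carE)
  then have "x + y = (a + c) + (b + d)" "a + c \<in> P False" "b + d \<in> P True"
    using subspace_P subspace_add by (auto simp: algebra_simps)
  then show "x + y \<in> car P" unfolding car_def by blast
next
  fix c x assume "x \<in> car P"
  then obtain a b where "a \<in> P False" "b \<in> P True" "x = a + b" by (metis carE)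
  then have "sc c x = sc c a + sc c b" "sc c a \<in> P False" "sc c b \<in> P True"
    using subspace_P subspace_scale by (auto simp: scale_right_distrib)
  then show "sc c x \<in> car P" unfolding car_def by blast
qed

lemma car_simps [simp]:
  "0 \<in> car P"
  "x \<in> car P \<Longrightarrow> y \<in> car P \<Longrightarrow> x + y \<in> car P"
  "x \<in> car P \<Longrightarrow> y \<in> car P \<Longrightarrow> x - y \<in> car P"
  "x \<in> car P \<Longrightarrow> - x \<in> car P"
  "x \<in> car P \<Longrightarrow> sc a x \<in> car P"
  by (simp_all add: subspace_car subspace_0 subspace_add subspace_diff subspace_neg subspace_scale)

lemma car_sum: "(\<And>i. i \<in> F \<Longrightarrow> f i \<in> car P) \<Longrightarrow> sum f F \<in> car P"
  by (rule subspace_sum[OF subspace_car])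

lemma br_lin:
  assumes "x \<in> car P" "y \<in> car P" "z \<in> car P"
  shows "br (sc a x + y) z = sc a (br x z) + br y z" "br z (sc a x + y) = sc a (br z x) + br z y"
  using lie assms unfolding lie_superalgebra_def by blast+

lemma br_add:
  assumes "x \<in> car P" "y \<in> car P" "z \<in> car P"
  shows "br (x + y) z = br x z + br y z" "br z (x + y) = br z x + br z y"
  using br_lin[OF assms, of 1] by simp_all

lemma br_0 [simp]:
  assumes "z \<in> car P" shows "br 0 z = 0" "br z 0 = 0"
  using br_add[of 0 0 z] assms by simp_all

lemma br_sc:
  assumes "x \<in> car P" "z \<in> car P"
  shows "br (sc a x) z = sc a (br x z)" "br z (sc a x) = sc a (br z x)"
  using br_lin[of x 0 z a] assms by simp_all

lemma br_minus:
  assumes "x \<in> car P" "z \<in> car P"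
  shows "br (- x) z = - br x z" "br z (- x) = - br z x"
  using br_sc[of x z "-1"] assms by simp_all

lemma br_diff:
  assumes "x \<in> car P" "y \<in> car P" "z \<in> car P"
  shows "br (x - y) z = br x z - br y z" "br z (x - y) = br z x - br z y"
  using br_add[of x "-y" z] br_minus[of y z] assms by simp_all

lemma br_sum:
  assumes "z \<in> car P" "\<And>i. i \<in> F \<Longrightarrow> f i \<in> car P"
  shows "br (sum f F) z = (\<Sum>i\<in>F. br (f i) z)" "br z (sum f F) = (\<Sum>i\<in>F. br z (f i))"
proof -
  have "br (sum f F) z = (\<Sum>i\<in>F. br (f i) z) \<and> br z (sum f F) = (\<Sum>i\<in>F. br z (f i))"
    using assms(2)
  proof (induction F rule: infinite_finite_induct)
    case (insert i F)
    then have "sum f F \<in> car P" "f i \<in> car P" by (auto intro: car_sum)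
    with insert assms(1) show ?case by (simp add: br_add)
  qed (use assms in auto)
  then show "br (sum f F) z = (\<Sum>i\<in>F. br (f i) z)" "br z (sum f F) = (\<Sum>i\<in>F. br z (f i))" by auto
qed

lemma br_P: "x \<in> P p \<Longrightarrow> y \<in> P q \<Longrightarrow> br x y \<in> P (p \<noteq> q)"
  using lie unfolding lie_superalgebra_def by blast

lemma br_skew: "x \<in> P p \<Longrightarrow> y \<in> P q \<Longrightarrow> br x y = - sc (sgnp p q) (br y x)"
  using lie unfolding lie_superalgebra_def by blast

lemma jacobi:
  "x \<in> P p \<Longrightarrow> y \<in> P q \<Longrightarrow> z \<in> P r \<Longrightarrow>
   br x (br y z) = br (br x y) z + sc (sgnp p q) (br y (br x z))"
  using lie unfolding lie_superalgebra_def by blast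

lemma br_car [simp]:
  assumes "x \<in> car P" "y \<in> car P" shows "br x y \<in> car P"
proof -
  obtain a b c d where *: "a \<in> P False" "b \<in> P True" "x = a + b"
    "c \<in> P False" "d \<in> P True" "y = c + d" using assms by (metis carE)
  then have "br a c \<in> car P" "br a d \<in> car P" "br b c \<in> car P" "br b d \<in> car P"
    using br_P P_car by blast+
  moreover have "br x y = br a c + br a d + (br b c + br b d)"
    using * P_car by (simp add: br_add)
  ultimately show ?thesis by simp
qed

lemma jacobi_right:
  assumes "x \<in> P p" "y \<in> P q" "z \<in> car P"
  shows "br x (br y z) = br (br x y) z + sc (sgnp p q) (br y (br x z))"
proof -
  obtain a b where *: "a \<in> P False" "b \<in> P True" "z = a + b" using assms(3) by (metis carE)
  have c: "a \<in> car P" "b \<in> car P" "x \<in> car P" "y \<in> car P" using * assms P_car by auto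
  show ?thesis using jacobi[OF assms(1,2) *(1)] jacobi[OF assms(1,2) *(2)] c
    by (simp add: *(3) br_add scale_right_distrib)
qed

lemma jacobi_even:
  assumes "x \<in> P False" "y \<in> car P" "z \<in> car P"
  shows "br x (br y z) = br (br x y) z + br y (br x z)"
proof -
  obtain a b where *: "a \<in> P False" "b \<in> P True" "y = a + b" using assms(2) by (metis carE)
  have c: "a \<in> car P" "b \<in> car P" "x \<in> car P" using * assms P_car by auto
  show ?thesis using jacobi_right[OF assms(1) *(1) assms(3)] jacobi_right[OF assms(1) *(2) assms(3)] c assms(3)
    by (simp add: *(3) br_add sgnp_def)
qed

lemma sgnp_sq [simp]: "sgnp p q * sgnp p q = 1" "sc (sgnp p q) (sc (sgnp p q) x) = x"
  by (simp_all add: sgnp_def)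

end

lemma sgnp_simps [simp]: "sgnp False q = 1" "sgnp p False = 1" "sgnp True True = -1"
  by (simp_all add: sgnp_def)

text \<open>A simple Lie superalgebra with a root decomposition: roots are elements of an abstract
group of weights, and \<open>\<Phi>\<close> turns a weight into a functional on the Cartan subalgebra.\<close>

locale rooted = lsa sc P br
  for sc :: "complex \<Rightarrow> 'v::ab_group_add \<Rightarrow> 'v" and P br +
  fixes h :: "'v set" and \<Phi> :: "'w::ab_group_add \<Rightarrow> 'v \<Rightarrow> complex" and R :: "'w set"
    and par :: "'w \<Rightarrow> bool"
  assumes simple: "simple_lsa sc P br"
    and h_subspace: "subspace h" and h_even: "h \<subseteq> P False"
    and h_abelian: "H1 \<in> h \<Longrightarrow> H2 \<in> h \<Longrightarrow> br H1 H2 = 0"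
    and Phi_lin: "lin_on sc h (\<Phi> w)"
    and Phi_add: "\<Phi> (v + w) H = \<Phi> v H + \<Phi> w H"
    and Phi_inj: "(\<And>H. H \<in> h \<Longrightarrow> \<Phi> w H = 0) \<Longrightarrow> w = 0"
    and finite_R: "finite R" and R_0: "0 \<notin> R" and R_neg: "w \<in> R \<Longrightarrow> - w \<in> R"
    and par_add: "par (v + w) = (par v \<noteq> par w)"
    and root_dim: "w \<in> R \<Longrightarrow> dim (root_space sc P br h (\<Phi> w)) = 1"
    and root_par: "w \<in> R \<Longrightarrow> root_space sc P br h (\<Phi> w) \<subseteq> P (par w)"
    and car_span: "car P = span (h \<union> (\<Union>w\<in>R. root_space sc P br h (\<Phi> w)))"
begin

definition Gw :: "'w \<Rightarrow> 'v set" where "Gw w = root_space sc P br h (\<Phi> w)"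

definition R0 :: "'w set" where "R0 = insert 0 R"

lemma finite_R0: "finite R0" by (simp add: R0_def finite_R)

lemma h_car: "H \<in> h \<Longrightarrow> H \<in> car P" using h_even P_car by blast

lemma Gw_car: "x \<in> Gw w \<Longrightarrow> x \<in> car P" by (simp add: Gw_def root_space_def)

lemma Gw_eig: "x \<in> Gw w \<Longrightarrow> H \<in> h \<Longrightarrow> br H x = sc (\<Phi> w H) x"
  by (simp add: Gw_def root_space_def)

lemma GwI: "x \<in> car P \<Longrightarrow> (\<And>H. H \<in> h \<Longrightarrow> br H x = sc (\<Phi> w H) x) \<Longrightarrow> x \<in> Gw w"
  by (simp add: Gw_def root_space_def)

lemma Phi_0 [simp]: "\<Phi> 0 H = 0" using Phi_add[of 0 0 H] by simp

lemma Phi_minus: "\<Phi> (- w) H = - \<Phi> w H"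
  using Phi_add[of w "- w" H] by (simp add: eq_neg_iff_add_eq_0 add.commute)

lemma Phi_diff: "\<Phi> (v - w) H = \<Phi> v H - \<Phi> w H"
  using Phi_add[of v "- w" H] by (simp add: Phi_minus)

lemma Phi_H_lin: "H1 \<in> h \<Longrightarrow> H2 \<in> h \<Longrightarrow> \<Phi> w (sc a H1 + H2) = a * \<Phi> w H1 + \<Phi> w H2"
  using Phi_lin by (auto simp: lin_on_def)

lemma Phi_H_0 [simp]: "\<Phi> w 0 = 0"
  using Phi_H_lin[of 0 0 w 1] subspace_0[OF h_subspace] by simp

lemma Phi_H_sc: "H \<in> h \<Longrightarrow> \<Phi> w (sc a H) = a * \<Phi> w H"
  using Phi_H_lin[of H 0 w a] subspace_0[OF h_subspace] by simp

lemma par_0 [simp]: "\<not> par 0" using par_add[of 0 0] by simp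

lemma par_minus [simp]: "par (- w) = par w" using par_add[of w "- w"] by simp

lemma par_diff: "par (v - w) = (par v \<noteq> par w)" using par_add[of v "- w"] by simp

section \<open>Weight spaces and weight components\<close>

lemma subspace_Gw: "subspace (Gw w)"
proof (rule subspaceI)
  show "0 \<in> Gw w" by (rule GwI) (auto simp: h_car)
next
  fix x y assume a: "x \<in> Gw w" "y \<in> Gw w"
  show "x + y \<in> Gw w"
  proof (rule GwI)
    show "x + y \<in> car P" using a Gw_car by auto
  next
    fix H assume "H \<in> h"
    then show "br H (x + y) = sc (\<Phi> w H) (x + y)"
      using a Gw_car h_car by (simp add: br_add Gw_eig scale_right_distrib)
  qed
next
  fix c x assume a: "x \<in> Gw w"
  show "sc c x \<in> Gw w"
  proof (rule GwI)
    show "sc c x \<in> car P" using a Gw_car by auto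
  next
    fix H assume "H \<in> h"
    then show "br H (sc c x) = sc (\<Phi> w H) (sc c x)"
      using a Gw_car h_car by (simp add: br_sc Gw_eig mult.commute)
  qed
qed

lemma Gw_simps [simp]:
  "0 \<in> Gw w"
  "x \<in> Gw w \<Longrightarrow> y \<in> Gw w \<Longrightarrow> x + y \<in> Gw w"
  "x \<in> Gw w \<Longrightarrow> y \<in> Gw w \<Longrightarrow> x - y \<in> Gw w"
  "x \<in> Gw w \<Longrightarrow> - x \<in> Gw w"
  "x \<in> Gw w \<Longrightarrow> sc a x \<in> Gw w"
  by (simp_all add: subspace_Gw subspace_0 subspace_add subspace_diff subspace_neg subspace_scale)

lemma h_Gw0: "h \<subseteq> Gw 0"
  by (auto intro!: GwI simp: h_car h_abelian)

lemma br_Gw: assumes "x \<in> Gw v" "y \<in> Gw w" shows "br x y \<in> Gw (v + w)"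
proof (rule GwI)
  show "br x y \<in> car P" using assms Gw_car by auto
next
  fix H assume H: "H \<in> h"
  have "br H (br x y) = br (br H x) y + br x (br H y)"
    using H h_even assms Gw_car by (intro jacobi_even) auto
  then show "br H (br x y) = sc (\<Phi> (v + w) H) (br x y)"
    using assms H Gw_car by (simp add: Gw_eig br_sc Phi_add scale_left_distrib)
qed

text \<open>Eigenvectors for different eigenvalues: some element of \<open>h\<close> separates two
  given weights, and subtracting its eigenvalue on one of them from its action removes that summand,
  which feeds the induction. Since weights live in an abstract group, separation rests on
  \<open>Phi_inj\<close>.\<close>

lemma weight_indep:
  assumes "finite A" "\<And>w. w \<in> A \<Longrightarrow> f w \<in> Gw w" "sum f A = 0" "w \<in> A"
  shows "f w = 0"
  using assms
proof (induction A arbitrary: f w rule: finite_induct)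
  case (insert u A)
  have fc: "f v \<in> car P" if "v \<in> insert u A" for v using insert.prems(1) that Gw_car by blast
  have z: "f w = 0" if w: "w \<in> A" for w
  proof -
    have "\<exists>H\<in>h. \<Phi> (w - u) H \<noteq> 0" using Phi_inj[of "w - u"] insert.hyps w by auto
    then obtain H where H: "H \<in> h" "\<Phi> (w - u) H \<noteq> 0" by blast
    have s: "f u + sum f A = 0" using insert by simp
    have "br H (f u + sum f A) = sc (\<Phi> u H) (f u) + (\<Sum>v\<in>A. sc (\<Phi> v H) (f v))"
    proof -
      have "br H (sum f A) = (\<Sum>v\<in>A. br H (f v))" using br_sum(2)[of H A f] H h_car fc by auto
      moreover have "br H (f v) = sc (\<Phi> v H) (f v)" if "v \<in> insert u A" for v
        using Gw_eig insert.prems(1) that H by blast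
      ultimately show ?thesis using H h_car fc by (simp add: br_add car_sum)
    qed
    moreover have "br H (f u + sum f A) = 0" using s H h_car by simp
    moreover have "sc (\<Phi> u H) (f u + sum f A) = 0" using s by simp
    ultimately have "(\<Sum>v\<in>A. sc (\<Phi> v H) (f v)) - (\<Sum>v\<in>A. sc (\<Phi> u H) (f v)) = 0"
      by (simp add: scale_right_distrib scale_sum_right algebra_simps)
         (metis add_left_cancel)
    then have "(\<Sum>v\<in>A. sc (\<Phi> (v - u) H) (f v)) = 0"
      by (simp add: sum_subtractf Phi_diff scale_left_diff_distrib)
    then have "sc (\<Phi> (w - u) H) (f w) = 0"
      using insert.IH[of "\<lambda>v. sc (\<Phi> (v - u) H) (f v)" w] insert.prems(1) w by auto
    then show ?thesis using H by simp
  qed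
  then have "sum f A = 0" by simp
  then have "f u = 0" using insert by simp
  then show ?case using z insert.prems(3) by auto
qed auto

text \<open>The summands are phrased with \<open>h\<close> and \<open>{0}\<close> because at this
  stage the zero weight space could still exceed \<open>h\<close>, and weights outside the roots
  could still occur; both are excluded next.\<close>

lemma decomp_ex:
  assumes "x \<in> car P"
  shows "\<exists>f. (\<forall>w. f w \<in> (if w = 0 then h else if w \<in> R then Gw w else {0})) \<and> x = sum f R0"
proof -
  define B where "B w = (if w = 0 then h else if w \<in> R then Gw w else {0})" for w
  let ?U = "{x. \<exists>f. (\<forall>w. f w \<in> B w) \<and> x = sum f R0}"
  have sB: "subspace (B w)" for w using h_subspace subspace_Gw subspace_single_0 by (auto simp: B_def)
  have "subspace ?U"
  proof (rule subspaceI)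
    have "\<forall>w. 0 \<in> B w" using sB subspace_0 by blast
    then show "0 \<in> ?U" by (auto intro!: exI[of _ "\<lambda>w. 0"])
  next
    fix x y assume "x \<in> ?U" "y \<in> ?U"
    then obtain f g where "\<forall>w. f w \<in> B w" "x = sum f R0" "\<forall>w. g w \<in> B w" "y = sum g R0" by blast
    moreover from this have "\<forall>w. f w + g w \<in> B w" using sB subspace_add by metis
    ultimately show "x + y \<in> ?U" by (auto simp: sum.distrib intro!: exI[of _ "\<lambda>w. f w + g w"])
  next
    fix c x assume "x \<in> ?U"
    then obtain f where "\<forall>w. f w \<in> B w" "x = sum f R0" by blast
    moreover from this have "\<forall>w. sc c (f w) \<in> B w" using sB subspace_scale by metis
    ultimately show "sc c x \<in> ?U" by (auto simp: scale_sum_right intro!: exI[of _ "\<lambda>w. sc c (f w)"])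
  qed
  moreover have "h \<union> (\<Union>w\<in>R. root_space sc P br h (\<Phi> w)) \<subseteq> ?U"
  proof
    fix x assume "x \<in> h \<union> (\<Union>w\<in>R. root_space sc P br h (\<Phi> w))"
    then obtain w where w: "w \<in> R0" "x \<in> B w"
    proof
      assume "x \<in> h"
      then show thesis using that[of 0] by (simp add: R0_def B_def)
    next
      assume "x \<in> (\<Union>w\<in>R. root_space sc P br h (\<Phi> w))"
      then obtain w where "w \<in> R" "x \<in> Gw w" by (auto simp: Gw_def)
      moreover from this have "w \<noteq> 0" using R_0 by auto
      ultimately have "w \<in> R0" "x \<in> B w" by (simp_all add: R0_def B_def)
      then show thesis by (rule that)
    qed
    have "x = sum (\<lambda>v. if v = w then x else 0) R0" using w finite_R0 by simp
    moreover have "\<forall>v. (if v = w then x else 0) \<in> B v" using w sB subspace_0 by auto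
    ultimately show "x \<in> ?U" by (auto intro!: exI[of _ "\<lambda>v. if v = w then x else 0"])
  qed
  ultimately have "car P \<subseteq> ?U" unfolding car_span using span_minimal by blast
  then show ?thesis using assms unfolding B_def by blast
qed

text \<open>Uniqueness of weight decompositions: a weight vector is already a decomposition of
  itself, so it must agree with the one supplied by the spanning hypothesis. In particular
  \<open>h\<close> is its own centraliser.\<close>

lemma Gw_0: "Gw 0 = h" and Gw_nonroot: "w \<notin> R0 \<Longrightarrow> Gw w = {0}"
proof -
  have key: "x \<in> (if w = 0 then h else if w \<in> R then Gw w else {0})" if x: "x \<in> Gw w" for x w
  proof -
    obtain f where f: "\<forall>w. f w \<in> (if w = 0 then h else if w \<in> R then Gw w else {0})" "x = sum f R0"
      using decomp_ex[OF Gw_car[OF x]] by blast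
    have fG: "f v \<in> Gw v" for v using f(1)[rule_format, of v] h_Gw0 by (auto split: if_splits)
    let ?A = "insert w R0"
    let ?g = "\<lambda>v. (if v = w then x else 0) - (if v \<in> R0 then f v else 0)"
    have "sum ?g ?A = x - sum (\<lambda>v. if v \<in> R0 then f v else 0) ?A"
      using finite_R0 by (simp add: sum_subtractf)
    also have "sum (\<lambda>v. if v \<in> R0 then f v else 0) ?A = sum f R0"
      using finite_R0 by (intro sum.mono_neutral_cong_right) auto
    finally have "sum ?g ?A = 0" using f by simp
    then have "?g w = 0" using weight_indep[of ?A ?g w] finite_R0 fG x by auto
    then have "x = (if w \<in> R0 then f w else 0)" by simp
    then show ?thesis using f(1)[rule_format, of w] by (auto simp: R0_def split: if_splits)
  qed
  show "Gw 0 = h" using key[of _ 0] h_Gw0 by auto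
  show "w \<notin> R0 \<Longrightarrow> Gw w = {0}" using key[of _ w] by (auto simp: R0_def)
qed

text \<open>Components are made zero outside \<open>R0\<close>, so that shifted weights such as
  \<open>w - v\<close> can be used without checking that they occur. Outside \<open>car P\<close>
  the choice carries no meaning.\<close>

definition comp :: "'v \<Rightarrow> 'w \<Rightarrow> 'v" where
  "comp x = (SOME f. (\<forall>w. f w \<in> Gw w) \<and> (\<forall>w. w \<notin> R0 \<longrightarrow> f w = 0) \<and> x = sum f R0)"

lemma comp:
  assumes "x \<in> car P"
  shows "comp x w \<in> Gw w" "w \<notin> R0 \<Longrightarrow> comp x w = 0" "x = sum (comp x) R0"
proof -
  have "\<exists>f. (\<forall>w. f w \<in> Gw w) \<and> (\<forall>w. w \<notin> R0 \<longrightarrow> f w = 0) \<and> x = sum f R0"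
  proof -
    obtain f where f: "\<forall>w. f w \<in> (if w = 0 then h else if w \<in> R then Gw w else {0})" "x = sum f R0"
      using decomp_ex[OF assms] by blast
    moreover have "f w \<in> Gw w" for w using f(1)[rule_format, of w] Gw_0 by (auto split: if_splits)
    moreover have "w \<notin> R0 \<Longrightarrow> f w = 0" for w using f(1)[rule_format, of w] by (auto simp: R0_def split: if_splits)
    ultimately show ?thesis by blast
  qed
  from someI_ex[OF this] show "comp x w \<in> Gw w" "w \<notin> R0 \<Longrightarrow> comp x w = 0" "x = sum (comp x) R0"
    unfolding comp_def[symmetric] by auto
qed

lemma comp_unique:
  assumes "\<And>w. w \<in> R0 \<Longrightarrow> f w \<in> Gw w" "x = sum f R0" "w \<in> R0"
  shows "comp x w = f w"
proof -
  have x: "x \<in> car P" unfolding assms(2) by (rule car_sum) (metis assms(1) Gw_car)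
  have "sum (\<lambda>w. comp x w - f w) R0 = 0" using comp(3)[OF x] assms(2) by (simp add: sum_subtractf)
  then have "comp x w - f w = 0"
    using weight_indep[of R0 "\<lambda>w. comp x w - f w" w] finite_R0 assms comp(1)[OF x] by auto
  then show ?thesis by simp
qed

lemma comp_lin:
  assumes "x \<in> car P" "y \<in> car P"
  shows "comp (sc a x + y) w = sc a (comp x w) + comp y w"
proof (cases "w \<in> R0")
  case True
  then show ?thesis
  proof (intro comp_unique[of "\<lambda>w. sc a (comp x w) + comp y w"])
    show "sc a x + y = (\<Sum>w\<in>R0. sc a (comp x w) + comp y w)"
      using comp(3) assms by (simp add: sum.distrib flip: scale_sum_right)
  qed (use comp(1) assms in auto)
next
  case False
  then show ?thesis using comp(2) assms by auto
qed

lemma comp_Gw: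
  assumes "x \<in> Gw v" shows "comp x w = (if w = v then x else 0)"
proof (cases "v \<in> R0")
  case True
  then have "x = (\<Sum>w\<in>R0. if w = v then x else 0)" using finite_R0 by simp
  with True assms show ?thesis
    using comp_unique[of "\<lambda>w. if w = v then x else 0" x w] comp(2)[OF Gw_car[OF assms], of w]
    by (cases "w \<in> R0") auto
next
  case False
  then have "x = 0" using assms Gw_nonroot by auto
  moreover have "comp 0 w = 0" using comp_lin[of 0 0 1 w] by simp
  ultimately show ?thesis by simp
qed

lemma comp_add: "x \<in> car P \<Longrightarrow> y \<in> car P \<Longrightarrow> comp (x + y) w = comp x w + comp y w"
  using comp_lin[of x y 1 w] by simp

lemma comp_0 [simp]: "comp 0 w = 0"
  using comp_lin[of 0 0 1 w] by simp

lemma comp_sc: "x \<in> car P \<Longrightarrow> comp (sc a x) w = sc a (comp x w)"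
  using comp_lin[of x 0 a w] by simp

text \<open>A weight vector shifts weights by its own weight. Together with its mirror image
  \<open>comp_br_right\<close> this makes it possible to take weight components of a derivation
  rule.\<close>

lemma comp_br_left:
  assumes "x \<in> Gw v" "y \<in> car P"
  shows "comp (br x y) w = br x (comp y (w - v))"
proof -
  have c: "comp y u \<in> car P" for u using comp(1)[OF assms(2)] Gw_car by blast
  have xc: "x \<in> car P" using assms Gw_car by auto
  have "br x y = br x (sum (comp y) R0)" using comp(3)[OF assms(2)] by simp
  also have "\<dots> = (\<Sum>u\<in>R0. br x (comp y u))" by (rule br_sum(2)) (auto simp: c xc)
  finally have e: "br x y = (\<Sum>u\<in>R0. br x (comp y u))" .
  have "comp (sum f F) w = (\<Sum>u\<in>F. comp (f u) w)" if "\<And>u. u \<in> F \<Longrightarrow> f u \<in> car P" for f and F :: "'w set"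
    using that by (induction F rule: infinite_finite_induct) (auto simp: comp_add car_sum)
  then have "comp (br x y) w = (\<Sum>u\<in>R0. comp (br x (comp y u)) w)"
    using e c xc by simp
  also have "\<dots> = (\<Sum>u\<in>R0. if u = w - v then br x (comp y u) else 0)"
    using comp_Gw[OF br_Gw[OF assms(1) comp(1)[OF assms(2)]]]
    by (intro sum.cong) (auto simp: algebra_simps)
  also have "\<dots> = br x (comp y (w - v))"
    using finite_R0 comp(2)[OF assms(2), of "w - v"] xc by (auto simp: sum.delta)
  finally show ?thesis .
qed

lemma Gw_par: "x \<in> Gw w \<Longrightarrow> x \<in> P (par w)"
proof (cases "w \<in> R")
  case True
  then show "x \<in> Gw w \<Longrightarrow> x \<in> P (par w)" using root_par by (auto simp: Gw_def)
next
  case False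
  then show "x \<in> Gw w \<Longrightarrow> x \<in> P (par w)"
    using Gw_0 h_even Gw_nonroot[of w] by (cases "w = 0") (auto simp: R0_def)
qed

text \<open>Every weight space is homogeneous of parity \<open>par w\<close>, so grouping the
  components by this parity gives the two parts of \<open>x\<close>. Directness of the parity
  decomposition removes the part of the wrong parity.\<close>

lemma comp_P:
  assumes "x \<in> P p" "par w \<noteq> p" shows "comp x w = 0"
proof -
  have xc: "x \<in> car P" using assms P_car by auto
  let ?s = "\<lambda>q. \<Sum>w\<in>{w\<in>R0. par w = q}. comp x w"
  have sq: "?s q \<in> P q" for q
    using comp(1)[OF xc] Gw_par by (auto intro!: subspace_sum[OF subspace_P])
  have "sum (comp x) R0 = ?s p + ?s (\<not> p)"
  proof -
    have "R0 = {w\<in>R0. par w = p} \<union> {w\<in>R0. par w = (\<not> p)}" by auto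
    moreover have "{w\<in>R0. par w = p} \<inter> {w\<in>R0. par w = (\<not> p)} = {}" by auto
    ultimately show ?thesis using finite_R0 sum.union_disjoint[of "{w\<in>R0. par w = p}" "{w\<in>R0. par w = (\<not> p)}" "comp x"]
      by simp
  qed
  then have "x = ?s p + ?s (\<not> p)" using comp(3)[OF xc] by (rule trans[rotated])
  then have e: "x - ?s p = ?s (\<not> p)" by (metis add_diff_cancel_left')
  have "x - ?s p \<in> P p" using sq assms subspace_P subspace_diff by blast
  then have "?s (\<not> p) = 0" using sq[of "\<not> p"] e P_other by metis
  moreover have "?s (\<not> p) = (\<Sum>w\<in>R0. if par w = (\<not> p) then comp x w else 0)"
    using finite_R0 by (simp add: sum.inter_filter)
  ultimately have z: "(\<Sum>w\<in>R0. if par w = (\<not> p) then comp x w else 0) = 0" by simp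
  show ?thesis
  proof (cases "w \<in> R0")
    case True
    have "(if par w = (\<not> p) then comp x w else 0) = 0"
      using weight_indep[of R0 "\<lambda>w. if par w = (\<not> p) then comp x w else 0" w] z finite_R0 True comp(1)[OF xc] by auto
    then show ?thesis using assms by auto
  qed (use comp(2)[OF xc] in auto)
qed

lemma root_vec_ex: "w \<in> R \<Longrightarrow> \<exists>e. e \<noteq> 0 \<and> e \<in> Gw w \<and> (\<forall>x\<in>Gw w. \<exists>a. x = sc a e)"
proof -
  assume "w \<in> R"
  then have d: "dim (Gw w) = 1" using root_dim by (simp add: Gw_def)
  obtain B where B: "B \<subseteq> Gw w" "independent B" "Gw w \<subseteq> span B" "card B = dim (Gw w)"
    using basis_exists by blast
  then obtain e where e: "B = {e}" using d card_1_singletonE by metis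
  then have "e \<noteq> 0" using B(2) dependent_zero by auto
  then show ?thesis using B e by (auto simp: span_singleton)
qed

definition rv :: "'w \<Rightarrow> 'v" where
  "rv w = (SOME e. e \<noteq> 0 \<and> e \<in> Gw w \<and> (\<forall>x\<in>Gw w. \<exists>a. x = sc a e))"

lemma rv: "w \<in> R \<Longrightarrow> rv w \<noteq> 0" "w \<in> R \<Longrightarrow> rv w \<in> Gw w" "w \<in> R \<Longrightarrow> x \<in> Gw w \<Longrightarrow> \<exists>a. x = sc a (rv w)"
  using someI_ex[OF root_vec_ex[of w]] unfolding rv_def[symmetric] by auto

lemma rv_car: "w \<in> R \<Longrightarrow> rv w \<in> car P" using rv Gw_car by blast

lemma Gw_line:
  assumes "w \<in> R" "e \<in> Gw w" "e \<noteq> 0" "x \<in> Gw w" shows "\<exists>a. x = sc a e"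
proof -
  obtain a b where "e = sc a (rv w)" "x = sc b (rv w)" using rv(3)[OF assms(1)] assms by blast
  moreover then have "a \<noteq> 0" using assms by auto
  ultimately have "x = sc (b / a) e" by simp
  then show ?thesis by blast
qed

lemma car_not_in_h: "\<not> car P \<subseteq> h"
proof
  assume a: "car P \<subseteq> h"
  obtain x y where "x \<in> car P" "y \<in> car P" "br x y \<noteq> 0"
    using simple unfolding simple_lsa_def by blast
  then show False using a h_abelian[of x y] by auto
qed

lemma R_ne: "R \<noteq> {}"
proof
  assume "R = {}"
  then have "car P = h" using car_span h_subspace span_eq_iff by auto
  then show False using car_not_in_h by simp
qed

text \<open>An element of \<open>h\<close> on which all roots vanish is central, and its line, being
  contained in \<open>h\<close>, would be a proper ideal of a simple superalgebra. Consequently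
  elements of \<open>h\<close> can be tested on roots alone.\<close>

lemma H_zero:
  assumes "H \<in> h" "\<And>w. w \<in> R \<Longrightarrow> \<Phi> w H = 0" shows "H = 0"
proof (rule ccontr)
  assume "H \<noteq> 0"
  have central: "br x H = 0" if "x \<in> car P" for x
  proof -
    have HG: "H \<in> Gw 0" using assms Gw_0 by simp
    have "br H (comp x w) = 0" for w
    proof -
      have "br H (comp x w) = sc (\<Phi> w H) (comp x w)" using Gw_eig comp(1) that assms by blast
      then show ?thesis using assms(2) comp(2)[OF that, of w] by (cases "w \<in> R0") (auto simp: R0_def)
    qed
    then have z: "br H x = 0"
      using comp_br_left[OF HG that] comp(3)[of "br H x"] h_car assms that by simp
    obtain a b where ab: "a \<in> P False" "b \<in> P True" "x = a + b" using \<open>x \<in> car P\<close> by (metis carE)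
    have Hc: "H \<in> P False" using assms h_even by auto
    have s: "br a H = - br H a" "br b H = - br H b"
      by (subst br_skew[OF ab(1) Hc], simp) (subst br_skew[OF ab(2) Hc], simp)
    then have "br x H = - br H x" using ab P_car Hc by (simp add: br_add)
    then show ?thesis using z by simp
  qed
  let ?I = "span {H}"
  have I: "?I = {x. \<exists>a. x = sc a H}" by (auto simp: span_singleton)
  have sub: "?I \<subseteq> h" using I assms(1) subspace_scale[OF h_subspace] by auto
  have "subspace ?I \<and> ?I \<subseteq> car P \<and>
          (\<forall>x\<in>?I. \<exists>a\<in>?I \<inter> P False. \<exists>b\<in>?I \<inter> P True. x = a + b) \<and>
          (\<forall>x\<in>car P. \<forall>y\<in>?I. br x y \<in> ?I)"
  proof (intro conjI ballI)
    show "subspace ?I" by (rule subspace_span)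
    show "?I \<subseteq> car P" using sub h_car by blast
  next
    fix x assume "x \<in> ?I"
    then have "x \<in> ?I \<inter> P False" "0 \<in> ?I \<inter> P True" "x = x + 0"
      using sub h_even subspace_0[OF subspace_span, of "{H}"] by auto
    then show "\<exists>a\<in>?I \<inter> P False. \<exists>b\<in>?I \<inter> P True. x = a + b" by blast
  next
    fix x y assume x: "x \<in> car P" and "y \<in> ?I"
    then obtain a where "y = sc a H" using I by auto
    then have "br x y = 0" using central x h_car assms by (simp add: br_sc)
    then show "br x y \<in> ?I" using subspace_0[OF subspace_span, of "{H}"] by simp
  qed
  then have "?I = {0} \<or> ?I = car P" using simple by (simp add: simple_lsa_def)
  moreover have "H \<in> ?I" by (simp add: span_base)
  ultimately have "car P \<subseteq> h" using sub \<open>H \<noteq> 0\<close> by auto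
  then show False using car_not_in_h by simp
qed

lemma h_ne: "\<exists>H\<in>h. H \<noteq> 0"
proof -
  obtain w where "w \<in> R" using R_ne by blast
  then have "w \<noteq> 0" using R_0 by auto
  then obtain H where "H \<in> h" "\<Phi> w H \<noteq> 0" using Phi_inj[of w] by blast
  then show ?thesis using Phi_H_0 by metis
qed

end

section \<open>Nonvanishing of brackets\<close>

definition sgn_par :: "bool \<Rightarrow> complex" where "sgn_par p = (if p then -1 else 1)"

lemma sgn_par_simps [simp]: "sgn_par p * sgn_par p = 1" "sgnp p p = sgn_par p"
  "sgn_par (p \<noteq> q) = sgn_par p * sgn_par q" "sgn_par p * (sgn_par p * z) = z" "sgn_par p \<noteq> 0"
  by (auto simp: sgn_par_def sgnp_def)

context rooted
begin

lemma br_Gw_minus: "x \<in> Gw \<alpha> \<Longrightarrow> y \<in> Gw (- \<alpha>) \<Longrightarrow> br x y \<in> h"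
  using br_Gw[of x \<alpha> y "- \<alpha>"] Gw_0 by simp

lemma br_H_right: assumes "x \<in> Gw w" "H \<in> h" shows "br x H = sc (- \<Phi> w H) x"
  using br_skew[OF Gw_par[OF assms(1)], of H False] assms h_even Gw_eig[OF assms] by auto

text \<open>The scalars \<open>a \<gamma>\<close> by which \<open>ad x ad y\<close> acts on the root spaces, where \<open>x\<close> and \<open>y\<close> have opposite
weights; \<open>a 0\<close> is the trace on the Cartan subalgebra.\<close>

lemma string_scalars:
  assumes \<alpha>: "\<alpha> \<in> R" and x: "x \<in> Gw \<alpha>" and y: "y \<in> Gw (- \<alpha>)"
  obtains a where "\<And>\<gamma> e. \<gamma> \<in> R \<Longrightarrow> e \<in> Gw \<gamma> \<Longrightarrow> br x (br y e) = sc (a \<gamma>) e"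
    and "\<And>\<gamma>. \<gamma> \<notin> R0 \<Longrightarrow> a \<gamma> = 0"
    and "\<And>\<gamma>. (if \<gamma> \<in> R0 then \<Phi> \<gamma> (br x y) else 0) = a \<gamma> - sgn_par (par \<alpha>) * a (\<gamma> + \<alpha>)"
proof -
  let ?H = "br x y" and ?s = "sgn_par (par \<alpha>)"
  have H: "?H \<in> h" using br_Gw_minus x y by blast
  have xc: "x \<in> car P" and yc: "y \<in> car P" using x y Gw_car by auto
  have xp: "x \<in> P (par \<alpha>)" and yp: "y \<in> P (par \<alpha>)" using Gw_par[OF x] Gw_par[OF y] by auto
  have inG: "br x (br y e) \<in> Gw \<gamma>" if "e \<in> Gw \<gamma>" for e \<gamma>
    using br_Gw[OF x br_Gw[OF y that]] by (simp add: algebra_simps)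
  \<comment> \<open>On the Cartan subalgebra \<open>ad x ad y\<close> has rank at most one: it sends
    \<open>H'\<close> to \<open>\<Phi> \<alpha> H'\<close> times \<open>[x, y]\<close>. Its trace
    there is the value chosen at index 0.\<close>
  define a where "a \<gamma> = (if \<gamma> = 0 then \<Phi> \<alpha> ?H else if \<gamma> \<in> R
    then (SOME c. br x (br y (rv \<gamma>)) = sc c (rv \<gamma>)) else 0)" for \<gamma>
  have a_rv: "br x (br y (rv \<gamma>)) = sc (a \<gamma>) (rv \<gamma>)" if "\<gamma> \<in> R" for \<gamma>
  proof -
    have "\<exists>c. br x (br y (rv \<gamma>)) = sc c (rv \<gamma>)" using rv(3)[OF that inG[OF rv(2)[OF that]]] .
    from someI_ex[OF this] show ?thesis using that R_0 by (auto simp: a_def)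
  qed
  have a1: "br x (br y e) = sc (a \<gamma>) e" if g: "\<gamma> \<in> R" and e: "e \<in> Gw \<gamma>" for \<gamma> e
  proof -
    obtain t where t: "e = sc t (rv \<gamma>)" using rv(3)[OF g e] by blast
    have "br x (br y e) = sc t (br x (br y (rv \<gamma>)))" using t xc yc rv_car[OF g] by (simp add: br_sc)
    then show ?thesis using a_rv[OF g] t by (simp add: mult.commute)
  qed
  have a2: "a \<gamma> = 0" if "\<gamma> \<notin> R0" for \<gamma> using that by (auto simp: a_def R0_def)
  have a0: "a 0 = \<Phi> \<alpha> ?H" by (simp add: a_def)
  \<comment> \<open>Two maps between the same pair of lines: \<open>ad y ad x\<close> on \<gamma>
    and \<open>ad x ad y\<close> on \<gamma> + \<alpha> are the same product of two scalars, taken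
    in opposite order. When \<gamma> + \<alpha> is 0, the trace on \<open>h\<close> takes over this
    role.\<close>
  have b: "br y (br x e) = sc (a (\<gamma> + \<alpha>)) e" if g: "\<gamma> \<in> R" and e: "e \<in> Gw \<gamma>" "e \<noteq> 0" for \<gamma> e
  proof -
    have ec: "e \<in> car P" using e Gw_car by auto
    have xe: "br x e \<in> Gw (\<gamma> + \<alpha>)" using br_Gw[OF x e(1)] by (simp add: add.commute)
    consider "\<gamma> + \<alpha> \<in> R" | "\<gamma> + \<alpha> = 0" | "\<gamma> + \<alpha> \<notin> R0" by (auto simp: R0_def)
    then show ?thesis
    proof cases
      case 1
      let ?f = "rv (\<gamma> + \<alpha>)"
      have fc: "?f \<in> car P" using rv_car[OF 1] .
      have yf: "br y ?f \<in> Gw \<gamma>" using br_Gw[OF y rv(2)[OF 1]] by (simp add: algebra_simps)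
      obtain c where c: "br y ?f = sc c e" using Gw_line[OF g e(1) e(2) yf] by blast
      obtain d where d: "br x e = sc d ?f" using rv(3)[OF 1 xe] by blast
      have "br y (br x e) = sc (d * c) e" using d c yc fc by (simp add: br_sc)
      moreover have "sc (c * d) ?f = sc (a (\<gamma> + \<alpha>)) ?f"
        using a_rv[OF 1] c d xc ec by (simp add: br_sc)
      then have "a (\<gamma> + \<alpha>) = c * d" using rv(1)[OF 1] by (metis scale_cancel_right)
      ultimately show ?thesis by (simp add: mult.commute)
    next
      case 2
      then have ge: "\<gamma> = - \<alpha>" by (simp add: eq_neg_iff_add_eq_0)
      show ?thesis
      proof (cases "y = 0")
        case True
        then show ?thesis using 2 a0 xc ec by simp
      next
        case False
        obtain c where c: "e = sc c y" using Gw_line[of "- \<alpha>" y e] False y e ge R_neg \<alpha> by auto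
        have "br y (br x e) = sc c (br y ?H)" using c xc yc H h_car by (simp add: br_sc)
        also have "br y ?H = sc (\<Phi> \<alpha> ?H) y" using br_H_right[OF y H] by (simp add: Phi_minus)
        finally show ?thesis using 2 a0 c by (simp add: mult.commute)
      qed
    next
      case 3
      then have "br x e = 0" using xe Gw_nonroot by auto
      then show ?thesis using a2[OF 3] yc by simp
    qed
  qed
  have a3: "(if \<gamma> \<in> R0 then \<Phi> \<gamma> ?H else 0) = a \<gamma> - ?s * a (\<gamma> + \<alpha>)" for \<gamma>
  proof -
    consider "\<gamma> \<in> R" | "\<gamma> = 0" | "\<gamma> \<notin> R0" by (auto simp: R0_def)
    then show ?thesis
    proof cases
      case 1
      let ?e = "rv \<gamma>"
      have e: "?e \<in> Gw \<gamma>" "?e \<noteq> 0" using rv 1 by auto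
      have "br x (br y ?e) = br ?H ?e + sc ?s (br y (br x ?e))"
        using jacobi_right[OF xp yp Gw_car[OF e(1)]] by simp
      then have "sc (a \<gamma>) ?e = sc (\<Phi> \<gamma> ?H + ?s * a (\<gamma> + \<alpha>)) ?e"
        using a1[OF 1 e(1)] b[OF 1 e] Gw_eig[OF e(1) H] by (simp add: scale_left_distrib)
      then have "a \<gamma> = \<Phi> \<gamma> ?H + ?s * a (\<gamma> + \<alpha>)" using e(2) by (simp add: scale_cancel_right)
      then show ?thesis using 1 by (simp add: R0_def)
    next
      case 2
      have "a \<alpha> = ?s * \<Phi> \<alpha> ?H"
      proof (cases "x = 0")
        case True
        then have "sc (a \<alpha>) (rv \<alpha>) = 0" using a_rv[OF \<alpha>] yc rv_car[OF \<alpha>] by simp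
        then have "a \<alpha> = 0" using rv(1)[OF \<alpha>] by simp
        then show ?thesis using True yc by simp
      next
        case False
        have "br x (br y x) = sc (a \<alpha>) x" using a1[OF \<alpha> x] .
        moreover have "br y x = sc (- ?s) ?H" using br_skew[OF yp xp] by simp
        moreover have "br x ?H = sc (- \<Phi> \<alpha> ?H) x" using br_H_right[OF x H] .
        ultimately have "sc (?s * \<Phi> \<alpha> ?H) x = sc (a \<alpha>) x" using xc H h_car by (simp add: br_sc br_minus)
        then show ?thesis using False by (metis scale_cancel_right)
      qed
      then show ?thesis using 2 a0 by (simp add: R0_def)
    next
      case 3
      have "a (\<gamma> + \<alpha>) = 0"
      proof (cases "\<gamma> + \<alpha> \<in> R")
        case True
        have "br y (rv (\<gamma> + \<alpha>)) \<in> Gw \<gamma>" using br_Gw[OF y rv(2)[OF True]] by (simp add: algebra_simps)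
        then have "br y (rv (\<gamma> + \<alpha>)) = 0" using Gw_nonroot[OF 3] by auto
        then have "sc (a (\<gamma> + \<alpha>)) (rv (\<gamma> + \<alpha>)) = 0" using a_rv[OF True] xc by simp
        then show ?thesis using rv(1)[OF True] by simp
      next
        case False
        have "\<gamma> + \<alpha> \<noteq> 0"
        proof
          assume "\<gamma> + \<alpha> = 0"
          then have "\<gamma> = - \<alpha>" by (simp add: eq_neg_iff_add_eq_0)
          then show False using 3 R_neg[OF \<alpha>] by (simp add: R0_def)
        qed
        then show ?thesis using a2 False by (auto simp: R0_def)
      qed
      then show ?thesis using a2[OF 3] 3 by simp
    qed
  qed
  show thesis by (rule that[OF a1 a2 a3])
qed

text \<open>The left-hand side is the supertrace form of the adjoint representation on the Cartan
subalgebra, so \<open>[x, y]\<close> is proportional to the dual of the weight of \<open>x\<close>.\<close>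

lemma killing_coroot:
  assumes \<alpha>: "\<alpha> \<in> R" and x: "x \<in> Gw \<alpha>" and y: "y \<in> Gw (- \<alpha>)"
  shows "\<exists>\<kappa>. \<forall>H'. (\<Sum>\<gamma>\<in>R. sgn_par (par \<gamma>) * \<Phi> \<gamma> (br x y) * \<Phi> \<gamma> H') = \<kappa> * \<Phi> \<alpha> H'"
proof -
  obtain a where a2: "\<And>\<gamma>. \<gamma> \<notin> R0 \<Longrightarrow> a \<gamma> = 0"
    and a3: "\<And>\<gamma>. (if \<gamma> \<in> R0 then \<Phi> \<gamma> (br x y) else 0) = a \<gamma> - sgn_par (par \<alpha>) * a (\<gamma> + \<alpha>)"
    using string_scalars[OF assms] by metis
  define A where "A \<gamma> = sgn_par (par \<gamma>) * a \<gamma>" for \<gamma>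
  have A2: "A \<gamma> = 0" if "\<gamma> \<notin> R0" for \<gamma> using a2[OF that] by (simp add: A_def)
  \<comment> \<open>The supertrace signs turn the Jacobi recursion into a telescoping difference.
    Summation by parts against \<open>\<Phi> \<gamma> H'\<close> then leaves
    \<open>\<Phi> \<alpha> H'\<close> times the sum of all \<open>A\<close>.\<close>
  have A3: "sgn_par (par \<gamma>) * (if \<gamma> \<in> R0 then \<Phi> \<gamma> (br x y) else 0) = A \<gamma> - A (\<gamma> + \<alpha>)" for \<gamma>
    by (simp only: a3) (auto simp: A_def par_add sgn_par_def algebra_simps)
  \<comment> \<open>The enlarged index set contains the support of \<open>A\<close> and of its shift
    by \<alpha>, so that the shifted sum can be reindexed without boundary terms.\<close>
  let ?R' = "(\<lambda>r. r - \<alpha>) ` R0"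
  let ?W = "R0 \<union> ?R'"
  have fW: "finite ?W" using finite_R0 by simp
  show ?thesis
  proof (intro exI allI)
    fix H'
    have "(\<Sum>\<gamma>\<in>R. sgn_par (par \<gamma>) * \<Phi> \<gamma> (br x y) * \<Phi> \<gamma> H')
        = (\<Sum>\<gamma>\<in>?W. sgn_par (par \<gamma>) * (if \<gamma> \<in> R0 then \<Phi> \<gamma> (br x y) else 0) * \<Phi> \<gamma> H')"
      using fW by (intro sum.mono_neutral_cong_left) (auto simp: R0_def)
    also have "\<dots> = (\<Sum>\<gamma>\<in>?W. A \<gamma> * \<Phi> \<gamma> H') - (\<Sum>\<gamma>\<in>?W. A (\<gamma> + \<alpha>) * \<Phi> \<gamma> H')"
      by (simp only: A3) (simp add: sum_subtractf left_diff_distrib)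
    also have "(\<Sum>\<gamma>\<in>?W. A \<gamma> * \<Phi> \<gamma> H') = (\<Sum>\<gamma>\<in>R0. A \<gamma> * \<Phi> \<gamma> H')"
      using fW A2 by (intro sum.mono_neutral_right) auto
    also have "(\<Sum>\<gamma>\<in>?W. A (\<gamma> + \<alpha>) * \<Phi> \<gamma> H') = (\<Sum>\<gamma>\<in>?R'. A (\<gamma> + \<alpha>) * \<Phi> \<gamma> H')"
    proof (rule sum.mono_neutral_right[OF fW])
      have "\<gamma> + \<alpha> \<notin> R0" if "\<gamma> \<notin> ?R'" for \<gamma>
        using that by (metis add_diff_cancel image_eqI)
      then show "\<forall>\<gamma>\<in>?W - ?R'. A (\<gamma> + \<alpha>) * \<Phi> \<gamma> H' = 0" using A2 by simp
    qed auto
    also have "\<dots> = (\<Sum>r\<in>R0. A r * \<Phi> (r - \<alpha>) H')"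
      by (subst sum.reindex) (auto simp: inj_on_def)
    finally show "(\<Sum>\<gamma>\<in>R. sgn_par (par \<gamma>) * \<Phi> \<gamma> (br x y) * \<Phi> \<gamma> H') = (\<Sum>r\<in>R0. A r) * \<Phi> \<alpha> H'"
      by (simp add: Phi_diff sum_subtractf right_diff_distrib sum_distrib_right)
  qed
qed

end

text \<open>Solves the recursion of \<open>string_scalars\<close> upwards along the \<alpha>-string,
  in units of the factor by which the coroot differs from \<open>B \<alpha>\<close>. The scalar is 0
  at the bottom of the string. The number is fuel, and \<open>None\<close> means that it ran out
  before the bottom was reached.\<close>

primrec string_val :: "('w::ab_group_add \<Rightarrow> bool) \<Rightarrow> ('w \<Rightarrow> bool) \<Rightarrow> ('w \<Rightarrow> 'w \<Rightarrow> int) \<Rightarrow> nat \<Rightarrow> 'w \<Rightarrow> 'w \<Rightarrow> int option"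
  where
    "string_val rt par B 0 \<alpha> \<gamma> = None"
  | "string_val rt par B (Suc n) \<alpha> \<gamma> =
      (if rt (\<gamma> - \<alpha>) \<or> \<gamma> = \<alpha> then map_option (\<lambda>t. (if par \<alpha> then -1 else 1) * (t - B \<alpha> (\<gamma> - \<alpha>))) (string_val rt par B n \<alpha> (\<gamma> - \<alpha>))
       else Some 0)"

text \<open>\<open>B\<close> stands for the form that the supertrace form induces on weights, up to
  scale, and \<open>coroot\<close> expresses its nondegeneracy. \<open>separate\<close> says that
  the coroots of \<beta> and \<alpha> + \<beta> are not proportional, except in the listed collinear
  cases. \<open>string_nonzero\<close> says that the string scalar at \<alpha> + \<beta> is nonzero.
  The last two are finite checks on the roots.\<close>

locale killing = rooted sc P br h \<Phi> R par
  for sc :: "complex \<Rightarrow> 'v::ab_group_add \<Rightarrow> 'v" and P br h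
    and \<Phi> :: "'w::ab_group_add \<Rightarrow> 'v \<Rightarrow> complex" and R par +
  fixes B :: "'w \<Rightarrow> 'w \<Rightarrow> int"
  assumes coroot: "\<alpha> \<in> R \<Longrightarrow> H \<in> h \<Longrightarrow>
      (\<And>H'. H' \<in> h \<Longrightarrow> (\<Sum>\<gamma>\<in>R. sgn_par (par \<gamma>) * \<Phi> \<gamma> H * \<Phi> \<gamma> H') = \<kappa> * \<Phi> \<alpha> H') \<Longrightarrow>
      \<exists>k. \<forall>\<beta>\<in>R. \<Phi> \<beta> H = k * of_int (B \<alpha> \<beta>)"
    and B_0: "B \<alpha> 0 = 0"
    and separate: "\<alpha> \<in> R \<Longrightarrow> \<beta> \<in> R \<Longrightarrow> \<alpha> + \<beta> \<in> R \<Longrightarrow>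
      (\<exists>\<gamma>\<in>R. B \<beta> \<gamma> = 0 \<and> B (\<alpha> + \<beta>) \<gamma> \<noteq> 0) \<or> \<beta> = \<alpha> \<or> \<beta> = - \<alpha> - \<alpha> \<or> \<alpha> = - \<beta> - \<beta> \<and> par \<beta>"
    and string_nonzero: "\<alpha> \<in> R \<Longrightarrow> \<beta> \<in> R \<Longrightarrow> \<alpha> + \<beta> \<in> R \<Longrightarrow>
      (\<exists>t n. string_val (\<lambda>w. w \<in> R) par B n \<alpha> (\<alpha> + \<beta>) = Some t \<and> t \<noteq> 0)"
begin

section \<open>Opposite root vectors never commute\<close>

lemma coroot_ex:
  assumes "\<alpha> \<in> R" "x \<in> Gw \<alpha>" "y \<in> Gw (- \<alpha>)"
  shows "\<exists>k. \<forall>\<beta>\<in>R0. \<Phi> \<beta> (br x y) = k * of_int (B \<alpha> \<beta>)"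
proof -
  obtain \<kappa> where "\<forall>H'. (\<Sum>\<gamma>\<in>R. sgn_par (par \<gamma>) * \<Phi> \<gamma> (br x y) * \<Phi> \<gamma> H') = \<kappa> * \<Phi> \<alpha> H'"
    using killing_coroot[OF assms] by blast
  then obtain k where "\<forall>\<beta>\<in>R. \<Phi> \<beta> (br x y) = k * of_int (B \<alpha> \<beta>)"
    using coroot[OF assms(1) br_Gw_minus[OF assms(2,3)], of \<kappa>] by blast
  then show ?thesis by (intro exI[of _ k]) (auto simp: R0_def B_0)
qed

text \<open>Roots whose coroot vanishes. Their root spaces turn out to span an ideal, so that
  simplicity can rule them out.\<close>

definition Bad :: "'w set" where "Bad = {\<alpha>\<in>R. br (rv \<alpha>) (rv (- \<alpha>)) = 0}"

lemma Bad_br: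
  assumes "\<alpha> \<in> Bad" "x \<in> Gw \<alpha>" "y \<in> Gw (- \<alpha>)" shows "br x y = 0" "br y x = 0"
proof -
  have R: "\<alpha> \<in> R" "- \<alpha> \<in> R" using assms R_neg by (auto simp: Bad_def)
  obtain a b where "x = sc a (rv \<alpha>)" "y = sc b (rv (- \<alpha>))" using rv(3) R assms by blast
  then show z: "br x y = 0" using assms(1) R rv_car by (simp add: Bad_def br_sc)
  show "br y x = 0" using br_skew[OF Gw_par[OF assms(3)] Gw_par[OF assms(2)]] z by simp
qed

lemma Bad_minus: assumes "\<alpha> \<in> Bad" shows "- \<alpha> \<in> Bad"
  using assms Bad_br[OF assms rv(2) rv(2)] R_neg by (auto simp: Bad_def)

text \<open>Let \<open>z\<close> have weight -(\<alpha> + \<beta>). Since \<open>[y, z]\<close> has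
  weight -\<alpha>, the Jacobi identity makes \<open>[[x, y], z]\<close> equal to
  \<open>[y, [x, z]]\<close> up to sign. The former is a multiple of the coroot of \<alpha> +
  \<beta>, the latter of that of \<beta>; if these are not proportional, both vanish. The collinear
  cases are argued separately.\<close>

lemma Bad_closed:
  assumes \<alpha>: "\<alpha> \<in> Bad" and \<beta>: "\<beta> \<in> R" and \<alpha>\<beta>: "\<alpha> + \<beta> \<in> R"
    and x: "x \<in> Gw \<alpha>" and y: "y \<in> Gw \<beta>" and nz: "br x y \<noteq> 0"
  shows "\<alpha> + \<beta> \<in> Bad"
proof -
  let ?z = "rv (- (\<alpha> + \<beta>))" and ?w = "rv (\<alpha> + \<beta>)"
  have \<alpha>R: "\<alpha> \<in> R" using \<alpha> by (simp add: Bad_def)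
  have mR: "- (\<alpha> + \<beta>) \<in> R" using R_neg[OF \<alpha>\<beta>] .
  have z: "?z \<in> Gw (- (\<alpha> + \<beta>))" using rv(2)[OF mR] .
  have c: "x \<in> car P" "y \<in> car P" "?z \<in> car P" using x y z Gw_car by auto
  have xy: "br x y \<in> Gw (\<alpha> + \<beta>)" using br_Gw[OF x y] .
  obtain t where t: "?w = sc t (br x y)" using Gw_line[OF \<alpha>\<beta> xy nz rv(2)[OF \<alpha>\<beta>]] by blast
  have yz: "br y ?z \<in> Gw (- \<alpha>)" using br_Gw[OF y z] by (simp add: algebra_simps)
  have xz: "br x ?z \<in> Gw (- \<beta>)" using br_Gw[OF x z] by (simp add: algebra_simps)
  let ?s = "sgnp (par \<alpha>) (par \<beta>)"
  have J: "br (br x y) ?z = - sc ?s (br y (br x ?z))"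
    using jacobi_right[OF Gw_par[OF x] Gw_par[OF y] c(3)] Bad_br(1)[OF \<alpha> x yz]
    by (simp add: eq_neg_iff_add_eq_0)
  have suff: ?thesis if "br (br x y) ?z = 0"
    using that \<alpha>\<beta> t c by (simp add: Bad_def br_sc)
  consider (sep) "\<exists>\<gamma>\<in>R. B \<beta> \<gamma> = 0 \<and> B (\<alpha> + \<beta>) \<gamma> \<noteq> 0" | (eq) "\<beta> = \<alpha>" | (m) "\<beta> = - \<alpha> - \<alpha>"
    | (m2) "\<alpha> = - \<beta> - \<beta>" "par \<beta>"
    using separate[OF \<alpha>R \<beta> \<alpha>\<beta>] by blast
  then show ?thesis
  proof cases
    case sep
    then obtain \<gamma> where g: "\<gamma> \<in> R" "B \<beta> \<gamma> = 0" "B (\<alpha> + \<beta>) \<gamma> \<noteq> 0" by blast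
    let ?H1 = "br (br x y) ?z" and ?H2 = "br y (br x ?z)"
    have H: "?H1 \<in> h" "?H2 \<in> h" using br_Gw_minus[OF xy z] br_Gw_minus[OF y xz] by auto
    obtain k1 where k1: "\<forall>\<beta>'\<in>R0. \<Phi> \<beta>' ?H1 = k1 * of_int (B (\<alpha> + \<beta>) \<beta>')"
      using coroot_ex[OF \<alpha>\<beta> xy z] by blast
    obtain k2 where k2: "\<forall>\<beta>'\<in>R0. \<Phi> \<beta>' ?H2 = k2 * of_int (B \<beta> \<beta>')"
      using coroot_ex[OF \<beta> y xz] by blast
    have "\<Phi> \<gamma> ?H1 = - ?s * \<Phi> \<gamma> ?H2"
      using J Phi_H_sc[OF H(2), of \<gamma> "- ?s"] by simp
    then have "k1 = 0" using k1 k2 g by (simp add: R0_def)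
    then have "?H1 = 0" using H_zero[OF H(1)] k1 by (simp add: R0_def)
    then show ?thesis by (rule suff)
  next
    case eq
    then have "br y (br x ?z) = 0" using Bad_br(1)[OF \<alpha>, of y "br x ?z"] y xz by simp
    then show ?thesis using J suff by simp
  next
    case m
    then have "\<alpha> + \<beta> = - \<alpha>" by simp
    then show ?thesis using Bad_minus[OF \<alpha>] by simp
  next
    \<comment> \<open>Here \<open>z\<close> has the weight \<beta> of \<open>y\<close>, so
      \<open>[[x, y], y]\<close> decides. The square \<open>[y, y]\<close> has weight -\<alpha> and
      commutes with \<open>x\<close>; as \<open>y\<close> and \<open>[x, y]\<close> are odd,
      expanding \<open>[x, [y, y]]\<close> gives twice \<open>[[x, y], y]\<close>.\<close>
    case m2
    then have s: "\<alpha> + \<beta> = - \<beta>" by simp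
    have zG: "?z \<in> Gw \<beta>" using z s by simp
    have "?z \<in> car P" "?z \<noteq> 0" using c rv(1)[OF mR] by auto
    obtain u where u: "?z = sc u y"
    proof -
      have "y \<noteq> 0" using nz c by auto
      then show thesis using Gw_line[OF \<beta> y _ zG] that by blast
    qed
    have evenp: "\<not> par \<alpha>" using m2 par_diff[of "- \<beta>" \<beta>] by simp
    have yy: "br y y \<in> Gw (- \<alpha>)" using br_Gw[OF y y] m2 by simp
    have xyP: "br x y \<in> P (par \<beta>)" using br_P[OF Gw_par[OF x] Gw_par[OF y]] evenp by simp
    have "br x (br y y) = br (br x y) y + br y (br x y)"
      using jacobi_right[OF Gw_par[OF x] Gw_par[OF y] c(2)] evenp by simp
    then have e: "br (br x y) y + br y (br x y) = 0" using Bad_br(1)[OF \<alpha> x yy] by simp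
    have "br y (br x y) = br (br x y) y" using br_skew[OF Gw_par[OF y] xyP] m2 by (simp add: sgn_par_def)
    then have "sc 2 (br (br x y) y) = 0" using e scale_left_distrib[of 1 1 "br (br x y) y"] by simp
    then have "br (br x y) y = 0" by simp
    then show ?thesis using suff u c by (simp add: br_sc)
  qed
qed

text \<open>The bad root spaces span a parity-stable ideal: \<open>Bad_closed\<close> handles
  nonzero brackets into other root spaces, and brackets into \<open>h\<close> vanish by definition.
  Elements of this ideal have no Cartan component, so it is not everything, and simplicity makes it
  zero.\<close>

lemma Bad_empty: "Bad = {}"
proof -
  let ?U = "\<Union>\<alpha>\<in>Bad. Gw \<alpha>"
  let ?I = "span ?U"
  have sub: "?I \<subseteq> car P"
    by (rule span_minimal[OF _ subspace_car]) (auto dest: Gw_car)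
  have sI: "subspace ?I" by (rule subspace_span)
  have GI: "x \<in> ?I" if "\<alpha> \<in> Bad" "x \<in> Gw \<alpha>" for x \<alpha> using that by (intro span_base) auto
  have parts: "\<exists>a\<in>?I \<inter> P False. \<exists>b\<in>?I \<inter> P True. x = a + b" if "x \<in> ?I" for x
    using that
  proof (induction rule: span_induct_alt)
    case base
    have "(0::'v) = 0 + 0" "0 \<in> ?I \<inter> P False" "0 \<in> ?I \<inter> P True" using subspace_0[OF sI] by auto
    then show ?case by blast
  next
    case (step c x y)
    then obtain \<alpha> where \<alpha>: "\<alpha> \<in> Bad" "x \<in> Gw \<alpha>" by blast
    obtain a b where ab: "a \<in> ?I \<inter> P False" "b \<in> ?I \<inter> P True" "y = a + b" using step by blast
    have xI: "sc c x \<in> ?I" using GI[OF \<alpha>] subspace_scale[OF sI] by blast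
    have xP: "sc c x \<in> P (par \<alpha>)" using Gw_par[OF \<alpha>(2)] subspace_scale[OF subspace_P] by blast
    show ?case
    proof (cases "par \<alpha>")
      case True
      have "sc c x + y = a + (sc c x + b)" using ab by (simp add: algebra_simps)
      moreover have "sc c x + b \<in> ?I \<inter> P True"
        using xI xP True ab subspace_add[OF sI] subspace_add[OF subspace_P] by auto
      ultimately show ?thesis using ab(1) by blast
    next
      case False
      have "sc c x + y = (sc c x + a) + b" using ab by (simp add: algebra_simps)
      moreover have "sc c x + a \<in> ?I \<inter> P False"
        using xI xP False ab subspace_add[OF sI] subspace_add[OF subspace_P] by auto
      ultimately show ?thesis using ab(2) by blast
    qed
  qed
  have gen: "br z x \<in> ?I" if z: "z \<in> Gw w" and \<alpha>: "\<alpha> \<in> Bad" and x: "x \<in> Gw \<alpha>" for z w x \<alpha>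
  proof (cases "br z x = 0")
    case True
    then show ?thesis using subspace_0[OF sI] by simp
  next
    case nz: False
    have zx: "br z x \<in> Gw (\<alpha> + w)" using br_Gw[OF z x] by (simp add: add.commute)
    have wR: "w \<in> R0"
    proof (rule ccontr)
      assume "w \<notin> R0"
      then have "z = 0" using Gw_nonroot z by blast
      then show False using nz Gw_car[OF x] by simp
    qed
    show ?thesis
    proof (cases "w = 0")
      case True
      then show ?thesis using zx GI[OF \<alpha>] by simp
    next
      case False
      then have wR: "w \<in> R" using wR by (simp add: R0_def)
      have "\<alpha> + w \<noteq> 0"
      proof
        assume "\<alpha> + w = 0"
        then have "w = - \<alpha>" by (simp add: eq_neg_iff_add_eq_0 add.commute)
        then show False using Bad_br(2)[OF \<alpha> x] z nz by simp
      qed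
      moreover have "\<alpha> + w \<in> R0" using zx nz Gw_nonroot by blast
      ultimately have s: "\<alpha> + w \<in> R" by (simp add: R0_def)
      have "br x z \<noteq> 0" using br_skew[OF Gw_par[OF z] Gw_par[OF x]] nz by auto
      then have "\<alpha> + w \<in> Bad" by (rule Bad_closed[OF \<alpha> wR s x z])
      then show ?thesis using GI zx by blast
    qed
  qed
  have ideal: "br z x \<in> ?I" if z: "z \<in> car P" and x: "x \<in> ?I" for z x
  proof -
    have "x \<in> car P \<and> br z x \<in> ?I" using x
    proof (induction rule: span_induct_alt)
      case base
      then show ?case using subspace_0[OF sI] z by simp
    next
      case (step c x y)
      then obtain \<alpha> where \<alpha>: "\<alpha> \<in> Bad" "x \<in> Gw \<alpha>" by blast
      have c: "x \<in> car P" "y \<in> car P" using Gw_car[OF \<alpha>(2)] step.IH by auto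
      have "br z x = (\<Sum>w\<in>R0. br (comp z w) x)"
        using br_sum(1)[of x R0 "comp z"] comp(3)[OF z] comp(1)[OF z] Gw_car c by metis
      also have "\<dots> \<in> ?I" by (rule subspace_sum[OF sI]) (rule gen[OF comp(1)[OF z] \<alpha>])
      finally have "br z x \<in> ?I" .
      moreover have "br z (sc c x + y) = sc c (br z x) + br z y" by (rule br_lin(2)[OF c z])
      ultimately show ?case using step.IH c by (simp add: subspace_add[OF sI] subspace_scale[OF sI])
    qed
    then show ?thesis by simp
  qed
  have c0: "comp x 0 = 0" if "x \<in> ?I" for x
  proof -
    have "x \<in> car P \<and> comp x 0 = 0" using that
    proof (induction rule: span_induct_alt)
      case (step c x y)
      then obtain \<alpha> where \<alpha>: "\<alpha> \<in> Bad" "x \<in> Gw \<alpha>" by blast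
      have "\<alpha> \<noteq> 0" using \<alpha>(1) R_0 by (auto simp: Bad_def)
      then have "comp x 0 = 0" using comp_Gw[OF \<alpha>(2), of 0] by simp
      moreover have "x \<in> car P" using Gw_car[OF \<alpha>(2)] .
      ultimately show ?case using step.IH by (simp add: comp_lin)
    qed simp
    then show ?thesis by simp
  qed
  have "?I = {0} \<or> ?I = car P"
    using simple sI sub parts ideal unfolding simple_lsa_def by blast
  moreover have "?I \<noteq> car P"
  proof
    assume e: "?I = car P"
    obtain H where H: "H \<in> h" "H \<noteq> 0" using h_ne by blast
    then have "comp H 0 = H" using comp_Gw[of H 0 0] Gw_0 by simp
    moreover have "comp H 0 = 0" using c0 e h_car H by simp
    ultimately show False using H by simp
  qed
  ultimately have I0: "?I = {0}" by simp
  show "Bad = {}"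
  proof (rule ccontr)
    assume "Bad \<noteq> {}"
    then obtain \<alpha> where \<alpha>: "\<alpha> \<in> Bad" by blast
    then have "\<alpha> \<in> R" by (simp add: Bad_def)
    then have "rv \<alpha> \<in> ?I" "rv \<alpha> \<noteq> 0" using GI[OF \<alpha> rv(2)] rv(1) by auto
    then show False using I0 by simp
  qed
qed

lemma br_opposite_nonzero:
  assumes "\<alpha> \<in> R" "x \<in> Gw \<alpha>" "y \<in> Gw (- \<alpha>)" "x \<noteq> 0" "y \<noteq> 0"
  shows "br x y \<noteq> 0"
proof
  assume z: "br x y = 0"
  obtain a where a: "rv \<alpha> = sc a x" using Gw_line[of \<alpha> x "rv \<alpha>"] assms rv(2) by blast
  obtain b where b: "rv (- \<alpha>) = sc b y" using Gw_line[of "- \<alpha>" y "rv (- \<alpha>)"] assms rv(2) R_neg by blast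
  have "br (rv \<alpha>) (rv (- \<alpha>)) = 0" using a b z assms Gw_car by (simp add: br_sc)
  then show False using Bad_empty assms(1) by (auto simp: Bad_def)
qed

text \<open>Take \<open>x'\<close> of weight -\<alpha> and \<open>f\<close> of weight \<alpha> +
  \<beta>. If \<open>[x, y] = 0\<close>, then \<open>[x, [x', f]] = 0\<close>, because
  \<open>[x', f]\<close> is a multiple of \<open>y\<close>. But \<open>ad x ad x'\<close> acts on
  \<open>f\<close> by the string scalar, a nonzero multiple of a nonzero integer.\<close>

lemma br_root_nonzero:
  assumes \<alpha>: "\<alpha> \<in> R" and \<beta>: "\<beta> \<in> R" and \<alpha>\<beta>: "\<alpha> + \<beta> \<in> R"
    and x: "x \<in> Gw \<alpha>" "x \<noteq> 0" and y: "y \<in> Gw \<beta>" "y \<noteq> 0"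
  shows "br x y \<noteq> 0"
proof
  assume z: "br x y = 0"
  let ?x' = "rv (- \<alpha>)" and ?f = "rv (\<alpha> + \<beta>)"
  have x': "?x' \<in> Gw (- \<alpha>)" "?x' \<noteq> 0" using rv R_neg \<alpha> by auto
  have f: "?f \<in> Gw (\<alpha> + \<beta>)" "?f \<noteq> 0" using rv \<alpha>\<beta> by auto
  let ?H = "br x ?x'"
  have H: "?H \<in> h" "?H \<noteq> 0" using br_Gw_minus[OF x(1) x'(1)] br_opposite_nonzero[OF \<alpha> x(1) x'(1) x(2) x'(2)] by auto
  obtain k where k: "\<forall>\<beta>\<in>R0. \<Phi> \<beta> ?H = k * of_int (B \<alpha> \<beta>)" using coroot_ex[OF \<alpha> x(1) x'(1)] by blast
  have "k \<noteq> 0" using H_zero[OF H(1)] H(2) k by (auto simp: R0_def)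
  obtain a where a1: "\<And>\<gamma> e. \<gamma> \<in> R \<Longrightarrow> e \<in> Gw \<gamma> \<Longrightarrow> br x (br ?x' e) = sc (a \<gamma>) e"
    and a2: "\<And>\<gamma>. \<gamma> \<notin> R0 \<Longrightarrow> a \<gamma> = 0"
    and a3: "\<And>\<gamma>. (if \<gamma> \<in> R0 then \<Phi> \<gamma> ?H else 0) = a \<gamma> - sgn_par (par \<alpha>) * a (\<gamma> + \<alpha>)"
    using string_scalars[OF \<alpha> x(1) x'(1)] by metis
  have rec: "a \<gamma> = sgn_par (par \<alpha>) * (a (\<gamma> - \<alpha>) - (if \<gamma> - \<alpha> \<in> R0 then \<Phi> (\<gamma> - \<alpha>) ?H else 0))" for \<gamma>
    using a3[of "\<gamma> - \<alpha>"] by (cases "par \<alpha>") (auto simp: sgn_par_def algebra_simps split: if_splits)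
  have sound: "string_val (\<lambda>w. w \<in> R) par B n \<alpha> \<gamma> = Some t \<Longrightarrow> a \<gamma> = k * of_int t" for n \<gamma> t
  proof (induction n arbitrary: \<gamma> t)
    case (Suc n)
    show ?case
    proof (cases "\<gamma> - \<alpha> \<in> R0")
      case True
      then have c: "\<gamma> - \<alpha> \<in> R \<or> \<gamma> = \<alpha>" by (auto simp: R0_def)
      then obtain t' where t': "string_val (\<lambda>w. w \<in> R) par B n \<alpha> (\<gamma> - \<alpha>) = Some t'"
        "t = (if par \<alpha> then -1 else 1) * (t' - B \<alpha> (\<gamma> - \<alpha>))" using Suc.prems by auto
      have "a \<gamma> = sgn_par (par \<alpha>) * (k * of_int t' - k * of_int (B \<alpha> (\<gamma> - \<alpha>)))"
        using rec[of \<gamma>] Suc.IH[OF t'(1)] True k by simp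
      then show ?thesis unfolding t'(2) by (cases "par \<alpha>") (simp_all add: sgn_par_def algebra_simps)
    next
      case False
      then have "t = 0" using Suc.prems by (auto simp: R0_def)
      moreover have "a \<gamma> = 0" using rec[of \<gamma>] False a2 by simp
      ultimately show ?thesis by simp
    qed
  qed simp
  obtain t n where "string_val (\<lambda>w. w \<in> R) par B n \<alpha> (\<alpha> + \<beta>) = Some t" "t \<noteq> 0"
    using string_nonzero[OF \<alpha> \<beta> \<alpha>\<beta>] by blast
  then have an: "a (\<alpha> + \<beta>) \<noteq> 0" using sound \<open>k \<noteq> 0\<close> by simp
  have "br ?x' ?f \<in> Gw \<beta>" using br_Gw[OF x'(1) f(1)] by (simp add: algebra_simps)
  then obtain c where "br ?x' ?f = sc c y" using Gw_line[OF \<beta> y] by blast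
  then have "br x (br ?x' ?f) = 0" using z x y Gw_car by (simp add: br_sc)
  then show False using a1[OF \<alpha>\<beta> f(1)] an f(2) by simp
qed

end

section \<open>Tanaka prolongation and derivations\<close>

lemma (in lsa) graded_facts:
  assumes "graded_lsa sc P br G"
  shows "subspace (G k)" "x \<in> G k \<Longrightarrow> x \<in> car P"
    "x \<in> G k \<Longrightarrow> \<exists>a b. a \<in> G k \<and> a \<in> P False \<and> b \<in> G k \<and> b \<in> P True \<and> x = a + b"
    "x \<in> car P \<Longrightarrow> x \<in> span (\<Union>k. G k)"
    "finite F \<Longrightarrow> (\<And>k. k \<in> F \<Longrightarrow> f k \<in> G k) \<Longrightarrow> sum f F = 0 \<Longrightarrow> k \<in> F \<Longrightarrow> f k = 0"
    "x \<in> G i \<Longrightarrow> y \<in> G j \<Longrightarrow> br x y \<in> G (i + j)"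
proof -
  note a = assms[unfolded graded_lsa_def, THEN conjunct2]
  note a1 = a[THEN conjunct1, rule_format] and a2 = a[THEN conjunct2]
  show "subspace (G k)" using a1[of k] by (rule conjunct1)
  have "G k \<subseteq> car P" using a1[of k] by (elim conjE)
  then show "x \<in> G k \<Longrightarrow> x \<in> car P" by (rule subsetD)
  have "\<forall>x\<in>G k. \<exists>a\<in>G k \<inter> P False. \<exists>b\<in>G k \<inter> P True. x = a + b" using a1[of k] by (elim conjE)
  then show "x \<in> G k \<Longrightarrow> \<exists>a b. a \<in> G k \<and> a \<in> P False \<and> b \<in> G k \<and> b \<in> P True \<and> x = a + b" by blast
  show "x \<in> car P \<Longrightarrow> x \<in> span (\<Union>k. G k)" using a2[THEN conjunct1] by (rule subsetD)
  show "finite F \<Longrightarrow> (\<And>k. k \<in> F \<Longrightarrow> f k \<in> G k) \<Longrightarrow> sum f F = 0 \<Longrightarrow> k \<in> F \<Longrightarrow> f k = 0"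
    using a2[THEN conjunct2, THEN conjunct1] by blast
  show "x \<in> G i \<Longrightarrow> y \<in> G j \<Longrightarrow> br x y \<in> G (i + j)"
    using a2[THEN conjunct2, THEN conjunct2] by blast
qed

locale tanaka = lsa sc P br for sc :: "complex \<Rightarrow> 'v::ab_group_add \<Rightarrow> 'v" and P br +
  fixes G :: "int \<Rightarrow> 'v set"
  assumes gr: "graded_lsa sc P br G" and tr: "transitive_gr br G"
begin

lemmas G_sub = graded_facts(1)[OF gr] and G_car = graded_facts(2)[OF gr]
  and G_parts = graded_facts(3)[OF gr] and car_G = graded_facts(4)[OF gr]
  and G_direct = graded_facts(5)[OF gr] and G_br = graded_facts(6)[OF gr]

lemma G_simps [simp]:
  "0 \<in> G k"
  "x \<in> G k \<Longrightarrow> y \<in> G k \<Longrightarrow> x + y \<in> G k"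
  "x \<in> G k \<Longrightarrow> y \<in> G k \<Longrightarrow> x - y \<in> G k"
  "x \<in> G k \<Longrightarrow> - x \<in> G k"
  "x \<in> G k \<Longrightarrow> sc a x \<in> G k"
  by (simp_all add: G_sub subspace_0 subspace_add subspace_diff subspace_neg subspace_scale)

lemma trans_zero: "k \<ge> 0 \<Longrightarrow> x \<in> G k \<Longrightarrow> (\<And>y. y \<in> G (-1) \<Longrightarrow> br x y = 0) \<Longrightarrow> x = 0"
  using tr by (auto simp: transitive_gr_def)

lemma G_neg: "k < 0 \<Longrightarrow> x \<in> G k \<Longrightarrow> x \<in> negpart sc G"
  unfolding negpart_def by (intro span_base) auto

lemma subspace_neg: "subspace (negpart sc G)" by (simp add: negpart_def)

text \<open>A superderivation of the negative part into the whole algebra, stored as one map per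
  degree, so that it is never applied to inhomogeneous elements. Only the first argument of the
  product rule has to be homogeneous in parity, since only its parity enters the sign.\<close>

definition der :: "int \<Rightarrow> bool \<Rightarrow> (int \<Rightarrow> 'v \<Rightarrow> 'v) \<Rightarrow> bool" where
  "der k p D \<longleftrightarrow>
     (\<forall>j<0. \<forall>u\<in>G j. D j u \<in> G (k + j)) \<and>
     (\<forall>j<0. \<forall>q. \<forall>u\<in>G j \<inter> P q. D j u \<in> P (p \<noteq> q)) \<and>
     (\<forall>j<0. \<forall>u\<in>G j. \<forall>v\<in>G j. \<forall>a. D j (sc a u + v) = sc a (D j u) + D j v) \<and>
     (\<forall>i<0. \<forall>j<0. \<forall>q. \<forall>u\<in>G i \<inter> P q. \<forall>v\<in>G j.
        D (i + j) (br u v) = br (D i u) v + sc (sgnp p q) (br u (D j v)))"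

text \<open>The degree \<open>k\<close> part of the cohomology \<open>H^1(m, g)\<close>: derivations
  modulo inner ones.\<close>

definition H1_vanishes :: "int \<Rightarrow> bool" where
  "H1_vanishes k \<longleftrightarrow> (\<forall>p D. der k p D \<longrightarrow> (\<exists>Y\<in>G k. \<forall>j<0. \<forall>u\<in>G j. D j u = br Y u))"

end

section \<open>Comparison of a transitive extension with the algebra\<close>

locale tanaka_ext = tanaka sc P br G for sc :: "complex \<Rightarrow> 'v::ab_group_add \<Rightarrow> 'v" and P br G +
  fixes sc' :: "complex \<Rightarrow> 'b::ab_group_add \<Rightarrow> 'b" and P' br' G' \<phi>
  assumes ext: "trans_ext sc P br G sc' P' br' G' \<phi>"
begin

sublocale E: tanaka sc' P' br' G'
proof -
  have g: "graded_lsa sc' P' br' G'" "transitive_gr br' G'" using ext by (auto simp: trans_ext_def)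
  then have "lsa sc' P' br'" unfolding lsa_def graded_lsa_def by blast
  with g show "tanaka sc' P' br' G'" by (simp add: tanaka_def tanaka_axioms_def)
qed

lemma phi_lin: "x \<in> negpart sc G \<Longrightarrow> y \<in> negpart sc G \<Longrightarrow> \<phi> (sc a x + y) = sc' a (\<phi> x) + \<phi> y"
  and phi_br: "x \<in> negpart sc G \<Longrightarrow> y \<in> negpart sc G \<Longrightarrow> \<phi> (br x y) = br' (\<phi> x) (\<phi> y)"
  and phi_bij: "k < 0 \<Longrightarrow> bij_betw \<phi> (G k) (G' k)"
  and phi_P: "k < 0 \<Longrightarrow> \<phi> ` (G k \<inter> P p) = G' k \<inter> P' p"
  using ext unfolding trans_ext_def by blast+

lemma phi_0 [simp]: "\<phi> 0 = 0"
  using phi_lin[of 0 0 1] subspace_0[OF subspace_neg] by simp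

lemma phi_add: "x \<in> negpart sc G \<Longrightarrow> y \<in> negpart sc G \<Longrightarrow> \<phi> (x + y) = \<phi> x + \<phi> y"
  using phi_lin[of x y 1] by simp

lemma phi_G: "k < 0 \<Longrightarrow> x \<in> G k \<Longrightarrow> \<phi> x \<in> G' k"
  using phi_bij bij_betwE by blast

lemma phi_inj: "k < 0 \<Longrightarrow> x \<in> G k \<Longrightarrow> y \<in> G k \<Longrightarrow> \<phi> x = \<phi> y \<Longrightarrow> x = y"
  using phi_bij by (meson bij_betw_imp_inj_on inj_onD)

lemma phi_surj: "k < 0 \<Longrightarrow> X \<in> G' k \<Longrightarrow> \<exists>x\<in>G k. X = \<phi> x"
  using phi_bij by (metis bij_betw_imp_surj_on imageE)

lemma phi_PP: "k < 0 \<Longrightarrow> x \<in> G k \<Longrightarrow> x \<in> P p \<Longrightarrow> \<phi> x \<in> P' p"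
  using phi_P by blast

lemma phi_car: "k < 0 \<Longrightarrow> x \<in> G k \<Longrightarrow> \<phi> x \<in> car P'"
  using phi_G E.G_car by blast

text \<open>\<open>W k X Y\<close>: the elements \<open>X\<close> and \<open>Y\<close> of degree \<open>k\<close> act in the same way on the common
negative part.\<close>

function W :: "int \<Rightarrow> 'b \<Rightarrow> 'v \<Rightarrow> bool" where
  "W k X Y = (if k < 0 then Y \<in> G k \<and> X = \<phi> Y
     else X \<in> G' k \<and> Y \<in> G k \<and> (\<forall>j<0. \<forall>u\<in>G j. W (k + j) (br' X (\<phi> u)) (br Y u)))"
  by auto
termination by (relation "measure (\<lambda>(k, X, Y). nat (k + 1))") auto

declare W.simps [simp del]

lemma W_neg: "k < 0 \<Longrightarrow> W k X Y \<longleftrightarrow> Y \<in> G k \<and> X = \<phi> Y"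
  by (subst W.simps) simp

lemma W_nonneg: "k \<ge> 0 \<Longrightarrow> W k X Y \<longleftrightarrow>
    X \<in> G' k \<and> Y \<in> G k \<and> (\<forall>j<0. \<forall>u\<in>G j. W (k + j) (br' X (\<phi> u)) (br Y u))"
  by (subst W.simps) simp

lemma W_mem: "W k X Y \<Longrightarrow> X \<in> G' k" "W k X Y \<Longrightarrow> Y \<in> G k"
  using phi_G by (cases "k < 0"; force simp: W_neg W_nonneg)+

lemma W_lin: "W k X Y \<Longrightarrow> W k X2 Y2 \<Longrightarrow> W k (sc' a X + X2) (sc a Y + Y2)"
proof (induction "nat (k + 1)" arbitrary: k X Y X2 Y2 rule: less_induct)
  case less
  show ?case
  proof (cases "k < 0")
    case True
    then have "Y \<in> G k" "Y2 \<in> G k" "X = \<phi> Y" "X2 = \<phi> Y2" using less.prems by (auto simp: W_neg)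
    then show ?thesis using True G_neg by (simp add: W_neg phi_lin)
  next
    case False
    note m = W_mem[OF less.prems(1)] W_mem[OF less.prems(2)]
    have "W (k + j) (br' (sc' a X + X2) (\<phi> u)) (br (sc a Y + Y2) u)" if j: "j < 0" and u: "u \<in> G j" for j u
    proof -
      have "br' (sc' a X + X2) (\<phi> u) = sc' a (br' X (\<phi> u)) + br' X2 (\<phi> u)"
        using E.G_car m(1,3) phi_car[OF j u] by (intro E.br_lin) auto
      moreover have "br (sc a Y + Y2) u = sc a (br Y u) + br Y2 u"
        using G_car m(2,4) u by (intro br_lin) auto
      moreover have "W (k + j) (br' X (\<phi> u)) (br Y u)" "W (k + j) (br' X2 (\<phi> u)) (br Y2 u)"
        using less.prems False j u by (auto simp: W_nonneg)
      ultimately show ?thesis using less.hyps[of "k + j"] j False by simp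
    qed
    then show ?thesis using False m by (simp add: W_nonneg)
  qed
qed

lemma W_zero: "W k 0 0"
proof (induction "nat (k + 1)" arbitrary: k rule: less_induct)
  case less
  show ?case
  proof (cases "k < 0")
    case False
    have "W (k + j) (br' 0 (\<phi> u)) (br 0 u)" if j: "j < 0" and u: "u \<in> G j" for j u
      using less.hyps[of "k + j"] False j phi_car[OF j u] G_car[OF u] by simp
    then show ?thesis using False by (simp add: W_nonneg)
  qed (simp add: W_neg)
qed

lemma W_act: assumes "W k X Y" "j < 0" "u \<in> G j" shows "W (k + j) (br' X (\<phi> u)) (br Y u)"
proof (cases "k < 0")
  case True
  then have "Y \<in> G k" "X = \<phi> Y" using assms by (auto simp: W_neg)
  then show ?thesis using True assms G_neg G_br by (simp add: W_neg phi_br)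
next
  case False
  then show ?thesis using assms by (simp add: W_nonneg)
qed

text \<open>Transitivity of \<open>g\<close>, by induction on the degree: a partner of 0 commutes
  with the degree -1 part. So partners are unique. The mirror statement uses transitivity of the
  extension and yields injectivity of the embedding.\<close>

lemma W_zero_left: "W k 0 Y \<Longrightarrow> Y = 0"
proof (induction "nat (k + 1)" arbitrary: k Y rule: less_induct)
  case less
  show ?case
  proof (cases "k < 0")
    case True
    then show ?thesis using less.prems phi_inj[of k Y 0] by (auto simp: W_neg)
  next
    case False
    show ?thesis
    proof (rule trans_zero[of k])
      fix u assume u: "u \<in> G (-1)"
      have "W (k + -1) (br' 0 (\<phi> u)) (br Y u)" using W_act[OF less.prems(1) _ u] by simp
      then show "br Y u = 0" using less.hyps[of "k + -1"] False phi_car[of "-1" u] u by simp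
    qed (use W_mem[OF less.prems] False in auto)
  qed
qed

lemma W_zero_right: "W k X 0 \<Longrightarrow> X = 0"
proof (induction "nat (k + 1)" arbitrary: k X rule: less_induct)
  case less
  show ?case
  proof (cases "k < 0")
    case True
    then show ?thesis using less.prems by (auto simp: W_neg)
  next
    case False
    show ?thesis
    proof (rule E.trans_zero[of k])
      fix U assume "U \<in> G' (-1)"
      then obtain u where u: "u \<in> G (-1)" "U = \<phi> u" using phi_surj[of "-1"] by auto
      have "W (k + -1) (br' X (\<phi> u)) (br 0 u)" using W_act[OF less.prems(1) _ u(1)] by simp
      then show "br' X U = 0" using less.hyps[of "k + -1"] False u G_car by simp
    qed (use W_mem[OF less.prems] False in auto)
  qed
qed

lemma W_unique: assumes "W k X Y" "W k X Y'" shows "Y = Y'"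
  using W_zero_left[of k "Y' - Y"] W_lin[OF assms, of "-1"] by simp

lemma W_add: "W k X Y \<Longrightarrow> W k X2 Y2 \<Longrightarrow> W k (X + X2) (Y + Y2)"
  using W_lin[of k X Y X2 Y2 1] by simp

lemma W_sc: "W k X Y \<Longrightarrow> W k (sc' a X) (sc a Y)"
  using W_lin[of k X Y 0 0 a] W_zero by simp

lemma W_minus: "W k X Y \<Longrightarrow> W k (- X) (- Y)"
  using W_sc[of k X Y "-1"] by simp

text \<open>By induction the component of \<open>Y\<close> of the wrong parity sends homogeneous
  elements of degree -1 to elements of both parities, that is to 0, and so it vanishes by
  transitivity.\<close>

lemma W_par: "W k X Y \<Longrightarrow> X \<in> P' p \<Longrightarrow> Y \<in> P p"
proof (induction "nat (k + 1)" arbitrary: k X Y p rule: less_induct)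
  case less
  note m = W_mem[OF less.prems(1)]
  show ?case
  proof (cases "k < 0")
    case True
    then have "X \<in> \<phi> ` (G k \<inter> P p)" using less.prems m phi_P by auto
    then show ?thesis using less.prems True phi_inj[of k] by (auto simp: W_neg)
  next
    case False
    obtain a b where ab: "a \<in> G k" "a \<in> P False" "b \<in> G k" "b \<in> P True" "Y = a + b"
      using G_parts[OF m(2)] by blast
    have "\<exists>c d. c \<in> G k \<and> c \<in> P p \<and> d \<in> G k \<and> d \<in> P (\<not> p) \<and> Y = c + d"
    proof (cases p)
      case True
      then show ?thesis using ab by (intro exI[of _ b] exI[of _ a]) (simp add: add.commute)
    next
      case False
      then show ?thesis using ab by (intro exI[of _ a] exI[of _ b]) simp
    qed
    then obtain c d where cd: "c \<in> G k" "c \<in> P p" "d \<in> G k" "d \<in> P (\<not> p)" "Y = c + d" by blast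
    have dz: "br d u = 0" if u: "u \<in> G (-1)" "u \<in> P q" for u q
    proof -
      have "W (k + -1) (br' X (\<phi> u)) (br Y u)" using W_act[OF less.prems(1) _ u(1)] by simp
      moreover have "br' X (\<phi> u) \<in> P' (p \<noteq> q)"
        using E.br_P less.prems(2) phi_PP[of "-1"] u by auto
      ultimately have 1: "br Y u \<in> P (p \<noteq> q)" using less.hyps[of "k + -1"] False by simp
      have "br Y u = br c u + br d u" using cd G_car u by (simp add: br_add)
      then have "br d u = br Y u - br c u" by simp
      then have "br d u \<in> P (p \<noteq> q)" using 1 br_P[OF cd(2) u(2)] subspace_diff[OF subspace_P] by simp
      moreover have "br d u \<in> P ((\<not> p) \<noteq> q)" using br_P[OF cd(4) u(2)] .
      ultimately show ?thesis using P_other by blast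
    qed
    have "d = 0"
    proof (rule trans_zero[of k])
      fix u assume u: "u \<in> G (-1)"
      obtain s t where st: "s \<in> G (-1)" "s \<in> P False" "t \<in> G (-1)" "t \<in> P True" "u = s + t"
        using G_parts[OF u] by blast
      then show "br d u = 0" using dz[OF st(1,2)] dz[OF st(3,4)] cd G_car by (simp add: br_add)
    qed (use cd False in auto)
    then show ?thesis using cd by simp
  qed
qed

lemma W_act_left:
  assumes W: "W k X Y" and X: "X \<in> P' p" and j: "j < 0" and u: "u \<in> G j" "u \<in> P q"
  shows "W (k + j) (br' (\<phi> u) X) (br u Y)"
proof -
  have "br' (\<phi> u) X = - sc' (sgnp q p) (br' X (\<phi> u))" using E.br_skew[OF phi_PP[OF j u] X] .
  moreover have "br u Y = - sc (sgnp q p) (br Y u)" using br_skew[OF u(2) W_par[OF W X]] .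
  ultimately show ?thesis using W_minus[OF W_sc[OF W_act[OF W j u(1)]]] by simp
qed

text \<open>The action of \<open>X\<close> on \<open>m\<close>, transported to \<open>g\<close>
  through partners of lower degree, is a derivation of \<open>m\<close> into \<open>g\<close>. If it
  is inner, an element inducing it is a partner of \<open>X\<close>.\<close>

lemma W_total_step:
  assumes k: "k \<ge> 0" and H1: "H1_vanishes k" and IH: "\<And>k' X. k' < k \<Longrightarrow> X \<in> G' k' \<Longrightarrow> \<exists>Y. W k' X Y"
    and X: "X \<in> G' k"
  shows "\<exists>Y. W k X Y"
proof -
  have hom: "\<exists>Y. W k X Y" if X: "X \<in> G' k" "X \<in> P' p" for X p
  proof -
    define D where "D j u = (THE Y. W (k + j) (br' X (\<phi> u)) Y)" for j u
    have Xc: "X \<in> car P'" using X E.G_car by auto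
    have WD: "W (k + j) (br' X (\<phi> u)) (D j u)" if j: "j < 0" "u \<in> G j" for j u
    proof -
      have "br' X (\<phi> u) \<in> G' (k + j)" using E.G_br[OF X(1) phi_G[OF j]] .
      then obtain Y where Y: "W (k + j) (br' X (\<phi> u)) Y" using IH[of "k + j"] j by auto
      have "\<And>Z. W (k + j) (br' X (\<phi> u)) Z \<Longrightarrow> Z = Y" using W_unique Y by blast
      with Y have "D j u = Y" unfolding D_def by (intro the_equality)
      then show ?thesis using Y by simp
    qed
    have "der k p D"
      unfolding der_def
    proof (intro conjI allI impI ballI)
      fix j :: int and u assume j: "j < 0" "u \<in> G j"
      show "D j u \<in> G (k + j)" using W_mem(2)[OF WD[OF j]] .
    next
      fix j :: int and q u assume j: "j < 0" and "u \<in> G j \<inter> P q"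
      then have u: "u \<in> G j" "u \<in> P q" by auto
      show "D j u \<in> P (p \<noteq> q)" using W_par[OF WD[OF j u(1)] E.br_P[OF X(2) phi_PP[OF j u]]] .
    next
      fix j :: int and u v a assume j: "j < 0" and u: "u \<in> G j" and v: "v \<in> G j"
      have "\<phi> (sc a u + v) = sc' a (\<phi> u) + \<phi> v" using phi_lin G_neg j u v by blast
      then have "br' X (\<phi> (sc a u + v)) = sc' a (br' X (\<phi> u)) + br' X (\<phi> v)"
        using E.br_lin(2)[OF phi_car[OF j u] phi_car[OF j v] Xc] by simp
      then have "W (k + j) (br' X (\<phi> (sc a u + v))) (sc a (D j u) + D j v)"
        using W_lin[OF WD[OF j u] WD[OF j v]] by simp
      then show "D j (sc a u + v) = sc a (D j u) + D j v"
        using WD[OF j, of "sc a u + v"] u v W_unique by simp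
    next
      fix i j :: int and q u v assume i: "i < 0" and j: "j < 0" and "u \<in> G i \<inter> P q" and v: "v \<in> G j"
      then have u: "u \<in> G i" "u \<in> P q" by auto
      let ?s = "sgnp p q"
      have e: "br' X (\<phi> (br u v)) = br' (br' X (\<phi> u)) (\<phi> v) + sc' ?s (br' (\<phi> u) (br' X (\<phi> v)))"
        using E.jacobi_right[OF X(2) phi_PP[OF i u] phi_car[OF j v]] phi_br[OF G_neg G_neg] i j u v by simp
      have 1: "W (k + i + j) (br' (br' X (\<phi> u)) (\<phi> v)) (br (D i u) v)" using W_act[OF WD[OF i u(1)] j v] .
      have 2: "W (k + i + j) (br' (\<phi> u) (br' X (\<phi> v))) (br u (D j v))" if v: "v \<in> G j" "v \<in> P r" for v r
        using W_act_left[OF WD[OF j v(1)] E.br_P[OF X(2) phi_PP[OF j v]] i u] by (simp add: algebra_simps)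
      \<comment> \<open>Acting from the left requires a definite parity, hence the splitting of
        \<open>v\<close>.\<close>
      have 3: "W (k + i + j) (br' (\<phi> u) (br' X (\<phi> v))) (br u (D j v))"
      proof -
        obtain a b where ab: "a \<in> G j" "a \<in> P False" "b \<in> G j" "b \<in> P True" "v = a + b"
          using G_parts[OF v] by blast
        have Wa: "W (k + j) (br' X (\<phi> v)) (D j a + D j b)"
        proof -
          have "\<phi> v = \<phi> a + \<phi> b" using ab G_neg j phi_add by simp
          then have "br' X (\<phi> v) = br' X (\<phi> a) + br' X (\<phi> b)"
            using E.br_add(2) phi_car j ab Xc by simp
          then show ?thesis using W_add[OF WD[OF j ab(1)] WD[OF j ab(3)]] by simp
        qed
        then have Dv: "D j v = D j a + D j b" using W_unique[OF WD[OF j v]] by simp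
        have c: "D j a \<in> car P" "D j b \<in> car P" "u \<in> car P"
          using W_mem(2)[OF WD[OF j]] ab G_car u by blast+
        have "\<phi> v = \<phi> a + \<phi> b" using ab G_neg j phi_add by simp
        then have "br' (\<phi> u) (br' X (\<phi> v)) = br' (\<phi> u) (br' X (\<phi> a)) + br' (\<phi> u) (br' X (\<phi> b))"
          using phi_car[OF j ab(1)] phi_car[OF j ab(3)] phi_car[OF i u(1)] Xc by (simp add: E.br_add)
        moreover have "br u (D j v) = br u (D j a) + br u (D j b)" using Dv c by (simp add: br_add)
        ultimately show ?thesis using W_add[OF 2[OF ab(1,2)] 2[OF ab(3,4)]] by simp
      qed
      have "W (k + i + j) (br' X (\<phi> (br u v))) (br (D i u) v + sc ?s (br u (D j v)))"
        using W_add[OF 1 W_sc[OF 3, of ?s]] e by simp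
      moreover have "W (k + i + j) (br' X (\<phi> (br u v))) (D (i + j) (br u v))"
        using WD[of "i + j" "br u v"] G_br[OF u(1) v] i j by (simp add: add.assoc)
      ultimately show "D (i + j) (br u v) = br (D i u) v + sc ?s (br u (D j v))" using W_unique by blast
    qed
    then obtain Y where Y: "Y \<in> G k" "\<forall>j<0. \<forall>u\<in>G j. D j u = br Y u" using H1 unfolding H1_vanishes_def by blast
    have "W (k + j) (br' X (\<phi> u)) (br Y u)" if "j < 0" "u \<in> G j" for j u
      using WD[OF that] Y that by simp
    then have "W k X Y" using k X Y by (simp add: W_nonneg)
    then show ?thesis by blast
  qed
  obtain a b where "a \<in> G' k" "a \<in> P' False" "b \<in> G' k" "b \<in> P' True" "X = a + b"
    using E.G_parts[OF X] by blast
  moreover from this obtain Y Z where "W k a Y" "W k b Z" using hom by meson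
  ultimately show ?thesis using W_add by blast
qed

text \<open>Degree zero has two sources of partners: vanishing cohomology, for the full
  prolongation, or the prescribed degree-zero part, for the relative one.\<close>

lemma W_total:
  assumes pos: "\<And>k. k > 0 \<Longrightarrow> H1_vanishes k"
    and zero: "H1_vanishes 0 \<or> same_zero_part sc br G br' G' \<phi>"
  shows "X \<in> G' k \<Longrightarrow> \<exists>Y. W k X Y"
proof (induction "nat (k + 1)" arbitrary: k X rule: less_induct)
  case less
  show ?case
  proof (cases "k < 0")
    case True
    then show ?thesis using phi_surj[of k X] less.prems by (auto simp: W_neg)
  next
    case False
    have IH: "\<exists>Y. W k' X Y" if "k' < k" "X \<in> G' k'" for k' X using less.hyps[of k' X] that False by simp
    show ?thesis
    proof (cases "H1_vanishes k")
      case True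
      then show ?thesis using W_total_step[OF _ True IH less.prems] False by simp
    next
      case nH: False
      then have k0: "k = 0" using pos[of k] False by fastforce
      then obtain Y where Y: "Y \<in> G 0" "\<forall>y\<in>negpart sc G. br' X (\<phi> y) = \<phi> (br Y y)"
        using zero nH less.prems unfolding same_zero_part_def by blast
      have "W (0 + j) (br' X (\<phi> u)) (br Y u)" if j: "j < 0" "u \<in> G j" for j u
        using Y(2) G_neg[OF j] G_br[OF Y(1) j(2)] j by (simp add: W_neg)
      then have "W 0 X Y" using less.prems k0 Y by (simp add: W_nonneg)
      then show ?thesis using k0 by blast
    qed
  qed
qed

text \<open>When both degrees are nonnegative, partnership is tested by bracketing with negative
  elements. The Jacobi identity moves such a bracket onto one of the factors, which lowers the sum
  of the truncated degrees.\<close>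

lemma W_br_hom:
  "W k X Y \<Longrightarrow> W l X2 Y2 \<Longrightarrow> X \<in> P' p \<Longrightarrow> X2 \<in> P' q \<Longrightarrow> W (k + l) (br' X X2) (br Y Y2)"
proof (induction "nat (k + 1) + nat (l + 1)" arbitrary: k l X Y X2 Y2 p q rule: less_induct)
  case less
  note m = W_mem[OF less.prems(1)] W_mem[OF less.prems(2)]
  have c: "X \<in> car P'" "X2 \<in> car P'" "Y \<in> car P" "Y2 \<in> car P" using m E.G_car G_car by auto
  have YP: "Y \<in> P p" "Y2 \<in> P q" using W_par less.prems by auto
  consider "l < 0" | "k < 0" "l \<ge> 0" | "k \<ge> 0" "l \<ge> 0" by linarith
  then show ?case
  proof cases
    case 1
    then have "Y2 \<in> G l" "X2 = \<phi> Y2" using less.prems by (auto simp: W_neg)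
    then show ?thesis using W_act[OF less.prems(1) 1] by simp
  next
    case 2
    then have "Y \<in> G k" "X = \<phi> Y" using less.prems by (auto simp: W_neg)
    then show ?thesis using W_act_left[OF less.prems(2,4) 2(1) _ YP(1)] by (simp add: add.commute)
  next
    case 3
    have hom: "W (k + l + j) (br' (br' X X2) (\<phi> u)) (br (br Y Y2) u)"
      if j: "j < 0" and u: "u \<in> G j" "u \<in> P r" for j u r
    proof -
      have uP: "\<phi> u \<in> P' r" using phi_PP[OF j u] .
      let ?s = "sgnp p q"
      have e1: "br' (br' X X2) (\<phi> u) = br' X (br' X2 (\<phi> u)) + - sc' ?s (br' X2 (br' X (\<phi> u)))"
        using E.jacobi[OF less.prems(3,4) uP] by simp
      have e2: "br (br Y Y2) u = br Y (br Y2 u) + - sc ?s (br Y2 (br Y u))"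
        using jacobi[OF YP u(2)] by simp
      have 1: "W (k + (l + j)) (br' X (br' X2 (\<phi> u))) (br Y (br Y2 u))"
        by (rule less.hyps[OF _ less.prems(1) W_act[OF less.prems(2) j u(1)] less.prems(3) E.br_P[OF less.prems(4) uP]])
           (use 3 j in simp)
      have 2: "W (l + (k + j)) (br' X2 (br' X (\<phi> u))) (br Y2 (br Y u))"
        by (rule less.hyps[OF _ less.prems(2) W_act[OF less.prems(1) j u(1)] less.prems(4) E.br_P[OF less.prems(3) uP]])
           (use 3 j in simp)
      have "l + (k + j) = k + l + j" "k + (l + j) = k + l + j" by auto
      then have "W (k + l + j) (br' X (br' X2 (\<phi> u)) + - sc' ?s (br' X2 (br' X (\<phi> u))))
          (br Y (br Y2 u) + - sc ?s (br Y2 (br Y u)))"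
        using W_add[OF 1[unfolded \<open>k + (l + j) = k + l + j\<close>] W_minus[OF W_sc[OF 2[unfolded \<open>l + (k + j) = k + l + j\<close>], of ?s]]] by simp
      then show ?thesis using e1 e2 by simp
    qed
    have "W (k + l + j) (br' (br' X X2) (\<phi> u)) (br (br Y Y2) u)" if j: "j < 0" and u: "u \<in> G j" for j u
    proof -
      obtain a b where ab: "a \<in> G j" "a \<in> P False" "b \<in> G j" "b \<in> P True" "u = a + b"
        using G_parts[OF u] by blast
      have "\<phi> u = \<phi> a + \<phi> b" using ab G_neg j phi_add by simp
      then have "br' (br' X X2) (\<phi> u) = br' (br' X X2) (\<phi> a) + br' (br' X X2) (\<phi> b)"
        using phi_car[OF j ab(1)] phi_car[OF j ab(3)] c by (simp add: E.br_add)
      moreover have "br (br Y Y2) u = br (br Y Y2) a + br (br Y Y2) b"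
        using ab G_car c by (simp add: br_add)
      ultimately show ?thesis using W_add[OF hom[OF j ab(1,2)] hom[OF j ab(3,4)]] by simp
    qed
    then show ?thesis using 3 m E.G_br G_br by (simp add: W_nonneg)
  qed
qed

context
  assumes total: "\<And>k X. X \<in> G' k \<Longrightarrow> \<exists>Y. W k X Y"
begin

lemma W_br: assumes "W k X Y" "W l X2 Y2" shows "W (k + l) (br' X X2) (br Y Y2)"
proof -
  obtain a b where ab: "a \<in> G' k" "a \<in> P' False" "b \<in> G' k" "b \<in> P' True" "X = a + b"
    using E.G_parts[OF W_mem(1)[OF assms(1)]] by blast
  obtain c d where cd: "c \<in> G' l" "c \<in> P' False" "d \<in> G' l" "d \<in> P' True" "X2 = c + d"
    using E.G_parts[OF W_mem(1)[OF assms(2)]] by blast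
  obtain a' b' c' d' where w: "W k a a'" "W k b b'" "W l c c'" "W l d d'" using total ab cd by meson
  have Y: "Y = a' + b'" "Y2 = c' + d'"
    using W_unique[OF assms(1)] W_unique[OF assms(2)] W_add[OF w(1,2)] W_add[OF w(3,4)] ab cd by auto
  have "br' X X2 = br' a c + br' a d + (br' b c + br' b d)"
    using ab cd E.G_car by (simp add: E.br_add)
  moreover have "br Y Y2 = br a' c' + br a' d' + (br b' c' + br b' d')"
    using Y W_mem(2)[OF w(1)] W_mem(2)[OF w(2)] W_mem(2)[OF w(3)] W_mem(2)[OF w(4)] G_car by (simp add: br_add)
  ultimately show ?thesis
    using W_add[OF W_add[OF W_br_hom[OF w(1,3) ab(2) cd(2)] W_br_hom[OF w(1,4) ab(2) cd(4)]]
        W_add[OF W_br_hom[OF w(2,3) ab(4) cd(2)] W_br_hom[OF w(2,4) ab(4) cd(4)]]] by simp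
qed

text \<open>The additive extension of the relation to inhomogeneous elements; it is the graph of the
  embedding to be constructed.\<close>

definition WW :: "'b \<Rightarrow> 'v \<Rightarrow> bool" where
  "WW X Y \<longleftrightarrow> (\<exists>F f g. finite F \<and> (\<forall>k\<in>F. W k (f k) (g k)) \<and> X = sum f F \<and> Y = sum g F)"

lemma WW_I: "W k X Y \<Longrightarrow> WW X Y"
  unfolding WW_def by (intro exI[of _ "{k}"] exI[of _ "\<lambda>_. X"] exI[of _ "\<lambda>_. Y"]) auto

lemma WW_lin: assumes "WW X Y" "WW X2 Y2" shows "WW (sc' a X + X2) (sc a Y + Y2)"
proof -
  obtain F f g where 1: "finite F" "\<forall>k\<in>F. W k (f k) (g k)" "X = sum f F" "Y = sum g F"
    using assms(1) unfolding WW_def by blast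
  obtain F2 f2 g2 where 2: "finite F2" "\<forall>k\<in>F2. W k (f2 k) (g2 k)" "X2 = sum f2 F2" "Y2 = sum g2 F2"
    using assms(2) unfolding WW_def by blast
  define e1 e2 where "e1 k = (if k \<in> F then f k else 0)" and "e2 k = (if k \<in> F2 then f2 k else 0)" for k
  define d1 d2 where "d1 k = (if k \<in> F then g k else 0)" and "d2 k = (if k \<in> F2 then g2 k else 0)" for k
  let ?F = "F \<union> F2"
  have s: "sum e1 ?F = X" "sum e2 ?F = X2" "sum d1 ?F = Y" "sum d2 ?F = Y2"
    unfolding e1_def e2_def d1_def d2_def 1(3,4) 2(3,4) using 1(1) 2(1)
    by (auto intro!: sum.mono_neutral_cong_right)
  have "W k (sc' a (e1 k) + e2 k) (sc a (d1 k) + d2 k)" for k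
    using 1(2) 2(2) W_zero by (intro W_lin) (auto simp: e1_def e2_def d1_def d2_def)
  moreover have "sc' a X + X2 = (\<Sum>k\<in>?F. sc' a (e1 k) + e2 k)" "sc a Y + Y2 = (\<Sum>k\<in>?F. sc a (d1 k) + d2 k)"
    by (simp_all add: sum.distrib s flip: scale_sum_right E.scale_sum_right)
  ultimately show ?thesis unfolding WW_def using 1(1) 2(1)
    by (intro exI[of _ ?F] exI[of _ "\<lambda>k. sc' a (e1 k) + e2 k"] exI[of _ "\<lambda>k. sc a (d1 k) + d2 k"]) auto
qed

lemma WW_zero: "WW 0 0" using WW_I[OF W_zero] .

lemma WW_add: "WW X Y \<Longrightarrow> WW X2 Y2 \<Longrightarrow> WW (X + X2) (Y + Y2)"
  using WW_lin[of X Y X2 Y2 1] by simp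

lemma WW_sum: "(\<And>i. i \<in> I \<Longrightarrow> WW (f i) (g i)) \<Longrightarrow> WW (sum f I) (sum g I)"
  by (induction I rule: infinite_finite_induct) (auto intro: WW_zero WW_add)

lemma WW_zero_left: assumes "WW 0 Y" shows "Y = 0"
proof -
  obtain F f g where 1: "finite F" "\<forall>k\<in>F. W k (f k) (g k)" "0 = sum f F" "Y = sum g F"
    using assms unfolding WW_def by blast
  have "f k = 0" if "k \<in> F" for k using E.G_direct[of F f k] 1 W_mem(1) that by metis
  then have "\<forall>k\<in>F. g k = 0" using 1(2) W_zero_left by metis
  then show ?thesis using 1 by simp
qed

lemma WW_zero_right: assumes "WW X 0" shows "X = 0"
proof -
  obtain F f g where 1: "finite F" "\<forall>k\<in>F. W k (f k) (g k)" "X = sum f F" "0 = sum g F"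
    using assms unfolding WW_def by blast
  have "g k = 0" if "k \<in> F" for k using G_direct[of F g k] 1 W_mem(2) that by metis
  then have "\<forall>k\<in>F. f k = 0" using 1(2) W_zero_right by metis
  then show ?thesis using 1 by simp
qed

lemma WW_unique: assumes "WW X Y" "WW X Y'" shows "Y = Y'"
  using WW_zero_left[of "Y' - Y"] WW_lin[OF assms, of "-1"] by simp

lemma WW_inj: assumes "WW X Y" "WW X' Y" shows "X = X'"
  using WW_zero_right[of "X' - X"] WW_lin[OF assms, of "-1"] by simp

lemma WW_total: assumes "X \<in> car P'" shows "\<exists>Y. WW X Y"
  using E.car_G[OF assms]
proof (induction rule: E.span_induct_alt)
  case base
  then show ?case using WW_zero by blast
next
  case (step c x y)
  then obtain k where "x \<in> G' k" by blast
  then obtain Z where "W k x Z" using total by blast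
  then show ?case using step.IH WW_lin WW_I by blast
qed

lemma WW_br: assumes "WW X Y" "WW X2 Y2" shows "WW (br' X X2) (br Y Y2)"
proof -
  obtain F f g where 1: "finite F" "\<forall>k\<in>F. W k (f k) (g k)" "X = sum f F" "Y = sum g F"
    using assms(1) unfolding WW_def by blast
  obtain F2 f2 g2 where 2: "finite F2" "\<forall>k\<in>F2. W k (f2 k) (g2 k)" "X2 = sum f2 F2" "Y2 = sum g2 F2"
    using assms(2) unfolding WW_def by blast
  have c: "k \<in> F \<Longrightarrow> f k \<in> car P'" "k \<in> F \<Longrightarrow> g k \<in> car P" "l \<in> F2 \<Longrightarrow> f2 l \<in> car P'" "l \<in> F2 \<Longrightarrow> g2 l \<in> car P" for k l
    using 1(2) 2(2) W_mem E.G_car G_car by blast+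
  have "br' X X2 = (\<Sum>k\<in>F. \<Sum>l\<in>F2. br' (f k) (f2 l))"
    using c by (simp add: 1(3) 2(3) E.br_sum E.car_sum) (rule sum.swap)
  moreover have "br Y Y2 = (\<Sum>k\<in>F. \<Sum>l\<in>F2. br (g k) (g2 l))"
    using c by (simp add: 1(4) 2(4) br_sum car_sum) (rule sum.swap)
  moreover have "WW (\<Sum>k\<in>F. \<Sum>l\<in>F2. br' (f k) (f2 l)) (\<Sum>k\<in>F. \<Sum>l\<in>F2. br (g k) (g2 l))"
    using 1(2) 2(2) by (intro WW_sum WW_I[OF W_br]) auto
  ultimately show ?thesis by simp
qed

text \<open>The degree parts of a parity-homogeneous element are parity-homogeneous: their wrong
  components add up to an element of both parities, hence to 0, and degrees are independent. Then
  \<open>W_par\<close> applies in each degree.\<close>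

lemma WW_P: assumes "WW X Y" "X \<in> P' p" shows "Y \<in> P p"
proof -
  obtain F f g where 1: "finite F" "\<forall>k\<in>F. W k (f k) (g k)" "X = sum f F" "Y = sum g F"
    using assms(1) unfolding WW_def by blast
  have "\<exists>c d. c \<in> G' k \<and> c \<in> P' p \<and> d \<in> G' k \<and> d \<in> P' (\<not> p) \<and> f k = c + d" if "k \<in> F" for k
  proof -
    obtain a b where ab: "a \<in> G' k" "a \<in> P' False" "b \<in> G' k" "b \<in> P' True" "f k = a + b"
      using E.G_parts[of "f k" k] W_mem(1) 1(2) \<open>k \<in> F\<close> by blast
    show ?thesis
    proof (cases p)
      case True
      then show ?thesis using ab by (intro exI[of _ b] exI[of _ a]) (simp add: add.commute)
    next
      case False
      then show ?thesis using ab by (intro exI[of _ a] exI[of _ b]) simp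
    qed
  qed
  then obtain c d where cd: "\<And>k. k \<in> F \<Longrightarrow> c k \<in> G' k" "\<And>k. k \<in> F \<Longrightarrow> c k \<in> P' p"
    "\<And>k. k \<in> F \<Longrightarrow> d k \<in> G' k" "\<And>k. k \<in> F \<Longrightarrow> d k \<in> P' (\<not> p)" "\<And>k. k \<in> F \<Longrightarrow> f k = c k + d k"
    by metis
  have X: "X = sum c F + sum d F" using 1(3) cd(5) by (simp flip: sum.distrib)
  have "sum c F \<in> P' p" using cd(2) E.subspace_sum[OF E.subspace_P] by blast
  moreover have dP: "sum d F \<in> P' (\<not> p)" using cd(4) E.subspace_sum[OF E.subspace_P] by blast
  ultimately have "X - sum c F \<in> P' p" using assms(2) E.subspace_diff[OF E.subspace_P] by blast
  then have "sum d F = 0" using X dP E.P_other[of "sum d F" p "\<not> p"] by simp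
  then have "d k = 0" if "k \<in> F" for k using E.G_direct[of F d k] 1(1) cd(3) that by blast
  then have "g k \<in> P p" if "k \<in> F" for k using W_par[of k "f k" "g k" p] 1(2) cd that by simp
  then show ?thesis using 1(4) subspace_sum[OF subspace_P] by blast
qed

lemma WW_phi: assumes "x \<in> negpart sc G" shows "WW (\<phi> x) x"
proof -
  have "x \<in> negpart sc G \<and> WW (\<phi> x) x" using assms unfolding negpart_def
  proof (induction rule: span_induct_alt)
    case base
    then show ?case using WW_zero subspace_0[OF subspace_neg] by (simp add: negpart_def)
  next
    case (step c x y)
    then obtain k where k: "k < 0" "x \<in> G k" by blast
    have x: "x \<in> negpart sc G" "WW (\<phi> x) x" using G_neg[OF k] WW_I[of k "\<phi> x" x] k by (auto simp: W_neg)
    have y: "y \<in> negpart sc G" "WW (\<phi> y) y" using step.IH by (auto simp: negpart_def)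
    have "sc c x + y \<in> negpart sc G" using x y subspace_neg subspace_add subspace_scale by blast
    moreover have "WW (\<phi> (sc c x + y)) (sc c x + y)" using WW_lin[OF x(2) y(2)] phi_lin[OF x(1) y(1)] by simp
    ultimately show ?case by (simp add: negpart_def)
  qed
  then show ?thesis by simp
qed

lemma embeds: "embeds_into sc P br G sc' P' br' G' \<phi>"
proof -
  define \<psi> where "\<psi> X = (THE Y. WW X Y)" for X
  have psiI: "\<psi> X = Y" if "WW X Y" for X Y
    unfolding \<psi>_def using that WW_unique by (intro the_equality) blast+
  have psi: "WW X (\<psi> X)" if "X \<in> car P'" for X using WW_total[OF that] psiI by metis
  show ?thesis
    unfolding embeds_into_def
  proof (intro exI[of _ \<psi>] conjI ballI allI subsetI)
    fix x y a assume "x \<in> car P'" "y \<in> car P'"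
    then show "\<psi> (sc' a x + y) = sc a (\<psi> x) + \<psi> y" using psiI WW_lin psi by blast
  next
    show "inj_on \<psi> (car P')" by (rule inj_onI) (metis psi WW_inj)
  next
    fix k y assume "y \<in> \<psi> ` G' k"
    then obtain X where X: "X \<in> G' k" "y = \<psi> X" by blast
    then obtain Y where "W k X Y" using total by blast
    then show "y \<in> G k" using psiI[OF WW_I] W_mem(2) X by metis
  next
    fix p y assume "y \<in> \<psi> ` P' p"
    then show "y \<in> P p" using WW_P psi E.P_car by blast
  next
    fix x y assume "x \<in> car P'" "y \<in> car P'"
    then show "\<psi> (br' x y) = br (\<psi> x) (\<psi> y)" using psiI WW_br psi by blast
  next
    fix x assume "x \<in> negpart sc G"
    then show "\<psi> (\<phi> x) = x" using psiI WW_phi by blast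
  qed
qed

end

end

context tanaka
begin

lemma trans_ext_id: "trans_ext sc P br G sc P br G id"
  using gr tr by (simp add: trans_ext_def)

lemma pr_equalsI:
  assumes "\<And>k. k \<ge> 0 \<Longrightarrow> H1_vanishes k"
  shows "pr_equals TYPE('b::ab_group_add) sc P br G"
  unfolding pr_equals_def
proof (intro conjI allI impI trans_ext_id)
  fix sc' :: "complex \<Rightarrow> 'b \<Rightarrow> 'b" and P' br' G' \<phi>
  assume "trans_ext sc P br G sc' P' br' G' \<phi>"
  then interpret tanaka_ext sc P br G sc' P' br' G' \<phi> by unfold_locales
  show "embeds_into sc P br G sc' P' br' G' \<phi>"
    by (rule embeds) (rule W_total, use assms in auto)
qed

lemma pr0_equalsI:
  assumes "\<And>k. k > 0 \<Longrightarrow> H1_vanishes k"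
  shows "pr0_equals TYPE('b::ab_group_add) sc P br G"
  unfolding pr0_equals_def
proof (intro conjI allI impI trans_ext_id)
  fix sc' :: "complex \<Rightarrow> 'b \<Rightarrow> 'b" and P' br' G' \<phi>
  assume a: "trans_ext sc P br G sc' P' br' G' \<phi> \<and> same_zero_part sc br G br' G' \<phi>"
  then interpret tanaka_ext sc P br G sc' P' br' G' \<phi> by unfold_locales simp
  show "embeds_into sc P br G sc' P' br' G' \<phi>"
    by (rule embeds) (rule W_total, use assms a in auto)
qed

end

section \<open>Borel and parabolic gradings\<close>

context rooted
begin

lemma comp_sum: "(\<And>i. i \<in> F \<Longrightarrow> f i \<in> car P) \<Longrightarrow> comp (sum f F) w = (\<Sum>i\<in>F. comp (f i) w)"
  by (induction F rule: infinite_finite_induct) (auto simp: comp_add car_sum)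

lemma comp_car: "x \<in> car P \<Longrightarrow> comp x w \<in> car P"
  using comp(1) Gw_car by blast

lemma comp_ext: assumes "x \<in> car P" "y \<in> car P" "\<And>w. w \<in> R0 \<Longrightarrow> comp x w = comp y w" shows "x = y"
  using comp(3)[OF assms(1)] comp(3)[OF assms(2)] assms(3) by (metis sum.cong)

lemma comp_br:
  assumes "x \<in> car P" "y \<in> car P"
  shows "comp (br x y) w = (\<Sum>v\<in>R0. br (comp x v) (comp y (w - v)))"
proof -
  have "br x y = br (sum (comp x) R0) y" using comp(3)[OF assms(1)] by simp
  also have "\<dots> = (\<Sum>v\<in>R0. br (comp x v) y)" using assms comp_car by (intro br_sum) auto
  finally have "comp (br x y) w = (\<Sum>v\<in>R0. comp (br (comp x v) y) w)"
    using assms comp_car by (simp add: comp_sum)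
  then show ?thesis using comp_br_left[OF comp(1)[OF assms(1)] assms(2)] by simp
qed

lemma comp_br_right:
  assumes "y \<in> car P" "u \<in> Gw b" shows "comp (br y u) w = br (comp y (w - b)) u"
proof -
  have "comp (br y u) w = (\<Sum>v\<in>R0. br (comp y v) (comp u (w - v)))"
    using comp_br assms Gw_car by blast
  also have "\<dots> = (\<Sum>v\<in>R0. if v = w - b then br (comp y v) u else 0)"
    using comp_Gw[OF assms(2)] comp_car[OF assms(1)]
    by (intro sum.cong) (auto simp: algebra_simps)
  also have "\<dots> = br (comp y (w - b)) u"
    using finite_R0 comp(2)[OF assms(1), of "w - b"] Gw_car[OF assms(2)] by (auto simp: sum.delta)
  finally show ?thesis .
qed

lemma br_Gw_nonroot: "x \<in> Gw v \<Longrightarrow> y \<in> Gw w \<Longrightarrow> v + w \<notin> R0 \<Longrightarrow> br x y = 0"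
  using br_Gw Gw_nonroot by blast

lemma jacobi_Gw:
  assumes "x \<in> Gw u" "y \<in> Gw v" "z \<in> Gw w"
  shows "br x (br y z) = br (br x y) z + sc (sgnp (par u) (par v)) (br y (br x z))"
  using jacobi[OF Gw_par[OF assms(1)] Gw_par[OF assms(2)] Gw_par[OF assms(3)]] .

lemma skew_Gw:
  assumes "x \<in> Gw u" "y \<in> Gw v" shows "br x y = - sc (sgnp (par u) (par v)) (br y x)"
  using br_skew[OF Gw_par[OF assms(1)] Gw_par[OF assms(2)]] .

end

text \<open>\<open>co i\<close> is \<open>q\<close> times the coefficient of the simple root
  \<open>sr ! i\<close>, extended additively to all weights, and \<open>q\<close> clears
  denominators. By \<open>dual\<close> every additive function on weights is evaluation at an
  element of \<open>h\<close>. \<open>spread\<close> serves transitivity: it provides a root with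
  positive coefficient at \<open>i\<close> that can be subtracted.\<close>

locale borel = killing sc P br h \<Phi> R par B
  for sc :: "complex \<Rightarrow> 'v::ab_group_add \<Rightarrow> 'v" and P br h
    and \<Phi> :: "'w::ab_group_add \<Rightarrow> 'v \<Rightarrow> complex" and R par B +
  fixes sr pos :: "'w list" and co :: "nat \<Rightarrow> 'w \<Rightarrow> int" and q :: int
  assumes dual: "(\<And>v w. f (v + w) = f v + (f w :: complex)) \<Longrightarrow> \<exists>H\<in>h. \<forall>w. \<Phi> w H = f w"
    and co_add: "co i (v + w) = co i v + co i w"
    and q_pos: "q > 0"
    and R_pos: "R = set pos \<union> uminus ` set pos"
    and sr_pos: "set sr \<subseteq> set pos"
    and pos_co: "\<beta> \<in> set pos \<Longrightarrow> i < length sr \<Longrightarrow> 0 \<le> co i \<beta>"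
    and co_sr: "i < length sr \<Longrightarrow> j < length sr \<Longrightarrow> co i (sr ! j) = (if i = j then q else 0)"
    and pos_dec: "\<beta> \<in> set pos \<Longrightarrow> \<beta> \<in> set sr \<or> (\<exists>\<alpha>\<in>set sr. \<beta> - \<alpha> \<in> set pos)"
    and co_dvd: "\<beta> \<in> set pos \<Longrightarrow> i < length sr \<Longrightarrow> q dvd co i \<beta>"
    and spread: "i < length sr \<Longrightarrow> \<gamma> \<in> R \<Longrightarrow> co i \<gamma> \<ge> 0 \<Longrightarrow> \<exists>\<beta>\<in>R. co i \<beta> > 0 \<and> (\<gamma> - \<beta> \<in> R \<or> \<gamma> = \<beta>)"
begin

abbreviation n where "n \<equiv> length sr"

lemma co_0 [simp]: "co i 0 = 0" using co_add[of i 0 0] by simp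

lemma co_minus: "co i (- w) = - co i w" using co_add[of i w "- w"] by simp

lemma co_diff: "co i (v - w) = co i v - co i w" using co_add[of i v "- w"] by (simp add: co_minus)

definition ht :: "'w \<Rightarrow> int" where "ht w = (\<Sum>i<n. co i w)"

lemma ht_add: "ht (v + w) = ht v + ht w" by (simp add: ht_def co_add sum.distrib)
lemma ht_minus: "ht (- w) = - ht w" by (simp add: ht_def co_minus sum_negf)
lemma ht_diff: "ht (v - w) = ht v - ht w" by (simp add: ht_def co_diff sum_subtractf)

lemma pos_R: "\<beta> \<in> set pos \<Longrightarrow> \<beta> \<in> R" "\<beta> \<in> set pos \<Longrightarrow> - \<beta> \<in> R"
  using R_pos by auto

lemma R_cases: "w \<in> R \<Longrightarrow> w \<in> set pos \<or> - w \<in> set pos"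
  by (subst (asm) R_pos) auto

lemma ht_sr: "\<alpha> \<in> set sr \<Longrightarrow> ht \<alpha> = q"
proof -
  assume "\<alpha> \<in> set sr"
  then obtain j where j: "j < n" "\<alpha> = sr ! j" by (metis in_set_conv_nth)
  then show "ht \<alpha> = q" by (simp add: ht_def co_sr)
qed

lemma ht_nonneg: "\<beta> \<in> set pos \<Longrightarrow> ht \<beta> \<ge> 0"
  unfolding ht_def by (intro sum_nonneg) (auto simp: pos_co)

lemma ht_pos: "\<beta> \<in> set pos \<Longrightarrow> ht \<beta> > 0"
proof -
  assume b: "\<beta> \<in> set pos"
  from pos_dec[OF b] show "ht \<beta> > 0"
  proof
    assume "\<beta> \<in> set sr" then show ?thesis using ht_sr q_pos by simp
  next
    assume "\<exists>\<alpha>\<in>set sr. \<beta> - \<alpha> \<in> set pos"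
    then obtain \<alpha> where "\<alpha> \<in> set sr" "\<beta> - \<alpha> \<in> set pos" by blast
    then show ?thesis using ht_nonneg[of "\<beta> - \<alpha>"] ht_sr[of \<alpha>] ht_diff[of \<beta> \<alpha>] q_pos by simp
  qed
qed

definition Neg :: "'w set" where "Neg = uminus ` set pos"

lemma Neg_R: "b \<in> Neg \<Longrightarrow> b \<in> R" using R_pos by (auto simp: Neg_def)

lemma Neg_iff: "b \<in> Neg \<longleftrightarrow> b \<in> R \<and> ht b < 0"
proof
  assume "b \<in> Neg" then show "b \<in> R \<and> ht b < 0" using Neg_R ht_pos by (auto simp: Neg_def ht_minus)
next
  assume a: "b \<in> R \<and> ht b < 0"
  then have "b \<notin> set pos" using ht_pos[of b] by auto
  then show "b \<in> Neg" using a R_pos by (auto simp: Neg_def)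
qed

lemma Neg_add: "b \<in> Neg \<Longrightarrow> c \<in> Neg \<Longrightarrow> b + c \<in> Neg \<or> b + c \<notin> R0"
proof -
  assume "b \<in> Neg" "c \<in> Neg"
  then have h: "ht (b + c) < 0" unfolding ht_add Neg_iff by simp
  then have "b + c \<noteq> 0" by (auto simp: ht_def)
  with h show ?thesis unfolding Neg_iff by (simp add: R0_def)
qed

text \<open>A superderivation of weight \<open>\<mu>\<close> with values in the whole algebra, given on the root spaces
with weights in \<open>A\<close>.\<close>

definition wder :: "'w \<Rightarrow> 'w set \<Rightarrow> ('w \<Rightarrow> 'v \<Rightarrow> 'v) \<Rightarrow> bool" where
  "wder \<mu> A E \<longleftrightarrow> (\<forall>w. E w 0 = 0) \<and> (\<forall>b\<in>A. \<forall>x\<in>Gw b. E b x \<in> Gw (\<mu> + b)) \<and>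
     (\<forall>b\<in>A. \<forall>x\<in>Gw b. \<forall>a. E b (sc a x) = sc a (E b x)) \<and>
     (\<forall>b\<in>A. \<forall>c\<in>A. \<forall>x\<in>Gw b. \<forall>y\<in>Gw c.
        E (b + c) (br x y) = br (E b x) y + sc (sgnp (par \<mu>) (par b)) (br x (E c y)))"

definition inner :: "'w \<Rightarrow> 'w set \<Rightarrow> ('w \<Rightarrow> 'v \<Rightarrow> 'v) \<Rightarrow> bool" where
  "inner \<mu> A E \<longleftrightarrow> (\<exists>Y\<in>Gw \<mu>. \<forall>b\<in>A. \<forall>x\<in>Gw b. E b x = br Y x)"

text \<open>Weight spaces outside \<open>R0\<close> vanish, so all rules hold trivially there. A sum
  of two weights can then be treated in one way, whether it lies in \<open>A\<close> or is no weight
  at all.\<close>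

lemma wder_nonroots:
  assumes "wder \<mu> A E" shows "wder \<mu> (A \<union> - R0) E"
proof -
  have z: "x = 0" if "x \<in> Gw b" "b \<notin> R0" for x b using that Gw_nonroot by blast
  have E0: "E w 0 = 0" for w using assms by (simp add: wder_def)
  have GwE: "E b x \<in> Gw (\<mu> + b)" if "b \<in> A \<union> - R0" "x \<in> Gw b" for b x
    using assms that z[of x b] E0 unfolding wder_def by (cases "b \<in> A") auto
  have "E (b + c) (br x y) = br (E b x) y + sc (sgnp (par \<mu>) (par b)) (br x (E c y))"
    if bc: "b \<in> A \<union> - R0" "c \<in> A \<union> - R0" and xy: "x \<in> Gw b" "y \<in> Gw c" for b c x y
  proof (cases "b \<in> A \<and> c \<in> A")
    case True
    then show ?thesis using assms xy unfolding wder_def by blast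
  next
    case False
    have c: "x \<in> car P" "y \<in> car P" "E b x \<in> car P" "E c y \<in> car P"
      using xy GwE[OF bc(1) xy(1)] GwE[OF bc(2) xy(2)] Gw_car by blast+
    have "x = 0 \<or> y = 0" using False bc xy z by auto
    then show ?thesis using c E0 by auto
  qed
  moreover have "E b (sc a x) = sc a (E b x)" if "b \<in> A \<union> - R0" "x \<in> Gw b" for b x a
    using assms that z[of x b] E0 unfolding wder_def by (cases "b \<in> A") auto
  ultimately show ?thesis using GwE E0 unfolding wder_def by blast
qed

lemma wderD:
  assumes "wder \<mu> A E"
  shows "E w 0 = 0"
    and "b \<in> A \<or> b \<notin> R0 \<Longrightarrow> x \<in> Gw b \<Longrightarrow> E b x \<in> Gw (\<mu> + b)"
    and "b \<in> A \<or> b \<notin> R0 \<Longrightarrow> x \<in> Gw b \<Longrightarrow> E b (sc a x) = sc a (E b x)"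
    and "b \<in> A \<or> b \<notin> R0 \<Longrightarrow> c \<in> A \<or> c \<notin> R0 \<Longrightarrow> x \<in> Gw b \<Longrightarrow> y \<in> Gw c \<Longrightarrow>
      E (b + c) (br x y) = br (E b x) y + sc (sgnp (par \<mu>) (par b)) (br x (E c y))"
  using wder_nonroots[OF assms] unfolding wder_def by blast+

text \<open>\<open>wder\<close> demands only homogeneity under scalars; since root spaces are lines,
  additivity follows from it.\<close>

lemma wder_add:
  assumes "wder \<mu> A E" "A \<subseteq> R" "b \<in> A \<or> b \<notin> R0" "x \<in> Gw b" "y \<in> Gw b"
  shows "E b (x + y) = E b x + E b y"
proof (cases "b \<in> A")
  case True
  then have R: "b \<in> R" using assms by auto
  obtain s t where st: "x = sc s (rv b)" "y = sc t (rv b)" using rv(3)[OF R] assms by blast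
  then have "x + y = sc (s + t) (rv b)" by (simp add: scale_left_distrib)
  then have "E b (x + y) = sc (s + t) (E b (rv b))" using wderD(3)[OF assms(1,3) rv(2)[OF R]] by simp
  then show ?thesis using st wderD(3)[OF assms(1,3) rv(2)[OF R]] by (simp add: scale_left_distrib)
next
  case False
  then have "x = 0" "y = 0" using assms Gw_nonroot by blast+
  then show ?thesis using wderD(1)[OF assms(1)] by simp
qed

text \<open>The supercommutator of \<open>ad f\<close> with a derivation is again a derivation. The
  closure assumptions say that \<open>ad f\<close> preserves the subalgebra with weights in
  \<open>A\<close>; the intended case is a negative root vector of degree zero, which acts on
  \<open>m\<close> without belonging to it.\<close>

lemma wder_commutator:
  assumes E: "wder \<mu> A E" and AR: "A \<subseteq> R" and f: "f \<in> Gw b"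
    and cl: "\<And>c. c \<in> A \<Longrightarrow> b + c \<in> A \<or> b + c \<notin> R0"
    and cl2: "\<And>c e. c \<in> A \<Longrightarrow> e \<in> A \<Longrightarrow> c + e \<in> A \<or> c + e \<notin> R0"
    and cl3: "\<And>c e. c \<in> A \<Longrightarrow> e \<in> A \<Longrightarrow> b + c + e \<in> A \<or> b + c + e \<notin> R0"
  shows "wder (\<mu> + b) A (\<lambda>c u. br f (E c u) - sc (sgnp (par \<mu>) (par b)) (E (b + c) (br f u)))"
proof -
  let ?F = "\<lambda>c u. br f (E c u) - sc (sgnp (par \<mu>) (par b)) (E (b + c) (br f u))"
  have fc: "f \<in> car P" using f Gw_car by blast
  have bf: "br f u \<in> Gw (b + c)" if "u \<in> Gw c" for c u using br_Gw[OF f that] .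
  have EG: "E c u \<in> Gw (\<mu> + c)" if "c \<in> A" "u \<in> Gw c" for c u using wderD(2)[OF E] that by blast
  have EG2: "E (b + c) (br f u) \<in> Gw (\<mu> + (b + c))" if "c \<in> A" "u \<in> Gw c" for c u
    using wderD(2)[OF E cl[OF that(1)] bf[OF that(2)]] .
  have "?F (c + e) (br u v) = br (?F c u) v + sc (sgnp (par (\<mu> + b)) (par c)) (br u (?F e v))"
    if ce: "c \<in> A" "e \<in> A" and uv: "u \<in> Gw c" "v \<in> Gw e" for c e u v
  proof -
    let ?s = "\<lambda>x y. sgnp (par x) (par y)"
    note G = EG[OF ce(1) uv(1)] EG[OF ce(2) uv(2)] EG2[OF ce(1) uv(1)] EG2[OF ce(2) uv(2)]
    have cr: "E c u \<in> car P" "E e v \<in> car P" "E (b + c) (br f u) \<in> car P" "E (b + e) (br f v) \<in> car P"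
      "u \<in> car P" "v \<in> car P" using G uv Gw_car by blast+
    have 1: "E (c + e) (br u v) = br (E c u) v + sc (?s \<mu> c) (br u (E e v))"
      using wderD(4)[OF E] ce uv by blast
    have 2: "br f (br (E c u) v) = br (br f (E c u)) v + sc (?s b (\<mu> + c)) (br (E c u) (br f v))"
      using jacobi_Gw[OF f G(1) uv(2)] .
    have 3: "br f (br u (E e v)) = br (br f u) (E e v) + sc (?s b c) (br u (br f (E e v)))"
      using jacobi_Gw[OF f uv(1) G(2)] .
    have 4: "br f (br u v) = br (br f u) v + sc (?s b c) (br u (br f v))"
      using jacobi_Gw[OF f uv] .
    have 5: "E (b + c + e) (br (br f u) v) = br (E (b + c) (br f u)) v + sc (?s \<mu> (b + c)) (br (br f u) (E e v))"
      using wderD(4)[OF E cl[OF ce(1)] _ bf[OF uv(1)] uv(2)] ce by blast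
    have 6: "E (b + c + e) (br u (br f v)) = br (E c u) (br f v) + sc (?s \<mu> c) (br u (E (b + e) (br f v)))"
      using wderD(4)[OF E _ cl[OF ce(2)] uv(1) bf[OF uv(2)]] ce by (simp add: algebra_simps)
    have m1: "br (br f u) v \<in> Gw (b + c + e)" using br_Gw[OF bf[OF uv(1)] uv(2)] .
    have m2: "br u (br f v) \<in> Gw (b + c + e)" using br_Gw[OF uv(1) bf[OF uv(2)]] by (simp add: algebra_simps)
    have 7: "E (b + (c + e)) (br f (br u v)) = E (b + c + e) (br (br f u) v) + sc (?s b c) (E (b + c + e) (br u (br f v)))"
      using wder_add[OF E AR cl3[OF ce] m1, of "sc (?s b c) (br u (br f v))"] wderD(3)[OF E cl3[OF ce] m2] m2 4
      by (simp add: add.assoc)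
    show ?thesis
      unfolding 7 1 5 6
      using fc cr
      by (cases "par \<mu>"; cases "par b"; cases "par c")
         (simp_all add: br_add br_diff br_minus br_sc 2 3 par_add sgn_par_def scale_right_distrib scale_right_diff_distrib)
  qed
  moreover have "?F c u \<in> Gw (\<mu> + b + c)" if "c \<in> A" "u \<in> Gw c" for c u
    using br_Gw[OF f EG[OF that]] EG2[OF that] by (simp add: algebra_simps)
  moreover have "?F c (sc a u) = sc a (?F c u)" if "c \<in> A" "u \<in> Gw c" for c u a
  proof -
    have "E c u \<in> car P" "u \<in> car P" using EG[OF that] that Gw_car by blast+
    moreover have "E (b + c) (sc a (br f u)) = sc a (E (b + c) (br f u))"
      using wderD(3)[OF E cl[OF that(1)] bf[OF that(2)]] .
    ultimately show ?thesis using wderD(3)[OF E _ that(2), of a] that fc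
      by (simp add: br_sc scale_right_diff_distrib mult.commute)
  qed
  moreover have "?F w 0 = 0" for w using wderD(1)[OF E] fc by simp
  ultimately show ?thesis unfolding wder_def by blast
qed

end

section \<open>Gradings attached to sets of simple roots\<close>

locale parabolic = borel sc P br h \<Phi> R par B sr pos co q
  for sc :: "complex \<Rightarrow> 'v::ab_group_add \<Rightarrow> 'v" and P br h
    and \<Phi> :: "'w::ab_group_add \<Rightarrow> 'v \<Rightarrow> complex" and R par B sr pos co q +
  fixes S :: "nat set"
  assumes S_sub: "S \<subseteq> {..<length sr}" and S_ne: "S \<noteq> {}"
begin

text \<open>\<open>q\<close> times the degree. This avoids division at weights outside the root
  lattice.\<close>

definition dg :: "'w \<Rightarrow> int" where "dg w = (\<Sum>i\<in>S. co i w)"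

text \<open>Describing the grading through components makes directness and the degrees of brackets
  immediate; \<open>Gr_span\<close> recovers the description by spans of root spaces.\<close>

definition Gr :: "int \<Rightarrow> 'v set" where
  "Gr k = {x \<in> car P. \<forall>w. comp x w \<noteq> 0 \<longrightarrow> dg w = q * k}"

lemma fin_S: "finite S" using S_sub finite_subset by blast

lemma dg_add: "dg (v + w) = dg v + dg w" by (simp add: dg_def co_add sum.distrib)
lemma dg_minus: "dg (- w) = - dg w" by (simp add: dg_def co_minus sum_negf)
lemma dg_diff: "dg (v - w) = dg v - dg w" by (simp add: dg_def co_diff sum_subtractf)
lemma dg_0 [simp]: "dg 0 = 0" by (simp add: dg_def)

lemma dg_pos: "\<beta> \<in> set pos \<Longrightarrow> dg \<beta> \<ge> 0"
  unfolding dg_def using S_sub pos_co by (intro sum_nonneg) auto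

lemma dg_dvd: "w \<in> R0 \<Longrightarrow> q dvd dg w"
proof -
  have p: "q dvd dg \<beta>" if "\<beta> \<in> set pos" for \<beta>
    unfolding dg_def using S_sub co_dvd[OF that] by (intro dvd_sum) auto
  assume "w \<in> R0"
  then consider "w = 0" | "w \<in> set pos" | "- w \<in> set pos" using R_cases by (auto simp: R0_def)
  then show ?thesis using p[of w] p[of "- w"] by cases (auto simp: dg_minus)
qed

lemma dg_sr: "\<alpha> \<in> set sr \<Longrightarrow> dg \<alpha> = q \<or> dg \<alpha> = 0"
proof -
  assume "\<alpha> \<in> set sr"
  then obtain j where j: "j < n" "\<alpha> = sr ! j" by (metis in_set_conv_nth)
  have "dg \<alpha> = (\<Sum>i\<in>S. if i = j then q else 0)"
    unfolding dg_def using j S_sub by (intro sum.cong) (auto simp: co_sr)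
  then show ?thesis using fin_S by (auto simp: sum.delta)
qed

lemma Gr_car: "x \<in> Gr k \<Longrightarrow> x \<in> car P" by (simp add: Gr_def)

lemma Gw_Gr: "x \<in> Gw w \<Longrightarrow> dg w = q * k \<Longrightarrow> x \<in> Gr k"
  using comp_Gw Gw_car by (auto simp: Gr_def)

lemma Gr_comp: "x \<in> Gr k \<Longrightarrow> dg w \<noteq> q * k \<Longrightarrow> comp x w = 0"
  by (auto simp: Gr_def)

lemma subspace_Gr: "subspace (Gr k)"
proof (rule subspaceI)
  fix x y assume a: "x \<in> Gr k" "y \<in> Gr k"
  have "dg w = q * k" if "comp (x + y) w \<noteq> 0" for w
    using that comp_add[OF Gr_car[OF a(1)] Gr_car[OF a(2)], of w] Gr_comp[OF a(1), of w] Gr_comp[OF a(2), of w] by (metis add_0)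
  then show "x + y \<in> Gr k" using Gr_car[OF a(1)] Gr_car[OF a(2)] by (simp add: Gr_def)
next
  fix c x assume "x \<in> Gr k" then show "sc c x \<in> Gr k" by (auto simp: Gr_def comp_sc)
qed (simp add: Gr_def)

lemma Gr_span: "Gr k = span ((if k = 0 then h else {}) \<union> \<Union>{Gw w | w. w \<in> R \<and> dg w = q * k})"
  (is "_ = span ?U")
proof
  show "span ?U \<subseteq> Gr k"
  proof (rule span_minimal[OF _ subspace_Gr])
    show "?U \<subseteq> Gr k"
    proof
      fix x assume "x \<in> ?U"
      then consider "k = 0" "x \<in> Gw 0" | w where "w \<in> R" "dg w = q * k" "x \<in> Gw w"
        using Gw_0 by (auto split: if_splits)
      then show "x \<in> Gr k" using Gw_Gr[of x 0 k] Gw_Gr by cases auto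
    qed
  qed
  show "Gr k \<subseteq> span ?U"
  proof
    fix x assume x: "x \<in> Gr k"
    have "comp x w \<in> span ?U" if w: "w \<in> R0" for w
    proof (cases "comp x w = 0")
      case True then show ?thesis using subspace_0[OF subspace_span] by simp
    next
      case False
      then have d: "dg w = q * k" using x Gr_comp by blast
      have m: "comp x w \<in> Gw w" using comp(1) Gr_car[OF x] by blast
      have "comp x w \<in> ?U"
      proof (cases "w = 0")
        case True
        then show ?thesis using d q_pos m Gw_0 by simp
      next
        case False
        then have "w \<in> R" using w by (simp add: R0_def)
        then show ?thesis using d m by blast
      qed
      then show ?thesis by (rule span_base)
    qed
    then have "sum (comp x) R0 \<in> span ?U" by (intro subspace_sum[OF subspace_span]) auto
    then show "x \<in> span ?U" using comp(3)[OF Gr_car[OF x]] by simp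
  qed
qed

lemma graded: "graded_lsa sc P br Gr"
  unfolding graded_lsa_def
proof (intro conjI allI ballI impI)
  show "lie_superalgebra sc P br" by (rule lie)
  show "subspace (Gr k)" "Gr k \<subseteq> car P" for k using subspace_Gr Gr_car by auto
next
  fix k x assume x: "x \<in> Gr k"
  have xc: "x \<in> car P" using Gr_car[OF x] .
  let ?s = "\<lambda>p. \<Sum>w\<in>R0. if par w = p then comp x w else 0"
  have "comp x w \<in> Gr k" for w
    using Gw_Gr[OF comp(1)[OF xc]] Gr_comp[OF x, of w] subspace_0[OF subspace_Gr] by (cases "dg w = q * k") auto
  moreover have "(if par w = p then comp x w else 0) \<in> P p" for w p
    using Gw_par[OF comp(1)[OF xc], of w] by (cases "par w"; cases p) simp_all
  ultimately have s: "?s p \<in> Gr k \<inter> P p" for p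
    using subspace_0[OF subspace_Gr]
    by (intro IntI subspace_sum[OF subspace_Gr] subspace_sum[OF subspace_P]) auto
  have "?s False + ?s True = (\<Sum>w\<in>R0. comp x w)"
    unfolding sum.distrib[symmetric] by (intro sum.cong) auto
  then have "x = ?s False + ?s True" using comp(3)[OF xc] by simp
  then show "\<exists>a\<in>Gr k \<inter> P False. \<exists>b\<in>Gr k \<inter> P True. x = a + b" using s by blast
next
  show "car P \<subseteq> span (\<Union>k. Gr k)"
  proof
    fix x assume x: "x \<in> car P"
    have "comp x w \<in> span (\<Union>k. Gr k)" if w: "w \<in> R0" for w
    proof -
      obtain k where "dg w = q * k" using dg_dvd[OF w] by (elim dvdE)
      then have "comp x w \<in> Gr k" using Gw_Gr comp(1)[OF x] by blast
      then show ?thesis by (intro span_base) blast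
    qed
    then have "sum (comp x) R0 \<in> span (\<Union>k. Gr k)" by (intro subspace_sum[OF subspace_span]) auto
    then show "x \<in> span (\<Union>k. Gr k)" using comp(3)[OF x] by simp
  qed
next
  fix F f k assume a: "finite F \<and> (\<forall>k\<in>F. f k \<in> Gr k) \<and> sum f F = 0" and k: "k \<in> F"
  have fc: "f j \<in> car P" if "j \<in> F" for j using a that Gr_car by blast
  have "comp (f k) w = comp 0 w" for w
  proof (cases "dg w = q * k")
    case True
    have "0 = (\<Sum>j\<in>F. comp (f j) w)" using a comp_sum[of F f w] fc by simp
    also have "\<dots> = (\<Sum>j\<in>F. if j = k then comp (f k) w else 0)"
      using a True q_pos Gr_comp by (intro sum.cong) auto
    finally show ?thesis using a k by simp
  next
    case False
    then show ?thesis using Gr_comp[of "f k" k w] a k by simp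
  qed
  then show "f k = 0" using comp_ext[of "f k" 0] fc[OF k] by simp
next
  fix i j x y assume x: "x \<in> Gr i" and y: "y \<in> Gr j"
  have c: "x \<in> car P" "y \<in> car P" using x y Gr_car by auto
  have "dg w = q * (i + j)" if nz: "comp (br x y) w \<noteq> 0" for w
  proof -
    obtain v where v: "br (comp x v) (comp y (w - v)) \<noteq> 0"
      using nz unfolding comp_br[OF c] by (meson sum.neutral)
    then have "comp x v \<noteq> 0" "comp y (w - v) \<noteq> 0" using c comp_car by auto
    then have "dg v = q * i" "dg (w - v) = q * j" using x y Gr_comp by blast+
    then show ?thesis by (simp add: dg_diff algebra_simps)
  qed
  then show "br x y \<in> Gr (i + j)" using c by (simp add: Gr_def)
qed

definition Mm :: "'w set" where "Mm = {b\<in>R. dg b < 0}"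

lemma Mm_Neg: "b \<in> Mm \<Longrightarrow> b \<in> Neg"
proof -
  assume b: "b \<in> Mm"
  then have "b \<notin> set pos" using dg_pos[of b] by (auto simp: Mm_def)
  then have "- b \<in> set pos" using b R_cases by (auto simp: Mm_def)
  then show "b \<in> Neg" unfolding Neg_def by (metis image_eqI minus_minus)
qed

lemma Neg_dg: "b \<in> Neg \<Longrightarrow> dg b \<le> 0"
  using dg_pos by (auto simp: Neg_def dg_minus)

lemma Mm_add: "b \<in> Neg \<Longrightarrow> c \<in> Mm \<Longrightarrow> b + c \<in> Mm \<or> b + c \<notin> R0"
proof -
  assume "b \<in> Neg" "c \<in> Mm"
  then have h: "dg (b + c) < 0" using Neg_dg[of b] unfolding dg_add Mm_def by simp
  then have "b + c \<noteq> 0" by auto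
  with h show ?thesis unfolding Mm_def by (simp add: R0_def)
qed

text \<open>\<open>m\<close> is generated by its degree -1 part. A negative root is split into
  -\<alpha> and -(\<beta> - \<alpha>) with \<alpha> simple, and the Jacobi identity is applied. The
  statement ranges over all \<open>y\<close> because, for \<alpha> of degree zero, the induction
  hypothesis is also used for \<open>[y, f]\<close>.\<close>

lemma kills_m:
  "\<beta> \<in> set pos \<Longrightarrow> dg \<beta> > 0 \<Longrightarrow> y \<in> Gw v \<Longrightarrow>
    (\<And>b u. b \<in> R \<Longrightarrow> dg b = - q \<Longrightarrow> u \<in> Gw b \<Longrightarrow> br y u = 0) \<Longrightarrow> u \<in> Gw (- \<beta>) \<Longrightarrow> br y u = 0"
proof (induction "nat (ht \<beta>)" arbitrary: \<beta> y v u rule: less_induct)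
  case less
  note yG = less.prems(3) and C = less.prems(4)
  have direct: "br y u = 0" if "dg \<beta> = q"
    using C[of "- \<beta>" u] that less.prems pos_R(2) by (simp add: dg_minus)
  show ?case
  proof (cases "\<beta> \<in> set sr")
    case True
    then show ?thesis using direct dg_sr[of \<beta>] less.prems(2) by auto
  next
    case False
    then obtain \<alpha> where \<alpha>: "\<alpha> \<in> set sr" "\<beta> - \<alpha> \<in> set pos" using pos_dec less.prems(1) by blast
    let ?b' = "\<beta> - \<alpha>"
    have \<alpha>p: "\<alpha> \<in> set pos" using \<alpha> sr_pos by auto
    have hb: "nat (ht ?b') < nat (ht \<beta>)" using ht_pos[OF less.prems(1)] ht_sr[OF \<alpha>(1)] q_pos by (simp add: ht_diff)
    let ?f = "rv (- \<alpha>)" and ?u = "rv (- ?b')"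
    have f: "?f \<in> Gw (- \<alpha>)" "?f \<noteq> 0" and u': "?u \<in> Gw (- ?b')" "?u \<noteq> 0" using rv(1,2)[OF pos_R(2)[OF \<alpha>(2)]] rv(1,2)[OF pos_R(2)[OF \<alpha>p]] by simp_all
    have sum: "- \<alpha> + - ?b' = - \<beta>" by simp
    have nz: "br ?f ?u \<noteq> 0" using br_root_nonzero[OF pos_R(2)[OF \<alpha>p] pos_R(2)[OF \<alpha>(2)] _ f u'] sum pos_R(2)[OF less.prems(1)] by simp
    have fu: "br ?f ?u \<in> Gw (- \<beta>)" using br_Gw[OF f(1) u'(1)] sum by simp
    obtain c where c: "u = sc c (br ?f ?u)" using Gw_line[OF pos_R(2)[OF less.prems(1)] fu nz less.prems(5)] by blast
    have cr: "y \<in> car P" "?f \<in> car P" "?u \<in> car P" using yG f u' Gw_car by blast+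
    have J: "br y (br ?f ?u) = br (br y ?f) ?u + sc (sgnp (par v) (par (- \<alpha>))) (br ?f (br y ?u))"
      using jacobi_Gw[OF yG f(1) u'(1)] .
    have "dg \<beta> = q \<or> br y (br ?f ?u) = 0"
    proof (cases "dg \<alpha> = q")
      case True
      have yf: "br y ?f = 0" using C[of "- \<alpha>" ?f] f True pos_R(2)[OF \<alpha>p] by (simp add: dg_minus)
      show ?thesis
      proof (cases "dg ?b' = 0")
        case True
        then show ?thesis using \<open>dg \<alpha> = q\<close> by (simp add: dg_diff)
      next
        case False
        then have "dg ?b' > 0" using dg_pos[OF \<alpha>(2)] by simp
        then have "br y ?u = 0" using less.hyps[OF hb \<alpha>(2) _ yG C u'(1)] by simp
        then show ?thesis using J yf cr by simp
      qed
    next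
      case False
      then have d0: "dg \<alpha> = 0" using dg_sr[OF \<alpha>(1)] by simp
      then have db: "dg ?b' > 0" using less.prems(2) by (simp add: dg_diff)
      have yu: "br y ?u = 0" using less.hyps[OF hb \<alpha>(2) db yG C u'(1)] .
      have yf: "br y ?f \<in> Gw (v + - \<alpha>)" using br_Gw[OF yG f(1)] .
      \<comment> \<open>\<open>[y, f]\<close> again annihilates the degree -1 part, since
        \<open>f\<close> has degree zero and so preserves that part.\<close>
      have C': "br (br y ?f) z = 0" if b: "b \<in> R" "dg b = - q" "z \<in> Gw b" for b z
      proof -
        have fz: "br ?f z \<in> Gw (- \<alpha> + b)" using br_Gw[OF f(1) b(3)] .
        have "br y (br ?f z) = 0"
        proof (cases "- \<alpha> + b \<in> R")
          case True
          then show ?thesis using C[OF True _ fz] b d0 by (simp add: dg_diff dg_add dg_minus)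
        next
          case False
          have "- \<alpha> + b \<noteq> 0" using dg_add[of "- \<alpha>" b] b d0 q_pos by (auto simp: dg_minus)
          then have "br ?f z = 0" using fz False Gw_nonroot[of "- \<alpha> + b"] by (auto simp: R0_def)
          then show ?thesis using cr by simp
        qed
        moreover have "br y z = 0" using C b by blast
        ultimately show ?thesis using jacobi_Gw[OF yG f(1) b(3)] cr by simp
      qed
      have "br (br y ?f) ?u = 0" using less.hyps[OF hb \<alpha>(2) db yf C' u'(1)] .
      then show ?thesis using J yu cr by simp
    qed
    then show ?thesis using direct c cr by (auto simp: br_sc)
  qed
qed

text \<open>The coefficient at \<open>i\<close> cannot be negative: a negative root has no positive
  coefficients, so nonnegative degree forces all its coefficients in \<open>S\<close> to be zero.
  Hence \<open>spread\<close> applies.\<close>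

lemma spreadD: "i \<in> S \<Longrightarrow> \<gamma> \<in> R \<Longrightarrow> dg \<gamma> \<ge> 0 \<Longrightarrow> \<exists>\<beta>\<in>set pos. dg \<beta> > 0 \<and> (\<gamma> - \<beta> \<in> R \<or> \<gamma> = \<beta>)"
proof -
  assume i: "i \<in> S" and "\<gamma> \<in> R" and d: "dg \<gamma> \<ge> 0"
  have iN: "i < n" using i S_sub by auto
  have "co i \<gamma> \<ge> 0"
  proof (cases "\<gamma> \<in> set pos")
    case True
    then show ?thesis using pos_co iN by blast
  next
    case False
    then have m: "- \<gamma> \<in> set pos" using R_cases \<open>\<gamma> \<in> R\<close> by blast
    then have nn: "0 \<le> co j (- \<gamma>)" if "j \<in> S" for j using pos_co that S_sub by auto
    have "(\<Sum>j\<in>S. co j (- \<gamma>)) = 0" using d dg_pos[OF m] by (simp add: dg_def co_minus sum_negf)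
    then have "co i (- \<gamma>) = 0" using sum_nonneg_eq_0_iff[of S "\<lambda>j. co j (- \<gamma>)"] fin_S nn i by auto
    then show ?thesis by (simp add: co_minus)
  qed
  obtain \<beta> where b: "\<beta> \<in> R" "co i \<beta> > 0" "\<gamma> - \<beta> \<in> R \<or> \<gamma> = \<beta>"
    using spread[OF iN \<open>\<gamma> \<in> R\<close> \<open>co i \<gamma> \<ge> 0\<close>] by blast
  have "\<beta> \<in> set pos"
  proof (rule ccontr)
    assume "\<beta> \<notin> set pos"
    then have "- \<beta> \<in> set pos" using b(1) R_pos by auto
    then show False using pos_co[of "- \<beta>" i] iN b(2) by (simp add: co_minus)
  qed
  moreover have "dg \<beta> > 0"
    unfolding dg_def using i fin_S S_sub pos_co[OF \<open>\<beta> \<in> set pos\<close>] b(2) by (intro sum_pos2[of S i]) auto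
  ultimately show ?thesis using b(3) by blast
qed

text \<open>For a root vector, \<open>spread\<close> yields a root vector of \<open>m\<close> whose
  bracket with it is nonzero. For an element of \<open>h\<close>, the roots of nonzero degree vanish
  on it at once, and a root of degree zero is a sum of two of those.\<close>

lemma transitive_weight:
  assumes y: "y \<in> Gw v" and d: "dg v \<ge> 0" and k: "\<And>b u. b \<in> Mm \<Longrightarrow> u \<in> Gw b \<Longrightarrow> br y u = 0"
  shows "y = 0"
proof (rule ccontr)
  assume nz: "y \<noteq> 0"
  then have vR: "v \<in> R0" using y Gw_nonroot by blast
  obtain i where i: "i \<in> S" using S_ne by blast
  have kp: "br y u = 0" if "\<beta> \<in> set pos" "dg \<beta> > 0" "u \<in> Gw (- \<beta>)" for \<beta> u
    using k[of "- \<beta>" u] that pos_R(2) by (simp add: Mm_def dg_minus)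
  show False
  proof (cases "v = 0")
    case False
    then have vR: "v \<in> R" using vR by (simp add: R0_def)
    obtain \<beta> where b: "\<beta> \<in> set pos" "dg \<beta> > 0" "v - \<beta> \<in> R \<or> v = \<beta>" using spreadD[OF i vR d] by blast
    let ?u = "rv (- \<beta>)"
    have u: "?u \<in> Gw (- \<beta>)" "?u \<noteq> 0" using rv pos_R(2)[OF b(1)] by auto
    have "br y ?u \<noteq> 0"
    proof (cases "v = \<beta>")
      case True
      then show ?thesis using br_opposite_nonzero[OF vR y] u nz by simp
    next
      case False
      then have "v + - \<beta> \<in> R" using b(3) by simp
      then show ?thesis using br_root_nonzero[OF vR pos_R(2)[OF b(1)] _ y nz u] by simp
    qed
    then show False using kp[OF b(1,2) u(1)] by simp
  next
    case True
    then have H: "y \<in> h" using y Gw_0 by simp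
    have Pb: "\<Phi> \<beta> y = 0" if b: "\<beta> \<in> set pos" "dg \<beta> > 0" for \<beta>
    proof -
      let ?u = "rv (- \<beta>)"
      have u: "?u \<in> Gw (- \<beta>)" "?u \<noteq> 0" using rv pos_R(2)[OF b(1)] by auto
      have "sc (\<Phi> (- \<beta>) y) ?u = 0" using kp[OF b u(1)] Gw_eig[OF u(1) H] by simp
      then show ?thesis using u(2) by (simp add: Phi_minus)
    qed
    have Pr: "\<Phi> \<beta> y = 0" if "\<beta> \<in> R" "dg \<beta> \<noteq> 0" for \<beta>
    proof (cases "\<beta> \<in> set pos")
      case True
      then show ?thesis using Pb that dg_pos[of \<beta>] by force
    next
      case False
      then have m: "- \<beta> \<in> set pos" using that R_pos by auto
      then have "dg (- \<beta>) > 0" using that dg_pos[OF m] by (auto simp: dg_minus)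
      then show ?thesis using Pb[OF m] by (simp add: Phi_minus)
    qed
    have "\<Phi> \<gamma> y = 0" if g: "\<gamma> \<in> R" for \<gamma>
    proof (cases "dg \<gamma> = 0")
      case False
      then show ?thesis using Pr g by blast
    next
      case True
      obtain \<beta> where b: "\<beta> \<in> set pos" "dg \<beta> > 0" "\<gamma> - \<beta> \<in> R \<or> \<gamma> = \<beta>" using spreadD[OF i g] True by auto
      then have "\<gamma> - \<beta> \<in> R" using True by auto
      moreover have "dg (\<gamma> - \<beta>) \<noteq> 0" using True b by (simp add: dg_diff)
      ultimately have "\<Phi> (\<gamma> - \<beta>) y = 0" using Pr by blast
      then show ?thesis using Pb[OF b(1,2)] by (simp add: Phi_diff)
    qed
    then show False using H_zero[OF H] nz by blast
  qed
qed

lemma transitive: "transitive_gr br Gr"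
  unfolding transitive_gr_def
proof (intro allI impI ballI)
  fix k :: int and x assume k: "k \<ge> 0" and x: "x \<in> Gr k" and z: "\<forall>y\<in>Gr (-1). br x y = 0"
  have xc: "x \<in> car P" using Gr_car[OF x] .
  have "comp x v = comp 0 v" for v
  proof (cases "dg v = q * k")
    case False
    then show ?thesis using Gr_comp[OF x] by simp
  next
    case True
    have C: "br (comp x v) u = 0" if "b \<in> R" "dg b = - q" "u \<in> Gw b" for b u
    proof -
      have "u \<in> Gr (-1)" using Gw_Gr[OF that(3), of "-1"] that(2) by simp
      then have "br x u = 0" using z by blast
      then have "comp (br x u) (v + b) = 0" by simp
      then show ?thesis using comp_br_right[OF xc that(3), of "v + b"] by simp
    qed
    have "comp x v = 0"
    proof (rule transitive_weight[OF comp(1)[OF xc]])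
      show "dg v \<ge> 0" using True k q_pos by simp
    next
      fix b u assume b: "b \<in> Mm" and u: "u \<in> Gw b"
      then have p: "- b \<in> set pos" "dg (- b) > 0" using Mm_Neg[OF b] by (auto simp: Neg_def Mm_def dg_minus)
      have "u \<in> Gw (- (- b))" using u by simp
      then show "br (comp x v) u = 0" by (intro kills_m[OF p comp(1)[OF xc] C])
    qed
    then show ?thesis by simp
  qed
  then show "x = 0" using comp_ext[OF xc, of 0] by simp
qed

sublocale tanaka sc P br Gr
  using graded transitive by unfold_locales

end

section \<open>From the nilpotent radical to the negative part\<close>

context parabolic
begin

definition N0 :: "'w set" where "N0 = {b\<in>Neg. dg b = 0}"

lemma Neg_split: "b \<in> Neg \<Longrightarrow> b \<in> Mm \<or> b \<in> N0"
  using Neg_dg[of b] Neg_R[of b] unfolding N0_def Mm_def by auto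

lemma dg_neg_Mm: "dg w < 0 \<Longrightarrow> w \<in> Mm \<or> w \<notin> R0"
  unfolding Mm_def R0_def by auto

lemma Mm_R: "Mm \<subseteq> R" unfolding Mm_def by blast

text \<open>If all derivations of the full nilpotent radical of a given nonnegative degree are inner, then so
are those of \<open>m\<close>: a derivation of \<open>m\<close> of minimal height that is not inner becomes inner after
bracketing with each negative root vector of degree zero, and therefore extends.\<close>

lemma extend_derivation:
  assumes d: "d \<ge> 0"
    and hyp: "\<And>\<mu> E. dg \<mu> = d \<Longrightarrow> wder \<mu> Neg E \<Longrightarrow> inner \<mu> Neg E"
  shows "dg \<mu> = d \<Longrightarrow> wder \<mu> Mm E \<Longrightarrow> inner \<mu> Mm E"
proof -
  \<comment> \<open>Bounds all heights of weights, so that a derivation of \<open>m\<close> whose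
    weight has height at most \<open>- C\<close> is zero. This starts the induction.\<close>
  define C where "C = (\<Sum>w\<in>R0. \<bar>ht w\<bar>)"
  have C: "ht w \<ge> - C" if "w \<in> R0" for w
    using member_le_sum[of w R0 "\<lambda>w. \<bar>ht w\<bar>"] that finite_R0 unfolding C_def by force
  show "dg \<mu> = d \<Longrightarrow> wder \<mu> Mm E \<Longrightarrow> inner \<mu> Mm E"
  proof (induction "nat (ht \<mu> + C)" arbitrary: \<mu> E rule: less_induct)
    case less
    note dm = less.prems(1) and E = less.prems(2)
    show ?case
    proof (cases "ht \<mu> + C > 0")
      case False
      have "E b x = br 0 x" if b: "b \<in> Mm" and x: "x \<in> Gw b" for b x
      proof -
        have "ht b < 0" using Mm_Neg[OF b] Neg_iff by blast
        then have "\<mu> + b \<notin> R0" using C[of "\<mu> + b"] False by (auto simp: ht_add)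
        then have "E b x = 0" using wderD(2)[OF E, of b x] b x Gw_nonroot by blast
        then show ?thesis using Gw_car[OF x] by simp
      qed
      moreover have "0 \<in> Gw \<mu>" by simp
      ultimately show ?thesis unfolding inner_def by blast
    next
      case True
      let ?s = "\<lambda>x y. sgnp (par x) (par y)"
      \<comment> \<open>The weight \<mu> + b has the same degree but smaller height, so the
        supercommutator with \<open>ad (rv b)\<close> is inner by induction.\<close>
      have "\<exists>Y\<in>Gw (\<mu> + b). \<forall>c\<in>Mm. \<forall>u\<in>Gw c.
          br (rv b) (E c u) - sc (?s \<mu> b) (E (b + c) (br (rv b) u)) = br Y u" if b: "b \<in> N0" for b
      proof -
        have bN: "b \<in> Neg" "dg b = 0" using b by (auto simp: N0_def)
        have bR: "b \<in> R" using Neg_R bN by blast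
        have "wder (\<mu> + b) Mm (\<lambda>c u. br (rv b) (E c u) - sc (?s \<mu> b) (E (b + c) (br (rv b) u)))"
        proof (rule wder_commutator[OF E Mm_R rv(2)[OF bR]])
          fix c e assume c: "c \<in> Mm"
          show "b + c \<in> Mm \<or> b + c \<notin> R0" using Mm_add[OF bN(1) c] .
          assume e: "e \<in> Mm"
          show "c + e \<in> Mm \<or> c + e \<notin> R0" using Mm_add[OF Mm_Neg[OF c] e] .
          show "b + c + e \<in> Mm \<or> b + c + e \<notin> R0"
            by (rule dg_neg_Mm) (use bN c e in \<open>auto simp: dg_add Mm_def\<close>)
        qed
        moreover have "nat (ht (\<mu> + b) + C) < nat (ht \<mu> + C)"
          using bN Neg_iff[of b] True by (simp add: ht_add)
        moreover have "dg (\<mu> + b) = d" using bN dm by (simp add: dg_add)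
        ultimately show ?thesis using less.hyps unfolding inner_def by blast
      qed
      then obtain Y where Y: "\<And>b. b \<in> N0 \<Longrightarrow> Y b \<in> Gw (\<mu> + b)"
        and YE: "\<And>b c u. b \<in> N0 \<Longrightarrow> c \<in> Mm \<Longrightarrow> u \<in> Gw c \<Longrightarrow>
          br (rv b) (E c u) - sc (?s \<mu> b) (E (b + c) (br (rv b) u)) = br (Y b) u" by metis
      define coef where "coef b x = (SOME t. x = sc t (rv b))" for b x
      have coef: "x = sc (coef b x) (rv b)" if "b \<in> N0" "x \<in> Gw b" for b x
      proof -
        have "b \<in> R" using that Neg_R by (auto simp: N0_def)
        then have "\<exists>t. x = sc t (rv b)" using rv(3) that by blast
        then show ?thesis unfolding coef_def by (rule someI_ex)
      qed
      have coef_eq: "coef b (sc t (rv b)) = t" if "b \<in> N0" for b t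
      proof -
        have "b \<in> R" using that Neg_R by (auto simp: N0_def)
        then have "rv b \<noteq> 0" "sc t (rv b) \<in> Gw b" using rv by auto
        then show ?thesis using coef[OF that, of "sc t (rv b)"] by (metis scale_cancel_right)
      qed
      \<comment> \<open>The value at \<open>rv b\<close> is forced: the derivation rule on
        \<open>[rv b, u]\<close> asks for an element acting on \<open>m\<close> as the
        supercommutator with \<open>ad (rv b)\<close> does, up to the sign
        \<open>?s \<mu> b\<close>.\<close>
      define E' where "E' b x = (if b \<in> N0 then sc (- ?s \<mu> b * coef b x) (Y b) else E b x)" for b x
      have MN: "b \<notin> N0" if "b \<in> Mm \<or> b \<notin> R0" for b
        using that Neg_R by (auto simp: N0_def Mm_def R0_def)
      have E'M: "E' b x = E b x" if "b \<in> Mm \<or> b \<notin> R0" for b x using MN[OF that] by (simp add: E'_def)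
      have E'0: "E' b 0 = 0" for b
        using coef_eq[of b 0] wderD(1)[OF E] by (simp add: E'_def)
      have E'G: "E' b x \<in> Gw (\<mu> + b)" if "b \<in> Neg \<or> b \<notin> R0" "x \<in> Gw b" for b x
      proof (cases "b \<in> N0")
        case True
        then show ?thesis using Y[OF True] by (simp add: E'_def)
      next
        case False
        then have "b \<in> Mm \<or> b \<notin> R0" using that(1) Neg_split by blast
        then show ?thesis using wderD(2)[OF E] that(2) False by (simp add: E'_def)
      qed
      have E'sc: "E' b (sc a x) = sc a (E' b x)" if "b \<in> Neg" "x \<in> Gw b" for b x a
      proof (cases "b \<in> N0")
        case True
        have "coef b (sc a x) = a * coef b x"
          using coef_eq[OF True, of "a * coef b x"] coef[OF True that(2)] scale_scale[of a "coef b x" "rv b"] by metis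
        then show ?thesis using True by (simp add: E'_def)
      next
        case False
        then have "b \<in> Mm" using that(1) Neg_split by blast
        then show ?thesis using wderD(3)[OF E _ that(2)] False by (simp add: E'_def)
      qed
      \<comment> \<open>The rule with first argument of degree zero holds by the choice of
        \<open>Y b\<close>. The remaining mixed case follows by skew-symmetry, and the case of two
        arguments of degree zero by transitivity.\<close>
      have star: "E (b + c) (br x u) = br (E' b x) u + sc (?s \<mu> b) (br x (E c u))"
        if b: "b \<in> N0 \<or> b \<notin> R0" and x: "x \<in> Gw b" and c: "c \<in> Mm \<or> c \<notin> R0" and u: "u \<in> Gw c" for b c x u
      proof -
        have uc: "u \<in> car P" using u Gw_car by blast
        have Ec: "E c u \<in> car P" using wderD(2)[OF E c u] Gw_car by blast
        have z: ?thesis if "u = 0 \<or> x = 0"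
        proof -
          have "E' b x \<in> car P" using E'G[of b x] b x Gw_car by (auto simp: N0_def)
          then show ?thesis using that E'0 wderD(1)[OF E] Ec uc Gw_car[OF x] by auto
        qed
        show ?thesis
        proof (cases "b \<in> N0 \<and> c \<in> Mm")
          case False
          then have "u = 0 \<or> x = 0" using b c x u Gw_nonroot by blast
          then show ?thesis by (rule z)
        next
          case True
          have bN: "b \<in> Neg" "b \<in> R" using True Neg_R by (auto simp: N0_def)
          let ?f = "rv b" and ?t = "coef b x"
          have f: "?f \<in> Gw b" "?f \<in> car P" using rv(2)[OF bN(2)] Gw_car by blast+
          have Yc: "Y b \<in> car P" using Y[of b] True Gw_car by blast
          have fu: "br ?f u \<in> Gw (b + c)" using br_Gw[OF f(1) u] .
          have xe: "x = sc ?t ?f" using coef[of b x] True x by blast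
          have m: "b + c \<in> Mm \<or> b + c \<notin> R0" using Mm_add bN True by blast
          have 1: "E (b + c) (br x u) = sc ?t (E (b + c) (br ?f u))"
            by (subst xe) (simp add: br_sc f uc wderD(3)[OF E m fu])
          have 2: "br x (E c u) = sc ?t (br ?f (E c u))"
            by (subst xe) (simp add: br_sc f Ec)
          have 3: "br (E' b x) u = sc (- ?s \<mu> b * ?t) (br (Y b) u)" using True Yc uc by (simp add: E'_def br_sc br_minus)
          have 4: "br (Y b) u = br ?f (E c u) - sc (?s \<mu> b) (E (b + c) (br ?f u))"
            using YE[of b c u] True u by simp
          show ?thesis unfolding 1 2 3 4
            by (cases "par \<mu>"; cases "par b") (simp_all add: scale_right_diff_distrib scale_right_distrib sgn_par_def)
        qed
      qed
      have "E' (b + c) (br x y) = br (E' b x) y + sc (?s \<mu> b) (br x (E' c y))"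
        if b: "b \<in> Neg" and c: "c \<in> Neg" and x: "x \<in> Gw b" and y: "y \<in> Gw c" for b c x y
      proof -
        have cr: "x \<in> car P" "y \<in> car P" "E' b x \<in> car P" "E' c y \<in> car P"
          using x y E'G[of b x] E'G[of c y] b c Gw_car by blast+
        consider (MM) "b \<in> Mm" "c \<in> Mm" | (NM) "b \<in> N0" "c \<in> Mm" | (MN) "b \<in> Mm" "c \<in> N0" | (NN) "b \<in> N0" "c \<in> N0"
          using Neg_split b c by blast
        then show ?thesis
        proof cases
          case MM
          have m: "b + c \<in> Mm \<or> b + c \<notin> R0" using Mm_add Mm_Neg MM by blast
          have "E (b + c) (br x y) = br (E b x) y + sc (?s \<mu> b) (br x (E c y))"
            using wderD(4)[OF E _ _ x y] MM by blast
          then show ?thesis using E'M m MM by simp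
        next
          case NM
          have m: "b + c \<in> Mm \<or> b + c \<notin> R0" using Mm_add NM b by blast
          show ?thesis using star[OF _ x _ y] NM E'M[OF m] E'M[of c y] by simp
        next
          case MN
          have m: "b + c \<in> Mm \<or> b + c \<notin> R0" using Mm_add[OF c, of b] MN by (simp add: add.commute)
          have Eb: "E b x \<in> Gw (\<mu> + b)" using wderD(2)[OF E _ x] MN by blast
          have Ec: "E' c y \<in> Gw (\<mu> + c)" using E'G[of c y] c y by blast
          have yx: "br y x \<in> Gw (b + c)" using br_Gw[OF y x] by (simp add: add.commute)
          have "E (c + b) (br y x) = br (E' c y) x + sc (?s \<mu> c) (br y (E b x))"
            using star[OF _ y _ x] MN by blast
          then have 1: "E (b + c) (br y x) = br (E' c y) x + sc (?s \<mu> c) (br y (E b x))"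
            by (simp only: add.commute)
          have 2: "br x y = sc (- ?s b c) (br y x)" using skew_Gw[OF x y] by simp
          have 3: "E (b + c) (br x y) = sc (- ?s b c) (E (b + c) (br y x))"
            unfolding 2 using wderD(3)[OF E m yx] .
          have 4: "br (E' c y) x = - sc (?s (\<mu> + c) b) (br x (E' c y))" using skew_Gw[OF Ec x] .
          have 5: "br y (E b x) = - sc (?s c (\<mu> + b)) (br (E b x) y)" using skew_Gw[OF y Eb] .
          have "E (b + c) (br x y) = br (E b x) y + sc (?s \<mu> b) (br x (E' c y))"
            unfolding 3 1 4 5
            by (cases "par \<mu>"; cases "par b"; cases "par c")
               (simp_all add: par_add scale_right_distrib scale_right_diff_distrib sgn_par_def)
          then show ?thesis using E'M[OF m] E'M[of b x] MN by simp
        next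
          case NN
          have bc: "b + c \<in> N0 \<or> b + c \<notin> R0" using Neg_add[OF b c] NN by (auto simp: N0_def dg_add)
          have xy: "br x y \<in> Gw (b + c)" using br_Gw[OF x y] .
          have Ex: "E' b x \<in> Gw (\<mu> + b)" and Ey: "E' c y \<in> Gw (\<mu> + c)" using E'G x y b c by blast+
          have Exy: "E' (b + c) (br x y) \<in> Gw (\<mu> + (b + c))" using E'G[of "b + c"] bc xy by (auto simp: N0_def)
          \<comment> \<open>The defect of the derivation rule. Its degree is nonnegative, and by
            repeated use of \<open>star\<close> and the Jacobi identity it commutes with
            \<open>m\<close>; so it vanishes by transitivity.\<close>
          let ?Z = "E' (b + c) (br x y) - br (E' b x) y - sc (?s \<mu> b) (br x (E' c y))"
          have "?Z = 0"
          proof (rule transitive_weight[of _ "\<mu> + (b + c)"])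
            show "?Z \<in> Gw (\<mu> + (b + c))"
              using Exy br_Gw[OF Ex y] br_Gw[OF x Ey] by (simp add: algebra_simps)
            show "0 \<le> dg (\<mu> + (b + c))" using dm d NN by (simp add: dg_add N0_def)
          next
            fix e u assume e: "e \<in> Mm" and u: "u \<in> Gw e"
            have uc: "u \<in> car P" using u Gw_car by blast
            have Eu: "E e u \<in> Gw (\<mu> + e)" using wderD(2)[OF E _ u] e by blast
            have xu: "br x u \<in> Gw (b + e)" and yu: "br y u \<in> Gw (c + e)" using br_Gw x y u by blast+
            have m1: "b + e \<in> Mm \<or> b + e \<notin> R0" and m2: "c + e \<in> Mm \<or> c + e \<notin> R0" using Mm_add b c e by blast+
            have m3: "b + c + e \<in> Mm \<or> b + c + e \<notin> R0"
              by (rule dg_neg_Mm) (use NN e in \<open>auto simp: dg_add Mm_def N0_def\<close>)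
            have cr2: "E e u \<in> car P" "E (b + e) (br x u) \<in> car P" "E (c + e) (br y u) \<in> car P"
              using Eu wderD(2)[OF E m1 xu] wderD(2)[OF E m2 yu] Gw_car by blast+
            have e1: "br (br (E' b x) y) u = br (E' b x) (br y u) - sc (?s (\<mu> + b) c) (br y (br (E' b x) u))"
              using jacobi_Gw[OF Ex y u] by simp
            have e2: "br (br x (E' c y)) u = br x (br (E' c y) u) - sc (?s b (\<mu> + c)) (br (E' c y) (br x u))"
              using jacobi_Gw[OF x Ey u] by simp
            have s1: "br (E' b x) (br y u) = E (b + c + e) (br x (br y u)) - sc (?s \<mu> b) (br x (E (c + e) (br y u)))"
              using star[OF _ x m2 yu] NN by (simp add: add.assoc)
            have s2: "br (E' b x) u = E (b + e) (br x u) - sc (?s \<mu> b) (br x (E e u))"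
              using star[OF _ x _ u] NN e by simp
            have s3: "br (E' c y) u = E (c + e) (br y u) - sc (?s \<mu> c) (br y (E e u))"
              using star[OF _ y _ u] NN e by simp
            have s4: "br (E' c y) (br x u) = E (b + c + e) (br y (br x u)) - sc (?s \<mu> c) (br y (E (b + e) (br x u)))"
              using star[OF _ y m1 xu] NN by (simp add: algebra_simps)
            have s5: "br (E' (b + c) (br x y)) u = E (b + c + e) (br (br x y) u) - sc (?s \<mu> (b + c)) (br (br x y) (E e u))"
              using star[OF bc xy _ u] e by simp
            have j1: "br x (br y u) = br (br x y) u + sc (?s b c) (br y (br x u))" using jacobi_Gw[OF x y u] .
            have j2: "br x (br y (E e u)) = br (br x y) (E e u) + sc (?s b c) (br y (br x (E e u)))" using jacobi_Gw[OF x y Eu] .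
            have g1: "br (br x y) u \<in> Gw (b + c + e)" using br_Gw[OF xy u] .
            have g2: "br y (br x u) \<in> Gw (b + c + e)" using br_Gw[OF y xu] by (simp add: algebra_simps)
            have j3: "E (b + c + e) (br x (br y u)) = E (b + c + e) (br (br x y) u) + sc (?s b c) (E (b + c + e) (br y (br x u)))"
              unfolding j1 using wder_add[OF E Mm_R m3 g1, of "sc (?s b c) (br y (br x u))"] wderD(3)[OF E m3 g2] g2 by simp
            have "br ?Z u = br (E' (b + c) (br x y)) u - br (br (E' b x) y) u - sc (?s \<mu> b) (br (br x (E' c y)) u)"
              using cr uc Exy Gw_car by (simp add: br_diff br_sc)
            also have "\<dots> = 0"
              unfolding e1 e2 s1 s2 s3 s4 s5 j3
              using cr cr2 uc
              by (cases "par \<mu>"; cases "par b"; cases "par c")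
                 (simp_all add: par_add br_diff br_sc br_minus br_add j2 scale_right_distrib scale_right_diff_distrib sgn_par_def)
            finally show "br ?Z u = 0" .
          qed
          then show ?thesis by (simp add: algebra_simps)
        qed
      qed
      then have "wder \<mu> Neg E'" unfolding wder_def using E'0 E'G E'sc by blast
      then have "inner \<mu> Neg E'" by (rule hyp[OF dm])
      then obtain Z where Z: "Z \<in> Gw \<mu>" "\<And>b x. b \<in> Neg \<Longrightarrow> x \<in> Gw b \<Longrightarrow> E' b x = br Z x"
        unfolding inner_def by blast
      have "E b x = br Z x" if "b \<in> Mm" "x \<in> Gw b" for b x
        using Z(2)[OF Mm_Neg[OF that(1)] that(2)] E'M[of b x] that by simp
      then show ?thesis using Z(1) unfolding inner_def by blast
    qed
  qed
qed

text \<open>A derivation of degree \<open>k\<close> is the sum of its weight components. Each is a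
  derivation of some weight \<mu> with \<open>dg \<mu> = q * k\<close>, and it is zero unless \<mu>
  has the parity of the derivation. If all components are inner, adding the inducing elements over
  the finitely many weights that matter induces the whole.\<close>

lemma H1_vanishesI:
  assumes k: "k \<ge> 0"
    and hyp: "\<And>\<mu> E. dg \<mu> = q * k \<Longrightarrow> wder \<mu> Neg E \<Longrightarrow> inner \<mu> Neg E"
  shows "H1_vanishes k"
  unfolding H1_vanishes_def
proof (intro allI impI)
  fix p D assume D: "der k p D"
  have D1: "D j u \<in> Gr (k + j)" if "j < 0" "u \<in> Gr j" for j u using D that unfolding der_def by blast
  have D2: "D j u \<in> P (p \<noteq> r)" if "j < 0" "u \<in> Gr j" "u \<in> P r" for j u r using D that unfolding der_def by blast
  have D3: "D j (sc a u + v) = sc a (D j u) + D j v" if "j < 0" "u \<in> Gr j" "v \<in> Gr j" for j u v a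
    using D that unfolding der_def by blast
  have D4: "D (i + j) (br u v) = br (D i u) v + sc (sgnp p r) (br u (D j v))"
    if "i < 0" "j < 0" "u \<in> Gr i" "u \<in> P r" "v \<in> Gr j" for i j u v r
    using D that unfolding der_def by blast
  define jd where "jd b = dg b div q" for b
  have jd: "dg b = q * jd b" if "b \<in> R0" for b using dg_dvd[OF that] by (simp add: jd_def)
  have jdn: "jd b < 0" if "b \<in> Mm" for b
    using jd[of b] that q_pos by (auto simp: Mm_def R0_def mult_less_0_iff)
  have MR: "b \<in> R0" "b \<in> R" if "b \<in> Mm" for b using that by (auto simp: Mm_def R0_def)
  have MG: "x \<in> Gr (jd b)" if "b \<in> Mm" "x \<in> Gw b" for b x using Gw_Gr[OF that(2) jd] MR that by blast
  have D0: "D j 0 = 0" if "j < 0" for j using D3[OF that, of 0 0 1] by simp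
  have Dsc: "D j (sc a u) = sc a (D j u)" if "j < 0" "u \<in> Gr j" for j a u
    using D3[OF that, of 0 a] D0[OF that(1)] by simp
  \<comment> \<open>The value at 0 is fixed explicitly, because \<open>D\<close> is unconstrained at
    nonnegative indices and these occur for weights outside \<open>m\<close>.\<close>
  define E where "E \<mu> b x = (if x = 0 then 0 else comp (D (jd b) x) (\<mu> + b))" for \<mu> b x
  have Dc: "D (jd b) x \<in> car P" if "b \<in> Mm" "x \<in> Gw b" for b x
    using D1[OF jdn MG] that Gr_car by blast
  have Ee: "E \<mu> b x = comp (D (jd b) x) (\<mu> + b)" if "b \<in> Mm" for \<mu> b x
    using D0[OF jdn[OF that]] by (simp add: E_def)
  have Ed: "E \<mu> b x = 0" if "b \<in> Mm" "x \<in> Gw b" "dg \<mu> \<noteq> q * k" for \<mu> b x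
    using Gr_comp[OF D1[OF jdn MG], of b x "\<mu> + b"] Ee that jd[OF MR(1)[OF that(1)]]
    by (simp add: dg_add algebra_simps)
  have inn: "inner \<mu> Mm (E \<mu>)" if dm: "dg \<mu> = q * k" for \<mu>
  proof (cases "par \<mu> = p")
    case False
    have "E \<mu> b x = br 0 x" if "b \<in> Mm" "x \<in> Gw b" for b x
    proof -
      have "D (jd b) x \<in> P (p \<noteq> par b)" using D2[OF jdn MG Gw_par] that by blast
      then have "E \<mu> b x = 0" using comp_P[of "D (jd b) x" _ "\<mu> + b"] False Ee[OF that(1)] by (auto simp: par_add)
      then show ?thesis using Gw_car[OF that(2)] by simp
    qed
    moreover have "0 \<in> Gw \<mu>" by simp
    ultimately show ?thesis unfolding inner_def by blast
  next
    case True
    have "wder \<mu> Mm (E \<mu>)"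
      unfolding wder_def
    proof (intro conjI ballI allI)
      show "E \<mu> w 0 = 0" for w by (simp add: E_def)
    next
      fix b x assume b: "b \<in> Mm" and x: "x \<in> Gw b"
      show "E \<mu> b x \<in> Gw (\<mu> + b)" unfolding Ee[OF b] using comp(1) Dc b x by blast
      fix a
      show "E \<mu> b (sc a x) = sc a (E \<mu> b x)"
        unfolding Ee[OF b] using Dsc[OF jdn[OF b] MG[OF b x], of a] comp_sc Dc[OF b x] by simp
    next
      fix b c x y assume b: "b \<in> Mm" and c: "c \<in> Mm" and x: "x \<in> Gw b" and y: "y \<in> Gw c"
      have cr: "br (D (jd b) x) y \<in> car P" "br x (D (jd c) y) \<in> car P" "x \<in> car P" "y \<in> car P"
        using Dc b c x y Gw_car by auto
      have e: "D (jd b + jd c) (br x y) = br (D (jd b) x) y + sc (sgnp p (par b)) (br x (D (jd c) y))"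
        using D4[OF jdn[OF b] jdn[OF c] MG[OF b x] Gw_par[OF x] MG[OF c y]] .
      have "comp (D (jd b + jd c) (br x y)) (\<mu> + (b + c)) = br (comp (D (jd b) x) (\<mu> + b)) y
          + sc (sgnp p (par b)) (br x (comp (D (jd c) y) (\<mu> + c)))"
        unfolding e using cr comp_br_right[OF Dc[OF b x] y] comp_br_left[OF x Dc[OF c y]]
        by (simp add: comp_add comp_sc algebra_simps)
      moreover have "E \<mu> (b + c) (br x y) = comp (D (jd b + jd c) (br x y)) (\<mu> + (b + c))"
      proof (cases "br x y = 0")
        case True
        then show ?thesis using D0[of "jd b + jd c"] jdn[OF b] jdn[OF c] by (simp add: E_def)
      next
        case False
        then have "b + c \<in> R0" using br_Gw[OF x y] Gw_nonroot by blast
        then have "q * jd (b + c) = q * (jd b + jd c)" using jd[of "b + c"] jd[OF MR(1)[OF b]] jd[OF MR(1)[OF c]] dg_add[of b c] by (simp add: distrib_left)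
        then have "jd (b + c) = jd b + jd c" using q_pos by simp
        then show ?thesis using False by (simp add: E_def)
      qed
      ultimately show "E \<mu> (b + c) (br x y) = br (E \<mu> b x) y + sc (sgnp (par \<mu>) (par b)) (br x (E \<mu> c y))"
        using Ee[OF b] Ee[OF c] True by simp
    qed
    moreover have "q * k \<ge> 0" using k q_pos by simp
    ultimately show ?thesis using extend_derivation[of "q * k" \<mu> "E \<mu>"] hyp dm by blast
  qed
  have "\<exists>Y. Y \<in> Gw \<mu> \<and> (\<forall>b\<in>Mm. \<forall>x\<in>Gw b. E \<mu> b x = br Y x)" for \<mu>
  proof (cases "dg \<mu> = q * k")
    case True
    then show ?thesis using inn unfolding inner_def by blast
  next
    case False
    then have "\<forall>b\<in>Mm. \<forall>x\<in>Gw b. E \<mu> b x = br 0 x" using Ed Gw_car by simp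
    moreover have "0 \<in> Gw \<mu>" by simp
    ultimately show ?thesis by blast
  qed
  then obtain Y where Y: "\<And>\<mu>. Y \<mu> \<in> Gw \<mu>" and YE: "\<And>\<mu> b x. b \<in> Mm \<Longrightarrow> x \<in> Gw b \<Longrightarrow> E \<mu> b x = br (Y \<mu>) x"
    by metis
  \<comment> \<open>Only differences of a weight and a root can carry some root space of
    \<open>m\<close> to a nonzero weight space.\<close>
  define L where "L = {\<mu> \<in> (\<lambda>(w, b). w - b) ` (R0 \<times> R). dg \<mu> = q * k}"
  have fL: "finite L" unfolding L_def using finite_R0 finite_R by simp
  have Yc: "Y \<mu> \<in> car P" for \<mu> using Y Gw_car by blast
  let ?Y = "\<Sum>\<mu>\<in>L. Y \<mu>"
  have YG: "?Y \<in> Gr k"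
    by (rule subspace_sum[OF subspace_Gr]) (use Y Gw_Gr in \<open>auto simp: L_def\<close>)
  have hom: "D (jd b) x = br ?Y x" if b: "b \<in> Mm" and x: "x \<in> Gw b" for b x
  proof -
    let ?I = "(\<lambda>w. w - b) ` R0"
    have bR: "b \<in> R" using MR b by blast
    have xc: "x \<in> car P" using Gw_car[OF x] .
    have "D (jd b) x = (\<Sum>w\<in>R0. comp (D (jd b) x) w)" using comp(3)[OF Dc[OF b x]] .
    also have "\<dots> = (\<Sum>\<mu>\<in>?I. E \<mu> b x)"
      by (subst sum.reindex) (auto simp: inj_on_def Ee[OF b])
    also have "\<dots> = (\<Sum>\<mu>\<in>?I. br (Y \<mu>) x)" using YE[OF b x] by simp
    also have "\<dots> = (\<Sum>\<mu>\<in>?I \<union> L. br (Y \<mu>) x)"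
    proof (rule sum.mono_neutral_left)
      show "\<forall>\<mu>\<in>?I \<union> L - ?I. br (Y \<mu>) x = 0"
      proof
        fix \<mu> assume "\<mu> \<in> ?I \<union> L - ?I"
        then have "\<mu> + b \<notin> R0" by (metis DiffD2 add_diff_cancel image_eqI)
        then show "br (Y \<mu>) x = 0" using br_Gw_nonroot[OF Y x] by blast
      qed
    qed (use fL finite_R0 in auto)
    also have "\<dots> = (\<Sum>\<mu>\<in>L. br (Y \<mu>) x)"
    proof (rule sum.mono_neutral_right)
      show "\<forall>\<mu>\<in>?I \<union> L - L. br (Y \<mu>) x = 0"
      proof
        fix \<mu> assume m: "\<mu> \<in> ?I \<union> L - L"
        then have "dg \<mu> \<noteq> q * k" using bR by (auto simp: L_def)
        then show "br (Y \<mu>) x = 0" using Ed[OF b x] YE[OF b x] by metis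
      qed
    qed (use fL finite_R0 in auto)
    also have "\<dots> = br ?Y x" using br_sum(1)[OF xc, of L Y] Yc by simp
    finally show ?thesis .
  qed
  have "D j u = br ?Y u" if j: "j < 0" and u: "u \<in> Gr j" for j u
  proof -
    have uc: "u \<in> car P" using Gr_car[OF u] .
    have cg: "comp u b \<in> Gr j" for b
      using Gw_Gr[OF comp(1)[OF uc], of b j] Gr_comp[OF u, of b] subspace_0[OF subspace_Gr] by (cases "dg b = q * j") auto
    have each: "D j (comp u b) = br ?Y (comp u b)" if b: "b \<in> R0" for b
    proof (cases "comp u b = 0")
      case True
      then show ?thesis using D0[OF j] Gr_car[OF YG] by simp
    next
      case False
      then have dj: "dg b = q * j" using Gr_comp[OF u] by blast
      then have neg: "dg b < 0" using j q_pos by (simp add: mult_pos_neg)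
      then have bM: "b \<in> Mm" using dg_neg_Mm b by blast
      have "jd b = j" using dj q_pos by (simp add: jd_def)
      then show ?thesis using hom[OF bM comp(1)[OF uc]] by simp
    qed
    have Dsum: "D j (\<Sum>b\<in>F. comp u b) = (\<Sum>b\<in>F. D j (comp u b))" for F :: "'w set"
    proof (induction F rule: infinite_finite_induct)
      case (insert b F)
      have "(\<Sum>b\<in>F. comp u b) \<in> Gr j" by (rule subspace_sum[OF subspace_Gr]) (rule cg)
      then show ?case using insert D3[OF j cg[of b], of "\<Sum>b\<in>F. comp u b" 1] by simp
    qed (use D0[OF j] in simp_all)
    have "D j u = D j (\<Sum>b\<in>R0. comp u b)" using comp(3)[OF uc] by simp
    also have "\<dots> = (\<Sum>b\<in>R0. br ?Y (comp u b))" unfolding Dsum using each by simp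
    also have "\<dots> = br ?Y (\<Sum>b\<in>R0. comp u b)" using br_sum(2)[OF Gr_car[OF YG], of R0 "comp u"] comp_car[OF uc] by simp
    also have "\<dots> = br ?Y u" using comp(3)[OF uc] by simp
    finally show ?thesis .
  qed
  then show "\<exists>Y\<in>Gr k. \<forall>j<0. \<forall>u\<in>Gr j. D j u = br Y u" using YG by blast
qed

end

section \<open>Certificates for inner derivations\<close>

text \<open>A derivation of weight \<open>\<mu>\<close> of the negative nilpotent radical maps the root space of \<open>-\<beta>\<close> to that
of \<open>\<mu>-\<beta>\<close>. The derivation rule for \<open>-\<beta>\<close> and \<open>-\<gamma>\<close> relates its values at \<open>\<beta>\<close>, \<open>\<gamma>\<close> and \<open>\<beta>+\<gamma>\<close>; as all
brackets between root spaces are nonzero whenever the sum of the weights is a root, a value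
vanishes as soon as the other two do. The list \<open>Z\<close> collects weights at which the derivation is
known to vanish, and \<open>K\<close> those known to vanish on its value in the Cartan subalgebra.\<close>

definition dead :: "('w::ab_group_add \<Rightarrow> bool) \<Rightarrow> 'w \<Rightarrow> 'w list \<Rightarrow> 'w \<Rightarrow> bool" where
  "dead rt \<mu> Z \<beta> \<longleftrightarrow> \<beta> \<in> set Z \<or> \<not> (rt (\<mu> - \<beta>) \<or> \<mu> = \<beta>)"

text \<open>The derivation rule at (-\<beta>, -\<gamma>) is then left with one term, the bracket of
  the value at -\<beta> with the root vector of -\<gamma>, which must therefore vanish. For \<beta>
  = \<gamma> odd, the two terms of the rule coincide and twice this bracket is 0.\<close>

definition isolated :: "('w::ab_group_add \<Rightarrow> bool) \<Rightarrow> ('w \<Rightarrow> bool) \<Rightarrow> 'w \<Rightarrow> 'w list \<Rightarrow> 'w \<Rightarrow> 'w \<Rightarrow> bool" where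
  "isolated rt par \<mu> Z \<beta> \<gamma> \<longleftrightarrow> (if \<beta> = \<gamma> then par \<beta> else dead rt \<mu> Z \<gamma>) \<and> (\<not> rt (\<beta> + \<gamma>) \<or> \<beta> + \<gamma> \<in> set Z)"

text \<open>The bracket of the value at -\<beta> with the root vector of -\<gamma> lands in a root
  space or in \<open>h\<close>, so it cannot vanish unless the value does.\<close>

definition hits :: "('w::ab_group_add \<Rightarrow> bool) \<Rightarrow> 'w \<Rightarrow> 'w \<Rightarrow> 'w \<Rightarrow> bool" where
  "hits rt \<mu> \<beta> \<gamma> \<longleftrightarrow> rt (\<mu> - \<beta> - \<gamma>) \<or> \<mu> = \<beta> + \<gamma>"

text \<open>A step is a pair (\<beta>, \<gamma>), read in the first way that fits. If both are dead,
  so is their sum. An isolated pair with \<mu> = \<beta> adds \<gamma> to the roots vanishing on the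
  Cartan value. An isolated pair that hits makes \<beta> dead. Any other step rejects the
  certificate.\<close>

fun propagate :: "('w::ab_group_add \<Rightarrow> bool) \<Rightarrow> ('w \<Rightarrow> bool) \<Rightarrow> 'w list \<Rightarrow> 'w \<Rightarrow> ('w \<times> 'w) list \<Rightarrow> 'w list \<Rightarrow> 'w list \<Rightarrow> ('w list \<times> 'w list) option"
  where
    "propagate rt par pos \<mu> [] Z K = Some (Z, K)"
  | "propagate rt par pos \<mu> ((\<beta>, \<gamma>) # st) Z K =
      (if \<beta> \<notin> set pos \<or> \<gamma> \<notin> set pos then None
       else if dead rt \<mu> Z \<beta> \<and> dead rt \<mu> Z \<gamma>
       then (if rt (\<beta> + \<gamma>) then propagate rt par pos \<mu> st ((\<beta> + \<gamma>) # Z) K else None)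
       else if isolated rt par \<mu> Z \<beta> \<gamma>
       then (if \<mu> = \<beta> then propagate rt par pos \<mu> st Z (\<gamma> # K)
             else if hits rt \<mu> \<beta> \<gamma> then propagate rt par pos \<mu> st (\<beta> # Z) K else None)
       else None)"

text \<open>A single pass over the simple roots without hints. It never fails; simple roots that it
  does not settle are left to the final test.\<close>

fun propagate_simple :: "('w::ab_group_add \<Rightarrow> bool) \<Rightarrow> ('w \<Rightarrow> bool) \<Rightarrow> 'w list \<Rightarrow> 'w \<Rightarrow> 'w list \<Rightarrow> 'w list \<Rightarrow> 'w list"
  where
    "propagate_simple rt par pos \<mu> [] Z = Z"
  | "propagate_simple rt par pos \<mu> (\<alpha> # as) Z =
      (if dead rt \<mu> Z \<alpha> \<or> \<mu> = \<alpha> then propagate_simple rt par pos \<mu> as Z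
       else if list_ex (\<lambda>\<gamma>. hits rt \<mu> \<alpha> \<gamma> \<and> isolated rt par \<mu> Z \<alpha> \<gamma>) pos
       then propagate_simple rt par pos \<mu> as (\<alpha> # Z)
       else propagate_simple rt par pos \<mu> as Z)"

text \<open>The derivation is first made to vanish at the root in \<open>z\<close> by subtracting an
  inner one, which is possible when \<mu> and \<mu> minus that root are roots. Without a table entry
  the first simple root that qualifies is taken. Afterwards the derivation has to vanish at all
  simple roots; at \<alpha> = \<mu> its value lies in \<open>h\<close>, and enough roots must vanish
  on it.\<close>

definition certified where
  "certified rt par sr pos spans tbl \<mu> \<longleftrightarrow>
     (let (z, st) = (case map_of tbl \<mu> of Some zs \<Rightarrow> zs
        | None \<Rightarrow> (if rt \<mu> then take 1 (filter (\<lambda>\<alpha>. rt (\<mu> - \<alpha>)) sr) else [], []))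
      in (z = [] \<or> (tl z = [] \<and> hd z \<in> set pos \<and> rt \<mu> \<and> rt (\<mu> - hd z))) \<and>
         (case propagate rt par pos \<mu> st z [] of None \<Rightarrow> False
          | Some (Z, K) \<Rightarrow> (let Z' = propagate_simple rt par pos \<mu> sr Z in
              list_all (\<lambda>\<alpha>. dead rt \<mu> Z' \<alpha> \<or> (\<mu> = \<alpha> \<and> spans K)) sr)))"

text \<open>The weights of positive degree for some \<open>S\<close>, or of degree zero for some
  \<open>S\<close> that is not exceptional. Without a positive coefficient, degree zero forces
  \<open>S\<close> into the set of zero coefficients; if this set is an exceptional singleton, only
  that exceptional grading is concerned. Indices in \<open>exc\<close> start at 0.\<close>

definition relevant :: "(nat \<Rightarrow> 'w \<Rightarrow> int) \<Rightarrow> nat \<Rightarrow> nat list \<Rightarrow> 'w \<Rightarrow> bool" where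
  "relevant co n exc \<mu> \<longleftrightarrow> list_ex (\<lambda>i. co i \<mu> > 0) [0..<n] \<or>
     (let z = filter (\<lambda>i. co i \<mu> = 0) [0..<n] in z \<noteq> [] \<and> \<not> list_ex (\<lambda>e. z = [e]) exc)"

text \<open>A derivation of weight \<mu> that does not vanish at the simple root \<alpha> requires
  \<mu> - \<alpha> to be 0 or a root, which leaves finitely many \<mu>. The weight 0 and the weights
  in \<open>special\<close> have their own lemmas.\<close>

definition all_certified where
  "all_certified rt par sr pos co exc spans special tbl \<longleftrightarrow>
     list_all (\<lambda>\<alpha>. list_all (\<lambda>\<gamma>. \<alpha> + \<gamma> = 0 \<or> \<not> relevant co (length sr) exc (\<alpha> + \<gamma>) \<or> \<alpha> + \<gamma> \<in> set special \<or>
        certified rt par sr pos spans tbl (\<alpha> + \<gamma>)) (0 # pos @ map uminus pos)) sr"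

context borel
begin

lemma wder_diff_inner:
  assumes E: "wder \<mu> A E" and Y: "Y \<in> Gw \<mu>" and A: "\<And>b. b \<in> A \<Longrightarrow> b \<in> Neg"
  shows "wder \<mu> A (\<lambda>b x. E b x - br Y x)"
proof -
  have Yc: "Y \<in> car P" using Y Gw_car by blast
  show ?thesis unfolding wder_def
  proof (intro conjI allI ballI)
    show "E w 0 - br Y 0 = 0" for w using wderD(1)[OF E] Yc by simp
  next
    fix b x assume b: "b \<in> A" "x \<in> Gw b"
    show "E b x - br Y x \<in> Gw (\<mu> + b)" using wderD(2)[OF E] br_Gw[OF Y] b by simp
    show "E b (sc a x) - br Y (sc a x) = sc a (E b x - br Y x)" for a
      using wderD(3)[OF E] b Gw_car Yc by (simp add: br_sc scale_right_diff_distrib)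
  next
    fix b c x y assume b: "b \<in> A" and c: "c \<in> A" and x: "x \<in> Gw b" and y: "y \<in> Gw c"
    have cr: "x \<in> car P" "y \<in> car P" "E b x \<in> car P" "E c y \<in> car P"
      using x y wderD(2)[OF E] b c Gw_car by blast+
    show "E (b + c) (br x y) - br Y (br x y) = br (E b x - br Y x) y + sc (sgnp (par \<mu>) (par b)) (br x (E c y - br Y y))"
      using wderD(4)[OF E _ _ x y] b c jacobi_Gw[OF Y x y] cr Yc
      by (simp add: br_diff scale_right_diff_distrib)
  qed
qed

context
  fixes \<mu> E assumes E: "wder \<mu> Neg E"
begin

definition kill :: "'w \<Rightarrow> bool" where "kill \<beta> \<longleftrightarrow> (\<forall>x\<in>Gw (- \<beta>). E (- \<beta>) x = 0)"

lemma pos_Neg: "\<beta> \<in> set pos \<Longrightarrow> - \<beta> \<in> Neg" by (simp add: Neg_def)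

lemma E_car: "\<beta> \<in> set pos \<Longrightarrow> x \<in> Gw (- \<beta>) \<Longrightarrow> E (- \<beta>) x \<in> Gw (\<mu> - \<beta>)"
  using wderD(2)[OF E, of "- \<beta>" x] pos_Neg by auto

lemma kill_sum:
  assumes b: "\<beta> \<in> set pos" and c: "\<gamma> \<in> set pos" and s: "\<beta> + \<gamma> \<in> R" and k: "kill \<beta>" "kill \<gamma>"
  shows "kill (\<beta> + \<gamma>)"
  unfolding kill_def
proof
  fix x assume x: "x \<in> Gw (- (\<beta> + \<gamma>))"
  let ?e = "rv (- \<beta>)" and ?f = "rv (- \<gamma>)"
  have e: "?e \<in> Gw (- \<beta>)" "?e \<noteq> 0" and f: "?f \<in> Gw (- \<gamma>)" "?f \<noteq> 0" using rv(1,2) pos_R(2) b c by blast+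
  have sm: "- \<beta> + - \<gamma> = - (\<beta> + \<gamma>)" by simp
  have sR: "- (\<beta> + \<gamma>) \<in> R" using R_neg s by blast
  have nz: "br ?e ?f \<noteq> 0" using br_root_nonzero[OF pos_R(2)[OF b] pos_R(2)[OF c] _ e f] sR sm by simp
  have ef: "br ?e ?f \<in> Gw (- (\<beta> + \<gamma>))" using br_Gw[OF e(1) f(1)] sm by simp
  obtain t where t: "x = sc t (br ?e ?f)" using Gw_line[OF sR ef nz x] by blast
  have Nn: "- (\<beta> + \<gamma>) \<in> Neg" using Neg_add[OF pos_Neg[OF b] pos_Neg[OF c]] sR sm by (simp add: R0_def)
  have "E (- \<beta> + - \<gamma>) (br ?e ?f) = 0"
    using wderD(4)[OF E _ _ e(1) f(1)] pos_Neg b c k e f Gw_car by (simp add: kill_def)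
  then have "E (- (\<beta> + \<gamma>)) (br ?e ?f) = 0" using sm by simp
  then show "E (- (\<beta> + \<gamma>)) x = 0" using wderD(3)[OF E _ ef] Nn t by simp
qed

text \<open>The root vectors of the negative simple roots generate the radical, so a derivation is
  determined by its values on them.\<close>

lemma kill_all:
  assumes "\<And>\<alpha>. \<alpha> \<in> set sr \<Longrightarrow> kill \<alpha>"
  shows "\<beta> \<in> set pos \<Longrightarrow> kill \<beta>"
proof (induction "nat (ht \<beta>)" arbitrary: \<beta> rule: less_induct)
  case less
  show ?case
  proof (cases "\<beta> \<in> set sr")
    case True then show ?thesis using assms by blast
  next
    case False
    then obtain \<alpha> where a: "\<alpha> \<in> set sr" "\<beta> - \<alpha> \<in> set pos" using pos_dec less.prems by blast
    have "nat (ht (\<beta> - \<alpha>)) < nat (ht \<beta>)" using ht_pos[OF less.prems] ht_sr[OF a(1)] q_pos by (simp add: ht_diff)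
    then have "kill (\<beta> - \<alpha>)" using less.hyps a by blast
    then have "kill (\<alpha> + (\<beta> - \<alpha>))"
      using kill_sum[of \<alpha> "\<beta> - \<alpha>"] a sr_pos assms pos_R(1)[OF less.prems] by auto
    then show ?thesis by simp
  qed
qed

lemma dead_kill:
  assumes "\<beta> \<in> set pos" "dead (\<lambda>w. w \<in> R) \<mu> Z \<beta>" "\<And>\<gamma>. \<gamma> \<in> set Z \<Longrightarrow> kill \<gamma>"
  shows "kill \<beta>"
proof (cases "\<beta> \<in> set Z")
  case True then show ?thesis using assms by blast
next
  case False
  then have "\<mu> - \<beta> \<notin> R0" using assms(2) by (auto simp: dead_def R0_def)
  then show ?thesis using E_car[OF assms(1)] Gw_nonroot unfolding kill_def by blast
qed

lemma isolated_zero: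
  assumes b: "\<beta> \<in> set pos" and c: "\<gamma> \<in> set pos" and i: "isolated (\<lambda>w. w \<in> R) par \<mu> Z \<beta> \<gamma>"
    and Z: "\<And>\<gamma>. \<gamma> \<in> set Z \<Longrightarrow> kill \<gamma>" and x: "x \<in> Gw (- \<beta>)" and y: "y \<in> Gw (- \<gamma>)"
  shows "br (E (- \<beta>) x) y = 0"
proof -
  have s0: "E (- \<beta> + - \<gamma>) (br x y) = 0" if x: "x \<in> Gw (- \<beta>)" and y: "y \<in> Gw (- \<gamma>)" for x y
  proof (cases "\<beta> + \<gamma> \<in> R")
    case True
    then have "kill (\<beta> + \<gamma>)" using i Z by (auto simp: isolated_def)
    moreover have "br x y \<in> Gw (- (\<beta> + \<gamma>))" using br_Gw[OF x y] by simp
    ultimately show ?thesis by (simp add: kill_def)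
  next
    case False
    have "- \<beta> + - \<gamma> \<notin> R0"
    proof
      assume a: "- \<beta> + - \<gamma> \<in> R0"
      have "ht (- \<beta> + - \<gamma>) < 0" unfolding ht_add ht_minus using ht_pos[OF b] ht_pos[OF c] by simp
      then have "- \<beta> + - \<gamma> \<noteq> 0" by (auto simp: ht_def)
      then have "- (- \<beta> + - \<gamma>) \<in> R" using a R_neg unfolding R0_def by blast
      then show False using False by (simp add: add.commute)
    qed
    then have "br x y = 0" using br_Gw_nonroot[OF x y] by blast
    then show ?thesis using wderD(1)[OF E] by simp
  qed
  have rule: "E (- \<beta> + - \<gamma>) (br x y) = br (E (- \<beta>) x) y + sc (sgnp (par \<mu>) (par \<beta>)) (br x (E (- \<gamma>) y))"
    if x: "x \<in> Gw (- \<beta>)" and y: "y \<in> Gw (- \<gamma>)" for x y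
    using wderD(4)[OF E _ _ x y] pos_Neg b c by simp
  show ?thesis
  proof (cases "\<beta> = \<gamma>")
    case False
    then have "dead (\<lambda>w. w \<in> R) \<mu> Z \<gamma>" using i by (simp add: isolated_def)
    then have "kill \<gamma>" by (rule dead_kill[OF c]) (rule Z)
    then have "E (- \<gamma>) y = 0" using y by (simp add: kill_def)
    then show ?thesis using rule[OF x y] s0[OF x y] Gw_car[OF x] by simp
  next
    \<comment> \<open>By skew-symmetry the two terms of the rule on the square of the odd root
      vector agree, so twice the bracket is 0.\<close>
    case True
    have p: "par \<beta>" using i True by (simp add: isolated_def)
    let ?e = "rv (- \<beta>)"
    have bR: "- \<beta> \<in> R" using pos_R(2)[OF b] .
    have e: "?e \<in> Gw (- \<beta>)" "?e \<in> car P" using rv(2)[OF bR] Gw_car by blast+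
    have Ee: "E (- \<beta>) ?e \<in> Gw (\<mu> - \<beta>)" using E_car[OF b e(1)] .
    have sk: "br ?e (E (- \<beta>) ?e) = - sc (sgnp (par (- \<beta>)) (par (\<mu> - \<beta>))) (br (E (- \<beta>) ?e) ?e)"
      using skew_Gw[OF e(1) Ee] .
    have "br (E (- \<beta>) ?e) ?e + sc (sgnp (par \<mu>) (par \<beta>)) (br ?e (E (- \<beta>) ?e)) = 0"
      using rule[OF e(1)] s0[OF e(1)] e True by simp
    then have "br (E (- \<beta>) ?e) ?e + br (E (- \<beta>) ?e) ?e = 0"
      unfolding sk using p by (cases "par \<mu>") (simp_all add: par_diff sgn_par_def)
    then have "sc 2 (br (E (- \<beta>) ?e) ?e) = 0" using scale_left_distrib[of 1 1 "br (E (- \<beta>) ?e) ?e"] by simp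
    then have z: "br (E (- \<beta>) ?e) ?e = 0" by simp
    obtain s t where "x = sc s ?e" "y = sc t ?e" using rv(3)[OF bR] x y True by blast
    moreover have "E (- \<beta>) (sc s ?e) = sc s (E (- \<beta>) ?e)" for s using wderD(3)[OF E _ e(1)] pos_Neg[OF b] by blast
    ultimately show ?thesis using z e Gw_car[OF Ee] by (simp add: br_sc)
  qed
qed

lemma isolated_kill:
  assumes b: "\<beta> \<in> set pos" and c: "\<gamma> \<in> set pos" and i: "isolated (\<lambda>w. w \<in> R) par \<mu> Z \<beta> \<gamma>"
    and Z: "\<And>\<gamma>. \<gamma> \<in> set Z \<Longrightarrow> kill \<gamma>" and hit: "hits (\<lambda>w. w \<in> R) \<mu> \<beta> \<gamma>" and ne: "\<mu> \<noteq> \<beta>"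
  shows "kill \<beta>"
  unfolding kill_def
proof (rule ballI, rule ccontr)
  fix x assume x: "x \<in> Gw (- \<beta>)" and nz: "E (- \<beta>) x \<noteq> 0"
  let ?y = "rv (- \<gamma>)"
  have y: "?y \<in> Gw (- \<gamma>)" "?y \<noteq> 0" using rv(1,2)[OF pos_R(2)[OF c]] by auto
  have Ex: "E (- \<beta>) x \<in> Gw (\<mu> - \<beta>)" using E_car[OF b x] .
  have "\<mu> - \<beta> \<in> R0" using Ex nz Gw_nonroot by blast
  then have mR: "\<mu> - \<beta> \<in> R" using ne by (simp add: R0_def)
  have "br (E (- \<beta>) x) ?y \<noteq> 0"
  proof (cases "\<mu> = \<beta> + \<gamma>")
    case True
    then have "\<mu> - \<beta> = \<gamma>" by simp
    then show ?thesis using br_opposite_nonzero[OF mR Ex _ nz y(2)] y(1) by simp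
  next
    case False
    then have "\<mu> - \<beta> + - \<gamma> \<in> R" using hit by (simp add: hits_def)
    then show ?thesis using br_root_nonzero[OF mR pos_R(2)[OF c] _ Ex nz y] by simp
  qed
  then show False using isolated_zero[OF b c i Z x y(1)] by blast
qed

definition Kinv :: "'w list \<Rightarrow> bool" where
  "Kinv K \<longleftrightarrow> (\<forall>\<gamma>\<in>set K. \<forall>x\<in>Gw (- \<mu>). \<Phi> \<gamma> (E (- \<mu>) x) = 0)"

lemma propagate_sound:
  "propagate (\<lambda>w. w \<in> R) par pos \<mu> st Z K = Some (Z', K') \<Longrightarrow> (\<And>\<gamma>. \<gamma> \<in> set Z \<Longrightarrow> kill \<gamma>) \<Longrightarrow> Kinv K
    \<Longrightarrow> (\<forall>\<gamma>\<in>set Z'. kill \<gamma>) \<and> Kinv K'"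
proof (induction st arbitrary: Z K)
  case Nil
  then show ?case by simp
next
  case (Cons bc st)
  obtain \<beta> \<gamma> where bc: "bc = (\<beta>, \<gamma>)" by (cases bc)
  note pr = Cons.prems(1)[unfolded bc propagate.simps]
  have p: "\<beta> \<in> set pos" "\<gamma> \<in> set pos" using pr by (auto split: if_splits)
  note kd = dead_kill[OF p(1) _ Cons.prems(2)] dead_kill[OF p(2) _ Cons.prems(2)]
  consider (sum) "dead (\<lambda>w. w \<in> R) \<mu> Z \<beta>" "dead (\<lambda>w. w \<in> R) \<mu> Z \<gamma>" "\<beta> + \<gamma> \<in> R"
      "propagate (\<lambda>w. w \<in> R) par pos \<mu> st ((\<beta> + \<gamma>) # Z) K = Some (Z', K')"
    | (cart) "isolated (\<lambda>w. w \<in> R) par \<mu> Z \<beta> \<gamma>" "\<mu> = \<beta>" "propagate (\<lambda>w. w \<in> R) par pos \<mu> st Z (\<gamma> # K) = Some (Z', K')"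
    | (hit) "isolated (\<lambda>w. w \<in> R) par \<mu> Z \<beta> \<gamma>" "\<mu> \<noteq> \<beta>" "hits (\<lambda>w. w \<in> R) \<mu> \<beta> \<gamma>"
      "propagate (\<lambda>w. w \<in> R) par pos \<mu> st (\<beta> # Z) K = Some (Z', K')"
    using pr p by (auto split: if_splits)
  then show ?case
  proof cases
    case sum
    have "kill (\<beta> + \<gamma>)" using kill_sum[OF p sum(3)] kd sum(1,2) by blast
    then show ?thesis using Cons.IH[OF sum(4)] Cons.prems by auto
  next
    case cart
    have "\<Phi> \<gamma> (E (- \<mu>) x) = 0" if x: "x \<in> Gw (- \<mu>)" for x
    proof -
      let ?y = "rv (- \<gamma>)"
      have y: "?y \<in> Gw (- \<gamma>)" "?y \<noteq> 0" using rv(1,2)[OF pos_R(2)[OF p(2)]] by auto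
      have H: "E (- \<mu>) x \<in> h" using E_car[OF p(1)] x cart(2) Gw_0 by force
      have "br (E (- \<mu>) x) ?y = 0" using isolated_zero[OF p cart(1) Cons.prems(2) _ y(1)] x cart(2) by blast
      then have "sc (\<Phi> (- \<gamma>) (E (- \<mu>) x)) ?y = 0" using Gw_eig[OF y(1) H] by simp
      then show ?thesis using y(2) by (simp add: Phi_minus)
    qed
    then have "Kinv (\<gamma> # K)" using Cons.prems(3) by (simp add: Kinv_def)
    then show ?thesis using Cons.IH[OF cart(3)] Cons.prems by blast
  next
    case hit
    have "kill \<beta>" using isolated_kill[OF p hit(1) Cons.prems(2) hit(3) hit(2)] by blast
    then show ?thesis using Cons.IH[OF hit(4)] Cons.prems by auto
  qed
qed

lemma propagate_simple_sound:
  "set as \<subseteq> set pos \<Longrightarrow> (\<And>\<gamma>. \<gamma> \<in> set Z \<Longrightarrow> kill \<gamma>)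
    \<Longrightarrow> \<gamma> \<in> set (propagate_simple (\<lambda>w. w \<in> R) par pos \<mu> as Z) \<Longrightarrow> kill \<gamma>"
proof (induction as arbitrary: Z)
  case (Cons \<alpha> as)
  show ?case
  proof (cases "\<not> (dead (\<lambda>w. w \<in> R) \<mu> Z \<alpha> \<or> \<mu> = \<alpha>) \<and>
      list_ex (\<lambda>\<gamma>. hits (\<lambda>w. w \<in> R) \<mu> \<alpha> \<gamma> \<and> isolated (\<lambda>w. w \<in> R) par \<mu> Z \<alpha> \<gamma>) pos")
    case True
    then obtain \<gamma>' where g: "\<gamma>' \<in> set pos" "hits (\<lambda>w. w \<in> R) \<mu> \<alpha> \<gamma>'" "isolated (\<lambda>w. w \<in> R) par \<mu> Z \<alpha> \<gamma>'"
      by (auto simp: list_ex_iff)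
    have "kill \<alpha>" using isolated_kill[OF _ g(1) g(3) Cons.prems(2) g(2)] Cons.prems(1) True by auto
    moreover have "\<gamma> \<in> set (propagate_simple (\<lambda>w. w \<in> R) par pos \<mu> as (\<alpha> # Z))" using Cons.prems(3) True by simp
    ultimately show ?thesis using Cons.IH[of "\<alpha> # Z"] Cons.prems(1,2) by auto
  next
    case False
    then have "\<gamma> \<in> set (propagate_simple (\<lambda>w. w \<in> R) par pos \<mu> as Z)"
      using Cons.prems(3) by (simp split: if_splits)
    then show ?thesis using Cons.IH[of Z] Cons.prems(1,2) by auto
  qed
qed simp

end

text \<open>Such a derivation rescales each negative simple root vector. As the coefficients at
  simple roots can be prescribed freely, some \<open>H\<close> in \<open>h\<close> acts with the
  same factors, and the difference vanishes on generators.\<close>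

lemma inner_weight_zero:
  assumes E: "wder 0 Neg E" shows "inner 0 Neg E"
proof -
  have "\<exists>c. E (- \<alpha>) (rv (- \<alpha>)) = sc c (rv (- \<alpha>))" if "\<alpha> \<in> set sr" for \<alpha>
  proof -
    have p: "\<alpha> \<in> set pos" using that sr_pos by auto
    have "E (- \<alpha>) (rv (- \<alpha>)) \<in> Gw (- \<alpha>)" using E_car[OF E p rv(2)[OF pos_R(2)[OF p]]] by simp
    then show ?thesis using rv(3)[OF pos_R(2)[OF p]] by blast
  qed
  then obtain c where c: "\<And>\<alpha>. \<alpha> \<in> set sr \<Longrightarrow> E (- \<alpha>) (rv (- \<alpha>)) = sc (c \<alpha>) (rv (- \<alpha>))" by metis
  \<comment> \<open>Additive with value \<open>- c \<alpha>\<close> at each simple root \<alpha>.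
    The sign appears because the vectors have weight -\<alpha>, the division because
    \<open>co\<close> carries the factor \<open>q\<close>.\<close>
  define f where "f w = (\<Sum>i<n. - c (sr ! i) * of_int (co i w) / of_int q)" for w
  have "f (v + w) = f v + f w" for v w
    unfolding f_def sum.distrib[symmetric]
    by (intro sum.cong refl) (simp add: co_add ring_distribs add_divide_distrib diff_divide_distrib)
  then obtain H where H: "H \<in> h" "\<And>w. \<Phi> w H = f w" using dual[of f] by blast
  have fsr: "f \<alpha> = - c \<alpha>" if "\<alpha> \<in> set sr" for \<alpha>
  proof -
    obtain j where j: "j < n" "\<alpha> = sr ! j" using \<open>\<alpha> \<in> set sr\<close> by (metis in_set_conv_nth)
    have "f \<alpha> = (\<Sum>i<n. if i = j then - c \<alpha> else 0)"
      unfolding f_def using j co_sr q_pos by (intro sum.cong) auto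
    then show ?thesis using j by simp
  qed
  have HG: "H \<in> Gw 0" using H Gw_0 by simp
  let ?E = "\<lambda>b x. E b x - br H x"
  have E': "wder 0 Neg ?E" by (rule wder_diff_inner[OF E HG])
  have "kill ?E \<alpha>" if a: "\<alpha> \<in> set sr" for \<alpha>
  proof -
    have p: "\<alpha> \<in> set pos" using a sr_pos by auto
    have r: "- \<alpha> \<in> R" using pos_R(2)[OF p] .
    have "?E (- \<alpha>) x = 0" if x: "x \<in> Gw (- \<alpha>)" for x
    proof -
      obtain t where t: "x = sc t (rv (- \<alpha>))" using rv(3)[OF r x] by blast
      have "E (- \<alpha>) x = sc (c \<alpha>) x"
        using t wderD(3)[OF E _ rv(2)[OF r], of t] c[OF a] p by (simp add: Neg_def mult.commute)
      moreover have "\<Phi> (- \<alpha>) H = c \<alpha>" by (subst Phi_minus) (simp add: H(2) fsr a)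
      then have "br H x = sc (c \<alpha>) x" using Gw_eig[OF x H(1)] by simp
      ultimately show ?thesis by simp
    qed
    then show ?thesis unfolding kill_def[OF E'] by blast
  qed
  then have "\<And>\<beta>. \<beta> \<in> set pos \<Longrightarrow> kill ?E \<beta>" using kill_all[OF E'] by blast
  then have "\<forall>b\<in>Neg. \<forall>x\<in>Gw b. E b x = br H x" by (auto simp: kill_def[OF E'] Neg_def)
  then show ?thesis using HG unfolding inner_def by blast
qed

lemma certified_inner:
  assumes cert: "certified (\<lambda>w. w \<in> R) par sr pos spans tbl \<mu>"
    and spans: "\<And>K H. spans K \<Longrightarrow> H \<in> h \<Longrightarrow> (\<And>\<gamma>. \<gamma> \<in> set K \<Longrightarrow> \<Phi> \<gamma> H = 0) \<Longrightarrow> H = 0"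
    and E: "wder \<mu> Neg E"
  shows "inner \<mu> Neg E"
proof -
  obtain z st where zst: "(case map_of tbl \<mu> of Some zs \<Rightarrow> zs
        | None \<Rightarrow> (if \<mu> \<in> R then take 1 (filter (\<lambda>\<alpha>. \<mu> - \<alpha> \<in> R) sr) else [], [])) = (z, st)"
    by (cases "(case map_of tbl \<mu> of Some zs \<Rightarrow> zs
        | None \<Rightarrow> (if \<mu> \<in> R then take 1 (filter (\<lambda>\<alpha>. \<mu> - \<alpha> \<in> R) sr) else [], []))")
  have z: "z = [] \<or> (tl z = [] \<and> hd z \<in> set pos \<and> \<mu> \<in> R \<and> \<mu> - hd z \<in> R)"
    and pr: "case propagate (\<lambda>w. w \<in> R) par pos \<mu> st z [] of None \<Rightarrow> False
          | Some (Z, K) \<Rightarrow> (let Z' = propagate_simple (\<lambda>w. w \<in> R) par pos \<mu> sr Z in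
              list_all (\<lambda>\<alpha>. dead (\<lambda>w. w \<in> R) \<mu> Z' \<alpha> \<or> (\<mu> = \<alpha> \<and> spans K)) sr)"
    using cert unfolding certified_def zst by simp_all
  obtain Z K where ZK: "propagate (\<lambda>w. w \<in> R) par pos \<mu> st z [] = Some (Z, K)"
    and fin: "\<And>\<alpha>. \<alpha> \<in> set sr \<Longrightarrow> dead (\<lambda>w. w \<in> R) \<mu> (propagate_simple (\<lambda>w. w \<in> R) par pos \<mu> sr Z) \<alpha> \<or> (\<mu> = \<alpha> \<and> spans K)"
    using pr by (auto split: option.splits simp: Let_def list_all_iff)
  obtain Y where Y: "Y \<in> Gw \<mu>" and Yz: "\<And>\<beta> x. \<beta> \<in> set z \<Longrightarrow> x \<in> Gw (- \<beta>) \<Longrightarrow> E (- \<beta>) x = br Y x"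
  proof (cases "z = []")
    case True
    then show thesis using that[of 0] by simp
  next
    case False
    then obtain \<beta> where zb: "z = [\<beta>]" using z by (cases z) auto
    then have b: "\<beta> \<in> set pos" "\<mu> \<in> R" "\<mu> - \<beta> \<in> R" using z by auto
    let ?e = "rv (- \<beta>)" and ?m = "rv \<mu>"
    have bR: "- \<beta> \<in> R" using pos_R(2)[OF b(1)] .
    have e: "?e \<in> Gw (- \<beta>)" "?e \<noteq> 0" and m: "?m \<in> Gw \<mu>" "?m \<noteq> 0" using rv(1,2) bR b(2) by blast+
    have me: "br ?m ?e \<in> Gw (\<mu> - \<beta>)" using br_Gw[OF m(1) e(1)] by simp
    have nz: "br ?m ?e \<noteq> 0" using br_root_nonzero[OF b(2) bR _ m e] b(3) by simp
    obtain c where c: "E (- \<beta>) ?e = sc c (br ?m ?e)" using Gw_line[OF b(3) me nz E_car[OF E b(1) e(1)]] by blast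
    have "E (- \<beta>) x = br (sc c ?m) x" if x: "x \<in> Gw (- \<beta>)" for x
    proof -
      obtain t where t: "x = sc t ?e" using rv(3)[OF bR x] by blast
      have "E (- \<beta>) x = sc t (E (- \<beta>) ?e)" using t wderD(3)[OF E _ e(1)] b(1) by (simp add: Neg_def)
      then show ?thesis using c t Gw_car[OF m(1)] Gw_car[OF e(1)] by (simp add: br_sc mult.commute)
    qed
    then show thesis using that[of "sc c ?m"] zb m(1) by simp
  qed
  let ?E = "\<lambda>b x. E b x - br Y x"
  have E': "wder \<mu> Neg ?E" by (rule wder_diff_inner[OF E Y])
  have kz: "kill ?E \<gamma>" if "\<gamma> \<in> set z" for \<gamma> using Yz[OF that] by (simp add: kill_def[OF E'])
  have ZKs: "\<forall>\<gamma>\<in>set Z. kill ?E \<gamma>" "Kinv \<mu> ?E K"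
    using propagate_sound[OF E' ZK kz] by (auto simp: Kinv_def[OF E'])
  have KK: "\<forall>\<gamma>\<in>set K. \<forall>x\<in>Gw (- \<mu>). \<Phi> \<gamma> (?E (- \<mu>) x) = 0" using ZKs(2) unfolding Kinv_def[OF E'] .
  have kZ': "kill ?E \<gamma>" if "\<gamma> \<in> set (propagate_simple (\<lambda>w. w \<in> R) par pos \<mu> sr Z)" for \<gamma>
    using propagate_simple_sound[OF E' sr_pos _ that] ZKs(1) by blast
  have "kill ?E \<alpha>" if a: "\<alpha> \<in> set sr" for \<alpha>
  proof -
    have p: "\<alpha> \<in> set pos" using a sr_pos by auto
    from fin[OF a] show ?thesis
    proof
      assume "dead (\<lambda>w. w \<in> R) \<mu> (propagate_simple (\<lambda>w. w \<in> R) par pos \<mu> sr Z) \<alpha>"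
      then show ?thesis using dead_kill[OF E' p] kZ' by blast
    next
      assume s: "\<mu> = \<alpha> \<and> spans K"
      have "?E (- \<alpha>) x = 0" if x: "x \<in> Gw (- \<alpha>)" for x
      proof (rule spans)
        show "spans K" using s by simp
        show "?E (- \<alpha>) x \<in> h" using E_car[OF E' p x] s Gw_0 by simp
        show "\<Phi> \<gamma> (?E (- \<alpha>) x) = 0" if "\<gamma> \<in> set K" for \<gamma>
          using KK that s x by auto
      qed
      then show ?thesis by (simp add: kill_def[OF E'])
    qed
  qed
  then have "\<And>\<beta>. \<beta> \<in> set pos \<Longrightarrow> kill ?E \<beta>" using kill_all[OF E'] by blast
  then have "\<forall>b\<in>Neg. \<forall>x\<in>Gw b. E b x = br Y x" by (auto simp: kill_def[OF E'] Neg_def)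
  then show ?thesis using Y unfolding inner_def by blast
qed

lemma all_certified_inner:
  assumes all: "all_certified (\<lambda>w. w \<in> R) par sr pos co exc spans special tbl"
    and spans: "\<And>K H. spans K \<Longrightarrow> H \<in> h \<Longrightarrow> (\<And>\<gamma>. \<gamma> \<in> set K \<Longrightarrow> \<Phi> \<gamma> H = 0) \<Longrightarrow> H = 0"
    and special: "\<And>\<mu> E. \<mu> \<in> set special \<Longrightarrow> wder \<mu> Neg E \<Longrightarrow> inner \<mu> Neg E"
    and rel: "relevant co n exc \<mu>" and E: "wder \<mu> Neg E"
  shows "inner \<mu> Neg E"
proof (cases "\<exists>\<alpha>\<in>set sr. \<not> kill E \<alpha>")
  case True
  then obtain \<alpha> where a: "\<alpha> \<in> set sr" "\<not> kill E \<alpha>" by blast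
  have p: "\<alpha> \<in> set pos" using a sr_pos by auto
  have "\<mu> - \<alpha> \<in> R0" using a(2) E_car[OF E p] Gw_nonroot unfolding kill_def[OF E] by blast
  then have "\<mu> - \<alpha> = 0 \<or> \<mu> - \<alpha> \<in> set pos \<or> - (\<mu> - \<alpha>) \<in> set pos" using R_cases unfolding R0_def by blast
  then have "\<mu> - \<alpha> = 0 \<or> \<mu> - \<alpha> \<in> set pos \<or> \<mu> - \<alpha> \<in> uminus ` set pos" by (metis image_eqI minus_minus)
  then have "\<mu> - \<alpha> \<in> set (0 # pos @ map uminus pos)" by auto
  then have "\<alpha> + (\<mu> - \<alpha>) = 0 \<or> \<not> relevant co n exc (\<alpha> + (\<mu> - \<alpha>)) \<or> \<alpha> + (\<mu> - \<alpha>) \<in> set special \<or>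
      certified (\<lambda>w. w \<in> R) par sr pos spans tbl (\<alpha> + (\<mu> - \<alpha>))"
    using all a(1) unfolding all_certified_def list_all_iff by blast
  then consider "\<mu> = 0" | "\<mu> \<in> set special" | "certified (\<lambda>w. w \<in> R) par sr pos spans tbl \<mu>" using rel by auto
  then show ?thesis
  proof cases
    case 1 then show ?thesis using inner_weight_zero E by blast
  next
    case 2 then show ?thesis using special E by blast
  next
    case 3 then show ?thesis by (rule certified_inner[OF _ _ E]) (erule spans, assumption, blast)
  qed
next
  case False
  then have "\<And>\<beta>. \<beta> \<in> set pos \<Longrightarrow> kill E \<beta>" using kill_all[OF E] by blast
  then have "\<forall>b\<in>Neg. \<forall>x\<in>Gw b. E b x = br 0 x" using Gw_car by (auto simp: kill_def[OF E] Neg_def)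
  then show ?thesis unfolding inner_def by (intro bexI[of _ 0]) auto
qed

end

context parabolic
begin

lemma relevantI:
  assumes "dg \<mu> \<ge> 0" and "dg \<mu> > 0 \<or> (\<forall>e\<in>set exc. S \<noteq> {e})"
  shows "relevant co n exc \<mu>"
proof (cases "\<exists>i<n. co i \<mu> > 0")
  case True
  then show ?thesis by (auto simp: relevant_def list_ex_iff)
next
  case False
  then have le: "co i \<mu> \<le> 0" if "i < n" for i using that by force
  have leS: "\<And>i. i \<in> S \<Longrightarrow> co i \<mu> \<le> 0" using le S_sub by auto
  then have "dg \<mu> \<le> 0" unfolding dg_def by (rule sum_nonpos)
  then have d0: "dg \<mu> = 0" using assms by simp
  have "(\<Sum>i\<in>S. - co i \<mu>) = 0" using d0 by (simp add: dg_def sum_negf)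
  then have z: "co i \<mu> = 0" if "i \<in> S" for i
    using sum_nonneg_eq_0_iff[OF fin_S, of "\<lambda>i. - co i \<mu>"] leS that by simp
  let ?z = "filter (\<lambda>i. co i \<mu> = 0) [0..<n]"
  have sub: "S \<subseteq> set ?z" using z S_sub by auto
  then have "?z \<noteq> []" using S_ne by (metis empty_set subset_empty)
  moreover have "?z \<noteq> [e]" if "e \<in> set exc" for e
  proof
    assume "?z = [e]"
    then have "S \<subseteq> {e}" using sub by (metis empty_set list.simps(15))
    then have "S = {e}" using S_ne by blast
    then show False using assms(2) d0 that by auto
  qed
  ultimately show ?thesis by (auto simp: relevant_def Let_def list_ex_iff)
qed

text \<open>Positive degrees are relevant for every \<open>S\<close>, so the relative prolongation
  is \<open>g\<close> even in the exceptional gradings; these escape only in degree zero.\<close>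

theorem prolongation:
  assumes all: "all_certified (\<lambda>w. w \<in> R) par sr pos co exc spans special tbl"
    and spans: "\<And>K H. spans K \<Longrightarrow> H \<in> h \<Longrightarrow> (\<And>\<gamma>. \<gamma> \<in> set K \<Longrightarrow> \<Phi> \<gamma> H = 0) \<Longrightarrow> H = 0"
    and special: "\<And>\<mu> E. \<mu> \<in> set special \<Longrightarrow> wder \<mu> Neg E \<Longrightarrow> inner \<mu> Neg E"
  shows "(\<forall>e\<in>set exc. S \<noteq> {e}) \<Longrightarrow> pr_equals TYPE('b::ab_group_add) sc P br Gr"
    and "pr0_equals TYPE('b::ab_group_add) sc P br Gr"
proof -
  have H: "H1_vanishes k" if k: "k \<ge> 0" "k > 0 \<or> (\<forall>e\<in>set exc. S \<noteq> {e})" for k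
  proof (rule H1_vanishesI[OF k(1)])
    fix \<mu> E assume d: "dg \<mu> = q * k" and E: "wder \<mu> Neg E"
    have "relevant co n exc \<mu>" by (rule relevantI) (use d k q_pos in auto)
    then show "inner \<mu> Neg E"
      by (rule all_certified_inner[OF all _ _ _ E, rotated 2]) (erule spans, assumption, blast, rule special)
  qed
  show "(\<forall>e\<in>set exc. S \<noteq> {e}) \<Longrightarrow> pr_equals TYPE('b) sc P br Gr" using H by (intro pr_equalsI) auto
  show "pr0_equals TYPE('b) sc P br Gr" using H by (intro pr0_equalsI) auto
qed

end

section \<open>Root data\<close>

text \<open>The tuple (d, a, b) stands for d \<delta> + a \<epsilon>1 + b \<epsilon>2, with
  \<epsilon>3 replaced by -\<epsilon>1 - \<epsilon>2.\<close>

definition simple3 :: "nat \<Rightarrow> (int \<times> int \<times> int) list" where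
  "simple3 \<Xi> = (if \<Xi> = 1 then [(1, -1, -1), (0, 1, 0), (0, -1, 1)]
     else if \<Xi> = 2 then [(-1, 1, 1), (1, 0, -1), (0, -1, 1)]
     else if \<Xi> = 3 then [(-1, 0, 1), (1, -1, 0), (0, 1, 0)]
     else [(0, -1, 1), (-1, 1, 0), (1, 0, 0)])"

text \<open>Each row reads off the coefficient at one simple root: the rows form the inverse of the
  matrix whose columns are the simple roots.\<close>

definition coord3 :: "nat \<Rightarrow> (int \<times> int \<times> int) list" where
  "coord3 \<Xi> = (if \<Xi> = 1 then [(1, 0, 0), (2, 1, 1), (1, 0, 1)]
     else if \<Xi> = 2 then [(1, 1, 1), (2, 1, 1), (1, 0, 1)]
     else if \<Xi> = 3 then [(0, 0, 1), (1, 0, 1), (1, 1, 1)]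
     else [(0, 0, 1), (0, 1, 1), (1, 1, 1)])"

definition exc3 :: "nat \<Rightarrow> nat list" where
  "exc3 \<Xi> = (if \<Xi> = 1 then [0]
     else if \<Xi> = 2 then []
     else if \<Xi> = 3 then [0]
     else [0])"

text \<open>An entry consists of a weight, at most one root at which to normalise, and the steps to
  be replayed. Correctness rests on the check alone, so nothing about the entries has to be proved
  separately.\<close>

definition hints3 :: "nat \<Rightarrow> ((int \<times> int \<times> int) \<times> (int \<times> int \<times> int) list \<times> ((int \<times> int \<times> int) \<times> (int \<times> int \<times> int)) list) list" where
  "hints3 \<Xi> = (if \<Xi> = 1 then [
      ((0, 1, 0), [(0, 0, 1)], [((0, 1, 0), (0, -1, 1)), ((0, 1, 0), (0, 1, 2)), ((0, 1, 0), (2, 0, 0))]),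
      ((0, -1, 1), [(0, 0, 1)], [((0, -1, 1), (0, 1, 0)), ((0, -1, 1), (1, -1, -1)), ((0, -1, 1), (0, 0, 1))]),
      ((1, -1, -1), [(1, 0, -1)], [((1, -1, -1), (0, -1, 1)), ((1, -1, -1), (0, 1, 0)), ((1, -1, -1), (1, -1, -1))]),
      ((0, 0, 1), [(0, -1, 1)], [((0, -1, 1), (0, 2, 1))]),
      ((1, 1, 0), [(0, 1, 0)], [((1, 0, -1), (0, 1, 0))]),
      ((1, 0, -1), [(0, 1, 0)], [((1, 1, 0), (0, 1, 0))]),
      ((1, 0, -2), [], [((1, 0, -1), (0, 1, 0))]),
      ((1, -2, 0), [], [((0, -1, 1), (1, 0, 0))]),
      ((1, 0, 0), [(0, 1, 0)], [((1, 0, -1), (0, 1, 0))]),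
      ((2, 1, 0), [], [((1, 0, -1), (1, 0, -1))]),
      ((0, 2, 2), [], [((0, 2, 1), (1, 0, 0))])]
     else if \<Xi> = 2 then [
      ((0, 1, 0), [(-1, 1, 1)], [((1, 1, 1), (-1, 1, 1))]),
      ((0, -1, 1), [(1, -1, 0)], [((0, -1, 1), (-1, 1, 1)), ((0, -1, 1), (1, 0, -1)), ((0, -1, 1), (1, -1, 0))]),
      ((1, 0, -1), [(0, 1, 0)], [((1, 0, -1), (-1, 1, 1)), ((1, 0, -1), (1, 0, -1)), ((1, 0, -1), (0, 2, 1))]),
      ((1, -1, 0), [(0, -1, 1)], [((1, 1, 1), (0, -1, 1))]),
      ((1, 2, 0), [], [((0, 1, 0), (2, 0, 0))]),
      ((1, 1, 1), [(1, 0, -1)], [((0, 2, 1), (1, 0, -1)), ((0, 0, 1), (0, 2, 1)), ((0, 1, 0), (0, -1, 1))]),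
      ((-1, 1, 1), [(0, 1, 0)], [((-1, 1, 1), (-1, 1, 1)), ((-1, 1, 1), (0, -1, 1)), ((-1, 1, 1), (1, 0, -1))]),
      ((-1, 0, 2), [], [((0, -1, 1), (0, 1, 1))]),
      ((-1, 2, 0), [], [((0, 1, 0), (1, 1, 0))])]
     else if \<Xi> = 3 then [
      ((0, -1, 1), [(-1, 0, 1)], [((0, 0, 1), (-1, 0, 1))]),
      ((0, 1, 0), [(-1, 1, 1)], [((0, 1, 0), (-1, 0, 1)), ((0, 1, 0), (-1, 1, 1)), ((0, 1, 0), (2, 0, 0))]),
      ((0, 0, 1), [(0, 1, 0)], [((0, 1, 2), (0, 1, 0)), ((1, -1, 0), (0, 1, 2)), ((0, -1, 1), (0, 2, 1))]),
      ((1, 0, 1), [(1, -1, 0)], [((1, 0, 0), (1, -1, 0)), ((0, -1, 1), (1, 0, 0))]),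
      ((-1, 2, 2), [], [((-1, 1, 1), (0, 1, 0))]),
      ((1, 0, -1), [(0, 1, 0)], [((0, 1, 0), (1, 0, 1))]),
      ((1, -1, 0), [(0, -1, 1)], [((1, -1, 0), (-1, 0, 1)), ((1, -1, 0), (1, -1, 0)), ((1, -1, 0), (0, 1, 2))]),
      ((-1, 0, 1), [(-1, 1, 1)], [((-1, 0, 1), (-1, 0, 1)), ((-1, 0, 1), (0, 1, 0)), ((-1, 0, 1), (0, 2, 1))]),
      ((1, 0, 0), [(0, 1, 0)], [((1, 1, 1), (0, 1, 0))]),
      ((0, 1, 1), [(0, 1, 0)], [((-1, 1, 1), (0, 1, 0))]),
      ((1, 0, 2), [], [((0, -1, 1), (-1, 1, 1))]),
      ((1, 1, 1), [(0, 1, 0)], [((0, 1, 2), (0, 1, 0))]),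
      ((-1, 1, 1), [(-1, 0, 1)], [((0, 0, 1), (-1, 0, 1))]),
      ((2, 1, 0), [], [((1, 0, 0), (0, 2, 1))]),
      ((0, -1, 0), [(-1, 0, 1)], [((1, 0, 1), (-1, 0, 1)), ((0, -1, 1), (1, 1, 0))]),
      ((-1, 1, 0), [(0, 1, 0)], [((-1, 1, 1), (0, 1, 0))]),
      ((0, 2, 2), [], [((-1, 1, 1), (-1, 1, 1))])]
     else [
      ((0, -1, 1), [(-1, 0, 1)], [((0, -1, 1), (-1, 1, 0)), ((0, -1, 1), (1, 0, 0)), ((0, -1, 1), (-1, 0, 1))]),
      ((0, 1, 0), [(-1, 1, 0)], [((1, 1, 0), (-1, 1, 0))]),
      ((-1, 2, 2), [], [((-1, 1, 1), (0, 1, 0))]),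
      ((1, 1, 0), [(1, 0, 0)], [((1, 1, 1), (1, 0, 0)), ((0, 1, 0), (1, 1, 1))]),
      ((-1, 0, 1), [(-1, 1, 0)], [((0, 1, 2), (-1, 1, 0))]),
      ((1, 0, 0), [(0, 1, 0)], [((1, 0, 0), (-1, 1, 0)), ((1, 0, 0), (0, -1, 1)), ((1, 0, 0), (0, 2, 1))]),
      ((0, 1, 1), [(-1, 1, 0)], [((0, 1, 2), (-1, 1, 0))]),
      ((-1, 0, 0), [(0, 1, 0)], [((-1, 1, 1), (0, 1, 0)), ((-1, 0, 1), (0, 1, 0))]),
      ((-1, 1, 0), [(-1, 0, 1)], [((-1, 1, 0), (-1, 1, 0)), ((-1, 1, 0), (0, -1, 1)), ((-1, 1, 0), (0, 1, 2))])])"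

definition roots3 :: "(int \<times> int \<times> int) list" where
  "roots3 = [(-2, 0, 0), (-1, -1, -1), (-1, -1, 0), (-1, 0, -1), (-1, 0, 0), (-1, 0, 1), (-1, 1, 0), (-1, 1, 1), (0, -2, -1), (0, -1, -2), (0, -1, -1), (0, -1, 0), (0, -1, 1), (0, 0, -1), (0, 0, 1), (0, 1, -1), (0, 1, 0), (0, 1, 1), (0, 1, 2), (0, 2, 1), (1, -1, -1), (1, -1, 0), (1, 0, -1), (1, 0, 0), (1, 0, 1), (1, 1, 0), (1, 1, 1), (2, 0, 0)]"

text \<open>All coordinates are twice the coefficients of \<delta>, \<epsilon>1, \<epsilon>2,
  \<epsilon>3, which makes the odd roots integral.\<close>

definition simple4 :: "nat \<Rightarrow> (int \<times> int \<times> int \<times> int) list" where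
  "simple4 \<Xi> = (if \<Xi> = 1 then [(1, -1, -1, -1), (0, 0, 0, 2), (0, 0, 2, -2), (0, 2, -2, 0)]
     else if \<Xi> = 2 then [(-1, 1, 1, 1), (1, -1, -1, 1), (0, 0, 2, -2), (0, 2, -2, 0)]
     else if \<Xi> = 3 then [(0, 2, -2, 0), (1, -1, 1, -1), (-1, 1, 1, -1), (0, 0, 0, 2)]
     else if \<Xi> = 4 then [(1, 1, -1, -1), (1, -1, 1, 1), (-1, 1, -1, 1), (0, 0, 2, -2)]
     else if \<Xi> = 5 then [(2, 0, 0, 0), (-1, 1, -1, -1), (0, 0, 0, 2), (0, 0, 2, -2)]
     else [(2, 0, 0, 0), (-1, -1, 1, 1), (0, 2, -2, 0), (0, 0, 2, -2)])"

text \<open>Pairing these rows with the doubled simple roots gives twice the identity matrix, whence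
  \<open>q\<close> is 2 for F(4).\<close>

definition coord4 :: "nat \<Rightarrow> (int \<times> int \<times> int \<times> int) list" where
  "coord4 \<Xi> = (if \<Xi> = 1 then [(2, 0, 0, 0), (3, 1, 1, 1), (2, 1, 1, 0), (1, 1, 0, 0)]
     else if \<Xi> = 2 then [(1, 1, 1, 1), (3, 1, 1, 1), (2, 1, 1, 0), (1, 1, 0, 0)]
     else if \<Xi> = 3 then [(1, 1, 0, 0), (2, 1, 1, 0), (0, 1, 1, 0), (1, 1, 1, 1)]
     else if \<Xi> = 4 then [(1, 1, 0, 0), (1, 1, 1, 1), (0, 2, 1, 1), (0, 1, 1, 0)]
     else if \<Xi> = 5 then [(1, 1, 0, 0), (0, 2, 0, 0), (0, 2, 1, 1), (0, 1, 1, 0)]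
     else [(1, 1, 1, 1), (0, 2, 2, 2), (0, 2, 1, 1), (0, 1, 1, 0)])"

definition exc4 :: "nat \<Rightarrow> nat list" where
  "exc4 \<Xi> = (if \<Xi> = 1 then [0, 3]
     else if \<Xi> = 2 then [3]
     else if \<Xi> = 3 then [0, 2]
     else if \<Xi> = 4 then [0, 3]
     else if \<Xi> = 5 then [0, 3]
     else [3])"

definition hints4 :: "nat \<Rightarrow> ((int \<times> int \<times> int \<times> int) \<times> (int \<times> int \<times> int \<times> int) list \<times> ((int \<times> int \<times> int \<times> int) \<times> (int \<times> int \<times> int \<times> int)) list) list" where
  "hints4 \<Xi> = (if \<Xi> = 1 then [
      ((1, -1, -1, 1), [(0, 0, 0, 2)], [((1, -1, 1, 1), (0, 0, 0, 2))]),
      ((0, 0, 0, 2), [(0, 0, 2, 0)], [((0, 0, 0, 2), (0, 0, 2, -2)), ((0, 0, 0, 2), (0, 2, -2, 0)), ((0, 0, 0, 2), (0, 2, 2, 0)), ((0, 0, 0, 2), (2, 0, 0, 0))]),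
      ((2, 0, 0, 2), [], [((1, -1, -1, 1), (1, -1, -1, 1))]),
      ((1, 1, -1, 1), [(0, 0, 0, 2)], [((0, 2, -2, 0), (0, 0, 0, 2))]),
      ((0, 0, -2, 0), [(0, 0, 0, 2)], [((0, 2, -2, 0), (0, 0, 0, 2))]),
      ((0, 2, 0, -2), [(0, 0, 2, -2)], [((0, 2, 0, 0), (0, 0, 2, -2))]),
      ((0, 0, 2, 0), [(0, 0, 0, 2)], [((0, 2, 2, 0), (0, 0, 0, 2))]),
      ((1, -3, -1, 1), [], [((1, -1, -1, 1), (0, 0, 0, 2))]),
      ((0, 2, -2, 0), [(0, 2, 0, -2)], [((0, 2, -2, 0), (0, 0, 0, 2)), ((0, 2, -2, 0), (0, 0, 2, -2)), ((0, 2, -2, 0), (1, -1, -1, -1)), ((0, 2, -2, 0), (0, 2, 0, -2))]),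
      ((1, -1, -1, -1), [(1, -1, -1, 1)], [((1, -1, -1, -1), (0, 0, 0, 2)), ((1, -1, -1, -1), (0, 0, 2, -2)), ((1, -1, -1, -1), (0, 2, -2, 0)), ((1, -1, -1, -1), (1, -1, -1, -1))]),
      ((0, 2, -2, 2), [], [((0, 2, -2, 0), (1, -1, -1, 1))]),
      ((0, 2, 2, 2), [], [((0, 0, 2, 2), (1, 1, -1, 1))]),
      ((0, 0, 2, -2), [(0, 0, 2, 0)], [((0, 0, 2, -2), (0, 0, 0, 2)), ((0, 0, 2, -2), (1, -1, -1, -1)), ((0, 0, 2, -2), (0, 0, 2, 0)), ((0, 0, 2, -2), (0, 2, 0, 0))]),
      ((0, -2, 2, 2), [], [((0, 0, 2, 2), (1, -1, -1, 1))]),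
      ((1, -1, 1, 1), [(0, 0, 0, 2)], [((1, -1, -1, 1), (0, 0, 0, 2))])]
     else if \<Xi> = 2 then [
      ((1, -1, -1, 1), [(0, 0, 0, 2)], [((1, -1, -1, 1), (-1, 1, 1, 1)), ((1, -1, -1, 1), (0, 2, -2, 0)), ((1, -1, -1, 1), (1, -1, -1, 1)), ((1, -1, -1, 1), (0, 0, 2, 2))]),
      ((0, 0, 0, 2), [(-1, 1, 1, 1)], [((1, 1, 1, 1), (-1, 1, 1, 1))]),
      ((-1, -1, 1, 3), [], [((0, 0, 0, 2), (1, -1, 1, 1))]),
      ((0, 2, 0, -2), [(0, 0, 2, -2)], [((1, 1, -1, -1), (0, 0, 2, -2))]),
      ((1, -1, 1, -1), [(0, 0, 2, -2)], [((1, 1, -1, -1), (0, 0, 2, -2))]),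
      ((0, 2, -2, 0), [(0, 2, 0, -2)], [((0, 2, -2, 0), (-1, 1, 1, 1)), ((0, 2, -2, 0), (0, 0, 2, -2)), ((0, 2, -2, 0), (1, -1, -1, 1)), ((0, 2, -2, 0), (0, 2, 0, -2))]),
      ((-1, 1, 1, 1), [(0, 0, 0, 2)], [((-1, 1, 1, 1), (-1, 1, 1, 1)), ((-1, 1, 1, 1), (0, 0, 2, -2)), ((-1, 1, 1, 1), (0, 2, -2, 0)), ((-1, 1, 1, 1), (1, -1, -1, 1))]),
      ((1, 1, 1, 1), [(1, -1, -1, 1)], [((0, 0, 2, 2), (1, -1, -1, 1)), ((0, 2, 0, 0), (0, 0, 2, 2)), ((0, 0, 0, 2), (0, 2, 0, -2))]),
      ((0, 0, 2, -2), [(0, 2, 0, -2)], [((0, 0, 2, -2), (-1, 1, 1, 1)), ((0, 0, 2, -2), (0, 2, -2, 0)), ((0, 0, 2, -2), (0, 2, 0, -2)), ((0, 0, 2, -2), (1, 1, -1, -1))])]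
     else if \<Xi> = 3 then [
      ((1, -1, -1, 1), [(0, 0, 0, 2)], [((1, -1, 1, 1), (0, 0, 0, 2))]),
      ((0, 0, 0, 2), [(-1, 1, 1, 1)], [((0, 0, 0, 2), (-1, 1, 1, -1)), ((0, 0, 0, 2), (0, 2, -2, 0)), ((0, 0, 0, 2), (-1, 1, 1, 1)), ((0, 0, 0, 2), (2, 0, 0, 0))]),
      ((-1, 1, 1, -1), [(-1, 1, 1, 1)], [((-1, 1, 1, -1), (-1, 1, 1, -1)), ((-1, 1, 1, -1), (0, 0, 0, 2)), ((-1, 1, 1, -1), (0, 2, -2, 0)), ((-1, 1, 1, -1), (0, 0, 2, 2))]),
      ((1, 1, 1, -1), [(1, -1, 1, -1)], [((1, 1, -1, -1), (1, -1, 1, -1)), ((0, 0, 2, -2), (1, 1, -1, -1))]),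
      ((2, 0, 0, 2), [], [((1, -1, 1, 1), (1, -1, 1, 1))]),
      ((1, -1, 1, -1), [(0, 0, 2, -2)], [((1, -1, 1, -1), (-1, 1, 1, -1)), ((1, -1, 1, -1), (1, -1, 1, -1)), ((1, -1, 1, -1), (0, 2, 0, -2)), ((1, -1, 1, -1), (0, 0, 2, 2))]),
      ((0, 0, 2, 0), [(-1, 1, 1, -1)], [((0, 0, 2, 2), (-1, 1, 1, -1)), ((1, -1, 1, -1), (0, 0, 2, 2)), ((0, 2, 0, 0), (0, 0, 2, 2))]),
      ((0, 2, -2, 0), [(1, 1, -1, -1)], [((0, 2, -2, 0), (-1, 1, 1, -1)), ((0, 2, -2, 0), (0, 0, 0, 2)), ((0, 2, -2, 0), (1, -1, 1, -1)), ((0, 2, -2, 0), (1, 1, -1, -1))]),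
      ((-1, 1, 1, 1), [(-1, 1, 1, -1)], [((0, 0, 2, 0), (-1, 1, 1, -1))]),
      ((0, 2, 2, 2), [], [((-1, 1, 1, 1), (-1, 1, 1, 1))]),
      ((1, 1, 1, 1), [(0, 0, 0, 2)], [((1, -1, 1, 1), (0, 0, 0, 2))]),
      ((0, 0, 0, -2), [(-1, 1, 1, -1)], [((-1, 1, 1, -1), (1, -1, 1, 1))]),
      ((0, 0, 2, -2), [(-1, 1, 1, -1)], [((0, 0, 2, 0), (-1, 1, 1, -1))]),
      ((0, -2, 2, 2), [], [((1, -1, 1, 1), (1, -1, 1, 1))]),
      ((-2, 0, 0, 2), [], [((-1, 1, 1, 1), (-1, 1, 1, 1))]),
      ((1, 1, -1, -1), [(0, 2, -2, 0)], [((1, 1, 1, 1), (0, 2, -2, 0))]),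
      ((1, -1, 1, 1), [(0, 0, 0, 2)], [((1, 1, 1, 1), (0, 0, 0, 2))]),
      ((-1, -1, 1, 1), [(0, 0, 0, 2)], [((-1, 1, 1, 1), (0, 0, 0, 2))])]
     else if \<Xi> = 4 then [
      ((1, -1, -1, 1), [(1, -1, 1, 1)], [((1, -1, 1, 1), (0, 2, 0, 0))]),
      ((2, 0, 0, 0), [(1, -1, 1, 1)], [((1, 1, -1, 1), (1, -1, 1, 1))]),
      ((0, 0, 0, 2), [(-1, 1, -1, 1)], [((1, 1, -1, 1), (-1, 1, -1, 1))]),
      ((-1, 1, 1, -1), [(-1, 1, -1, 1)], [((0, 2, 0, -2), (-1, 1, -1, 1))]),
      ((1, 1, 1, -1), [(0, 0, 2, -2)], []),
      ((-1, 1, -1, 1), [(-1, 1, 1, -1)], [((-1, 1, -1, 1), (-1, 1, -1, 1)), ((-1, 1, -1, 1), (0, 0, 2, -2)), ((-1, 1, -1, 1), (0, 2, 0, -2)), ((-1, 1, -1, 1), (0, 0, 2, 2))]),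
      ((1, 1, -1, 1), [(1, -1, 1, 1)], [((0, 2, 0, 2), (1, -1, 1, 1)), ((1, 1, -1, -1), (0, 2, 0, 2)), ((0, 2, -2, 0), (0, 0, 2, 2))]),
      ((1, -1, 1, -1), [(0, 0, 2, -2)], []),
      ((0, 2, -2, 0), [(-1, 1, -1, 1)], [((0, 2, 0, -2), (-1, 1, -1, 1))]),
      ((0, 2, 0, 0), [(-1, 1, -1, 1)], [((0, 2, 2, 0), (-1, 1, -1, 1))]),
      ((1, 1, 1, 1), [(1, -1, 1, 1)], [((0, 2, 0, 2), (1, -1, 1, 1))]),
      ((0, 0, 2, -2), [(-1, 1, 1, -1)], [((0, 0, 2, -2), (-1, 1, -1, 1)), ((0, 0, 2, -2), (1, -1, 1, 1)), ((0, 0, 2, -2), (1, 1, -1, -1)), ((0, 0, 2, -2), (-1, 1, 1, -1))]),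
      ((-1, 1, -1, -1), [(-1, 1, -1, 1)], [((-1, 1, 1, -1), (-1, 1, -1, 1)), ((0, 2, -2, 0), (-1, 1, 1, -1))]),
      ((1, 1, -1, -1), [(0, 2, -2, 0)], [((1, 1, -1, -1), (-1, 1, -1, 1)), ((1, 1, -1, -1), (0, 0, 2, -2)), ((1, 1, -1, -1), (1, 1, -1, -1)), ((1, 1, -1, -1), (0, 2, 0, 2))]),
      ((1, -1, 1, 1), [(0, 0, 0, 2)], [((1, -1, 1, 1), (-1, 1, -1, 1)), ((1, -1, 1, 1), (0, 0, 2, -2)), ((1, -1, 1, 1), (1, -1, 1, 1)), ((1, -1, 1, 1), (0, 2, 0, 2))]),
      ((-1, -1, 1, 1), [(0, 0, 0, 2)], [((-1, 1, 1, 1), (0, 0, 0, 2)), ((-1, 1, 1, -1), (0, 0, 0, 2)), ((-1, 1, -1, 1), (0, 0, 2, -2))])]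
     else if \<Xi> = 5 then [
      ((2, 0, 0, 0), [(1, 1, -1, -1)], [((2, 0, 0, 0), (-1, 1, -1, -1)), ((2, 0, 0, 0), (0, 0, 0, 2)), ((2, 0, 0, 0), (0, 0, 2, -2)), ((2, 0, 0, 0), (1, 1, -1, -1))]),
      ((0, 0, 0, 2), [(-1, 1, -1, 1)], [((0, 0, 0, 2), (-1, 1, -1, -1)), ((0, 0, 0, 2), (2, 0, 0, 0)), ((0, 0, 0, 2), (-1, 1, -1, 1)), ((0, 0, 0, 2), (0, 2, 2, 0))]),
      ((-1, 1, -1, 1), [(-1, 1, -1, -1)], [((-1, 1, 1, 1), (-1, 1, -1, -1))]),
      ((0, 0, -2, 0), [(-1, 1, -1, -1)], [((-1, 1, -1, -1), (1, 1, 1, 1))]),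
      ((0, 0, 2, 0), [(0, 0, 0, 2)], [((0, 2, 2, 0), (0, 0, 0, 2))]),
      ((0, 2, 0, 0), [(-1, 1, -1, -1)], [((0, 2, 2, 0), (-1, 1, -1, -1))]),
      ((0, 2, -2, 2), [], [((-1, 1, -1, 1), (-1, 1, -1, 1))]),
      ((-1, 1, 1, 1), [(-1, 1, -1, -1)], [((0, 2, 2, 0), (-1, 1, -1, -1))]),
      ((0, 2, 2, 2), [], [((0, 0, 2, 2), (-1, 1, -1, 1))]),
      ((0, 0, 2, -2), [(0, 0, 2, 0)], [((0, 0, 2, -2), (-1, 1, -1, -1)), ((0, 0, 2, -2), (0, 0, 0, 2)), ((0, 0, 2, -2), (2, 0, 0, 0)), ((0, 0, 2, -2), (0, 0, 2, 0))]),
      ((-2, 0, 0, 2), [], [((-1, 1, -1, 1), (-1, 1, -1, 1))]),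
      ((-1, 1, -1, -1), [(-1, 1, -1, 1)], [((-1, 1, -1, -1), (-1, 1, -1, -1)), ((-1, 1, -1, -1), (0, 0, 0, 2)), ((-1, 1, -1, -1), (0, 0, 2, -2)), ((-1, 1, -1, -1), (0, 2, 0, 2))]),
      ((1, 1, -1, -1), [(2, 0, 0, 0)], [((0, 2, -2, 0), (2, 0, 0, 0)), ((2, 0, 0, 0), (-1, 1, -1, 1))])]
     else [
      ((2, 0, 0, 0), [(1, -1, 1, 1)], [((2, 0, 0, 0), (-1, -1, 1, 1)), ((2, 0, 0, 0), (0, 0, 2, -2)), ((2, 0, 0, 0), (0, 2, -2, 0)), ((2, 0, 0, 0), (1, -1, 1, 1))]),
      ((-1, 1, -1, 1), [(-1, -1, 1, 1)], [((0, 2, 0, 2), (-1, -1, 1, 1))]),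
      ((0, 2, 0, -2), [(0, 0, 2, -2)], [((0, 2, 0, 0), (0, 0, 2, -2))]),
      ((0, 2, -2, 0), [(-1, 1, -1, 1)], [((0, 2, -2, 0), (-1, -1, 1, 1)), ((0, 2, -2, 0), (2, 0, 0, 0)), ((0, 2, -2, 0), (-1, 1, -1, 1)), ((0, 2, -2, 0), (-1, 1, 1, -1))]),
      ((0, 0, 2, -2), [(0, 2, 0, -2)], [((0, 0, 2, -2), (-1, -1, 1, 1)), ((0, 0, 2, -2), (0, 2, -2, 0)), ((0, 0, 2, -2), (2, 0, 0, 0)), ((0, 0, 2, -2), (0, 2, 0, -2))]),
      ((1, -1, 1, 1), [(2, 0, 0, 0)], [((0, 0, 0, 2), (2, 0, 0, 0)), ((2, 0, 0, 0), (-1, 1, -1, 1))]),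
      ((-1, -1, 1, 1), [(-1, 1, -1, 1)], [((-1, -1, 1, 1), (-1, -1, 1, 1)), ((-1, -1, 1, 1), (0, 0, 2, -2)), ((-1, -1, 1, 1), (0, 2, -2, 0)), ((-1, -1, 1, 1), (0, 2, 0, 2))])])"

definition roots4 :: "(int \<times> int \<times> int \<times> int) list" where
  "roots4 = [(-2, 0, 0, 0), (-1, -1, -1, -1), (-1, -1, -1, 1), (-1, -1, 1, -1), (-1, -1, 1, 1), (-1, 1, -1, -1), (-1, 1, -1, 1), (-1, 1, 1, -1), (-1, 1, 1, 1), (0, -2, -2, 0), (0, -2, 0, -2), (0, -2, 0, 0), (0, -2, 0, 2), (0, -2, 2, 0), (0, 0, -2, -2), (0, 0, -2, 0), (0, 0, -2, 2), (0, 0, 0, -2), (0, 0, 0, 2), (0, 0, 2, -2), (0, 0, 2, 0), (0, 0, 2, 2), (0, 2, -2, 0), (0, 2, 0, -2), (0, 2, 0, 0), (0, 2, 0, 2), (0, 2, 2, 0), (1, -1, -1, -1), (1, -1, -1, 1), (1, -1, 1, -1), (1, -1, 1, 1), (1, 1, -1, -1), (1, 1, -1, 1), (1, 1, 1, -1), (1, 1, 1, 1), (2, 0, 0, 0)]"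

text \<open>The short roots of G2 in the coordinates of \<epsilon>1 and \<epsilon>2;
  \<open>long\<close> describes the long ones.\<close>

fun short :: "int \<Rightarrow> int \<Rightarrow> bool" where
  "short a b = (if a = 0 then b = 1 \<or> b = - 1 else if a = 1 then b = 0 \<or> b = 1 else a = - 1 \<and> (b = 0 \<or> b = - 1))"

fun long :: "int \<Rightarrow> int \<Rightarrow> bool" where
  "long a b = (if a = 1 then b = - 1 \<or> b = 2 else if a = - 1 then b = 1 \<or> b = - 2
     else (a = 2 \<and> b = 1) \<or> (a = - 2 \<and> b = - 1))"

fun rt3 :: "int \<times> int \<times> int \<Rightarrow> bool" where
  "rt3 (d, a, b) = (if d = 0 then short a b \<or> long a b
     else if d = 1 \<or> d = - 1 then short a b \<or> (a = 0 \<and> b = 0)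
     else (d = 2 \<or> d = - 2) \<and> a = 0 \<and> b = 0)"

fun rt4 :: "int \<times> int \<times> int \<times> int \<Rightarrow> bool" where
  "rt4 (d, a, b, c) =
    (if d = 0 then
       (if a = 0 then (if b = 0 then c = 2 \<or> c = - 2 else (b = 2 \<or> b = - 2) \<and> (c = 0 \<or> c = 2 \<or> c = - 2))
        else (a = 2 \<or> a = - 2) \<and> (if b = 0 then c = 0 \<or> c = 2 \<or> c = - 2 else (b = 2 \<or> b = - 2) \<and> c = 0))
     else if d = 1 \<or> d = - 1 then (a = 1 \<or> a = - 1) \<and> (b = 1 \<or> b = - 1) \<and> (c = 1 \<or> c = - 1)
     else (d = 2 \<or> d = - 2) \<and> a = 0 \<and> b = 0 \<and> c = 0)"

text \<open>The coefficient of \<delta>, doubled for F(4), is odd exactly at the odd roots. Being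
  additive, it extends parity to all weights.\<close>

definition parity :: "int \<times> 'a \<Rightarrow> bool" where "parity w = odd (fst w)"

text \<open>Twelve times the inverse of the supertrace form computed in
  \<open>killing_form3\<close>. For F(4), in doubled coordinates, the factor is 24.\<close>

fun form3 :: "int \<times> int \<times> int \<Rightarrow> int \<times> int \<times> int \<Rightarrow> int" where
  "form3 (d, a, b) (d', a', b') = - 2 * d * d' + 2 * a * a' + 2 * b * b' - a * b' - b * a'"

fun form4 :: "int \<times> int \<times> int \<times> int \<Rightarrow> int \<times> int \<times> int \<times> int \<Rightarrow> int" where
  "form4 (d, a, b, c) (d', a', b', c') = - 3 * d * d' + a * a' + b * b' + c * c'"

fun dot3 :: "int \<times> int \<times> int \<Rightarrow> int \<times> int \<times> int \<Rightarrow> int" where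
  "dot3 (d, a, b) (d', a', b') = d * d' + a * a' + b * b'"

fun dot4 :: "int \<times> int \<times> int \<times> int \<Rightarrow> int \<times> int \<times> int \<times> int \<Rightarrow> int" where
  "dot4 (d, a, b, c) (d', a', b', c') = d * d' + a * a' + b * b' + c * c'"

definition co3 where "co3 \<Xi> i w = dot3 (coord3 \<Xi> ! i) w"
definition co4 where "co4 \<Xi> i w = dot4 (coord4 \<Xi> ! i) w"

definition pos3 where "pos3 \<Xi> = filter (\<lambda>w. list_all (\<lambda>i. 0 \<le> co3 \<Xi> i w) [0..<3]) roots3"
definition pos4 where "pos4 \<Xi> = filter (\<lambda>w. list_all (\<lambda>i. 0 \<le> co4 \<Xi> i w) [0..<4]) roots4"

text \<open>A nonzero determinant: the three listed roots then have only 0 as a common zero in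
  \<open>h\<close>.\<close>

fun spans3 :: "(int \<times> int \<times> int) list \<Rightarrow> bool" where
  "spans3 [(a, b, c), (d, e, f), (g, h, i)] = (a * (e * i - f * h) - b * (d * i - f * g) + c * (d * h - e * g) \<noteq> 0)"
| "spans3 _ = False"

fun det3 :: "int \<Rightarrow> int \<Rightarrow> int \<Rightarrow> int \<Rightarrow> int \<Rightarrow> int \<Rightarrow> int \<Rightarrow> int \<Rightarrow> int \<Rightarrow> int" where
  "det3 a b c d e f g h i = a * (e * i - f * h) - b * (d * i - f * g) + c * (d * h - e * g)"

fun spans4 :: "(int \<times> int \<times> int \<times> int) list \<Rightarrow> bool" where
  "spans4 [(a1, a2, a3, a4), (b1, b2, b3, b4), (c1, c2, c3, c4), (d1, d2, d3, d4)] =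
    (a1 * det3 b2 b3 b4 c2 c3 c4 d2 d3 d4 - a2 * det3 b1 b3 b4 c1 c3 c4 d1 d3 d4
     + a3 * det3 b1 b2 b4 c1 c2 c4 d1 d2 d4 - a4 * det3 b1 b2 b3 c1 c2 c3 d1 d2 d3 \<noteq> 0)"
| "spans4 _ = False"

text \<open>The weight -\<epsilon>1 + \<epsilon>2 + \<epsilon>3 in system V, which is settled by
  \<open>serre_inner\<close>. Its coefficients vanish exactly at the last two simple roots, so it
  has degree zero for \<open>S\<close> inside {3, 4}.\<close>

definition special4 :: "nat \<Rightarrow> (int \<times> int \<times> int \<times> int) list" where
  "special4 \<Xi> = (if \<Xi> = 5 then [(0, - 2, 2, 2)] else [])"

definition borel_check where
  "borel_check rt rl sr pos co q \<longleftrightarrow>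
     list_all (\<lambda>w. w \<in> set pos \<or> - w \<in> set pos) rl \<and>
     list_all (\<lambda>w. rt w \<and> rt (- w)) pos \<and>
     list_all (\<lambda>w. w \<in> set pos) sr \<and>
     list_all (\<lambda>\<beta>. list_all (\<lambda>i. 0 \<le> co i \<beta> \<and> q dvd co i \<beta>) [0..<length sr]) pos \<and>
     list_all (\<lambda>i. list_all (\<lambda>j. co i (sr ! j) = (if i = j then q else 0)) [0..<length sr]) [0..<length sr] \<and>
     list_all (\<lambda>\<beta>. \<beta> \<in> set sr \<or> list_ex (\<lambda>\<alpha>. \<beta> - \<alpha> \<in> set pos) sr) pos \<and>
     list_all (\<lambda>i. list_all (\<lambda>\<gamma>. co i \<gamma> < 0 \<or> list_ex (\<lambda>\<beta>. 0 < co i \<beta> \<and> (rt (\<gamma> - \<beta>) \<or> \<gamma> = \<beta>)) rl) rl) [0..<length sr]"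

text \<open>Fuel 6 is enough for the strings that occur; a longest descent runs through 2 \<alpha>,
  \<alpha>, 0, -\<alpha>, -2 \<alpha>, as for \<alpha> = \<delta> in G(3).\<close>

definition killing_check where
  "killing_check rt par B rl \<longleftrightarrow>
     list_all (\<lambda>\<alpha>. list_all (\<lambda>\<beta>. \<not> rt (\<alpha> + \<beta>) \<or>
       (list_ex (\<lambda>\<gamma>. B \<beta> \<gamma> = 0 \<and> B (\<alpha> + \<beta>) \<gamma> \<noteq> 0) rl \<or> \<beta> = \<alpha> \<or> \<beta> = - \<alpha> - \<alpha> \<or> \<alpha> = - \<beta> - \<beta> \<and> par \<beta>) \<and>
       (case string_val rt par B 6 \<alpha> (\<alpha> + \<beta>) of None \<Rightarrow> False | Some t \<Rightarrow> t \<noteq> 0)) rl) rl"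

section \<open>Evaluation of the finite checks\<close>

lemma killing_check3: "killing_check rt3 parity form3 roots3"
  by code_simp

lemma borel_check3:
  assumes "\<Xi> \<in> {1, 2, 3, 4}"
  shows "borel_check rt3 roots3 (simple3 \<Xi>) (pos3 \<Xi>) (co3 \<Xi>) 1"
proof -
  have "borel_check rt3 roots3 (simple3 1) (pos3 1) (co3 1) 1" by code_simp
  moreover have "borel_check rt3 roots3 (simple3 2) (pos3 2) (co3 2) 1" by code_simp
  moreover have "borel_check rt3 roots3 (simple3 3) (pos3 3) (co3 3) 1" by code_simp
  moreover have "borel_check rt3 roots3 (simple3 4) (pos3 4) (co3 4) 1" by code_simp
  ultimately show ?thesis using assms by auto
qed

lemma all_certified3:
  assumes "\<Xi> \<in> {1, 2, 3, 4}"
  shows "all_certified rt3 parity (simple3 \<Xi>) (pos3 \<Xi>) (co3 \<Xi>) (exc3 \<Xi>) spans3 [] (hints3 \<Xi>)"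
proof -
  have "all_certified rt3 parity (simple3 1) (pos3 1) (co3 1) (exc3 1) spans3 [] (hints3 1)" by code_simp
  moreover have "all_certified rt3 parity (simple3 2) (pos3 2) (co3 2) (exc3 2) spans3 [] (hints3 2)" by code_simp
  moreover have "all_certified rt3 parity (simple3 3) (pos3 3) (co3 3) (exc3 3) spans3 [] (hints3 3)" by code_simp
  moreover have "all_certified rt3 parity (simple3 4) (pos3 4) (co3 4) (exc3 4) spans3 [] (hints3 4)" by code_simp
  ultimately show ?thesis using assms by auto
qed

lemma killing_check4: "killing_check rt4 parity form4 roots4"
  by code_simp

lemma borel_check4:
  assumes "\<Xi> \<in> {1, 2, 3, 4, 5, 6}"
  shows "borel_check rt4 roots4 (simple4 \<Xi>) (pos4 \<Xi>) (co4 \<Xi>) 2"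
proof -
  have "borel_check rt4 roots4 (simple4 1) (pos4 1) (co4 1) 2" by code_simp
  moreover have "borel_check rt4 roots4 (simple4 2) (pos4 2) (co4 2) 2" by code_simp
  moreover have "borel_check rt4 roots4 (simple4 3) (pos4 3) (co4 3) 2" by code_simp
  moreover have "borel_check rt4 roots4 (simple4 4) (pos4 4) (co4 4) 2" by code_simp
  moreover have "borel_check rt4 roots4 (simple4 5) (pos4 5) (co4 5) 2" by code_simp
  moreover have "borel_check rt4 roots4 (simple4 6) (pos4 6) (co4 6) 2" by code_simp
  ultimately show ?thesis using assms by auto
qed

lemma all_certified4:
  assumes "\<Xi> \<in> {1, 2, 3, 4, 5, 6}"
  shows "all_certified rt4 parity (simple4 \<Xi>) (pos4 \<Xi>) (co4 \<Xi>) (exc4 \<Xi>) spans4 (special4 \<Xi>) (hints4 \<Xi>)"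
proof -
  have "all_certified rt4 parity (simple4 1) (pos4 1) (co4 1) (exc4 1) spans4 (special4 1) (hints4 1)" by code_simp
  moreover have "all_certified rt4 parity (simple4 2) (pos4 2) (co4 2) (exc4 2) spans4 (special4 2) (hints4 2)" by code_simp
  moreover have "all_certified rt4 parity (simple4 3) (pos4 3) (co4 3) (exc4 3) spans4 (special4 3) (hints4 3)" by code_simp
  moreover have "all_certified rt4 parity (simple4 4) (pos4 4) (co4 4) (exc4 4) spans4 (special4 4) (hints4 4)" by code_simp
  moreover have "all_certified rt4 parity (simple4 5) (pos4 5) (co4 5) (exc4 5) spans4 (special4 5) (hints4 5)" by code_simp
  moreover have "all_certified rt4 parity (simple4 6) (pos4 6) (co4 6) (exc4 6) spans4 (special4 6) (hints4 6)" by code_simp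
  ultimately show ?thesis using assms by auto
qed

section \<open>Realising the integral root data inside the algebra\<close>

context lsa
begin

lemma lin_on_simps:
  assumes "lin_on sc h f" "subspace h"
  shows "f 0 = 0" "x \<in> h \<Longrightarrow> f (sc a x) = a * f x" "x \<in> h \<Longrightarrow> y \<in> h \<Longrightarrow> f (x - y) = f x - f y"
    "(\<And>j. j \<in> J \<Longrightarrow> X j \<in> h) \<Longrightarrow> f (\<Sum>j\<in>J. sc (t j) (X j)) = (\<Sum>j\<in>J. t j * f (X j))"
proof -
  have l: "f (sc a x + y) = a * f x + f y" if "x \<in> h" "y \<in> h" for x y a
    using assms(1) that by (auto simp: lin_on_def)
  have h0: "0 \<in> h" using subspace_0[OF assms(2)] .
  show f0: "f 0 = 0" using l[of 0 0 1] h0 by simp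
  show "x \<in> h \<Longrightarrow> f (sc a x) = a * f x" using l[of x 0 a] h0 f0 by simp
  show "x \<in> h \<Longrightarrow> y \<in> h \<Longrightarrow> f (x - y) = f x - f y" using l[of y x "-1"] by simp
  show "(\<And>j. j \<in> J \<Longrightarrow> X j \<in> h) \<Longrightarrow> f (\<Sum>j\<in>J. sc (t j) (X j)) = (\<Sum>j\<in>J. t j * f (X j))"
  proof (induction J rule: infinite_finite_induct)
    case (insert j J)
    have "(\<Sum>j\<in>J. sc (t j) (X j)) \<in> h"
      using insert.prems by (intro subspace_sum[OF assms(2)] subspace_scale[OF assms(2)]) auto
    then show ?case using insert l[of "X j"] by simp
  qed (simp_all add: f0)
qed

text \<open>A dual system by induction, without reference to the dimension of \<open>h\<close>. By
  independence some combination of the functionals is nonzero although it vanishes on all earlier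
  dual vectors; this produces a vector killed by the earlier functionals but not by the last
  one.\<close>

lemma dual_vectors:
  fixes m :: nat
  assumes h: "subspace h" and lin: "\<And>j. lin_on sc h (\<theta> j)"
    and ind: "\<And>c. (\<And>H. H \<in> h \<Longrightarrow> (\<Sum>j<m. c j * \<theta> j H) = 0) \<Longrightarrow> (\<forall>j<m. c j = 0)"
  shows "\<exists>X. \<forall>j<m. X j \<in> h \<and> (\<forall>i<m. \<theta> i (X j) = (if i = j then 1 else 0))"
  using ind
proof (induction m)
  case (Suc m)
  have "\<forall>j<m. c j = 0" if "\<And>H. H \<in> h \<Longrightarrow> (\<Sum>j<m. c j * \<theta> j H) = 0" for c
  proof -
    have "\<forall>j<Suc m. (if j < m then c j else 0) = 0"
    proof (rule Suc.prems)
      fix H assume "H \<in> h"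
      have "(\<Sum>j<m. (if j < m then c j else 0) * \<theta> j H) = (\<Sum>j<m. c j * \<theta> j H)" by (intro sum.cong) auto
      then show "(\<Sum>j<Suc m. (if j < m then c j else 0) * \<theta> j H) = 0" using that[OF \<open>H \<in> h\<close>] by simp
    qed
    then show ?thesis by (metis less_SucI)
  qed
  then have "\<exists>X. \<forall>j<m. X j \<in> h \<and> (\<forall>i<m. \<theta> i (X j) = (if i = j then 1 else 0))" by (rule Suc.IH)
  then obtain X where "\<forall>j<m. X j \<in> h \<and> (\<forall>i<m. \<theta> i (X j) = (if i = j then 1 else 0))" by (rule exE)
  then have X: "\<And>j. j < m \<Longrightarrow> X j \<in> h"
    and XX: "\<And>i j. j < m \<Longrightarrow> i < m \<Longrightarrow> \<theta> i (X j) = (if i = j then 1 else 0)" by simp_all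
  note L = lin_on_simps[OF lin h]
  \<comment> \<open>Coefficients of the combination, with last functional taken once, that vanishes
    on every earlier \<open>X j\<close>.\<close>
  let ?c = "\<lambda>j. if j = m then 1 else - \<theta> m (X j)"
  have cs: "(\<Sum>j<Suc m. ?c j * \<theta> j H) = \<theta> m H - (\<Sum>j<m. \<theta> m (X j) * \<theta> j H)" for H
  proof -
    have "(\<Sum>j<m. ?c j * \<theta> j H) = (\<Sum>j<m. - (\<theta> m (X j) * \<theta> j H))" by (intro sum.cong) auto
    then show ?thesis by (simp add: sum_negf)
  qed
  have "\<exists>H0\<in>h. \<theta> m H0 - (\<Sum>j<m. \<theta> m (X j) * \<theta> j H0) \<noteq> 0"
  proof (rule ccontr)
    assume "\<not> ?thesis"
    then have "\<forall>j<Suc m. ?c j = 0" by (intro Suc.prems) (simp only: cs, blast)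
    then show False by (metis lessI zero_neq_one)
  qed
  then obtain H0 where H0: "H0 \<in> h" "\<theta> m H0 - (\<Sum>j<m. \<theta> m (X j) * \<theta> j H0) \<noteq> 0" by blast
  define H1 where "H1 = H0 - (\<Sum>j<m. sc (\<theta> j H0) (X j))"
  have sh: "(\<Sum>j<m. sc (\<theta> j H0) (X j)) \<in> h"
    using X by (intro subspace_sum[OF h] subspace_scale[OF h]) auto
  have H1h: "H1 \<in> h" unfolding H1_def using H0 sh subspace_diff[OF h] by blast
  have H1e: "\<theta> i H1 = \<theta> i H0 - (\<Sum>j<m. \<theta> j H0 * \<theta> i (X j))" for i
    unfolding H1_def using L(3)[OF H0(1) sh, of i] L(4)[of "{..<m}" X i] X by simp
  have H1i: "\<theta> i H1 = 0" if "i < m" for i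
  proof -
    have "(\<Sum>j<m. \<theta> j H0 * \<theta> i (X j)) = (\<Sum>j<m. if i = j then \<theta> j H0 else 0)"
      using XX that by (intro sum.cong) auto
    then show ?thesis using that H1e[of i] by simp
  qed
  have H1m: "\<theta> m H1 \<noteq> 0" using H0(2) H1e[of m] by (simp add: mult.commute)
  define Y where "Y = sc (1 / \<theta> m H1) H1"
  have Y: "Y \<in> h" "\<theta> m Y = 1" "\<And>i. i < m \<Longrightarrow> \<theta> i Y = 0"
    unfolding Y_def using H1h H1m H1i L(2)[OF H1h] subspace_scale[OF h] by auto
  define X' where "X' j = (if j = m then Y else X j - sc (\<theta> m (X j)) Y)" for j
  have "X' j \<in> h \<and> (\<forall>i<Suc m. \<theta> i (X' j) = (if i = j then 1 else 0))" if j: "j < Suc m" for j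
  proof (cases "j = m")
    case True
    then show ?thesis using Y by (auto simp: X'_def less_Suc_eq)
  next
    case False
    then have jm: "j < m" using j by simp
    have sY: "sc (\<theta> m (X j)) Y \<in> h" using Y(1) subspace_scale[OF h] by blast
    have "\<theta> i (X' j) = \<theta> i (X j) - \<theta> m (X j) * \<theta> i Y" for i
      using L(3)[OF X[OF jm] sY, of i] L(2)[OF Y(1), of i] False by (simp add: X'_def)
    moreover have "X' j \<in> h" using False X[OF jm] sY subspace_diff[OF h] by (simp add: X'_def)
    ultimately show ?thesis using XX[OF jm] Y jm by (auto simp: less_Suc_eq)
  qed
  then show ?case by blast
qed simp

end

lemma root_space_cong: "(\<And>H. H \<in> h \<Longrightarrow> \<alpha> H = \<beta> H) \<Longrightarrow> root_space sc P br h \<alpha> = root_space sc P br h \<beta>"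
  by (auto simp: root_space_def)

definition Phi3 :: "('v \<Rightarrow> complex) \<Rightarrow> (nat \<Rightarrow> 'v \<Rightarrow> complex) \<Rightarrow> int \<times> int \<times> int \<Rightarrow> 'v \<Rightarrow> complex" where
  "Phi3 \<delta> \<epsilon> w H = (case w of (d, a, b) \<Rightarrow> of_int d * \<delta> H + of_int a * \<epsilon> 1 H + of_int b * \<epsilon> 2 H)"

definition Phi4 :: "('v \<Rightarrow> complex) \<Rightarrow> (nat \<Rightarrow> 'v \<Rightarrow> complex) \<Rightarrow> int \<times> int \<times> int \<times> int \<Rightarrow> 'v \<Rightarrow> complex" where
  "Phi4 \<delta> \<epsilon> w H = (case w of (d, a, b, c) \<Rightarrow>
     (of_int d * \<delta> H + of_int a * \<epsilon> 1 H + of_int b * \<epsilon> 2 H + of_int c * \<epsilon> 3 H) / 2)"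

lemma rt3_iff: "rt3 w \<longleftrightarrow> w \<in> set roots3"
  by (cases w) (auto simp: roots3_def split: if_splits)

lemma rt4_iff: "rt4 w \<longleftrightarrow> w \<in> set roots4"
  by (cases w) (auto simp: roots4_def split: if_splits)

lemma distinct_roots3: "distinct roots3" by code_simp
lemma distinct_roots4: "distinct roots4" by code_simp

text \<open>Turns the set comprehensions into unions over explicit finite sets, so that
  simplification can enumerate the roots one by one.\<close>

lemma Collect_families:
  "{f s |s. s \<in> A} = (\<Union>s\<in>A. {f s})"
  "{f2 s i |s i. s \<in> A2 \<and> i \<in> B2} = (\<Union>s\<in>A2. \<Union>i\<in>B2. {f2 s i})"
  "{g2 i j |i j. i \<in> C2 \<and> j \<in> D2 \<and> i \<noteq> j} = (\<Union>i\<in>C2. \<Union>j\<in>D2. if i \<noteq> j then {g2 i j} else {})"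
  "{f3 s t i |s t i. s \<in> A3 \<and> t \<in> B3 \<and> i \<in> C3} = (\<Union>s\<in>A3. \<Union>t\<in>B3. \<Union>i\<in>C3. {f3 s t i})"
  "{f4 s t i j |s t i j. s \<in> A4 \<and> t \<in> B4 \<and> i \<in> C4 \<and> j \<in> D4} =
    (\<Union>s\<in>A4. \<Union>t\<in>B4. \<Union>i\<in>C4. \<Union>j\<in>D4. {f4 s t i j})"
  "{f5 s t i j |s t i j. s \<in> A5 \<and> t \<in> B5 \<and> i \<in> C5 \<and> j \<in> D5 \<and> i < (j::nat)} =
    (\<Union>s\<in>A5. \<Union>t\<in>B5. \<Union>i\<in>C5. \<Union>j\<in>D5. if i < j then {f5 s t i j} else {})"
  by (auto split: if_splits)

lemma even_roots_G3: "even_roots G3 = (\<Union>s\<in>{2, - 2}. {\<lambda>n. s * ev 0 n})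
    \<union> (\<Union>s\<in>{1, - 1}. \<Union>i\<in>{1, 2, 3}. {\<lambda>n. s * ev i n})
    \<union> (\<Union>i\<in>{1, 2, 3}. \<Union>j\<in>{1, 2, 3}. if i \<noteq> j then {\<lambda>n. ev i n - ev j n} else {})"
  unfolding even_roots_def algtype.case Collect_families ..

lemma odd_roots_G3: "odd_roots G3 = (\<Union>s\<in>{1, - 1}. {\<lambda>n. s * ev 0 n})
    \<union> (\<Union>s\<in>{1, - 1}. \<Union>t\<in>{1, - 1}. \<Union>i\<in>{1, 2, 3}. {\<lambda>n. s * ev 0 n + t * ev i n})"
  unfolding odd_roots_def algtype.case Collect_families ..

lemma even_roots_F4: "even_roots F4 = (\<Union>s\<in>{1, - 1}. {\<lambda>n. s * ev 0 n})
    \<union> (\<Union>s\<in>{1, - 1}. \<Union>i\<in>{1, 2, 3}. {\<lambda>n. s * ev i n})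
    \<union> (\<Union>s\<in>{1, - 1}. \<Union>t\<in>{1, - 1}. \<Union>i\<in>{1, 2, 3}. \<Union>j\<in>{1, 2, 3}. if i < j then {\<lambda>n. s * ev i n + t * ev j n} else {})"
  unfolding even_roots_def algtype.case Collect_families ..

lemma odd_roots_F4: "odd_roots F4 = (\<Union>s0\<in>{1, - 1}. \<Union>s1\<in>{1, - 1}. \<Union>s2\<in>{1, - 1}. \<Union>s3\<in>{1, - 1}.
    {\<lambda>n. (1/2) * (s0 * ev 0 n + s1 * ev 1 n + s2 * ev 2 n + s3 * ev 3 n)})"
  unfolding odd_roots_def algtype.case Collect_families ..

text \<open>The two descriptions agree only where the three \<epsilon> add up to 0, which
  \<open>is_alg\<close> grants on \<open>h\<close>; hence the condition on \<open>H\<close>.\<close>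

lemma even_roots3:
  "\<forall>c\<in>even_roots G3. \<exists>w\<in>set roots3. \<not> parity w \<and> (\<forall>H. \<epsilon> 1 H + \<epsilon> 2 H + \<epsilon> 3 H = 0 \<longrightarrow> fnl \<delta> \<epsilon> c H = Phi3 \<delta> \<epsilon> w H)"
  "\<forall>w\<in>set roots3. \<not> parity w \<longrightarrow> (\<exists>c\<in>even_roots G3. \<forall>H. \<epsilon> 1 H + \<epsilon> 2 H + \<epsilon> 3 H = 0 \<longrightarrow> fnl \<delta> \<epsilon> c H = Phi3 \<delta> \<epsilon> w H)"
proof -
  have e: "\<epsilon> 1 H + \<epsilon> 2 H + \<epsilon> 3 H = 0 \<longleftrightarrow> \<epsilon> 3 H = - \<epsilon> 1 H - \<epsilon> 2 H" for H
    by (simp add: eq_neg_iff_add_eq_0 algebra_simps)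
  show "\<forall>c\<in>even_roots G3. \<exists>w\<in>set roots3. \<not> parity w \<and> (\<forall>H. \<epsilon> 1 H + \<epsilon> 2 H + \<epsilon> 3 H = 0 \<longrightarrow> fnl \<delta> \<epsilon> c H = Phi3 \<delta> \<epsilon> w H)"
    "\<forall>w\<in>set roots3. \<not> parity w \<longrightarrow> (\<exists>c\<in>even_roots G3. \<forall>H. \<epsilon> 1 H + \<epsilon> 2 H + \<epsilon> 3 H = 0 \<longrightarrow> fnl \<delta> \<epsilon> c H = Phi3 \<delta> \<epsilon> w H)"
    unfolding e by (simp_all add: even_roots_G3 roots3_def parity_def fnl_def ev_def Phi3_def)
qed

lemma odd_roots3:
  "\<forall>c\<in>odd_roots G3. \<exists>w\<in>set roots3. parity w \<and> (\<forall>H. \<epsilon> 1 H + \<epsilon> 2 H + \<epsilon> 3 H = 0 \<longrightarrow> fnl \<delta> \<epsilon> c H = Phi3 \<delta> \<epsilon> w H)"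
  "\<forall>w\<in>set roots3. parity w \<longrightarrow> (\<exists>c\<in>odd_roots G3. \<forall>H. \<epsilon> 1 H + \<epsilon> 2 H + \<epsilon> 3 H = 0 \<longrightarrow> fnl \<delta> \<epsilon> c H = Phi3 \<delta> \<epsilon> w H)"
proof -
  have e: "\<epsilon> 1 H + \<epsilon> 2 H + \<epsilon> 3 H = 0 \<longleftrightarrow> \<epsilon> 3 H = - \<epsilon> 1 H - \<epsilon> 2 H" for H
    by (simp add: eq_neg_iff_add_eq_0 algebra_simps)
  show "\<forall>c\<in>odd_roots G3. \<exists>w\<in>set roots3. parity w \<and> (\<forall>H. \<epsilon> 1 H + \<epsilon> 2 H + \<epsilon> 3 H = 0 \<longrightarrow> fnl \<delta> \<epsilon> c H = Phi3 \<delta> \<epsilon> w H)"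
    "\<forall>w\<in>set roots3. parity w \<longrightarrow> (\<exists>c\<in>odd_roots G3. \<forall>H. \<epsilon> 1 H + \<epsilon> 2 H + \<epsilon> 3 H = 0 \<longrightarrow> fnl \<delta> \<epsilon> c H = Phi3 \<delta> \<epsilon> w H)"
    unfolding e by (simp_all add: odd_roots_G3 roots3_def parity_def fnl_def ev_def Phi3_def)
qed

lemma even_roots4:
  "\<forall>c\<in>even_roots F4. \<exists>w\<in>set roots4. \<not> parity w \<and> (\<forall>H. fnl \<delta> \<epsilon> c H = Phi4 \<delta> \<epsilon> w H)"
  "\<forall>w\<in>set roots4. \<not> parity w \<longrightarrow> (\<exists>c\<in>even_roots F4. \<forall>H. fnl \<delta> \<epsilon> c H = Phi4 \<delta> \<epsilon> w H)"
  by (simp_all add: even_roots_F4 roots4_def parity_def fnl_def ev_def Phi4_def field_simps)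

lemma odd_roots4:
  "\<forall>c\<in>odd_roots F4. \<exists>w\<in>set roots4. parity w \<and> (\<forall>H. fnl \<delta> \<epsilon> c H = Phi4 \<delta> \<epsilon> w H)"
  "\<forall>w\<in>set roots4. parity w \<longrightarrow> (\<exists>c\<in>odd_roots F4. \<forall>H. fnl \<delta> \<epsilon> c H = Phi4 \<delta> \<epsilon> w H)"
  by (simp_all add: odd_roots_F4 roots4_def parity_def fnl_def ev_def Phi4_def field_simps)

text \<open>Direct summation with supertrace signs: for \<delta> the even roots contribute 8 and the
  odd ones -14, which gives -6. Together with the block of entries 8, 4, 4, 8 for \<epsilon>1 and
  \<epsilon>2 the form is nondegenerate.\<close>

lemma killing_form3:
  "(\<Sum>\<gamma>\<in>set roots3. sgn_par (parity \<gamma>) * Phi3 \<delta> \<epsilon> \<gamma> H * Phi3 \<delta> \<epsilon> \<gamma> H') =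
     (- 6 * \<delta> H) * \<delta> H' + (8 * \<epsilon> 1 H + 4 * \<epsilon> 2 H) * \<epsilon> 1 H' + (4 * \<epsilon> 1 H + 8 * \<epsilon> 2 H) * \<epsilon> 2 H'"
  unfolding sum.distinct_set_conv_list[OF distinct_roots3]
  by (simp add: roots3_def parity_def Phi3_def sgn_par_def algebra_simps)

lemma killing_form4:
  "(\<Sum>\<gamma>\<in>set roots4. sgn_par (parity \<gamma>) * Phi4 \<delta> \<epsilon> \<gamma> H * Phi4 \<delta> \<epsilon> \<gamma> H') =
     (- 2 * \<delta> H) * \<delta> H' + (6 * \<epsilon> 1 H) * \<epsilon> 1 H' + (6 * \<epsilon> 2 H) * \<epsilon> 2 H' + (6 * \<epsilon> 3 H) * \<epsilon> 3 H'"
  unfolding sum.distinct_set_conv_list[OF distinct_roots4]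
  by (simp add: roots4_def parity_def Phi4_def sgn_par_def field_simps)

lemma cramer3:
  fixes x y z :: complex
  assumes "a * x + b * y + c * z = 0" "d * x + e * y + f * z = 0" "g * x + h * y + i * z = 0"
    and D: "a * (e * i - f * h) - b * (d * i - f * g) + c * (d * h - e * g) \<noteq> 0" (is "?D \<noteq> 0")
  shows "x = 0 \<and> y = 0 \<and> z = 0"
proof -
  have "?D * x = (e * i - f * h) * (a * x + b * y + c * z) - (b * i - c * h) * (d * x + e * y + f * z) + (b * f - c * e) * (g * x + h * y + i * z)"
    "?D * y = - (d * i - f * g) * (a * x + b * y + c * z) + (a * i - c * g) * (d * x + e * y + f * z) - (a * f - c * d) * (g * x + h * y + i * z)"
    "?D * z = (d * h - e * g) * (a * x + b * y + c * z) - (a * h - b * g) * (d * x + e * y + f * z) + (a * e - b * d) * (g * x + h * y + i * z)"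
    by (simp_all add: algebra_simps)
  then have "?D * x = 0" "?D * y = 0" "?D * z = 0" unfolding assms(1-3) by simp_all
  then show ?thesis using D by simp
qed

context borel
begin

text \<open>Climbing from the simple roots along \<open>pos_dec\<close> shows that
  \<open>co i\<close> is \<open>q\<close> times an integer coefficient, as needed for comparison
  with the integers \<open>m\<close> in \<open>grading\<close>.\<close>

lemma pos_comb:
  "\<beta> \<in> set pos \<Longrightarrow> \<exists>m. (\<forall>H. \<Phi> \<beta> H = (\<Sum>i<n. of_int (m i) * \<Phi> (sr ! i) H)) \<and> (\<forall>i<n. co i \<beta> = q * m i)"
proof (induction "nat (ht \<beta>)" arbitrary: \<beta> rule: less_induct)
  case less
  have base: "\<exists>m. (\<forall>H. \<Phi> \<alpha> H = (\<Sum>i<n. of_int (m i) * \<Phi> (sr ! i) H)) \<and> (\<forall>i<n. co i \<alpha> = q * m i)"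
    if "\<alpha> \<in> set sr" for \<alpha>
  proof -
    obtain j where j: "j < n" "\<alpha> = sr ! j" using \<open>\<alpha> \<in> set sr\<close> by (metis in_set_conv_nth)
    have "(\<Sum>i<n. of_int (if i = j then 1 else 0) * \<Phi> (sr ! i) H) = (\<Sum>i<n. if i = j then \<Phi> \<alpha> H else 0)" for H
      using j by (intro sum.cong) auto
    then show ?thesis using j by (intro exI[of _ "\<lambda>i. if i = j then 1 else 0"]) (auto simp: co_sr)
  qed
  show ?case
  proof (cases "\<beta> \<in> set sr")
    case True then show ?thesis by (rule base)
  next
    case False
    then obtain \<alpha> where a: "\<alpha> \<in> set sr" "\<beta> - \<alpha> \<in> set pos" using pos_dec less.prems by blast
    have "nat (ht (\<beta> - \<alpha>)) < nat (ht \<beta>)" using ht_pos[OF less.prems] ht_sr[OF a(1)] q_pos by (simp add: ht_diff)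
    then obtain m where m: "\<forall>H. \<Phi> (\<beta> - \<alpha>) H = (\<Sum>i<n. of_int (m i) * \<Phi> (sr ! i) H)" "\<forall>i<n. co i (\<beta> - \<alpha>) = q * m i"
      using less.hyps a by blast
    obtain m' where m': "\<forall>H. \<Phi> \<alpha> H = (\<Sum>i<n. of_int (m' i) * \<Phi> (sr ! i) H)" "\<forall>i<n. co i \<alpha> = q * m' i"
      using base[OF a(1)] by blast
    have "\<Phi> \<beta> H = (\<Sum>i<n. of_int (m i + m' i) * \<Phi> (sr ! i) H)" for H
      using m(1) m'(1) Phi_add[of "\<beta> - \<alpha>" \<alpha> H] by (simp add: distrib_right sum.distrib)
    moreover have "co i \<beta> = q * (m i + m' i)" if "i < n" for i
      using m(2) m'(2) that co_add[of i "\<beta> - \<alpha>" \<alpha>] by (simp add: distrib_left)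
    ultimately show ?thesis by (intro exI[of _ "\<lambda>i. m i + m' i"]) auto
  qed
qed

lemma root_comb:
  assumes "w \<in> R"
  shows "\<exists>m. (\<forall>H. \<Phi> w H = (\<Sum>i<n. of_int (m i) * \<Phi> (sr ! i) H)) \<and> (\<forall>i<n. co i w = q * m i)"
proof (cases "w \<in> set pos")
  case True then show ?thesis by (rule pos_comb)
next
  case False
  then have "- w \<in> set pos" using R_cases assms by blast
  then obtain m where m: "\<forall>H. \<Phi> (- w) H = (\<Sum>i<n. of_int (m i) * \<Phi> (sr ! i) H)" "\<forall>i<n. co i (- w) = q * m i"
    using pos_comb by blast
  have "\<Phi> w H = (\<Sum>i<n. of_int (- m i) * \<Phi> (sr ! i) H)" for H
  proof -
    have "\<Phi> w H = - \<Phi> (- w) H" by (simp add: Phi_minus)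
    also have "\<dots> = - (\<Sum>i<n. of_int (m i) * \<Phi> (sr ! i) H)" using m(1) by simp
    finally show ?thesis by (simp add: sum_negf)
  qed
  moreover have "co i w = q * (- m i)" if "i < n" for i
    using m(2)[rule_format, OF that] co_minus[of i w] by (metis minus_minus mult_minus_right)
  ultimately show ?thesis by (intro exI[of _ "\<lambda>i. - m i"]) auto
qed

text \<open>An equality of functionals on \<open>h\<close> determines the coefficients: by
  \<open>dual\<close> some element of \<open>h\<close> evaluates each weight to its value under
  \<open>co j\<close>.\<close>

lemma co_comb:
  assumes "\<And>H. H \<in> h \<Longrightarrow> \<Phi> w H = (\<Sum>i<n. of_int (m i) * \<Phi> (sr ! i) H)" and j: "j < n"
  shows "co j w = q * m j"
proof -
  have "(of_int (co j (u + v)) :: complex) = of_int (co j u) + of_int (co j v)" for u v by (simp add: co_add)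
  then obtain H where H: "H \<in> h" "\<And>w. \<Phi> w H = of_int (co j w)" using dual[of "\<lambda>w. of_int (co j w)"] by blast
  have "(of_int (co j w) :: complex) = (\<Sum>i<n. of_int (m i) * of_int (co j (sr ! i)))"
    using assms(1)[OF H(1)] by (simp add: H(2))
  also have "\<dots> = (\<Sum>i<n. if i = j then of_int (q * m i) else 0)"
    using j by (intro sum.cong) (auto simp: co_sr)
  finally have "(of_int (co j w) :: complex) = (\<Sum>i<n. if i = j then of_int (q * m i) else 0)" .
  then have "(of_int (co j w) :: complex) = of_int (q * m j)" using j by simp
  then show ?thesis by (simp only: of_int_eq_iff)
qed

text \<open>The only weight that needs a Serre relation: if \<open>f\<close> and \<open>e\<close> are the root vectors of \<open>-a\<close> and \<open>-b\<close> and
\<open>X\<close> is the image of \<open>f\<close>, then applying the derivation to \<open>[f,[f,[f,e]]] = 0\<close> gives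
\<open>3 [f,[f,[X,e]]] = 0\<close>.\<close>

lemma serre_inner:
  assumes E: "wder \<mu> Neg E" and ab: "a \<in> set sr" "b \<in> set sr" "a \<noteq> b" and par: "\<not> par a" "\<not> par b" "\<not> par \<mu>"
    and others: "\<And>\<alpha>. \<alpha> \<in> set sr \<Longrightarrow> \<alpha> \<noteq> a \<Longrightarrow> \<mu> - \<alpha> \<notin> R0"
    and strg: "- a - a - a - b \<notin> R0"
    and str: "\<mu> - a \<in> R" "\<mu> - a - a \<notin> R0" "\<mu> - a - b \<in> R" "\<mu> - a - b - a \<in> R" "\<mu> - a - b - a - a \<in> R"
  shows "inner \<mu> Neg E"
proof -
  have p: "a \<in> set pos" "b \<in> set pos" using ab sr_pos by auto
  have aR: "- a \<in> R" and bR: "- b \<in> R" using pos_R(2) p by auto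
  let ?f = "rv (- a)" and ?e = "rv (- b)"
  have f: "?f \<in> Gw (- a)" "?f \<noteq> 0" and e: "?e \<in> Gw (- b)" "?e \<noteq> 0" using rv(1,2) aR bR by auto
  let ?X = "E (- a) ?f"
  have X: "?X \<in> Gw (\<mu> - a)" using E_car[OF E p(1) f(1)] .
  have Ee: "E (- b) ?e = 0" using E_car[OF E p(2) e(1)] others[OF ab(2)] ab(3) Gw_nonroot by auto
  have Nn: "- a \<in> Neg \<or> - a \<notin> R0" "- b \<in> Neg \<or> - b \<notin> R0" using p by (simp_all add: Neg_def)
  have N1: "- a + - b \<in> Neg \<or> - a + - b \<notin> R0" by (rule Neg_add) (use p in \<open>simp_all add: Neg_def\<close>)
  have N2: "- a + (- a + - b) \<in> Neg \<or> - a + (- a + - b) \<notin> R0"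
  proof -
    have h: "ht (- a + (- a + - b)) < 0" unfolding ht_add ht_minus using ht_pos[OF p(1)] ht_pos[OF p(2)] by simp
    then have "- a + (- a + - b) \<noteq> 0" by (auto simp: ht_def)
    with h show ?thesis unfolding Neg_iff R0_def by blast
  qed
  let ?g1 = "br ?f ?e" and ?Xe = "br ?X ?e"
  let ?g2 = "br ?f ?g1"
  have g1: "?g1 \<in> Gw (- a + - b)" using br_Gw[OF f(1) e(1)] .
  have g2: "?g2 \<in> Gw (- a + (- a + - b))" using br_Gw[OF f(1) g1] .
  have cr: "?f \<in> car P" "?e \<in> car P" "?X \<in> car P" "?g1 \<in> car P" "?g2 \<in> car P" using f e X g1 g2 Gw_car by blast+
  have Xf: "br ?X ?f = 0" using br_Gw_nonroot[OF X f(1)] str(2) by simp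
  \<comment> \<open>\<open>X\<close> and \<open>f\<close> are even and commute, so
    \<open>ad X\<close> and \<open>ad f\<close> commute. Hence each of the three places at which the
    derivation can act contributes the same term.\<close>
  have swap: "br ?X (br ?f z) = br ?f (br ?X z)" if z: "z \<in> Gw c" for z c
    using jacobi_Gw[OF X f(1) z] Xf Gw_car[OF z] par by (simp add: par_diff sgn_par_def)
  have rule: "E (- a + c) (br ?f z) = br ?X z + br ?f (E c z)" if "z \<in> Gw c" "c \<in> Neg \<or> c \<notin> R0" for z c
    using wderD(4)[OF E Nn(1) that(2) f(1) that(1)] par by (simp add: sgn_par_def)
  have E1: "E (- a + - b) ?g1 = ?Xe" using rule[OF e(1) Nn(2)] Ee cr by simp
  have E2: "E (- a + (- a + - b)) ?g2 = br ?f ?Xe + br ?f ?Xe" using rule[OF g1 N1] E1 swap[OF e(1)] by simp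
  have g3: "br ?f ?g2 = 0" using br_Gw_nonroot[OF f(1) g2] strg by (simp add: algebra_simps)
  have "0 = br ?X ?g2 + br ?f (br ?f ?Xe + br ?f ?Xe)"
    using rule[OF g2 N2] E2 g3 wderD(1)[OF E] by simp
  also have "br ?X ?g2 = br ?f (br ?f ?Xe)" using swap[OF g1] swap[OF e(1)] by simp
  finally have "sc 3 (br ?f (br ?f ?Xe)) = 0"
    using cr scale_left_distrib[of 1 2 "br ?f (br ?f ?Xe)"] scale_left_distrib[of 1 1 "br ?f (br ?f ?Xe)"] by (simp add: br_add)
  then have z3: "br ?f (br ?f ?Xe) = 0" by simp
  have X0: "?X = 0"
  proof (rule ccontr)
    assume nz: "?X \<noteq> 0"
    have s1: "\<mu> - a + - b \<in> R" using str(3) by simp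
    have Xe: "?Xe \<in> Gw (\<mu> - a + - b)" "?Xe \<noteq> 0" using br_Gw[OF X e(1)] br_root_nonzero[OF str(1) bR s1 X nz e] by auto
    have s2: "- a + (\<mu> - a + - b) \<in> R" using str(4) by (simp add: algebra_simps)
    have fX: "br ?f ?Xe \<in> Gw (- a + (\<mu> - a + - b))" "br ?f ?Xe \<noteq> 0"
      using br_Gw[OF f(1) Xe(1)] br_root_nonzero[OF aR s1 s2 f Xe] by auto
    have s3: "- a + (- a + (\<mu> - a + - b)) \<in> R" using str(5) by (simp add: algebra_simps)
    show False using br_root_nonzero[OF aR s2 s3 f fX] z3 by blast
  qed
  have "kill E \<alpha>" if al: "\<alpha> \<in> set sr" for \<alpha>
  proof (cases "\<alpha> = a")
    case True
    have "E (- a) x = 0" if x: "x \<in> Gw (- a)" for x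
    proof -
      obtain t where "x = sc t ?f" using rv(3)[OF aR x] by blast
      then show ?thesis using wderD(3)[OF E Nn(1) f(1)] X0 by simp
    qed
    then show ?thesis using True by (simp add: kill_def[OF E])
  next
    case False
    then show ?thesis using others[OF al] E_car[OF E] al sr_pos Gw_nonroot unfolding kill_def[OF E] by blast
  qed
  then have "\<And>\<beta>. \<beta> \<in> set pos \<Longrightarrow> kill E \<beta>" using kill_all[OF E] by blast
  then have "\<forall>b\<in>Neg. \<forall>x\<in>Gw b. E b x = br 0 x" using Gw_car by (auto simp: kill_def[OF E] Neg_def)
  then show ?thesis unfolding inner_def by (intro bexI[of _ 0]) auto
qed

end

text \<open>Simple roots are numbered from 1 in \<open>grading\<close> and from 0 in the lists,
  whence \<open>Suc\<close>. The roots of the two descriptions are identified only as functionals on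
  \<open>h\<close>; \<open>co_comb\<close> and \<open>root_comb\<close> pass between coefficients on
  \<open>h\<close> and the values of \<open>co\<close>.\<close>

lemma (in parabolic) grading_eq:
  assumes cw: "\<And>c. c \<in> roots T \<Longrightarrow> \<exists>w\<in>R. \<forall>H\<in>h. fnl \<delta> \<epsilon> c H = \<Phi> w H"
    and wc: "\<And>w. w \<in> R \<Longrightarrow> \<exists>c\<in>roots T. \<forall>H\<in>h. fnl \<delta> \<epsilon> c H = \<Phi> w H"
    and N: "Nset T = Suc ` {..<n}"
    and simp_root: "\<And>i H. i < n \<Longrightarrow> fnl \<delta> \<epsilon> (simple_root T \<Xi> (Suc i)) H = \<Phi> (sr ! i) H"
    and S': "S' = Suc ` S"
  shows "grading T sc P br h \<delta> \<epsilon> \<Xi> S' = Gr"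
proof
  fix k
  let ?A = "{root_space sc P br h (fnl \<delta> \<epsilon> c) | c. c \<in> roots T \<and>
          (\<exists>m :: nat \<Rightarrow> int.
             (\<forall>H\<in>h. fnl \<delta> \<epsilon> c H = (\<Sum>i\<in>Nset T. of_int (m i) * fnl \<delta> \<epsilon> (simple_root T \<Xi> i) H)) \<and>
             (\<Sum>i\<in>S'. m i) = k)}"
  let ?B = "{Gw w | w. w \<in> R \<and> dg w = q * k}"
  have sN: "(\<Sum>i\<in>Nset T. of_int (m i) * fnl \<delta> \<epsilon> (simple_root T \<Xi> i) H) = (\<Sum>i<n. of_int (m (Suc i)) * \<Phi> (sr ! i) H)"
    for m :: "nat \<Rightarrow> int" and H
    unfolding N by (subst sum.reindex) (auto simp: simp_root)
  have sS: "(\<Sum>i\<in>S'. m i) = (\<Sum>i\<in>S. m (Suc i))" for m :: "nat \<Rightarrow> int"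
    unfolding S' by (subst sum.reindex) auto
  have dgm: "dg w = q * (\<Sum>i\<in>S. m i)" if "\<forall>i<n. co i w = q * m i" for w m
    unfolding dg_def sum_distrib_left using S_sub that by (intro sum.cong) auto
  have "?A = ?B"
  proof (intro equalityI subsetI)
    fix V assume "V \<in> ?A"
    then obtain c m where c: "V = root_space sc P br h (fnl \<delta> \<epsilon> c)" "c \<in> roots T"
      "\<forall>H\<in>h. fnl \<delta> \<epsilon> c H = (\<Sum>i<n. of_int (m (Suc i)) * \<Phi> (sr ! i) H)" "(\<Sum>i\<in>S. m (Suc i)) = k"
      unfolding sN sS by blast
    obtain w where w: "w \<in> R" "\<forall>H\<in>h. fnl \<delta> \<epsilon> c H = \<Phi> w H" using cw c(2) by blast
    have "\<forall>i<n. co i w = q * m (Suc i)" using co_comb[of w "\<lambda>i. m (Suc i)"] c(3) w(2) by simp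
    then have "dg w = q * k" using dgm[of w "\<lambda>i. m (Suc i)"] c(4) by simp
    moreover have "V = Gw w" unfolding Gw_def c(1) using w(2) by (intro root_space_cong) auto
    ultimately show "V \<in> ?B" using w(1) by blast
  next
    fix V assume "V \<in> ?B"
    then obtain w where w: "V = Gw w" "w \<in> R" "dg w = q * k" by blast
    obtain c where c: "c \<in> roots T" "\<forall>H\<in>h. fnl \<delta> \<epsilon> c H = \<Phi> w H" using wc w(2) by blast
    obtain m where m: "\<forall>H. \<Phi> w H = (\<Sum>i<n. of_int (m i) * \<Phi> (sr ! i) H)" "\<forall>i<n. co i w = q * m i"
      using root_comb[OF w(2)] by blast
    have "(\<Sum>i\<in>S. m i) = k" using dgm[OF m(2)] w(3) q_pos by simp
    then have "\<exists>m. (\<forall>H\<in>h. fnl \<delta> \<epsilon> c H = (\<Sum>i<n. of_int (m (Suc i)) * \<Phi> (sr ! i) H)) \<and> (\<Sum>i\<in>S. m (Suc i)) = k"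
      using m(1) c(2) by (intro exI[of _ "\<lambda>i. m (i - 1)"]) auto
    moreover have "V = root_space sc P br h (fnl \<delta> \<epsilon> c)" unfolding w(1) Gw_def using c(2) by (intro root_space_cong) auto
    ultimately show "V \<in> ?A" unfolding sN sS using c(1) by blast
  qed
  then show "grading T sc P br h \<delta> \<epsilon> \<Xi> S' k = Gr k" unfolding grading_def Gr_span by simp
qed

lemma additive_int:
  fixes g :: "int \<Rightarrow> complex"
  assumes "\<And>m n. g (m + n) = g m + g n"
  shows "g k = of_int k * g 1"
proof (induction k rule: int_induct[where k = 0])
  case base
  then show ?case using assms[of 0 0] by simp
next
  case (step1 i)
  then show ?case using assms[of i 1] by (simp add: distrib_right)
next
  case (step2 i)
  then show ?case using assms[of "i - 1" 1] by (simp add: algebra_simps)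
qed

lemma rt3_fun: "rt3 = (\<lambda>w. w \<in> set roots3)" by (simp add: fun_eq_iff rt3_iff del: rt3.simps)
lemma rt4_fun: "rt4 = (\<lambda>w. w \<in> set roots4)" by (simp add: fun_eq_iff rt4_iff del: rt4.simps)

lemma roots3_neg: "list_all (\<lambda>w. - w \<in> set roots3) roots3 \<and> 0 \<notin> set roots3" by code_simp
lemma roots4_neg: "list_all (\<lambda>w. - w \<in> set roots4) roots4 \<and> 0 \<notin> set roots4" by code_simp

lemma killing_checkD:
  assumes "killing_check (\<lambda>w. w \<in> set rl) par B rl" "\<alpha> \<in> set rl" "\<beta> \<in> set rl" "\<alpha> + \<beta> \<in> set rl"
  shows "(\<exists>\<gamma>\<in>set rl. B \<beta> \<gamma> = 0 \<and> B (\<alpha> + \<beta>) \<gamma> \<noteq> 0) \<or> \<beta> = \<alpha> \<or> \<beta> = - \<alpha> - \<alpha> \<or> \<alpha> = - \<beta> - \<beta> \<and> par \<beta>"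
    "\<exists>t n. string_val (\<lambda>w. w \<in> set rl) par B n \<alpha> (\<alpha> + \<beta>) = Some t \<and> t \<noteq> 0"
proof -
  have c: "(list_ex (\<lambda>\<gamma>. B \<beta> \<gamma> = 0 \<and> B (\<alpha> + \<beta>) \<gamma> \<noteq> 0) rl \<or> \<beta> = \<alpha> \<or> \<beta> = - \<alpha> - \<alpha> \<or> \<alpha> = - \<beta> - \<beta> \<and> par \<beta>) \<and>
      (case string_val (\<lambda>w. w \<in> set rl) par B 6 \<alpha> (\<alpha> + \<beta>) of None \<Rightarrow> False | Some t \<Rightarrow> t \<noteq> 0)"
    using assms unfolding killing_check_def list_all_iff by blast
  then show "(\<exists>\<gamma>\<in>set rl. B \<beta> \<gamma> = 0 \<and> B (\<alpha> + \<beta>) \<gamma> \<noteq> 0) \<or> \<beta> = \<alpha> \<or> \<beta> = - \<alpha> - \<alpha> \<or> \<alpha> = - \<beta> - \<beta> \<and> par \<beta>"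
    unfolding list_ex_iff by blast
  from c obtain t where "string_val (\<lambda>w. w \<in> set rl) par B 6 \<alpha> (\<alpha> + \<beta>) = Some t" "t \<noteq> 0"
    by (auto split: option.splits)
  then show "\<exists>t n. string_val (\<lambda>w. w \<in> set rl) par B n \<alpha> (\<alpha> + \<beta>) = Some t \<and> t \<noteq> 0" by blast
qed

lemma borelI:
  assumes k: "killing sc P br h \<Phi> (set rl) par B"
    and dual: "\<And>f. (\<And>v w. f (v + w) = f v + (f w :: complex)) \<Longrightarrow> \<exists>H\<in>h. \<forall>w. \<Phi> w H = f w"
    and add: "\<And>i v w. co i (v + w) = co i v + co i w" and q: "q > 0"
    and c: "borel_check (\<lambda>w. w \<in> set rl) rl sr pos co q"
  shows "borel sc P br h \<Phi> (set rl) par B sr pos co q"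
proof -
  note c' = c[unfolded borel_check_def list_all_iff list_ex_iff]
  note c1 = c'[THEN conjunct1] and d1 = c'[THEN conjunct2]
  note c2 = d1[THEN conjunct1] and d2 = d1[THEN conjunct2]
  note c3 = d2[THEN conjunct1] and d3 = d2[THEN conjunct2]
  note c4 = d3[THEN conjunct1] and d4 = d3[THEN conjunct2]
  note c5 = d4[THEN conjunct1] and d5 = d4[THEN conjunct2]
  note c6 = d5[THEN conjunct1] and c7 = d5[THEN conjunct2]
  have up: "i \<in> set [0..<length sr]" if "i < length sr" for i using that by simp
  show ?thesis
  proof (rule borel.intro[OF k], rule borel_axioms.intro)
    show "set rl = set pos \<union> uminus ` set pos"
    proof (intro equalityI subsetI)
      fix w assume "w \<in> set rl"
      then have "w \<in> set pos \<or> - w \<in> set pos" using c1 by blast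
      then show "w \<in> set pos \<union> uminus ` set pos" by (metis UnCI image_eqI minus_minus)
    next
      fix w assume "w \<in> set pos \<union> uminus ` set pos"
      then show "w \<in> set rl" using c2 by blast
    qed
    show "set sr \<subseteq> set pos" using c3 by blast
    show "0 \<le> co i \<beta>" "q dvd co i \<beta>" if "\<beta> \<in> set pos" "i < length sr" for \<beta> i
      using c4[rule_format, OF that(1) up[OF that(2)]] by simp_all
    show "co i (sr ! j) = (if i = j then q else 0)" if "i < length sr" "j < length sr" for i j
      using c5[rule_format, OF up[OF that(1)] up[OF that(2)]] .
    show "\<beta> \<in> set sr \<or> (\<exists>\<alpha>\<in>set sr. \<beta> - \<alpha> \<in> set pos)" if "\<beta> \<in> set pos" for \<beta>
      using c6[rule_format, OF that] .
    show "\<exists>\<beta>\<in>set rl. 0 < co i \<beta> \<and> (\<gamma> - \<beta> \<in> set rl \<or> \<gamma> = \<beta>)"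
      if "i < length sr" "\<gamma> \<in> set rl" "0 \<le> co i \<gamma>" for i \<gamma>
      using c7[rule_format, OF up[OF that(1)] that(2)] that(3) by (meson not_less)
  qed (fact dual add q)+
qed

lemma is_algD:
  assumes "is_alg T sc P br h \<delta> \<epsilon>"
  shows "lie_superalgebra sc P br" "simple_lsa sc P br" "module.subspace sc h" "h \<subseteq> P False"
    "H1 \<in> h \<Longrightarrow> H2 \<in> h \<Longrightarrow> br H1 H2 = 0" "lin_on sc h \<delta>" "i \<in> {1, 2, 3} \<Longrightarrow> lin_on sc h (\<epsilon> i)"
    "c \<in> even_roots T \<Longrightarrow> vector_space.dim sc (root_space sc P br h (fnl \<delta> \<epsilon> c)) = 1 \<and> root_space sc P br h (fnl \<delta> \<epsilon> c) \<subseteq> P False"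
    "c \<in> odd_roots T \<Longrightarrow> vector_space.dim sc (root_space sc P br h (fnl \<delta> \<epsilon> c)) = 1 \<and> root_space sc P br h (fnl \<delta> \<epsilon> c) \<subseteq> P True"
    "car P = module.span sc (h \<union> (\<Union>c\<in>roots T. root_space sc P br h (fnl \<delta> \<epsilon> c)))"
  using assms unfolding is_alg_def by (simp_all, auto)

lemma lin_on_mult: "lin_on sc h f \<Longrightarrow> lin_on sc h (\<lambda>H. c * f H)"
  by (simp add: lin_on_def algebra_simps)

lemma lin_on_add: "lin_on sc h f \<Longrightarrow> lin_on sc h g \<Longrightarrow> lin_on sc h (\<lambda>H. f H + g H)"
  by (simp add: lin_on_def algebra_simps)

lemma killingI:
  fixes \<Phi> :: "'w::ab_group_add \<Rightarrow> 'v::ab_group_add \<Rightarrow> complex"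
  assumes alg: "is_alg T sc P br h \<delta> \<epsilon>"
    and lin: "\<And>w. lin_on sc h (\<Phi> w)" and add: "\<And>v w H. \<Phi> (v + w) H = \<Phi> v H + \<Phi> w H"
    and inj: "\<And>w. (\<And>H. H \<in> h \<Longrightarrow> \<Phi> w H = 0) \<Longrightarrow> w = 0"
    and neg: "list_all (\<lambda>w. - w \<in> set rl) rl \<and> 0 \<notin> set rl"
    and par: "\<And>v w. par (v + w) = (par v \<noteq> par w)"
    and even1: "\<forall>c\<in>even_roots T. \<exists>w\<in>set rl. \<not> par w \<and> (\<forall>H\<in>h. fnl \<delta> \<epsilon> c H = \<Phi> w H)"
    and even2: "\<forall>w\<in>set rl. \<not> par w \<longrightarrow> (\<exists>c\<in>even_roots T. \<forall>H\<in>h. fnl \<delta> \<epsilon> c H = \<Phi> w H)"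
    and odd1: "\<forall>c\<in>odd_roots T. \<exists>w\<in>set rl. par w \<and> (\<forall>H\<in>h. fnl \<delta> \<epsilon> c H = \<Phi> w H)"
    and odd2: "\<forall>w\<in>set rl. par w \<longrightarrow> (\<exists>c\<in>odd_roots T. \<forall>H\<in>h. fnl \<delta> \<epsilon> c H = \<Phi> w H)"
    and coroot: "\<And>\<alpha> H \<kappa>. \<alpha> \<in> set rl \<Longrightarrow> H \<in> h \<Longrightarrow>
      (\<And>H'. H' \<in> h \<Longrightarrow> (\<Sum>\<gamma>\<in>set rl. sgn_par (par \<gamma>) * \<Phi> \<gamma> H * \<Phi> \<gamma> H') = \<kappa> * \<Phi> \<alpha> H') \<Longrightarrow>
      \<exists>k. \<forall>\<beta>\<in>set rl. \<Phi> \<beta> H = k * of_int (B \<alpha> \<beta>)"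
    and B0: "\<And>\<alpha>. B \<alpha> 0 = 0" and check: "killing_check (\<lambda>w. w \<in> set rl) par B rl"
  shows "killing sc P br h \<Phi> (set rl) par B"
    and "\<And>c. c \<in> roots T \<Longrightarrow> \<exists>w\<in>set rl. \<forall>H\<in>h. fnl \<delta> \<epsilon> c H = \<Phi> w H"
    and "\<And>w. w \<in> set rl \<Longrightarrow> \<exists>c\<in>roots T. \<forall>H\<in>h. fnl \<delta> \<epsilon> c H = \<Phi> w H"
proof -
  note A = is_algD[OF alg]
  interpret lsa sc P br by (rule lsa.intro[OF A(1)])
  show cw: "\<And>c. c \<in> roots T \<Longrightarrow> \<exists>w\<in>set rl. \<forall>H\<in>h. fnl \<delta> \<epsilon> c H = \<Phi> w H"
    using even1 odd1 unfolding roots_def by blast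
  show "\<And>w. w \<in> set rl \<Longrightarrow> \<exists>c\<in>roots T. \<forall>H\<in>h. fnl \<delta> \<epsilon> c H = \<Phi> w H"
    using even2 odd2 unfolding roots_def by blast
  have rs: "dim (root_space sc P br h (\<Phi> w)) = 1 \<and> root_space sc P br h (\<Phi> w) \<subseteq> P (par w)" if w: "w \<in> set rl" for w
  proof (cases "par w")
    case True
    then obtain c where c: "c \<in> odd_roots T" "\<forall>H\<in>h. fnl \<delta> \<epsilon> c H = \<Phi> w H" using odd2 w by blast
    have "root_space sc P br h (fnl \<delta> \<epsilon> c) = root_space sc P br h (\<Phi> w)" using c(2) by (intro root_space_cong) auto
    then show ?thesis using A(9)[OF c(1)] True by simp
  next
    case False
    then obtain c where c: "c \<in> even_roots T" "\<forall>H\<in>h. fnl \<delta> \<epsilon> c H = \<Phi> w H" using even2 w by blast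
    have "root_space sc P br h (fnl \<delta> \<epsilon> c) = root_space sc P br h (\<Phi> w)" using c(2) by (intro root_space_cong) auto
    then show ?thesis using A(8)[OF c(1)] False by simp
  qed
  have sp: "car P = span (h \<union> (\<Union>w\<in>set rl. root_space sc P br h (\<Phi> w)))"
  proof
    have "h \<union> (\<Union>c\<in>roots T. root_space sc P br h (fnl \<delta> \<epsilon> c)) \<subseteq> h \<union> (\<Union>w\<in>set rl. root_space sc P br h (\<Phi> w))"
    proof (intro Un_mono order_refl UN_least)
      fix c assume "c \<in> roots T"
      then obtain w where w: "w \<in> set rl" "\<forall>H\<in>h. fnl \<delta> \<epsilon> c H = \<Phi> w H" using cw by blast
      then have "root_space sc P br h (fnl \<delta> \<epsilon> c) = root_space sc P br h (\<Phi> w)" by (intro root_space_cong) auto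
      then show "root_space sc P br h (fnl \<delta> \<epsilon> c) \<subseteq> (\<Union>w\<in>set rl. root_space sc P br h (\<Phi> w))" using w(1) by blast
    qed
    then show "car P \<subseteq> span (h \<union> (\<Union>w\<in>set rl. root_space sc P br h (\<Phi> w)))" unfolding A(10) by (rule span_mono)
    have "h \<union> (\<Union>w\<in>set rl. root_space sc P br h (\<Phi> w)) \<subseteq> car P"
      using A(4) P_car by (auto simp: root_space_def)
    then show "span (h \<union> (\<Union>w\<in>set rl. root_space sc P br h (\<Phi> w))) \<subseteq> car P"
      by (rule span_minimal[OF _ subspace_car])
  qed
  have rooted: "rooted sc P br h \<Phi> (set rl) par"
  proof (intro rooted.intro lsa_axioms rooted_axioms.intro)
    show "w \<in> set rl \<Longrightarrow> - w \<in> set rl" "0 \<notin> set rl" for w using neg by (auto simp: list_all_iff)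
    show "w \<in> set rl \<Longrightarrow> dim (root_space sc P br h (\<Phi> w)) = 1" "w \<in> set rl \<Longrightarrow> root_space sc P br h (\<Phi> w) \<subseteq> P (par w)" for w
      using rs by auto
  qed (use A lin add inj par sp in simp_all)
  show "killing sc P br h \<Phi> (set rl) par B"
  proof (intro killing.intro rooted killing_axioms.intro)
    show "\<exists>k. \<forall>\<beta>\<in>set rl. \<Phi> \<beta> H = k * of_int (B \<alpha> \<beta>)"
      if "\<alpha> \<in> set rl" "H \<in> h" "\<And>H'. H' \<in> h \<Longrightarrow> (\<Sum>\<gamma>\<in>set rl. sgn_par (par \<gamma>) * \<Phi> \<gamma> H * \<Phi> \<gamma> H') = \<kappa> * \<Phi> \<alpha> H'" for \<alpha> H \<kappa>
      using coroot[OF that(1,2), of \<kappa>] that(3) by blast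
    show "B \<alpha> 0 = 0" for \<alpha> by (rule B0)
  qed (use killing_checkD[OF check] in blast)+
qed

lemma co3_add: "co3 \<Xi> i (v + w) = co3 \<Xi> i v + co3 \<Xi> i w"
  by (cases "coord3 \<Xi> ! i"; cases v; cases w) (simp add: co3_def algebra_simps)

lemma co4_add: "co4 \<Xi> i (v + w) = co4 \<Xi> i v + co4 \<Xi> i w"
  by (cases "coord4 \<Xi> ! i"; cases v; cases w) (simp add: co4_def algebra_simps)

lemma G3_facts:
  assumes alg: "is_alg G3 sc P br h \<delta> \<epsilon>"
  shows "killing sc P br h (Phi3 \<delta> \<epsilon>) (set roots3) parity form3"
    and "\<And>c. c \<in> roots G3 \<Longrightarrow> \<exists>w\<in>set roots3. \<forall>H\<in>h. fnl \<delta> \<epsilon> c H = Phi3 \<delta> \<epsilon> w H"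
    and "\<And>w. w \<in> set roots3 \<Longrightarrow> \<exists>c\<in>roots G3. \<forall>H\<in>h. fnl \<delta> \<epsilon> c H = Phi3 \<delta> \<epsilon> w H"
    and "\<And>f. (\<And>v w. f (v + w) = f v + (f w :: complex)) \<Longrightarrow> \<exists>H\<in>h. \<forall>w. Phi3 \<delta> \<epsilon> w H = f w"
proof -
  note A = is_algD[OF alg]
  have e3: "H \<in> h \<Longrightarrow> \<epsilon> 1 H + \<epsilon> 2 H + \<epsilon> 3 H = 0" for H using alg by (simp add: is_alg_def)
  have ind: "(\<And>H. H \<in> h \<Longrightarrow> a * \<delta> H + b * \<epsilon> 1 H + c * \<epsilon> 2 H = 0) \<Longrightarrow> a = 0 \<and> b = 0 \<and> c = 0" for a b c
    using alg unfolding is_alg_def algtype.case by blast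
  have lin: "lin_on sc h (Phi3 \<delta> \<epsilon> w)" for w
    using A(6) A(7)[of 1] A(7)[of 2] unfolding Phi3_def
    by (cases w) (simp add: lin_on_mult lin_on_add)
  have add: "Phi3 \<delta> \<epsilon> (v + w) H = Phi3 \<delta> \<epsilon> v H + Phi3 \<delta> \<epsilon> w H" for v w H
    by (cases v; cases w) (simp add: Phi3_def algebra_simps)
  have inj: "w = 0" if "\<And>H. H \<in> h \<Longrightarrow> Phi3 \<delta> \<epsilon> w H = 0" for w
  proof -
    obtain d a b where w: "w = (d, a, b)" by (cases w)
    have "complex_of_int d = 0 \<and> complex_of_int a = 0 \<and> complex_of_int b = 0"
      using that by (intro ind) (simp add: w Phi3_def)
    then show ?thesis by (simp add: w zero_prod_def)
  qed
  have coroot: "\<exists>k. \<forall>\<beta>\<in>set roots3. Phi3 \<delta> \<epsilon> \<beta> H = k * of_int (form3 \<alpha> \<beta>)"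
    if "\<And>H'. H' \<in> h \<Longrightarrow> (\<Sum>\<gamma>\<in>set roots3. sgn_par (parity \<gamma>) * Phi3 \<delta> \<epsilon> \<gamma> H * Phi3 \<delta> \<epsilon> \<gamma> H') = \<kappa> * Phi3 \<delta> \<epsilon> \<alpha> H'" for \<alpha> H \<kappa>
  proof -
    obtain d a b where w: "\<alpha> = (d, a, b)" by (cases \<alpha>)
    \<comment> \<open>Independence of \<delta>, \<epsilon>1, \<epsilon>2 on \<open>h\<close> allows
      coefficients in \<open>H'\<close> to be compared. Inverting the form then expresses
      \<open>H\<close> through \<kappa> and \<alpha>.\<close>
    have "- 6 * \<delta> H - \<kappa> * of_int d = 0 \<and> (8 * \<epsilon> 1 H + 4 * \<epsilon> 2 H) - \<kappa> * of_int a = 0 \<and> (4 * \<epsilon> 1 H + 8 * \<epsilon> 2 H) - \<kappa> * of_int b = 0"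
      using that unfolding killing_form3 by (intro ind) (simp add: w Phi3_def algebra_simps)
    then have r: "12 * \<delta> H = - 2 * (\<kappa> * of_int d)" "12 * \<epsilon> 1 H = \<kappa> * (2 * of_int a - of_int b)" "12 * \<epsilon> 2 H = \<kappa> * (2 * of_int b - of_int a)"
      by (simp_all add: algebra_simps) (algebra+)
    have "12 * Phi3 \<delta> \<epsilon> \<beta> H = \<kappa> * of_int (form3 \<alpha> \<beta>)" for \<beta>
    proof (cases \<beta>)
      case (fields d' a' b')
      have "12 * Phi3 \<delta> \<epsilon> \<beta> H = of_int d' * (12 * \<delta> H) + of_int a' * (12 * \<epsilon> 1 H) + of_int b' * (12 * \<epsilon> 2 H)"
        by (simp add: fields Phi3_def algebra_simps)
      then show ?thesis unfolding r by (simp add: fields w algebra_simps)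
    qed
    then show ?thesis by (intro exI[of _ "\<kappa> / 12"]) (simp add: field_simps)
  qed
  note K = killingI[OF alg lin add inj roots3_neg _ _ _ _ _ coroot _ killing_check3[unfolded rt3_fun]]
  have pa: "parity (v + w) = (parity v \<noteq> parity w)" for v w :: "int \<times> int \<times> int" by (simp add: parity_def)
  have ev: "\<forall>c\<in>even_roots G3. \<exists>w\<in>set roots3. \<not> parity w \<and> (\<forall>H\<in>h. fnl \<delta> \<epsilon> c H = Phi3 \<delta> \<epsilon> w H)"
    "\<forall>w\<in>set roots3. \<not> parity w \<longrightarrow> (\<exists>c\<in>even_roots G3. \<forall>H\<in>h. fnl \<delta> \<epsilon> c H = Phi3 \<delta> \<epsilon> w H)"
    "\<forall>c\<in>odd_roots G3. \<exists>w\<in>set roots3. parity w \<and> (\<forall>H\<in>h. fnl \<delta> \<epsilon> c H = Phi3 \<delta> \<epsilon> w H)"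
    "\<forall>w\<in>set roots3. parity w \<longrightarrow> (\<exists>c\<in>odd_roots G3. \<forall>H\<in>h. fnl \<delta> \<epsilon> c H = Phi3 \<delta> \<epsilon> w H)"
    using even_roots3 odd_roots3 e3 by meson+
  have B0: "form3 \<alpha> 0 = 0" for \<alpha> by (cases \<alpha>) (simp add: zero_prod_def)
  show "killing sc P br h (Phi3 \<delta> \<epsilon>) (set roots3) parity form3"
    by (rule K(1)) (assumption | rule pa ev B0)+
  show "\<And>c. c \<in> roots G3 \<Longrightarrow> \<exists>w\<in>set roots3. \<forall>H\<in>h. fnl \<delta> \<epsilon> c H = Phi3 \<delta> \<epsilon> w H"
    using ev unfolding roots_def by blast
  show "\<And>w. w \<in> set roots3 \<Longrightarrow> \<exists>c\<in>roots G3. \<forall>H\<in>h. fnl \<delta> \<epsilon> c H = Phi3 \<delta> \<epsilon> w H"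
    using ev unfolding roots_def by blast
  interpret lsa sc P br by (rule lsa.intro[OF A(1)])
  fix f :: "int \<times> int \<times> int \<Rightarrow> complex" assume f: "\<And>v w. f (v + w) = f v + f w"
  define \<theta> where "\<theta> j = (if j = 0 then \<delta> else if j = 1 then \<epsilon> 1 else \<epsilon> 2)" for j :: nat
  have s3: "(\<Sum>j<3. g j) = g 0 + g 1 + g (2::nat)" for g :: "nat \<Rightarrow> 'x::comm_monoid_add"
    by (simp add: numeral_3_eq_3 numeral_2_eq_2)
  have "\<exists>X. \<forall>j<3. X j \<in> h \<and> (\<forall>i<3. \<theta> i (X j) = (if i = j then 1 else 0))"
  proof (rule dual_vectors[OF A(3)])
    show "lin_on sc h (\<theta> j)" for j using A(6) A(7) by (simp add: \<theta>_def)
    fix c :: "nat \<Rightarrow> complex" assume "\<And>H. H \<in> h \<Longrightarrow> (\<Sum>j<3. c j * \<theta> j H) = 0"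
    then have "c 0 = 0 \<and> c 1 = 0 \<and> c 2 = 0" by (intro ind) (simp add: s3 \<theta>_def)
    then show "\<forall>j<3. c j = 0" by (auto simp: numeral_3_eq_3 less_Suc_eq numeral_2_eq_2)
  qed
  then obtain X where X: "\<And>j. j < 3 \<Longrightarrow> X j \<in> h" "\<And>i j. i < 3 \<Longrightarrow> j < 3 \<Longrightarrow> \<theta> i (X j) = (if i = j then 1 else 0)" by blast
  define c where "c j = (if j = 0 then f (1, 0, 0) else if j = 1 then f (0, 1, 0) else f (0, 0, 1))" for j :: nat
  let ?H = "\<Sum>j<3. sc (c j) (X j)"
  have H: "?H \<in> h" using X(1) by (intro subspace_sum[OF A(3)] subspace_scale[OF A(3)]) auto
  have th: "\<theta> i ?H = c i" if "i < 3" for i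
  proof -
    have "\<theta> i ?H = (\<Sum>j<3. c j * \<theta> i (X j))"
      using A(6) A(7) X(1) by (intro lin_on_simps(4)[OF _ A(3)]) (auto simp: \<theta>_def)
    also have "\<dots> = (\<Sum>j<3. if i = j then c j else 0)" using X(2) that by (intro sum.cong) auto
    finally show ?thesis using that by simp
  qed
  have "Phi3 \<delta> \<epsilon> w ?H = f w" for w
  proof (cases w)
    case (fields d a b)
    have "f (d, a, b) = f (d, 0, 0) + f (0, a, 0) + f (0, 0, b)"
      using f[of "(d, 0, 0)" "(0, a, 0)"] f[of "(d, a, 0)" "(0, 0, b)"] by simp
    moreover have "f (d, 0, 0) = of_int d * f (1, 0, 0)"
      by (rule additive_int[of "\<lambda>d. f (d, 0, 0)"]) (simp flip: f)
    moreover have "f (0, a, 0) = of_int a * f (0, 1, 0)"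
      by (rule additive_int[of "\<lambda>a. f (0, a, 0)"]) (simp flip: f)
    moreover have "f (0, 0, b) = of_int b * f (0, 0, 1)"
      by (rule additive_int[of "\<lambda>b. f (0, 0, b)"]) (simp flip: f)
    ultimately show ?thesis using th[of 0] th[of 1] th[of 2] by (simp add: fields Phi3_def \<theta>_def c_def)
  qed
  then show "\<exists>H\<in>h. \<forall>w. Phi3 \<delta> \<epsilon> w H = f w" using H by blast
qed

lemma F4_facts:
  assumes alg: "is_alg F4 sc P br h \<delta> \<epsilon>"
  shows "killing sc P br h (Phi4 \<delta> \<epsilon>) (set roots4) parity form4"
    and "\<And>c. c \<in> roots F4 \<Longrightarrow> \<exists>w\<in>set roots4. \<forall>H\<in>h. fnl \<delta> \<epsilon> c H = Phi4 \<delta> \<epsilon> w H"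
    and "\<And>w. w \<in> set roots4 \<Longrightarrow> \<exists>c\<in>roots F4. \<forall>H\<in>h. fnl \<delta> \<epsilon> c H = Phi4 \<delta> \<epsilon> w H"
    and "\<And>f. (\<And>v w. f (v + w) = f v + (f w :: complex)) \<Longrightarrow> \<exists>H\<in>h. \<forall>w. Phi4 \<delta> \<epsilon> w H = f w"
proof -
  note A = is_algD[OF alg]
  have ind: "(\<And>H. H \<in> h \<Longrightarrow> a * \<delta> H + b * \<epsilon> 1 H + c * \<epsilon> 2 H + e * \<epsilon> 3 H = 0) \<Longrightarrow> a = 0 \<and> b = 0 \<and> c = 0 \<and> e = 0" for a b c e
    using alg unfolding is_alg_def algtype.case by blast
  have lin: "lin_on sc h (Phi4 \<delta> \<epsilon> w)" for w
    using A(6) A(7)[of 1] A(7)[of 2] A(7)[of 3] by (cases w) (simp add: Phi4_def lin_on_def field_simps)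
  have add: "Phi4 \<delta> \<epsilon> (v + w) H = Phi4 \<delta> \<epsilon> v H + Phi4 \<delta> \<epsilon> w H" for v w H
    by (cases v; cases w) (simp add: Phi4_def field_simps)
  have inj: "w = 0" if "\<And>H. H \<in> h \<Longrightarrow> Phi4 \<delta> \<epsilon> w H = 0" for w
  proof -
    obtain d a b c where w: "w = (d, a, b, c)" by (cases w)
    have "complex_of_int d = 0 \<and> complex_of_int a = 0 \<and> complex_of_int b = 0 \<and> complex_of_int c = 0"
      using that by (intro ind) (simp add: w Phi4_def)
    then show ?thesis by (simp add: w zero_prod_def)
  qed
  have coroot: "\<exists>k. \<forall>\<beta>\<in>set roots4. Phi4 \<delta> \<epsilon> \<beta> H = k * of_int (form4 \<alpha> \<beta>)"
    if "\<And>H'. H' \<in> h \<Longrightarrow> (\<Sum>\<gamma>\<in>set roots4. sgn_par (parity \<gamma>) * Phi4 \<delta> \<epsilon> \<gamma> H * Phi4 \<delta> \<epsilon> \<gamma> H') = \<kappa> * Phi4 \<delta> \<epsilon> \<alpha> H'" for \<alpha> H \<kappa>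
  proof -
    obtain d a b c where w: "\<alpha> = (d, a, b, c)" by (cases \<alpha>)
    have "- 4 * \<delta> H - \<kappa> * of_int d = 0 \<and> 12 * \<epsilon> 1 H - \<kappa> * of_int a = 0 \<and> 12 * \<epsilon> 2 H - \<kappa> * of_int b = 0
        \<and> 12 * \<epsilon> 3 H - \<kappa> * of_int c = 0"
      using that unfolding killing_form4 by (intro ind) (simp add: w Phi4_def field_simps)
    then have r: "12 * \<delta> H = - 3 * (\<kappa> * of_int d)" "12 * \<epsilon> 1 H = \<kappa> * of_int a" "12 * \<epsilon> 2 H = \<kappa> * of_int b" "12 * \<epsilon> 3 H = \<kappa> * of_int c"
      by algebra+
    have "24 * Phi4 \<delta> \<epsilon> \<beta> H = \<kappa> * of_int (form4 \<alpha> \<beta>)" for \<beta>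
    proof (cases \<beta>)
      case (fields d' a' b' c')
      have "24 * Phi4 \<delta> \<epsilon> \<beta> H = of_int d' * (12 * \<delta> H) + of_int a' * (12 * \<epsilon> 1 H) + of_int b' * (12 * \<epsilon> 2 H) + of_int c' * (12 * \<epsilon> 3 H)"
        by (simp add: fields Phi4_def algebra_simps)
      then show ?thesis unfolding r by (simp add: fields w algebra_simps)
    qed
    then show ?thesis by (intro exI[of _ "\<kappa> / 24"]) (simp add: field_simps)
  qed
  note K = killingI[OF alg lin add inj roots4_neg _ _ _ _ _ coroot _ killing_check4[unfolded rt4_fun]]
  have pa: "parity (v + w) = (parity v \<noteq> parity w)" for v w :: "int \<times> int \<times> int \<times> int" by (simp add: parity_def)
  have ev: "\<forall>c\<in>even_roots F4. \<exists>w\<in>set roots4. \<not> parity w \<and> (\<forall>H\<in>h. fnl \<delta> \<epsilon> c H = Phi4 \<delta> \<epsilon> w H)"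
    "\<forall>w\<in>set roots4. \<not> parity w \<longrightarrow> (\<exists>c\<in>even_roots F4. \<forall>H\<in>h. fnl \<delta> \<epsilon> c H = Phi4 \<delta> \<epsilon> w H)"
    "\<forall>c\<in>odd_roots F4. \<exists>w\<in>set roots4. parity w \<and> (\<forall>H\<in>h. fnl \<delta> \<epsilon> c H = Phi4 \<delta> \<epsilon> w H)"
    "\<forall>w\<in>set roots4. parity w \<longrightarrow> (\<exists>c\<in>odd_roots F4. \<forall>H\<in>h. fnl \<delta> \<epsilon> c H = Phi4 \<delta> \<epsilon> w H)"
    using even_roots4 odd_roots4 by meson+
  have B0: "form4 \<alpha> 0 = 0" for \<alpha> by (cases \<alpha>) (simp add: zero_prod_def)
  show "killing sc P br h (Phi4 \<delta> \<epsilon>) (set roots4) parity form4"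
    by (rule K(1)) (assumption | rule pa ev B0)+
  show "\<And>c. c \<in> roots F4 \<Longrightarrow> \<exists>w\<in>set roots4. \<forall>H\<in>h. fnl \<delta> \<epsilon> c H = Phi4 \<delta> \<epsilon> w H"
    using ev unfolding roots_def by blast
  show "\<And>w. w \<in> set roots4 \<Longrightarrow> \<exists>c\<in>roots F4. \<forall>H\<in>h. fnl \<delta> \<epsilon> c H = Phi4 \<delta> \<epsilon> w H"
    using ev unfolding roots_def by blast
  interpret lsa sc P br by (rule lsa.intro[OF A(1)])
  fix f :: "int \<times> int \<times> int \<times> int \<Rightarrow> complex" assume f: "\<And>v w. f (v + w) = f v + f w"
  define \<theta> where "\<theta> j = (if j = 0 then \<delta> else \<epsilon> j)" for j :: nat
  have s4: "(\<Sum>j<4. g j) = g 0 + g 1 + g 2 + g (3::nat)" for g :: "nat \<Rightarrow> 'x::comm_monoid_add"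
    by (simp add: eval_nat_numeral)
  have l4: "j < 4 \<longleftrightarrow> j = 0 \<or> j = 1 \<or> j = 2 \<or> j = 3" for j :: nat by auto
  \<comment> \<open>Linearity of \<epsilon> is known only for the indices 1, 2, 3, while
    \<open>dual_vectors\<close> asks for it at every index; the others are redirected to
    \<delta>.\<close>
  have lt: "lin_on sc h (\<theta> (if j < 4 then j else 0))" for j using A(6) A(7) by (auto simp: \<theta>_def l4)
  have "\<exists>X. \<forall>j<4. X j \<in> h \<and> (\<forall>i<4. \<theta> (if i < 4 then i else 0) (X j) = (if i = j then 1 else 0))"
  proof (rule dual_vectors[OF A(3) lt])
    fix c :: "nat \<Rightarrow> complex" assume "\<And>H. H \<in> h \<Longrightarrow> (\<Sum>j<4. c j * \<theta> (if j < 4 then j else 0) H) = 0"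
    then have "c 0 = 0 \<and> c 1 = 0 \<and> c 2 = 0 \<and> c 3 = 0" by (intro ind) (simp add: s4 \<theta>_def)
    then show "\<forall>j<4. c j = 0" by (simp add: l4)
  qed
  then obtain X where X: "\<And>j. j < 4 \<Longrightarrow> X j \<in> h" "\<And>i j. i < 4 \<Longrightarrow> j < 4 \<Longrightarrow> \<theta> i (X j) = (if i = j then 1 else 0)" by auto
  \<comment> \<open>In doubled coordinates \<delta> is the tuple (2, 0, 0, 0), and likewise for the
    three \<epsilon>.\<close>
  define c where "c j = (if j = 0 then f (2, 0, 0, 0) else if j = 1 then f (0, 2, 0, 0) else if j = 2 then f (0, 0, 2, 0) else f (0, 0, 0, 2))" for j :: nat
  let ?H = "\<Sum>j<4. sc (c j) (X j)"
  have H: "?H \<in> h" using X(1) by (intro subspace_sum[OF A(3)] subspace_scale[OF A(3)]) auto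
  have th: "\<theta> i ?H = c i" if "i < 4" for i
  proof -
    have "\<theta> i ?H = (\<Sum>j<4. c j * \<theta> i (X j))"
      using lt[of i] that X(1) by (intro lin_on_simps(4)[OF _ A(3)]) auto
    also have "\<dots> = (\<Sum>j<4. if i = j then c j else 0)" using X(2) that by (intro sum.cong) auto
    finally show ?thesis using that by simp
  qed
  have "Phi4 \<delta> \<epsilon> w ?H = f w" for w
  proof (cases w)
    case (fields x a b y)
    have f0: "f (x, a, b, y) = f (x, 0, 0, 0) + f (0, a, 0, 0) + f (0, 0, b, 0) + f (0, 0, 0, y)"
      using f[of "(x, 0, 0, 0)" "(0, a, 0, 0)"] f[of "(x, a, 0, 0)" "(0, 0, b, 0)"] f[of "(x, a, b, 0)" "(0, 0, 0, y)"] by simp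
    have g1: "f (x, 0, 0, 0) = of_int x * f (1, 0, 0, 0)" for x
      by (rule additive_int[of "\<lambda>d. f (d, 0, 0, 0)"]) (simp flip: f)
    have g2: "f (0, a, 0, 0) = of_int a * f (0, 1, 0, 0)" for a
      by (rule additive_int[of "\<lambda>a. f (0, a, 0, 0)"]) (simp flip: f)
    have g3: "f (0, 0, b, 0) = of_int b * f (0, 0, 1, 0)" for b
      by (rule additive_int[of "\<lambda>b. f (0, 0, b, 0)"]) (simp flip: f)
    have g4: "f (0, 0, 0, b) = of_int b * f (0, 0, 0, 1)" for b
      by (rule additive_int[of "\<lambda>b. f (0, 0, 0, b)"]) (simp flip: f)
    have fw: "f w = of_int x * f (1, 0, 0, 0) + of_int a * f (0, 1, 0, 0) + of_int b * f (0, 0, 1, 0) + of_int y * f (0, 0, 0, 1)"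
      unfolding fields f0 by (simp only: g1[of x] g2[of a] g3[of b] g4[of y])
    have "\<delta> ?H = 2 * f (1, 0, 0, 0)" "\<epsilon> 1 ?H = 2 * f (0, 1, 0, 0)" "\<epsilon> 2 ?H = 2 * f (0, 0, 1, 0)" "\<epsilon> 3 ?H = 2 * f (0, 0, 0, 1)"
      using th[of 0] th[of 1] th[of 2] th[of 3] g1[of 2] g2[of 2] g3[of 2] g4[of 2] by (simp_all add: \<theta>_def c_def)
    then show ?thesis unfolding fw by (simp add: fields Phi4_def)
  qed
  then show "\<exists>H\<in>h. \<forall>w. Phi4 \<delta> \<epsilon> w H = f w" using H by blast
qed

lemma spans3_sound:
  assumes k: "rooted sc P br h (Phi3 \<delta> \<epsilon>) (set roots3) parity" and s: "spans3 K" and H: "H \<in> h"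
    and z: "\<And>\<gamma>. \<gamma> \<in> set K \<Longrightarrow> Phi3 \<delta> \<epsilon> \<gamma> H = 0"
  shows "H = 0"
proof -
  obtain a b c d e f g i j where K: "K = [(a, b, c), (d, e, f), (g, i, j)]"
    and D: "a * (e * j - f * i) - b * (d * j - f * g) + c * (d * i - e * g) \<noteq> 0"
    using s by (cases K rule: spans3.cases) auto
  have "\<delta> H = 0 \<and> \<epsilon> 1 H = 0 \<and> \<epsilon> 2 H = 0"
  proof (rule cramer3)
    show "of_int a * \<delta> H + of_int b * \<epsilon> 1 H + of_int c * \<epsilon> 2 H = 0"
      "of_int d * \<delta> H + of_int e * \<epsilon> 1 H + of_int f * \<epsilon> 2 H = 0"
      "of_int g * \<delta> H + of_int i * \<epsilon> 1 H + of_int j * \<epsilon> 2 H = 0"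
      using z[of "(a, b, c)"] z[of "(d, e, f)"] z[of "(g, i, j)"] by (simp_all add: K Phi3_def)
    show "complex_of_int a * (of_int e * of_int j - of_int f * of_int i) - of_int b * (of_int d * of_int j - of_int f * of_int g)
        + of_int c * (of_int d * of_int i - of_int e * of_int g) \<noteq> 0"
      using D unfolding of_int_mult[symmetric] of_int_diff[symmetric] of_int_add[symmetric] of_int_eq_0_iff .
  qed
  then have "Phi3 \<delta> \<epsilon> w H = 0" for w by (cases w) (simp add: Phi3_def)
  then show ?thesis using rooted.H_zero[OF k H] by blast
qed

lemma cramer4:
  fixes x y z t :: complex
  assumes e: "a1 * x + a2 * y + a3 * z + a4 * t = 0" "b1 * x + b2 * y + b3 * z + b4 * t = 0"
    "c1 * x + c2 * y + c3 * z + c4 * t = 0" "d1 * x + d2 * y + d3 * z + d4 * t = 0"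
    and D: "a1 * (b2 * (c3 * d4 - c4 * d3) - b3 * (c2 * d4 - c4 * d2) + b4 * (c2 * d3 - c3 * d2))
      - a2 * (b1 * (c3 * d4 - c4 * d3) - b3 * (c1 * d4 - c4 * d1) + b4 * (c1 * d3 - c3 * d1))
      + a3 * (b1 * (c2 * d4 - c4 * d2) - b2 * (c1 * d4 - c4 * d1) + b4 * (c1 * d2 - c2 * d1))
      - a4 * (b1 * (c2 * d3 - c3 * d2) - b2 * (c1 * d3 - c3 * d1) + b3 * (c1 * d2 - c2 * d1)) \<noteq> 0" (is "?D \<noteq> 0")
  shows "x = 0 \<and> y = 0 \<and> z = 0 \<and> t = 0"
proof -
  have "?D * x = 0" "?D * y = 0" "?D * z = 0" "?D * t = 0" using e by algebra+
  then show ?thesis using D by simp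
qed

lemma spans4_sound:
  assumes k: "rooted sc P br h (Phi4 \<delta> \<epsilon>) (set roots4) parity" and s: "spans4 K" and H: "H \<in> h"
    and z: "\<And>\<gamma>. \<gamma> \<in> set K \<Longrightarrow> Phi4 \<delta> \<epsilon> \<gamma> H = 0"
  shows "H = 0"
proof -
  obtain a1 a2 a3 a4 b1 b2 b3 b4 c1 c2 c3 c4 d1 d2 d3 d4 where K: "K = [(a1, a2, a3, a4), (b1, b2, b3, b4), (c1, c2, c3, c4), (d1, d2, d3, d4)]"
    and D: "a1 * (b2 * (c3 * d4 - c4 * d3) - b3 * (c2 * d4 - c4 * d2) + b4 * (c2 * d3 - c3 * d2))
      - a2 * (b1 * (c3 * d4 - c4 * d3) - b3 * (c1 * d4 - c4 * d1) + b4 * (c1 * d3 - c3 * d1))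
      + a3 * (b1 * (c2 * d4 - c4 * d2) - b2 * (c1 * d4 - c4 * d1) + b4 * (c1 * d2 - c2 * d1))
      - a4 * (b1 * (c2 * d3 - c3 * d2) - b2 * (c1 * d3 - c3 * d1) + b3 * (c1 * d2 - c2 * d1)) \<noteq> 0"
    using s by (cases K rule: spans4.cases) auto
  have "\<delta> H = 0 \<and> \<epsilon> 1 H = 0 \<and> \<epsilon> 2 H = 0 \<and> \<epsilon> 3 H = 0"
  proof (rule cramer4[of "of_int a1" _ "of_int a2" _ "of_int a3" _ "of_int a4" _ "of_int b1" "of_int b2" "of_int b3" "of_int b4"
      "of_int c1" "of_int c2" "of_int c3" "of_int c4" "of_int d1" "of_int d2" "of_int d3" "of_int d4"])
    show "of_int a1 * \<delta> H + of_int a2 * \<epsilon> 1 H + of_int a3 * \<epsilon> 2 H + of_int a4 * \<epsilon> 3 H = 0"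
      "of_int b1 * \<delta> H + of_int b2 * \<epsilon> 1 H + of_int b3 * \<epsilon> 2 H + of_int b4 * \<epsilon> 3 H = 0"
      "of_int c1 * \<delta> H + of_int c2 * \<epsilon> 1 H + of_int c3 * \<epsilon> 2 H + of_int c4 * \<epsilon> 3 H = 0"
      "of_int d1 * \<delta> H + of_int d2 * \<epsilon> 1 H + of_int d3 * \<epsilon> 2 H + of_int d4 * \<epsilon> 3 H = 0"
      using z[of "(a1, a2, a3, a4)"] z[of "(b1, b2, b3, b4)"] z[of "(c1, c2, c3, c4)"] z[of "(d1, d2, d3, d4)"] by (simp_all add: K Phi4_def)
  qed (use D in \<open>unfold of_int_mult[symmetric] of_int_diff[symmetric] of_int_add[symmetric] of_int_eq_0_iff, assumption\<close>)
  then have "Phi4 \<delta> \<epsilon> w H = 0" for w by (cases w) (simp add: Phi4_def)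
  then show ?thesis using rooted.H_zero[OF k H] by blast
qed

section \<open>Infinite prolongations\<close>

context tanaka_ext
begin

text \<open>\<open>pr_infinite\<close> fixes the type of complex sequences as carrier type, so an
  infinite-dimensional extension on any type is copied along a linear injection \<iota> of its
  carrier into sequences.\<close>

lemma pr_infiniteI:
  fixes \<iota> :: "'b \<Rightarrow> nat \<Rightarrow> complex"
  assumes inf: "\<not> fin_dim sc' P'"
    and lin: "\<And>x y a. x \<in> car P' \<Longrightarrow> y \<in> car P' \<Longrightarrow> \<iota> (sc' a x + y) = (\<lambda>n. a * \<iota> x n + \<iota> y n :: complex)"
    and inj: "inj_on \<iota> (car P')"
  shows "pr_infinite sc P br G"
proof -
  define s :: "complex \<Rightarrow> (nat \<Rightarrow> complex) \<Rightarrow> nat \<Rightarrow> complex" where "s a f = (\<lambda>n. a * f n)" for a f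
  interpret V: vector_space s by unfold_locales (auto simp: s_def fun_eq_iff algebra_simps)
  define \<kappa> where "\<kappa> = inv_into (car P') \<iota>"
  have k: "\<kappa> (\<iota> x) = x" if "x \<in> car P'" for x using inv_into_f_f[OF inj that] by (simp add: \<kappa>_def)
  have il: "\<iota> (sc' a x + y) = s a (\<iota> x) + \<iota> y" if "x \<in> car P'" "y \<in> car P'" for x y a
    using lin[OF that] by (simp add: s_def fun_eq_iff)
  have i0: "\<iota> 0 = 0" using il[of 0 0 1] by simp
  have ia: "\<iota> (x + y) = \<iota> x + \<iota> y" if "x \<in> car P'" "y \<in> car P'" for x y using il[OF that, of 1] by simp
  have isc: "\<iota> (sc' a x) = s a (\<iota> x)" if "x \<in> car P'" for x a using il[OF that, of 0 a] i0 by simp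
  have im: "\<iota> (- x) = - \<iota> x" if "x \<in> car P'" for x using isc[OF that, of "-1"] by simp
  have z: "x = 0" if "x \<in> car P'" "\<iota> x = 0" for x using inj_onD[OF inj, of x 0] that i0 by simp
  have isum: "\<iota> (sum f F) = (\<Sum>i\<in>F. \<iota> (f i))" if "\<And>i. i \<in> F \<Longrightarrow> f i \<in> car P'" for f and F :: "int set"
    using that by (induction F rule: infinite_finite_induct) (auto simp: i0 ia E.car_sum)
  have isum2: "\<iota> (sum f F) = (\<Sum>i\<in>F. \<iota> (f i))" if "\<And>i. i \<in> F \<Longrightarrow> f i \<in> car P'" for f and F :: "(nat \<Rightarrow> complex) set"
    using that by (induction F rule: infinite_finite_induct) (auto simp: i0 ia E.car_sum)
  define P2 where "P2 p = \<iota> ` P' p" for p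
  define G2 where "G2 k = \<iota> ` G' k" for k
  define br2 where "br2 u v = \<iota> (br' (\<kappa> u) (\<kappa> v))" for u v
  have b2: "br2 (\<iota> x) (\<iota> y) = \<iota> (br' x y)" if "x \<in> car P'" "y \<in> car P'" for x y using k that by (simp add: br2_def)
  have car2: "car P2 = \<iota> ` car P'"
  proof (intro equalityI subsetI)
    fix u assume "u \<in> car P2"
    then obtain a b where "a \<in> P' False" "b \<in> P' True" "u = \<iota> a + \<iota> b" by (auto simp: car_def P2_def)
    then show "u \<in> \<iota> ` car P'" using ia[of a b] E.P_car by (metis E.car_simps(2) image_eqI)
  next
    fix u assume "u \<in> \<iota> ` car P'"
    then obtain a b where "a \<in> P' False" "b \<in> P' True" "u = \<iota> (a + b)" by (metis E.carE imageE)
    then have "u = \<iota> a + \<iota> b \<and> \<iota> a \<in> P2 False \<and> \<iota> b \<in> P2 True" using ia[of a b] E.P_car by (auto simp: P2_def)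
    then show "u \<in> car P2" unfolding car_def by blast
  qed
  have sub: "V.subspace (\<iota> ` U)" if U: "E.subspace U" "U \<subseteq> car P'" for U
  proof (rule V.subspaceI)
    show "0 \<in> \<iota> ` U" using i0 E.subspace_0[OF U(1)] by (metis image_eqI)
  next
    fix x y assume "x \<in> \<iota> ` U" "y \<in> \<iota> ` U"
    then obtain a b where "a \<in> U" "b \<in> U" "x = \<iota> a" "y = \<iota> b" by blast
    then show "x + y \<in> \<iota> ` U" using ia[of a b] U E.subspace_add[OF U(1)] by (metis image_eqI subsetD)
  next
    fix c x assume "x \<in> \<iota> ` U"
    then obtain a where "a \<in> U" "x = \<iota> a" by blast
    then show "s c x \<in> \<iota> ` U" using isc[of a c] U E.subspace_scale[OF U(1)] by (metis image_eqI subsetD)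
  qed
  have PC: "P' p \<subseteq> car P'" for p using E.P_car by blast
  have GC: "G' k \<subseteq> car P'" for k using E.G_car by blast
  have lie2: "lie_superalgebra s P2 br2"
    unfolding lie_superalgebra_def
  proof (intro conjI allI ballI)
    show "vector_space s" by (rule V.vector_space_axioms)
    show "V.subspace (P2 p)" for p unfolding P2_def by (rule sub[OF E.subspace_P PC])
    show "P2 False \<inter> P2 True = {0}"
    proof (intro equalityI subsetI)
      fix u assume "u \<in> P2 False \<inter> P2 True"
      then obtain a b where ab: "a \<in> P' False" "b \<in> P' True" "u = \<iota> a" "u = \<iota> b" by (auto simp: P2_def)
      then have "a = b" using inj_onD[OF inj, of a b] PC by auto
      then show "u \<in> {0}" using ab E.P_disjoint[of a] i0 by simp
    qed (auto simp: P2_def i0[symmetric])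
  next
    fix x y w a assume "x \<in> car P2" "y \<in> car P2" "w \<in> car P2"
    then obtain x' y' w' where c: "x' \<in> car P'" "y' \<in> car P'" "w' \<in> car P'" and e: "x = \<iota> x'" "y = \<iota> y'" "w = \<iota> w'" unfolding car2 by blast
    have e1: "s a x + y = \<iota> (sc' a x' + y')" using il[OF c(1,2)] e by simp
    have u: "sc' a x' + y' \<in> car P'" by (intro E.car_simps c)
    show "br2 (s a x + y) w = s a (br2 x w) + br2 y w" "br2 w (s a x + y) = s a (br2 w x) + br2 w y"
      unfolding e1 unfolding e b2[OF u c(3)] b2[OF c(3) u] b2[OF c(1,3)] b2[OF c(2,3)] b2[OF c(3,1)] b2[OF c(3,2)]
      using c by (simp_all add: E.br_lin il)
  next
    fix p q x y assume "x \<in> P2 p" "y \<in> P2 q"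
    then obtain x' y' where c: "x' \<in> P' p" "y' \<in> P' q" and e: "x = \<iota> x'" "y = \<iota> y'" by (auto simp: P2_def)
    have cc: "x' \<in> car P'" "y' \<in> car P'" using c PC by auto
    show "br2 x y \<in> P2 (p \<noteq> q)" unfolding e b2[OF cc] P2_def using E.br_P[OF c] by blast
    show "br2 x y = - s (sgnp p q) (br2 y x)"
      unfolding e b2[OF cc] b2[OF cc(2,1)] using E.br_skew[OF c] cc by (simp add: im isc)
  next
    fix p q r x y w assume "x \<in> P2 p" "y \<in> P2 q" "w \<in> P2 r"
    then obtain x' y' w' where c: "x' \<in> P' p" "y' \<in> P' q" "w' \<in> P' r" and e: "x = \<iota> x'" "y = \<iota> y'" "w = \<iota> w'" by (auto simp: P2_def)
    have cc: "x' \<in> car P'" "y' \<in> car P'" "w' \<in> car P'" using c PC by auto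
    show "br2 x (br2 y w) = br2 (br2 x y) w + s (sgnp p q) (br2 y (br2 x w))"
      unfolding e using cc E.jacobi[OF c] by (simp add: b2 ia isc)
  qed
  have gr2: "graded_lsa s P2 br2 G2"
    unfolding graded_lsa_def
  proof (intro conjI allI ballI impI lie2)
    show "V.subspace (G2 k)" for k unfolding G2_def by (rule sub[OF E.G_sub GC])
    show "G2 k \<subseteq> car P2" for k unfolding G2_def car2 using GC by blast
  next
    fix k x assume "x \<in> G2 k"
    then obtain x' where x': "x' \<in> G' k" "x = \<iota> x'" by (auto simp: G2_def)
    obtain a b where ab: "a \<in> G' k" "a \<in> P' False" "b \<in> G' k" "b \<in> P' True" "x' = a + b" using E.G_parts[OF x'(1)] by blast
    have "x = \<iota> a + \<iota> b" using ab x' ia[OF E.G_car[OF ab(1)] E.G_car[OF ab(3)]] by simp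
    then show "\<exists>a\<in>G2 k \<inter> P2 False. \<exists>b\<in>G2 k \<inter> P2 True. x = a + b" using ab by (auto simp: G2_def P2_def)
  next
    show "car P2 \<subseteq> V.span (\<Union>k. G2 k)"
    proof
      fix u assume "u \<in> car P2"
      then obtain x where x: "x \<in> car P'" "u = \<iota> x" unfolding car2 by blast
      have "x \<in> car P' \<and> \<iota> x \<in> V.span (\<Union>k. G2 k)" using E.car_G[OF x(1)]
      proof (induction rule: E.span_induct_alt)
        case base show ?case unfolding i0 using V.span_zero E.subspace_0[OF E.subspace_car] by blast
      next
        case (step c a b)
        then obtain k where a: "a \<in> G' k" by blast
        then have "\<iota> a \<in> V.span (\<Union>k. G2 k)" by (intro V.span_base) (auto simp: G2_def)
        moreover have "a \<in> car P'" using a GC by blast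
        moreover have "\<iota> (sc' c a + b) \<in> V.span (\<Union>k. G2 k)"
          unfolding il[OF \<open>a \<in> car P'\<close> step.IH[THEN conjunct1]]
          by (intro V.span_add V.span_scale calculation step.IH[THEN conjunct2])
        ultimately show ?case using step.IH by simp
      qed
      then show "u \<in> V.span (\<Union>k. G2 k)" using x by simp
    qed
  next
    fix F f k assume a: "finite F \<and> (\<forall>k\<in>F. f k \<in> G2 k) \<and> sum f F = 0" and kF: "k \<in> F"
    then have "\<forall>k\<in>F. \<exists>x. x \<in> G' k \<and> f k = \<iota> x" by (auto simp: G2_def)
    then obtain g where g: "\<And>k. k \<in> F \<Longrightarrow> g k \<in> G' k" "\<And>k. k \<in> F \<Longrightarrow> f k = \<iota> (g k)" by metis
    have gc: "g i \<in> car P'" if "i \<in> F" for i using g(1)[OF that] E.G_car by blast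
    have "\<iota> (sum g F) = (\<Sum>i\<in>F. \<iota> (g i))" using isum[of F g] gc by blast
    then have "\<iota> (sum g F) = sum f F" using g(2) by (simp cong: sum.cong)
    then have "\<iota> (sum g F) = 0" using a by simp
    then have "sum g F = 0" using z[OF E.car_sum[of F g]] gc by blast
    then have "g k = 0" using E.G_direct[of F g k] a g kF by blast
    then show "f k = 0" using g kF i0 by simp
  next
    fix i j x y assume "x \<in> G2 i" "y \<in> G2 j"
    then obtain x' y' where c: "x' \<in> G' i" "y' \<in> G' j" and e: "x = \<iota> x'" "y = \<iota> y'" by (auto simp: G2_def)
    show "br2 x y \<in> G2 (i + j)" unfolding e using b2[of x' y'] c GC E.G_br[OF c] by (auto simp: G2_def)
  qed
  have tr2: "transitive_gr br2 G2"
    unfolding transitive_gr_def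
  proof (intro allI impI ballI)
    fix k :: int and x assume k0: "0 \<le> k" and "x \<in> G2 k" and zz: "\<forall>y\<in>G2 (-1). br2 x y = 0"
    then obtain x' where x': "x' \<in> G' k" "x = \<iota> x'" by (auto simp: G2_def)
    have "x' = 0"
    proof (rule E.trans_zero[OF k0 x'(1)])
      fix y assume y: "y \<in> G' (-1)"
      then have "\<iota> (br' x' y) = 0" using zz b2[of x' y] x' GC by (auto simp: G2_def)
      then show "br' x' y = 0" using z E.br_car[of x' y] x' y GC by blast
    qed
    then show "x = 0" using x' i0 by simp
  qed
  have phic: "\<phi> x \<in> car P'" if "x \<in> negpart sc G" for x
  proof -
    have "x \<in> negpart sc G \<and> \<phi> x \<in> car P'" using that unfolding negpart_def
    proof (induction rule: span_induct_alt)
      case base then show ?case using span_zero by simp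
    next
      case (step c a b)
      then obtain k where a: "k < 0" "a \<in> G k" by blast
      have n: "a \<in> negpart sc G" "b \<in> negpart sc G" using G_neg[OF a] step.IH by (auto simp: negpart_def)
      then have "\<phi> (sc c a + b) = sc' c (\<phi> a) + \<phi> b" by (rule phi_lin)
      then show ?case using step.IH phi_car[OF a] n by (simp add: negpart_def span_add span_scale)
    qed
    then show ?thesis by simp
  qed
  have "trans_ext sc P br G s P2 br2 G2 (\<lambda>x. \<iota> (\<phi> x))"
    unfolding trans_ext_def
  proof (intro conjI allI impI ballI gr2 tr2)
    fix j :: int assume j: "j < 0"
    have "bij_betw \<iota> (G' j) (G2 j)" unfolding G2_def using inj GC by (meson bij_betw_imageI inj_on_subset)
    then have "bij_betw (\<iota> \<circ> \<phi>) (G j) (G2 j)" using bij_betw_trans[OF phi_bij[OF j]] by blast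
    then show "bij_betw (\<lambda>x. \<iota> (\<phi> x)) (G j) (G2 j)" by (simp add: comp_def)
    fix p
    have "\<iota> ` (G' j \<inter> P' p) = G2 j \<inter> P2 p" unfolding G2_def P2_def
      using inj_on_image_Int[OF inj GC PC] by blast
    then show "(\<lambda>x. \<iota> (\<phi> x)) ` (G j \<inter> P p) = G2 j \<inter> P2 p" using phi_P[OF j, of p] by (metis image_image)
  next
    fix x y a assume n: "x \<in> negpart sc G" "y \<in> negpart sc G"
    show "\<iota> (\<phi> (sc a x + y)) = s a (\<iota> (\<phi> x)) + \<iota> (\<phi> y)" using phi_lin[OF n] il phic n by simp
    show "\<iota> (\<phi> (br x y)) = br2 (\<iota> (\<phi> x)) (\<iota> (\<phi> y))" using phi_br[OF n] b2 phic n by simp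
  qed
  moreover have "\<not> fin_dim s P2"
  proof
    assume "fin_dim s P2"
    then obtain B where B: "finite B" "car P2 \<subseteq> V.span B" by (auto simp: fin_dim_def)
    \<comment> \<open>\<open>fin_dim\<close> admits spanning sets outside the carrier, on which the
      inverse of \<iota> has no meaning. A maximal independent set inside the carrier is finite as
      well and can be pulled back.\<close>
    obtain C where C: "C \<subseteq> car P2" "V.independent C" "car P2 \<subseteq> V.span C"
      using V.maximal_independent_subset by blast
    have fC: "finite C" using V.independent_span_bound[OF B(1) C(2)] C(1) B(2) by blast
    have "car P' \<subseteq> E.span (\<kappa> ` C)"
    proof
      fix x assume x: "x \<in> car P'"
      have kc: "\<kappa> u \<in> car P'" "\<iota> (\<kappa> u) = u" if "u \<in> C" for u
        using C(1) that k unfolding car2 by force+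
      have "\<iota> x \<in> V.span C" using C(3) x car2 by blast
      then obtain t where t: "\<iota> x = (\<Sum>u\<in>C. s (t u) u)" using V.span_finite[OF fC] by (auto simp: image_iff)
      have "\<iota> (\<Sum>u\<in>C. sc' (t u) (\<kappa> u)) = \<iota> x"
      proof -
        have "\<iota> (\<Sum>u\<in>C. sc' (t u) (\<kappa> u)) = (\<Sum>u\<in>C. \<iota> (sc' (t u) (\<kappa> u)))"
          by (rule isum2) (use kc in auto)
        also have "\<dots> = (\<Sum>u\<in>C. s (t u) u)" using kc isc by (intro sum.cong) auto
        finally show ?thesis using t by simp
      qed
      moreover have "(\<Sum>u\<in>C. sc' (t u) (\<kappa> u)) \<in> car P'" using kc by (intro E.car_sum) auto
      ultimately have "x = (\<Sum>u\<in>C. sc' (t u) (\<kappa> u))" using inj_onD[OF inj] x by metis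
      then show "x \<in> E.span (\<kappa> ` C)" by (simp add: E.span_sum E.span_scale E.span_base)
    qed
    then show False using inf fC unfolding fin_dim_def by blast
  qed
  ultimately show ?thesis unfolding pr_infinite_def by blast
qed

end

section \<open>Contact superalgebras\<close>

text \<open>Parity and degree are given by operators, so that the construction below has to verify
  only operator identities; the subspaces are recovered as eigenspaces.\<close>

definition par_space :: "(complex \<Rightarrow> 'b \<Rightarrow> 'b) \<Rightarrow> ('b \<Rightarrow> 'b) \<Rightarrow> bool \<Rightarrow> 'b set" where
  "par_space sc \<sigma> p = {x. \<sigma> x = sc (sgn_par p) x}"

definition deg_space :: "(complex \<Rightarrow> 'b \<Rightarrow> 'b) \<Rightarrow> ('b \<Rightarrow> 'b) \<Rightarrow> int \<Rightarrow> 'b set" where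
  "deg_space sc D k = {x. D x = sc (of_int k) x}"

text \<open>\<open>\<sigma>\<close> is the parity involution and \<open>D\<close> the degree derivation; the degree \<open>-2\<close> part is spanned by \<open>z\<close>,
and \<open>\<Psi>\<close> parametrises the odd degree \<open>-1\<close> part by its first \<open>n\<close> arguments. The map \<open>\<iota>\<close> only records that
the dimension is at most that of sequences. Transitivity may use \<open>z\<close>, since for \<open>n = 0\<close> it has to.\<close>

locale contact = vector_space sc
  for sc :: "complex \<Rightarrow> 'b::ab_group_add \<Rightarrow> 'b" +
  fixes br :: "'b \<Rightarrow> 'b \<Rightarrow> 'b" and \<sigma> D :: "'b \<Rightarrow> 'b" and z :: 'b and n :: nat
    and \<Psi> :: "(nat \<Rightarrow> complex) \<Rightarrow> 'b" and Q :: "(nat \<Rightarrow> complex) \<Rightarrow> (nat \<Rightarrow> complex) \<Rightarrow> complex"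
    and \<iota> :: "'b \<Rightarrow> nat \<Rightarrow> complex"
  assumes br_lin: "br (sc a x + y) w = sc a (br x w) + br y w" "br w (sc a x + y) = sc a (br w x) + br w y"
    and s_lin: "\<sigma> (sc a x + y) = sc a (\<sigma> x) + \<sigma> y" and s_s: "\<sigma> (\<sigma> x) = x"
    and s_br: "\<sigma> (br x y) = br (\<sigma> x) (\<sigma> y)"
    and D_lin: "D (sc a x + y) = sc a (D x) + D y" and D_s: "D (\<sigma> x) = \<sigma> (D x)"
    and D_br: "D (br x y) = br (D x) y + br x (D y)"
    and skew: "x \<in> par_space sc \<sigma> p \<Longrightarrow> y \<in> par_space sc \<sigma> q \<Longrightarrow> br x y = - sc (sgnp p q) (br y x)"
    and jac: "x \<in> par_space sc \<sigma> p \<Longrightarrow> y \<in> par_space sc \<sigma> q \<Longrightarrow> w \<in> par_space sc \<sigma> r \<Longrightarrow>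
      br x (br y w) = br (br x y) w + sc (sgnp p q) (br y (br x w))"
    and span_deg: "x \<in> span (\<Union>k. deg_space sc D k)"
    and inf: "finite B \<Longrightarrow> \<exists>x. x \<notin> span B"
    and below: "k < -2 \<Longrightarrow> D x = sc (of_int k) x \<Longrightarrow> x = 0"
    and bottom: "D x = sc (-2) x \<longleftrightarrow> (\<exists>a. x = sc a z)"
    and z_even: "\<sigma> z = z" and z_ne: "z \<noteq> 0"
    and Psi_lin: "\<Psi> (\<lambda>i. a * v i + v' i) = sc a (\<Psi> v) + \<Psi> v'"
    and Psi_deg: "D x = - x \<longleftrightarrow> (\<exists>v. x = \<Psi> v)" and Psi_odd: "\<sigma> (\<Psi> v) = - \<Psi> v"
    and Psi_0: "\<Psi> v = 0 \<longleftrightarrow> (\<forall>i<n. v i = 0)"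
    and Psi_br: "br (\<Psi> v) (\<Psi> v') = sc (Q v v') z"
    and weak: "0 \<le> k \<Longrightarrow> D x = sc (of_int k) x \<Longrightarrow> br x z = 0 \<Longrightarrow> (\<And>v. br x (\<Psi> v) = 0) \<Longrightarrow> x = 0"
    and iota_lin: "\<iota> (sc a x + y) = (\<lambda>i. a * \<iota> x i + \<iota> y i)"
    and iota_0: "\<iota> x = (\<lambda>_. 0) \<Longrightarrow> x = 0"
begin

lemma lin_map:
  assumes "\<And>a x y. f (sc a x + y) = sc a (f x) + (f y :: 'b)"
  shows "f 0 = 0" "f (x + y) = f x + f y" "f (sc a x) = sc a (f x)" "f (- x) = - f x" "f (x - y) = f x - f y"
proof -
  show 0: "f 0 = 0" using assms[of 1 0 0] by simp
  show a: "f (x + y) = f x + f y" for x y using assms[of 1 x y] by simp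
  show s: "f (sc a x) = sc a (f x)" for a x using assms[of a x 0] 0 by simp
  show m: "f (- x) = - f x" for x using s[of "-1" x] by simp
  show "f (x - y) = f x - f y" using a[of x "- y"] m by simp
qed

lemmas br_simps [simp] = lin_map[of "\<lambda>x. br x w" for w, OF br_lin(1)] lin_map[of "br w" for w, OF br_lin(2)]
lemmas s_simps [simp] = lin_map[of \<sigma>, OF s_lin] s_s s_br
lemmas D_simps [simp] = lin_map[of D, OF D_lin] D_s

lemma par_space_car: "car (par_space sc \<sigma>) = UNIV"
proof -
  have "x \<in> car (par_space sc \<sigma>)" for x
  proof -
    have "x = sc (1/2) (x + \<sigma> x) + sc (1/2) (x - \<sigma> x)"
      by (simp add: scale_right_distrib scale_right_diff_distrib flip: scale_left_distrib)
    moreover have "sc (1/2) (x + \<sigma> x) \<in> par_space sc \<sigma> False" "sc (1/2) (x - \<sigma> x) \<in> par_space sc \<sigma> True"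
      by (simp_all add: par_space_def sgn_par_def add.commute flip: scale_minus_right)
    ultimately show ?thesis unfolding car_def by blast
  qed
  then show ?thesis by blast
qed

lemma par_subspace: "subspace (par_space sc \<sigma> p)"
  by (rule subspaceI) (auto simp: par_space_def scale_right_distrib mult.commute)

lemma deg_subspace: "subspace (deg_space sc D k)"
  by (rule subspaceI) (auto simp: deg_space_def scale_right_distrib mult.commute)

lemma lie: "lie_superalgebra sc (par_space sc \<sigma>) br"
  unfolding lie_superalgebra_def
proof (intro conjI allI ballI)
  show "vector_space sc" by (rule vector_space_axioms)
  show "par_space sc \<sigma> False \<inter> par_space sc \<sigma> True = {0}"
  proof (intro equalityI subsetI)
    fix x assume "x \<in> par_space sc \<sigma> False \<inter> par_space sc \<sigma> True"
    then have "x = - x" by (auto simp: par_space_def sgn_par_def)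
    then have "sc 2 x = 0" using scale_left_distrib[of 1 1 x] by (metis add.right_inverse one_add_one scale_one)
    then show "x \<in> {0}" by simp
  qed (auto simp: par_space_def)
  show "br x y \<in> par_space sc \<sigma> (p \<noteq> q)" if "x \<in> par_space sc \<sigma> p" "y \<in> par_space sc \<sigma> q" for p q x y
    using that by (cases p; cases q) (auto simp: par_space_def sgn_par_def)
qed (rule par_subspace br_lin | erule (2) jac | erule (1) skew)+

sublocale L: lsa sc "par_space sc \<sigma>" br by unfold_locales (rule lie)

text \<open>The same elimination as for weights, with the single operator \<open>D\<close> in place
  of \<open>h\<close>.\<close>

lemma deg_direct:
  assumes "finite F" "\<And>k. k \<in> F \<Longrightarrow> f k \<in> deg_space sc D k" "sum f F = 0" "j \<in> F"
  shows "f j = 0"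
  using assms
proof (induction F arbitrary: f j rule: finite_induct)
  case (insert k F)
  have Ds: "D (sum f A) = (\<Sum>j\<in>A. D (f j))" for A by (induction A rule: infinite_finite_induct) auto
  have z: "sc (of_int (i - k)) (f i) = 0" if i: "i \<in> F" for i
  proof (rule insert.IH[of "\<lambda>i. sc (of_int (i - k)) (f i)" i, OF _ _ i])
    show "sc (of_int (j - k)) (f j) \<in> deg_space sc D j" if "j \<in> F" for j
      using insert.prems(1)[of j] that subspace_scale[OF deg_subspace] by simp
    have "0 = D (sum f (insert k F)) - sc (of_int k) (sum f (insert k F))" using insert.prems(2) by simp
    also have "\<dots> = (\<Sum>j\<in>insert k F. sc (of_int j) (f j)) - (\<Sum>j\<in>insert k F. sc (of_int k) (f j))"
      using insert.prems(1) by (simp only: Ds scale_sum_right) (auto intro!: arg_cong2[where f = minus] sum.cong simp: deg_space_def simp del: sum.insert)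
    also have "\<dots> = (\<Sum>j\<in>insert k F. sc (of_int (j - k)) (f j))"
      by (simp only: flip: sum_subtractf) (simp add: scale_left_diff_distrib)
    finally show "(\<Sum>j\<in>F. sc (of_int (j - k)) (f j)) = 0" using insert.hyps by simp
  qed
  have F0: "f i = 0" if "i \<in> F" for i using z[OF that] that insert.hyps by auto
  then have "f k = 0" using insert.prems(2) insert.hyps by simp
  then show ?case using F0 insert.prems by auto
qed simp

lemma graded: "graded_lsa sc (par_space sc \<sigma>) br (deg_space sc D)"
  unfolding graded_lsa_def
proof (intro conjI allI ballI impI lie)
  fix k x assume x: "x \<in> deg_space sc D k"
  have "x = sc (1/2) (x + \<sigma> x) + sc (1/2) (x - \<sigma> x)"
    by (simp add: scale_right_distrib scale_right_diff_distrib flip: scale_left_distrib)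
  moreover have "sc (1/2) (x + \<sigma> x) \<in> par_space sc \<sigma> False" "sc (1/2) (x - \<sigma> x) \<in> par_space sc \<sigma> True"
    by (simp_all add: par_space_def sgn_par_def add.commute flip: scale_minus_right)
  moreover have "\<sigma> x \<in> deg_space sc D k" using x by (simp add: deg_space_def)
  then have "sc (1/2) (x + \<sigma> x) \<in> deg_space sc D k" "sc (1/2) (x - \<sigma> x) \<in> deg_space sc D k"
    using x subspace_add[OF deg_subspace] subspace_diff[OF deg_subspace] subspace_scale[OF deg_subspace] by simp_all
  ultimately show "\<exists>a\<in>deg_space sc D k \<inter> par_space sc \<sigma> False. \<exists>b\<in>deg_space sc D k \<inter> par_space sc \<sigma> True. x = a + b"
    by blast
next
  fix i j x y assume "x \<in> deg_space sc D i" "y \<in> deg_space sc D j"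
  then show "br x y \<in> deg_space sc D (i + j)" by (simp add: deg_space_def D_br scale_left_distrib)
next
  fix F and f :: "int \<Rightarrow> 'b" and k assume "finite F \<and> (\<forall>k\<in>F. f k \<in> deg_space sc D k) \<and> sum f F = 0" "k \<in> F"
  then show "f k = 0" using deg_direct by blast
qed (use deg_subspace par_space_car span_deg in auto)

lemma z_deg: "D z = sc (-2) z" using bottom[of z] by (metis scale_one)

lemma Psi_D: "D (\<Psi> v) = - \<Psi> v" using Psi_deg by blast

text \<open>Both brackets have degree -3, below the bottom of the grading.\<close>

lemma br_z_Psi: "br z (\<Psi> v) = 0" "br (\<Psi> v) z = 0"
proof -
  have "- sc 2 y - y = - sc 3 y" "- y - sc 2 y = - sc 3 y" for y
    using scale_left_distrib[of 2 1 y] by (simp_all add: algebra_simps)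
  note e = this
  show "br z (\<Psi> v) = 0" by (rule below[of "-3"]) (simp_all add: D_br z_deg Psi_D e)
  show "br (\<Psi> v) z = 0" by (rule below[of "-3"]) (simp_all add: D_br z_deg Psi_D e)
qed

lemma Psi_cong: assumes "\<And>i. i < n \<Longrightarrow> v i = v' i" shows "\<Psi> v = \<Psi> v'"
proof -
  have "\<Psi> (\<lambda>i. (-1) * v' i + v i) = 0" unfolding Psi_0 using assms by simp
  then show ?thesis unfolding Psi_lin by simp
qed

end

text \<open>A subalgebra of \<open>K(1|n+2)\<close> built from \<open>L = K(1|n)\<close>: the triple \<open>(x, y, c)\<close> stands for
\<open>x + \<theta> y + c \<partial>\<^sub>\<theta>\<close> in the extension of \<open>L \<otimes> \<Lambda>(\<theta>)\<close> by \<open>\<partial>\<^sub>\<theta>\<close>. The new vectors \<open>\<theta> z\<close> and \<open>\<partial>\<^sub>\<theta>\<close> have degree \<open>-1\<close>,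
and \<open>[\<partial>\<^sub>\<theta>, \<theta> z] = z\<close>.\<close>

definition scX :: "(complex \<Rightarrow> 'b \<Rightarrow> 'b) \<Rightarrow> complex \<Rightarrow> 'b \<times> 'b \<times> complex \<Rightarrow> 'b \<times> 'b \<times> complex" where
  "scX sc a = (\<lambda>(x, y, c). (sc a x, sc a y, a * c))"

definition brX :: "(complex \<Rightarrow> 'b::ab_group_add \<Rightarrow> 'b) \<Rightarrow> ('b \<Rightarrow> 'b \<Rightarrow> 'b) \<Rightarrow> ('b \<Rightarrow> 'b) \<Rightarrow>
    'b \<times> 'b \<times> complex \<Rightarrow> 'b \<times> 'b \<times> complex \<Rightarrow> 'b \<times> 'b \<times> complex" where
  "brX sc br \<sigma> = (\<lambda>(x, y, c) (x', y', c').
     (br x x' + sc c y' + sc c' (\<sigma> y), br y x' + br (\<sigma> x) y', 0))"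

definition sX :: "('b \<Rightarrow> 'b::ab_group_add) \<Rightarrow> 'b \<times> 'b \<times> complex \<Rightarrow> 'b \<times> 'b \<times> complex" where
  "sX \<sigma> = (\<lambda>(x, y, c). (\<sigma> x, - \<sigma> y, - c))"

definition DX :: "('b \<Rightarrow> 'b::ab_group_add) \<Rightarrow> 'b \<times> 'b \<times> complex \<Rightarrow> 'b \<times> 'b \<times> complex" where
  "DX D = (\<lambda>(x, y, c). (D x, D y + y, - c))"

definition PsiX :: "(complex \<Rightarrow> 'b \<Rightarrow> 'b) \<Rightarrow> 'b \<Rightarrow> nat \<Rightarrow> ((nat \<Rightarrow> complex) \<Rightarrow> 'b) \<Rightarrow>
    (nat \<Rightarrow> complex) \<Rightarrow> 'b \<times> 'b \<times> complex" where
  "PsiX sc z n \<Psi> v = (\<Psi> v, sc (v n) z, v (Suc n))"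

text \<open>The symmetric form on the odd degree -1 part gains a hyperbolic plane, spanned by
  \<open>\<theta> z\<close> and \<open>\<partial>\<^sub>\<theta>\<close>.\<close>

definition QX :: "nat \<Rightarrow> ((nat \<Rightarrow> complex) \<Rightarrow> (nat \<Rightarrow> complex) \<Rightarrow> complex) \<Rightarrow>
    (nat \<Rightarrow> complex) \<Rightarrow> (nat \<Rightarrow> complex) \<Rightarrow> complex" where
  "QX n Q v w = Q v w + v n * w (Suc n) + v (Suc n) * w n"

text \<open>Interleaves the coordinates: \<open>c\<close> at place 0, those of \<open>x\<close> at
  the odd places, those of \<open>y\<close> at the positive even places.\<close>

definition iX :: "('b \<Rightarrow> nat \<Rightarrow> complex) \<Rightarrow> 'b \<times> 'b \<times> complex \<Rightarrow> nat \<Rightarrow> complex" where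
  "iX \<iota> = (\<lambda>(x, y, c) k. if k = 0 then c else if odd k then \<iota> x (k div 2) else \<iota> y (k div 2 - 1))"

lemma scX_apply [simp]: "scX sc a (x, y, c) = (sc a x, sc a y, a * c)" by (simp add: scX_def)
lemma brX_apply [simp]: "brX sc br \<sigma> (x, y, c) (x', y', c') =
     (br x x' + sc c y' + sc c' (\<sigma> y), br y x' + br (\<sigma> x) y', 0)" by (simp add: brX_def)
lemma sX_apply [simp]: "sX \<sigma> (x, y, c) = (\<sigma> x, - \<sigma> y, - c)" by (simp add: sX_def)
lemma DX_apply [simp]: "DX D (x, y, c) = (D x, D y + y, - c)" by (simp add: DX_def)

context contact
begin

lemma vector_spaceX: "vector_space (scX sc)"
  by unfold_locales (auto simp: scale_right_distrib scale_left_distrib algebra_simps)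

lemma deg_shift: "D y + y = sc a y \<longleftrightarrow> D y = sc (a - 1) y"
  by (auto simp: scale_left_diff_distrib algebra_simps)

text \<open>Bracketing with \<open>\<partial>\<^sub>\<theta>\<close> detects \<open>y\<close>,
  bracketing with \<open>\<theta> z\<close> detects \<open>[x, z]\<close>, and \<open>c\<close>
  vanishes since it has degree -1. What remains is the weak transitivity of the smaller algebra. In
  the extension \<open>z\<close> is itself a bracket of elements of degree -1, so transitivity holds
  there without referring to it.\<close>

lemma transX:
  assumes k: "0 \<le> k" and X: "DX D X = scX sc (of_int k) X" and v: "\<And>v. brX sc br \<sigma> X (PsiX sc z n \<Psi> v) = 0"
  shows "X = 0"
proof -
  obtain x y c where Xe: "X = (x, y, c)" by (cases X)
  have x: "D x = sc (of_int k) x" and c: "- c = of_int k * c" using X by (auto simp: Xe)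
  have "of_int (k + 1) * c = 0" using c by (simp add: algebra_simps) (metis add.right_inverse)
  moreover have "(of_int (k + 1) :: complex) \<noteq> 0" using k by (simp only: of_int_eq_0_iff)
  ultimately have c0: "c = 0" by (simp del: of_int_add)
  have p1: "\<Psi> (\<lambda>i. if i = Suc n then 1 else 0) = 0" "\<Psi> (\<lambda>i. if i = n then 1 else 0) = 0"
    unfolding Psi_0 by auto
  have "\<sigma> y = 0" using v[of "\<lambda>i. if i = Suc n then 1 else 0"]
    by (simp add: Xe PsiX_def p1 zero_prod_def)
  then have y0: "y = 0" using s_s[of y] by simp
  have "br (\<sigma> x) z = 0" using v[of "\<lambda>i. if i = n then 1 else 0"]
    by (simp add: Xe PsiX_def p1 zero_prod_def)
  then have "\<sigma> (br (\<sigma> x) z) = 0" by simp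
  then have "br x z = 0" by (simp add: z_even)
  moreover have "br x (\<Psi> u) = 0" for u using v[of u] by (simp add: Xe PsiX_def zero_prod_def c0 y0)
  ultimately have "x = 0" using weak[OF k x] by blast
  then show ?thesis by (simp add: Xe c0 y0 zero_prod_def)
qed

lemma par_spaceX: "(x, y, c) \<in> par_space (scX sc) (sX \<sigma>) p \<Longrightarrow>
    x \<in> par_space sc \<sigma> p \<and> y \<in> par_space sc \<sigma> (\<not> p) \<and> (c = 0 \<or> p)"
  by (cases p) (auto simp: par_space_def sgn_par_def minus_equation_iff)

lemma par_cases:
  "x \<in> par_space sc \<sigma> False \<Longrightarrow> \<sigma> x = x" "x \<in> par_space sc \<sigma> True \<Longrightarrow> \<sigma> x = - x"
  by (simp_all add: par_space_def sgn_par_def)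

lemma skewX:
  assumes "X \<in> par_space (scX sc) (sX \<sigma>) p" "Y \<in> par_space (scX sc) (sX \<sigma>) q"
  shows "brX sc br \<sigma> X Y = - scX sc (sgnp p q) (brX sc br \<sigma> Y X)"
proof -
  obtain x y c x' y' c' where e: "X = (x, y, c)" "Y = (x', y', c')" by (cases X, cases Y)
  note m = par_spaceX[OF assms(1)[unfolded e]] par_spaceX[OF assms(2)[unfolded e]]
  have sk: "br x' x = - sc (sgnp q p) (br x x')" "br y' x = - sc (sgnp (\<not> q) p) (br x y')"
    "br x' y = - sc (sgnp q (\<not> p)) (br y x')" using m skew by blast+
  show ?thesis unfolding e using m sk
    by (cases p; cases q) (auto simp: par_cases sgnp_def sgn_par_def)
qed

lemma jacX:
  assumes "X \<in> par_space (scX sc) (sX \<sigma>) p" "Y \<in> par_space (scX sc) (sX \<sigma>) q" "W \<in> par_space (scX sc) (sX \<sigma>) r"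
  shows "brX sc br \<sigma> X (brX sc br \<sigma> Y W) =
    brX sc br \<sigma> (brX sc br \<sigma> X Y) W + scX sc (sgnp p q) (brX sc br \<sigma> Y (brX sc br \<sigma> X W))"
proof -
  obtain x y c x' y' c' x'' y'' c'' where e: "X = (x, y, c)" "Y = (x', y', c')" "W = (x'', y'', c'')"
    by (cases X, cases Y, cases W)
  note m = par_spaceX[OF assms(1)[unfolded e]] par_spaceX[OF assms(2)[unfolded e]] par_spaceX[OF assms(3)[unfolded e]]
  have sk: "br x' y = - sc (sgnp q (\<not> p)) (br y x')" "br y' y = - sc (sgnp (\<not> q) (\<not> p)) (br y y')" using m skew by blast+
  have j: "br x (br x' x'') = br (br x x') x'' + sc (sgnp p q) (br x' (br x x''))"
    "br y (br x' x'') = br (br y x') x'' + sc (sgnp (\<not> p) q) (br x' (br y x''))"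
    "br x (br y' x'') = br (br x y') x'' + sc (sgnp p (\<not> q)) (br y' (br x x''))"
    "br x (br x' y'') = br (br x x') y'' + sc (sgnp p q) (br x' (br x y''))"
    using m jac by blast+
  show ?thesis unfolding e using m sk j
    by (cases p; cases q; cases r) (auto simp: par_cases sgnp_def sgn_par_def scale_right_distrib scale_right_diff_distrib algebra_simps)
qed

text \<open>The axioms reproduce themselves with \<open>n + 2\<close> in place of \<open>n\<close>,
  so the construction can be iterated.\<close>

lemma ext: "contact (scX sc) (brX sc br \<sigma>) (sX \<sigma>) (DX D) (z, 0, 0) (n + 2) (PsiX sc z n \<Psi>) (QX n Q) (iX \<iota>)"
proof -
  interpret X: vector_space "scX sc" by (rule vector_spaceX)
  show ?thesis
  proof (intro contact.intro contact_axioms.intro vector_spaceX)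
    fix a and X Y W :: "'b \<times> 'b \<times> complex"
    show "brX sc br \<sigma> (scX sc a X + Y) W = scX sc a (brX sc br \<sigma> X W) + brX sc br \<sigma> Y W"
      "brX sc br \<sigma> W (scX sc a X + Y) = scX sc a (brX sc br \<sigma> W X) + brX sc br \<sigma> W Y"
      "sX \<sigma> (scX sc a X + Y) = scX sc a (sX \<sigma> X) + sX \<sigma> Y"
      "sX \<sigma> (sX \<sigma> X) = X" "sX \<sigma> (brX sc br \<sigma> X Y) = brX sc br \<sigma> (sX \<sigma> X) (sX \<sigma> Y)"
      "DX D (scX sc a X + Y) = scX sc a (DX D X) + DX D Y" "DX D (sX \<sigma> X) = sX \<sigma> (DX D X)"
      "DX D (brX sc br \<sigma> X Y) = brX sc br \<sigma> (DX D X) Y + brX sc br \<sigma> X (DX D Y)"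
      "sX \<sigma> (z, 0, 0) = (z, 0, 0)" "(z, 0, 0) \<noteq> (0 :: 'b \<times> 'b \<times> complex)"
      by (cases X; cases Y; cases W; simp add: D_br z_even z_ne zero_prod_def scale_right_distrib scale_left_distrib algebra_simps)+
    show "iX \<iota> (scX sc a X + Y) = (\<lambda>i. a * iX \<iota> X i + iX \<iota> Y i)"
      by (cases X; cases Y) (auto simp: iX_def iota_lin)
    show "X = 0" if "iX \<iota> X = (\<lambda>_. 0)"
    proof -
      obtain x y c where e: "X = (x, y, c)" by (cases X)
      have "c = 0" using fun_cong[OF that, of 0] by (simp add: e iX_def)
      moreover have "\<iota> x j = 0" for j using fun_cong[OF that, of "Suc (2 * j)"] by (simp add: e iX_def)
      then have "x = 0" by (intro iota_0) auto
      moreover have "\<iota> y j = 0" for j using fun_cong[OF that, of "2 * Suc j"] by (simp add: e iX_def del: mult_Suc_right)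
      then have "y = 0" by (intro iota_0) auto
      ultimately show ?thesis by (simp add: e zero_prod_def)
    qed
    show "X \<in> X.span (\<Union>k. deg_space (scX sc) (DX D) k)"
    proof -
      let ?U = "\<Union>k. deg_space (scX sc) (DX D) k"
      obtain x y c where e: "X = (x, y, c)" by (cases X)
      have 1: "(x, 0, 0) \<in> X.span ?U" using span_deg[of x]
      proof (induction rule: span_induct_alt)
        case base show ?case using X.span_zero[of ?U] by (simp add: zero_prod_def)
      next
        case (step d a b)
        then obtain k where "a \<in> deg_space sc D k" by blast
        then have "(a, 0, 0) \<in> deg_space (scX sc) (DX D) k" by (simp add: deg_space_def)
        then have "scX sc d (a, 0, 0) + (b, 0, 0) \<in> X.span ?U" by (intro X.span_add X.span_scale step.IH X.span_base) blast
        then show ?case by simp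
      qed
      have 2: "(0, y, 0) \<in> X.span ?U" using span_deg[of y]
      proof (induction rule: span_induct_alt)
        case base show ?case using X.span_zero[of ?U] by (simp add: zero_prod_def)
      next
        case (step d a b)
        then obtain k where "a \<in> deg_space sc D k" by blast
        then have "(0, a, 0) \<in> deg_space (scX sc) (DX D) (k + 1)" by (simp add: deg_space_def scale_left_distrib)
        then have "scX sc d (0, a, 0) + (0, b, 0) \<in> X.span ?U" by (intro X.span_add X.span_scale step.IH X.span_base) blast
        then show ?case by simp
      qed
      have "(0, 0, c) \<in> deg_space (scX sc) (DX D) (-1)" by (simp add: deg_space_def)
      then have 3: "(0, 0, c) \<in> X.span ?U" by (intro X.span_base) blast
      show ?thesis using X.span_add[OF 1 X.span_add[OF 2 3]] by (simp add: e)
    qed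
  next
    fix B :: "('b \<times> 'b \<times> complex) set" assume B: "finite B"
    then obtain x where x: "x \<notin> span (fst ` B)" using inf by blast
    have "fst X \<in> span (fst ` B)" if "X \<in> X.span B" for X
      using that
    proof (induction rule: X.span_induct_alt)
      case base show ?case by (simp add: span_zero)
    next
      case (step d a b)
      have "fst a \<in> span (fst ` B)" using step.hyps span_base by blast
      then have "sc d (fst a) + fst b \<in> span (fst ` B)" by (intro span_add span_scale step.IH)
      then show ?case by (cases a) simp
    qed
    then show "\<exists>X. X \<notin> X.span B" using x by (metis fst_conv)
  next
    fix k and X :: "'b \<times> 'b \<times> complex" assume k: "k < -2" and X: "DX D X = scX sc (of_int k) X"
    obtain x y c where e: "X = (x, y, c)" by (cases X)
    have "x = 0" using X below[OF k] by (simp add: e)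
    moreover have "y = 0" using X below[of "k - 1" y] k by (simp add: e deg_shift)
    moreover have "of_int (k + 1) * c = 0" using X by (simp add: e algebra_simps) (metis add.right_inverse)
    moreover have "(of_int (k + 1) :: complex) \<noteq> 0" using k by (simp only: of_int_eq_0_iff)
    ultimately show "X = 0" by (simp add: e zero_prod_def del: of_int_add)
  next
    fix X :: "'b \<times> 'b \<times> complex"
    obtain x y c where e: "X = (x, y, c)" by (cases X)
    have "D y + y = sc (-2) y \<longleftrightarrow> y = 0" unfolding deg_shift using below[of "-3" y] by auto
    moreover have "- c = -2 * c \<longleftrightarrow> c = 0" by auto
    ultimately show "DX D X = scX sc (-2) X \<longleftrightarrow> (\<exists>a. X = scX sc a (z, 0, 0))"
      unfolding e using bottom[of x] by simp
    have "D y + y = - y \<longleftrightarrow> (\<exists>a. y = sc a z)" using deg_shift[of y "-1"] bottom[of y] by simp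
    then have *: "DX D X = - X \<longleftrightarrow> (\<exists>v. x = \<Psi> v) \<and> (\<exists>a. y = sc a z)" unfolding e by (simp add: Psi_deg)
    show "DX D X = - X \<longleftrightarrow> (\<exists>v. X = PsiX sc z n \<Psi> v)"
    proof
      assume "DX D X = - X"
      then obtain v a where v: "x = \<Psi> v" "y = sc a z" using * by blast
      define u where "u i = (if i < n then v i else if i = n then a else c)" for i
      have "\<Psi> u = \<Psi> v" by (rule Psi_cong) (simp add: u_def)
      then have "X = PsiX sc z n \<Psi> u" by (simp add: PsiX_def e v u_def)
      then show "\<exists>v. X = PsiX sc z n \<Psi> v" by blast
    next
      assume "\<exists>v. X = PsiX sc z n \<Psi> v"
      then show "DX D X = - X" using * by (auto simp: PsiX_def e)
    qed
  next
    fix a v v'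
    show "PsiX sc z n \<Psi> (\<lambda>i. a * v i + v' i) = scX sc a (PsiX sc z n \<Psi> v) + PsiX sc z n \<Psi> v'"
      by (simp add: PsiX_def Psi_lin scale_left_distrib)
    show "sX \<sigma> (PsiX sc z n \<Psi> v) = - PsiX sc z n \<Psi> v" by (simp add: PsiX_def Psi_odd z_even)
    show "PsiX sc z n \<Psi> v = 0 \<longleftrightarrow> (\<forall>i<n + 2. v i = 0)"
      using z_ne by (auto simp: PsiX_def Psi_0 zero_prod_def less_Suc_eq)
    show "brX sc br \<sigma> (PsiX sc z n \<Psi> v) (PsiX sc z n \<Psi> v') = scX sc (QX n Q v v') (z, 0, 0)"
      by (simp add: PsiX_def QX_def Psi_br Psi_odd br_z_Psi z_even scale_left_distrib mult.commute)
  qed (use skewX jacX transX in blast)+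
qed

lemma transitiveX: "transitive_gr (brX sc br \<sigma>) (deg_space (scX sc) (DX D))"
proof -
  interpret X: contact "scX sc" "brX sc br \<sigma>" "sX \<sigma>" "DX D" "(z, 0, 0)" "n + 2" "PsiX sc z n \<Psi>" "QX n Q" "iX \<iota>" by (rule ext)
  show ?thesis unfolding transitive_gr_def
  proof (intro allI impI ballI)
    fix k :: int and X assume k: "0 \<le> k" and X: "X \<in> deg_space (scX sc) (DX D) k"
      and *: "\<forall>Y\<in>deg_space (scX sc) (DX D) (-1). brX sc br \<sigma> X Y = 0"
    have "PsiX sc z n \<Psi> v \<in> deg_space (scX sc) (DX D) (-1)" for v using X.Psi_D by (simp add: deg_space_def)
    then have "brX sc br \<sigma> X (PsiX sc z n \<Psi> v) = 0" for v using * by blast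
    moreover have "DX D X = scX sc (of_int k) X" using X by (simp add: deg_space_def)
    ultimately show "X = 0" using transX[OF k] by blast
  qed
qed

end

section \<open>Base cases of the contact construction\<close>

definition tt :: "complex poly" where "tt = [:0, 1:]"

lemma pderiv_tt [simp]: "pderiv tt = 1" by (simp add: tt_def pderiv_pCons)

lemma coeff_tt_pderiv [simp]: "coeff (tt * pderiv f) i = of_nat i * coeff f i"
  by (cases i) (simp_all add: tt_def coeff_pderiv)

lemma pderiv_double [simp]: "pderiv (2 * f) = 2 * pderiv (f :: complex poly)"
  by (simp only: mult_2 pderiv_add)

lemma coeff_double [simp]: "coeff (2 * f) i = 2 * coeff (f :: complex poly) i"
  by (simp only: mult_2 coeff_add)

lemma const_of_pderiv: "pderiv f = 0 \<Longrightarrow> \<exists>c. f = [:c:]" for f :: "complex poly"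
  by (metis pderiv_eq_0_iff degree_eq_zeroE)

lemma const_iff: "(\<forall>i. i \<noteq> 0 \<longrightarrow> coeff f i = 0) \<longleftrightarrow> (\<exists>c. f = [:c:])" for f :: "complex poly"
proof
  assume *: "\<forall>i. i \<noteq> 0 \<longrightarrow> coeff f i = 0"
  have "coeff f i = coeff [:coeff f 0:] i" for i using * by (cases i) simp_all
  then show "\<exists>c. f = [:c:]" using poly_eqI by blast
next
  assume "\<exists>c. f = [:c:]"
  then obtain c where "f = [:c:]" by blast
  then show "\<forall>i. i \<noteq> 0 \<longrightarrow> coeff f i = 0" by (metis coeff_pCons_Suc coeff_0 not0_implies_Suc)
qed

lemma smult_1_const: "smult a 1 = [:a:]" for a :: complex by (simp add: one_pCons)

text \<open>The Neveu-Schwarz superalgebra \<open>K(1|1)\<close> on pairs of polynomials in \<open>t\<close>, rescaled to avoid halves.\<close>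

definition ns_sc :: "complex \<Rightarrow> complex poly \<times> complex poly \<Rightarrow> complex poly \<times> complex poly" where
  "ns_sc a = (\<lambda>(f, g). (smult a f, smult a g))"

definition ns_br :: "complex poly \<times> complex poly \<Rightarrow> complex poly \<times> complex poly \<Rightarrow> complex poly \<times> complex poly" where
  "ns_br = (\<lambda>(f, g) (f', g'). (2 * (f * pderiv f' - pderiv f * f') + g * g',
     2 * (f * pderiv g') - pderiv f * g' - 2 * (f' * pderiv g) + pderiv f' * g))"

definition ns_par :: "complex poly \<times> complex poly \<Rightarrow> complex poly \<times> complex poly" where
  "ns_par = (\<lambda>(f, g). (f, - g))"

definition ns_deg :: "complex poly \<times> complex poly \<Rightarrow> complex poly \<times> complex poly" where
  "ns_deg = (\<lambda>(f, g). (2 * (tt * pderiv f) - 2 * f, 2 * (tt * pderiv g) - g))"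

definition ns_coord :: "complex poly \<times> complex poly \<Rightarrow> nat \<Rightarrow> complex" where
  "ns_coord = (\<lambda>(f, g) k. if even k then coeff f (k div 2) else coeff g (k div 2))"

lemma ns_apply [simp]:
  "ns_sc a (f, g) = (smult a f, smult a g)"
  "ns_br (f, g) (f', g') = (2 * (f * pderiv f' - pderiv f * f') + g * g',
     2 * (f * pderiv g') - pderiv f * g' - 2 * (f' * pderiv g) + pderiv f' * g)"
  "ns_par (f, g) = (f, - g)"
  "ns_deg (f, g) = (2 * (tt * pderiv f) - 2 * f, 2 * (tt * pderiv g) - g)"
  by (simp_all add: ns_sc_def ns_br_def ns_par_def ns_deg_def)

lemma minus_eq_self: "- f = f \<longleftrightarrow> f = (0 :: complex poly)" "f = - f \<longleftrightarrow> f = (0 :: complex poly)"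
  by (auto simp: poly_eq_iff)

lemma ns_parity: "(f, g) \<in> par_space ns_sc ns_par p \<longleftrightarrow> (if p then f = 0 else g = 0)"
  by (cases p) (auto simp: par_space_def sgn_par_def minus_eq_self)

lemma ns_deg_eq: "ns_deg (f, g) = ns_sc a (f, g) \<longleftrightarrow>
    (\<forall>i. (2 * of_nat i - 2 - a) * coeff f i = 0) \<and> (\<forall>i. (2 * of_nat i - 1 - a) * coeff g i = 0)"
  by (simp only: ns_apply prod.inject poly_eq_iff coeff_diff coeff_double coeff_tt_pderiv coeff_smult)
    (simp only: algebra_simps add_0_left add_0_right mult_1_left)

lemmas poly_diff_simps = pderiv_mult pderiv_add pderiv_diff pderiv_minus pderiv_smult smult_add_right smult_diff_right

lemma odd_neq_even: "2 * of_nat i - 1 - 2 * of_int k \<noteq> (0 :: complex)"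
proof
  assume "2 * of_nat i - 1 - 2 * of_int k = (0 :: complex)"
  then have "of_int (2 * int i - 1 - 2 * k) = (0 :: complex)" by simp
  then have "2 * int i - 1 - 2 * k = 0" by (simp only: of_int_eq_0_iff)
  then show False by presburger
qed

lemma nat_neq_neg: "k < 0 \<Longrightarrow> of_nat i - of_int k \<noteq> (0 :: complex)"
proof
  assume k: "k < 0" and "of_nat i - of_int k = (0 :: complex)"
  then have "of_int (int i - k) = (0 :: complex)" by simp
  then have "int i - k = 0" by (simp only: of_int_eq_0_iff)
  then show False using k by simp
qed

lemma contact_ns: "contact ns_sc ns_br ns_par ns_deg (1, 0) 1 (\<lambda>v. (0, [:v 0:])) (\<lambda>v w. v 0 * w 0) ns_coord"
proof -
  have vs: "vector_space ns_sc" by unfold_locales (auto simp: smult_add_right smult_add_left)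
  interpret X: vector_space ns_sc by (rule vs)
  show ?thesis
  proof (intro contact.intro contact_axioms.intro vs)
    fix a and X Y W :: "complex poly \<times> complex poly"
    show "ns_br (ns_sc a X + Y) W = ns_sc a (ns_br X W) + ns_br Y W"
      "ns_br W (ns_sc a X + Y) = ns_sc a (ns_br W X) + ns_br W Y"
      "ns_par (ns_sc a X + Y) = ns_sc a (ns_par X) + ns_par Y"
      "ns_par (ns_par X) = X" "ns_par (ns_br X Y) = ns_br (ns_par X) (ns_par Y)"
      "ns_deg (ns_sc a X + Y) = ns_sc a (ns_deg X) + ns_deg Y" "ns_deg (ns_par X) = ns_par (ns_deg X)"
      "ns_deg (ns_br X Y) = ns_br (ns_deg X) Y + ns_br X (ns_deg Y)"
      "ns_par (1, 0) = (1, 0)" "(1, 0) \<noteq> (0 :: complex poly \<times> complex poly)"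
      by (cases X; cases Y; cases W; simp add: poly_diff_simps zero_prod_def algebra_simps)+
    show "ns_coord (ns_sc a X + Y) = (\<lambda>i. a * ns_coord X i + ns_coord Y i)"
      by (cases X; cases Y) (auto simp: ns_coord_def)
    show "X = 0" if "ns_coord X = (\<lambda>_. 0)"
    proof -
      obtain f g where e: "X = (f, g)" by (cases X)
      have "coeff f j = 0" "coeff g j = 0" for j
        using fun_cong[OF that, of "2 * j"] fun_cong[OF that, of "Suc (2 * j)"] by (simp_all add: e ns_coord_def)
      then show ?thesis by (simp add: e zero_prod_def poly_eq_iff)
    qed
    show "X \<in> X.span (\<Union>k. deg_space ns_sc ns_deg k)"
    proof -
      obtain f g where e: "X = (f, g)" by (cases X)
      have 1: "(monom c i, 0) \<in> deg_space ns_sc ns_deg (2 * int i - 2)" "(0, monom c i) \<in> deg_space ns_sc ns_deg (2 * int i - 1)" for c i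
        unfolding deg_space_def mem_Collect_eq ns_deg_eq by auto
      have "X = (\<Sum>i\<le>degree f. (monom (coeff f i) i, 0)) + (\<Sum>i\<le>degree g. (0, monom (coeff g i) i))"
        by (simp add: e prod_eq_iff fst_sum snd_sum poly_as_sum_of_monoms)
      moreover have "\<dots> \<in> X.span (\<Union>k. deg_space ns_sc ns_deg k)"
        by (intro X.span_add X.span_sum X.span_base) (use 1 in blast)+
      ultimately show ?thesis by simp
    qed
  next
    fix p q and X Y :: "complex poly \<times> complex poly"
    assume "X \<in> par_space ns_sc ns_par p" "Y \<in> par_space ns_sc ns_par q"
    then show "ns_br X Y = - ns_sc (sgnp p q) (ns_br Y X)"
      by (cases X; cases Y; cases p; cases q) (auto simp: ns_parity sgn_par_def algebra_simps)
  next
    fix p q r and X Y W :: "complex poly \<times> complex poly"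
    assume "X \<in> par_space ns_sc ns_par p" "Y \<in> par_space ns_sc ns_par q" "W \<in> par_space ns_sc ns_par r"
    then show "ns_br X (ns_br Y W) = ns_br (ns_br X Y) W + ns_sc (sgnp p q) (ns_br Y (ns_br X W))"
      by (cases X; cases Y; cases W; cases p; cases q; cases r)
        (auto simp: ns_parity sgn_par_def poly_diff_simps algebra_simps)
  next
    fix B :: "(complex poly \<times> complex poly) set" assume B: "finite B"
    define N where "N = Suc (Max (insert 0 ((\<lambda>b. degree (fst b)) ` B)))"
    have N: "degree (fst b) < N" if "b \<in> B" for b unfolding N_def less_Suc_eq_le using B that by (intro Max_ge) auto
    have "coeff (fst X) N = 0" if "X \<in> X.span B" for X
      using that
    proof (induction rule: X.span_induct_alt)
      case (step d a b)
      then show ?case using N[of a] by (cases a) (simp add: coeff_eq_0)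
    qed simp
    then have "(monom 1 N, 0) \<notin> X.span B" by fastforce
    then show "\<exists>X. X \<notin> X.span B" by blast
  next
    fix k and X :: "complex poly \<times> complex poly" assume k: "k < -2" and X: "ns_deg X = ns_sc (of_int k) X"
    obtain f g where e: "X = (f, g)" by (cases X)
    have "2 * of_nat i - 2 - of_int k \<noteq> (0 :: complex)" "2 * of_nat i - 1 - of_int k \<noteq> (0 :: complex)" for i
      using nat_neq_neg[of "k + 2" "2 * i"] nat_neq_neg[of "k + 1" "2 * i"] k by (auto simp: algebra_simps)
    then show "X = 0" using X unfolding e ns_deg_eq by (auto simp: zero_prod_def poly_eq_iff)
  next
    fix X :: "complex poly \<times> complex poly"
    obtain f g where e: "X = (f, g)" by (cases X)
    have "2 * of_nat i - 1 - (- 2) \<noteq> (0 :: complex)" for i using odd_neq_even[of i "-1"] by simp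
    then have "ns_deg X = ns_sc (-2) X \<longleftrightarrow> (\<forall>i. i \<noteq> 0 \<longrightarrow> coeff f i = 0) \<and> g = 0"
      unfolding e ns_deg_eq by (auto simp: poly_eq_iff; metis less_irrefl)
    also have "\<dots> \<longleftrightarrow> (\<exists>a. X = ns_sc a (1, 0))"
      unfolding const_iff by (auto simp: e smult_1_const)
    finally show "ns_deg X = ns_sc (-2) X \<longleftrightarrow> (\<exists>a. X = ns_sc a (1, 0))" .
    have "2 * of_nat i - 2 - (- 1) \<noteq> (0 :: complex)" for i using odd_neq_even[of i 0] by simp
    then have "ns_deg X = ns_sc (-1) X \<longleftrightarrow> f = 0 \<and> (\<forall>i. i \<noteq> 0 \<longrightarrow> coeff g i = 0)"
      unfolding e ns_deg_eq by (auto simp: poly_eq_iff; metis less_irrefl)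
    also have "\<dots> \<longleftrightarrow> (\<exists>v :: nat \<Rightarrow> complex. X = (0, [:v 0:]))"
    proof
      assume "f = 0 \<and> (\<forall>i. i \<noteq> 0 \<longrightarrow> coeff g i = 0)"
      then obtain c where "X = (0, [:c:])" unfolding const_iff e by blast
      then show "\<exists>v :: nat \<Rightarrow> complex. X = (0, [:v 0:])" by (intro exI[of _ "\<lambda>_. c"])
    next
      assume "\<exists>v :: nat \<Rightarrow> complex. X = (0, [:v 0:])"
      then have "f = 0 \<and> (\<exists>c. g = [:c:])" by (auto simp: e)
      then show "f = 0 \<and> (\<forall>i. i \<noteq> 0 \<longrightarrow> coeff g i = 0)" unfolding const_iff .
    qed
    finally show "ns_deg X = - X \<longleftrightarrow> (\<exists>v :: nat \<Rightarrow> complex. X = (0, [:v 0:]))" by simp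
  next
    fix k and X :: "complex poly \<times> complex poly" assume k: "0 \<le> k" and X: "ns_deg X = ns_sc (of_int k) X"
      and *: "\<And>v :: nat \<Rightarrow> complex. ns_br X (0, [:v 0:]) = 0"
    obtain f g where e: "X = (f, g)" by (cases X)
    \<comment> \<open>The components of this bracket are \<open>g\<close> and minus the derivative
      of \<open>f\<close>. What survives is a constant \<open>f\<close>, which has degree -2 and is
      excluded by the nonnegative degree.\<close>
    have "ns_br (f, g) (0, 1) = 0" using *[of "\<lambda>_. 1"] by (simp add: e one_pCons)
    then have g: "g = 0" and "pderiv f = 0" by (simp_all add: zero_prod_def)
    then obtain c where c: "f = [:c:]" using const_of_pderiv by blast
    have "(2 * of_nat 0 - 2 - of_int k) * coeff f 0 = 0" using X unfolding e ns_deg_eq by blast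
    then have "of_int (-2 - k) * coeff f 0 = 0" by simp
    moreover have "(of_int (-2 - k) :: complex) \<noteq> 0" using k by (simp only: of_int_eq_0_iff)
    ultimately have "c = 0" unfolding mult_eq_0_iff using c by simp
    then show "X = 0" using c g by (simp add: e zero_prod_def)
  next
    fix a and v v' :: "nat \<Rightarrow> complex"
    show "(0, [:a * v 0 + v' 0:]) = ns_sc a (0, [:v 0:]) + (0, [:v' 0:])" by simp
    show "ns_par (0, [:v 0:]) = - (0, [:v 0:])" by simp
    show "(0, [:v 0:]) = (0 :: complex poly \<times> complex poly) \<longleftrightarrow> (\<forall>i<1. v i = 0)" by (simp add: zero_prod_def)
    show "ns_br (0, [:v 0:]) (0, [:v' 0:]) = ns_sc (v 0 * v' 0) (1, 0)" by (simp add: smult_1_const pderiv_pCons)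
  qed
qed

text \<open>Polynomial vector fields on the line, that is \<open>K(1|0)\<close>. The degree operator
  below is doubled so that the constant field has degree -2; degree -1 is then zero, and elements of
  nonnegative degree can be detected only by \<open>z\<close>.\<close>

definition wt_br :: "complex poly \<Rightarrow> complex poly \<Rightarrow> complex poly" where
  "wt_br f g = f * pderiv g - pderiv f * g"

definition wt_deg :: "complex poly \<Rightarrow> complex poly" where
  "wt_deg f = 2 * (tt * pderiv f) - 2 * f"

lemma wt_parity: "f \<in> par_space smult id p \<longleftrightarrow> (if p then f = 0 else True)"
  by (cases p) (auto simp: par_space_def sgn_par_def minus_eq_self)

lemma wt_deg_eq: "wt_deg f = smult a f \<longleftrightarrow> (\<forall>i. (2 * of_nat i - 2 - a) * coeff f i = 0)"
  by (simp only: wt_deg_def poly_eq_iff coeff_diff coeff_double coeff_tt_pderiv coeff_smult)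
    (simp only: algebra_simps add_0_left add_0_right mult_1_left)

lemma contact_wt: "contact smult wt_br id wt_deg 1 0 (\<lambda>v. 0) (\<lambda>v w. 0) coeff"
proof -
  have vs: "vector_space (smult :: complex \<Rightarrow> _)" by unfold_locales (auto simp: smult_add_right smult_add_left)
  interpret X: vector_space "smult :: complex \<Rightarrow> _" by (rule vs)
  show ?thesis
  proof (intro contact.intro contact_axioms.intro vs)
    fix a and X Y W :: "complex poly"
    show "wt_br (smult a X + Y) W = smult a (wt_br X W) + wt_br Y W"
      "wt_br W (smult a X + Y) = smult a (wt_br W X) + wt_br W Y"
      "wt_deg (smult a X + Y) = smult a (wt_deg X) + wt_deg Y"
      "wt_deg (wt_br X Y) = wt_br (wt_deg X) Y + wt_br X (wt_deg Y)"
      by (simp_all add: wt_br_def wt_deg_def poly_diff_simps algebra_simps)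
    show "X \<in> X.span (\<Union>k. deg_space smult wt_deg k)"
    proof -
      have 1: "monom c i \<in> deg_space smult wt_deg (2 * int i - 2)" for c i
        unfolding deg_space_def mem_Collect_eq wt_deg_eq by auto
      have "(\<Sum>i\<le>degree X. monom (coeff X i) i) \<in> X.span (\<Union>k. deg_space smult wt_deg k)"
        by (intro X.span_sum X.span_base) (use 1 in blast)
      then show ?thesis by (simp add: poly_as_sum_of_monoms)
    qed
  next
    fix p q and X Y :: "complex poly"
    assume "X \<in> par_space smult id p" "Y \<in> par_space smult id q"
    then show "wt_br X Y = - smult (sgnp p q) (wt_br Y X)"
      by (cases p; cases q) (auto simp: wt_parity wt_br_def sgn_par_def algebra_simps)
  next
    fix p q r and X Y W :: "complex poly"
    assume "X \<in> par_space smult id p" "Y \<in> par_space smult id q" "W \<in> par_space smult id r"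
    then show "wt_br X (wt_br Y W) = wt_br (wt_br X Y) W + smult (sgnp p q) (wt_br Y (wt_br X W))"
      by (cases p; cases q; cases r) (auto simp: wt_parity wt_br_def sgn_par_def poly_diff_simps algebra_simps)
  next
    fix B :: "complex poly set" assume B: "finite B"
    define N where "N = Suc (Max (insert 0 (degree ` B)))"
    have N: "degree b < N" if "b \<in> B" for b unfolding N_def less_Suc_eq_le using B that by (intro Max_ge) auto
    have "coeff X N = 0" if "X \<in> X.span B" for X
      using that
    proof (induction rule: X.span_induct_alt)
      case (step d a b)
      then show ?case using N[of a] by (simp add: coeff_eq_0)
    qed simp
    then have "monom 1 N \<notin> X.span B" by fastforce
    then show "\<exists>X. X \<notin> X.span B" by blast
  next
    fix k and X :: "complex poly" assume k: "k < -2" and X: "wt_deg X = smult (of_int k) X"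
    have "2 * of_nat i - 2 - of_int k \<noteq> (0 :: complex)" for i
      using nat_neq_neg[of "k + 2" "2 * i"] k by (auto simp: algebra_simps)
    then show "X = 0" using X unfolding wt_deg_eq by (auto simp: poly_eq_iff)
  next
    fix X :: "complex poly"
    have "wt_deg X = smult (-2) X \<longleftrightarrow> (\<forall>i. i \<noteq> 0 \<longrightarrow> coeff X i = 0)"
      unfolding wt_deg_eq by (auto; metis less_irrefl)
    also have "\<dots> \<longleftrightarrow> (\<exists>a. X = smult a 1)"
      unfolding const_iff by (simp add: smult_1_const)
    finally show "wt_deg X = smult (-2) X \<longleftrightarrow> (\<exists>a. X = smult a 1)" .
    have "2 * of_nat i - 2 - (- 1) \<noteq> (0 :: complex)" for i using odd_neq_even[of i 0] by simp
    then have "wt_deg X = smult (-1) X \<longleftrightarrow> X = 0"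
      unfolding wt_deg_eq by (auto simp: poly_eq_iff)
    then show "wt_deg X = - X \<longleftrightarrow> (\<exists>v :: nat \<Rightarrow> complex. X = 0)" by simp
  next
    fix k and X :: "complex poly" assume k: "0 \<le> k" and X: "wt_deg X = smult (of_int k) X" and *: "wt_br X 1 = 0"
    have "pderiv X = 0" using * by (simp add: wt_br_def)
    then obtain c where c: "X = [:c:]" using const_of_pderiv by blast
    have "(2 * of_nat 0 - 2 - of_int k) * coeff X 0 = 0" using X unfolding wt_deg_eq by blast
    then have "of_int (-2 - k) * coeff X 0 = 0" by simp
    moreover have "(of_int (-2 - k) :: complex) \<noteq> 0" using k by (simp only: of_int_eq_0_iff)
    ultimately have "c = 0" unfolding mult_eq_0_iff using c by simp
    then show "X = 0" using c by simp
  next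
    fix X :: "complex poly" assume "coeff X = (\<lambda>_. 0)"
    then show "X = 0" by (intro poly_eqI) simp
  qed (simp_all add: wt_br_def fun_eq_iff)
qed

type_synonym 'b ext = "'b \<times> 'b \<times> complex"

text \<open>The degree -1 part of the odd contact grading has dimension 7 = 1 + 2 + 2 + 2 for G(3),
  reached by three extensions of the Neveu-Schwarz superalgebra. For F(4) the dimension is 8,
  reached from the case \<open>n = 0\<close> in four.\<close>

lemma contact_odd:
  "\<exists>(sc' :: complex \<Rightarrow> (complex poly \<times> complex poly) ext ext ext \<Rightarrow> _) br' \<sigma> D z \<Psi> \<iota>.
     contact sc' br' \<sigma> D z 7 \<Psi> (QX 5 (QX 3 (QX 1 (\<lambda>v w. v 0 * w 0)))) \<iota> \<and> transitive_gr br' (deg_space sc' D)"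
proof -
  have e: "(1::nat) + 2 = 3" "(3::nat) + 2 = 5" "(5::nat) + 2 = 7" by simp_all
  note c1 = contact.ext[OF contact_ns, unfolded e]
  note c2 = contact.ext[OF c1, unfolded e]
  show ?thesis using contact.ext[OF c2, unfolded e] contact.transitiveX[OF c2] by blast
qed

lemma contact_even:
  "\<exists>(sc' :: complex \<Rightarrow> complex poly ext ext ext ext \<Rightarrow> _) br' \<sigma> D z \<Psi> \<iota>.
     contact sc' br' \<sigma> D z 8 \<Psi> (QX 6 (QX 4 (QX 2 (QX 0 (\<lambda>v w. 0))))) \<iota> \<and> transitive_gr br' (deg_space sc' D)"
proof -
  have e: "(0::nat) + 2 = 2" "(2::nat) + 2 = 4" "(4::nat) + 2 = 6" "(6::nat) + 2 = 8" by simp_all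
  note c1 = contact.ext[OF contact_wt, unfolded e]
  note c2 = contact.ext[OF c1, unfolded e]
  note c3 = contact.ext[OF c2, unfolded e]
  show ?thesis using contact.ext[OF c3, unfolded e] contact.transitiveX[OF c3] by blast
qed

section \<open>Infinite prolongation from a contact superalgebra\<close>

context tanaka
begin

lemma G_zero_br: assumes "\<And>k. k < -2 \<Longrightarrow> G k = {0}" "x \<in> G i" "y \<in> G j" "i + j < -2" shows "br x y = 0"
  using G_br[OF assms(2,3)] assms(1)[OF assms(4)] by simp

text \<open>Both negative parts are Heisenberg superalgebras: \<xi> and \<zeta> are coordinates on
  degrees -1 and -2 in which the bracket of \<open>m\<close> becomes the form \<open>Q\<close>.
  Matching coordinates makes the contact superalgebra a transitive extension of
  \<open>m\<close>.\<close>

lemma contact_infinite: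
  fixes sc' :: "complex \<Rightarrow> 'c::ab_group_add \<Rightarrow> 'c"
  assumes con: "contact sc' br' \<sigma> D z n \<Psi> Q \<iota>" and trn: "transitive_gr br' (deg_space sc' D)"
    and deep: "\<And>k. k < -2 \<Longrightarrow> G k = {0}"
    and xi_lin: "\<And>a x y. x \<in> car P \<Longrightarrow> y \<in> car P \<Longrightarrow> \<xi> (sc a x + y) = (\<lambda>i. a * \<xi> x i + \<xi> y i)"
    and ze_lin: "\<And>a x y. x \<in> car P \<Longrightarrow> y \<in> car P \<Longrightarrow> \<zeta> (sc a x + y) = a * \<zeta> x + \<zeta> y"
    and ze_1: "\<And>x. x \<in> G (-1) \<Longrightarrow> \<zeta> x = 0" and xi_2: "\<And>x i. x \<in> G (-2) \<Longrightarrow> i < n \<Longrightarrow> \<xi> x i = 0"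
    and onto1: "\<And>v. \<exists>x\<in>G (-1). \<forall>i<n. \<xi> x i = v i" and inj1: "\<And>x. x \<in> G (-1) \<Longrightarrow> (\<And>i. i < n \<Longrightarrow> \<xi> x i = 0) \<Longrightarrow> x = 0"
    and u: "u \<in> G (-2)" "u \<in> P False" "\<zeta> u = 1" and inj2: "\<And>x. x \<in> G (-2) \<Longrightarrow> x = sc (\<zeta> x) u"
    and odd1: "G (-1) \<subseteq> P True"
    and br1: "\<And>x y. x \<in> G (-1) \<Longrightarrow> y \<in> G (-1) \<Longrightarrow> br x y = sc (Q (\<xi> x) (\<xi> y)) u"
  shows "pr_infinite sc P br G"
proof -
  interpret C: contact sc' br' \<sigma> D z n \<Psi> Q \<iota> by (rule con)
  let ?P = "par_space sc' \<sigma>" and ?G = "deg_space sc' D"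
  have vs: "vector_space sc'" by (rule C.vector_space_axioms)
  define \<phi> where "\<phi> x = \<Psi> (\<xi> x) + sc' (\<zeta> x) z" for x
  have phl: "\<phi> (sc a x + y) = sc' a (\<phi> x) + \<phi> y" if "x \<in> car P" "y \<in> car P" for a x y
    using that by (simp add: \<phi>_def xi_lin ze_lin C.Psi_lin C.scale_right_distrib C.scale_left_distrib)
  have ph1: "\<phi> x = \<Psi> (\<xi> x)" if "x \<in> G (-1)" for x using ze_1[OF that] by (simp add: \<phi>_def)
  have ph2: "\<phi> x = sc' (\<zeta> x) z" if "x \<in> G (-2)" for x
  proof -
    have "\<Psi> (\<xi> x) = 0" unfolding C.Psi_0 using xi_2[OF that] by blast
    then show ?thesis by (simp add: \<phi>_def)
  qed
  have p0: "\<phi> 0 = 0" using phl[of 0 0 1] by simp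
  have g1: "?G (-1) = range \<Psi>" unfolding deg_space_def using C.Psi_deg by auto
  have g2: "?G (-2) = range (\<lambda>a. sc' a z)" unfolding deg_space_def using C.bottom by auto
  have g3: "?G k = {0}" if "k < -2" for k unfolding deg_space_def using C.below[OF that] by auto
  have negc: "k = -1 \<or> k = -2 \<or> k < -2" if "k < 0" for k :: int using that by linarith
  have even2: "G (-2) \<subseteq> P False"
    using inj2 u(2) subspace_scale[OF subspace_P] by (metis subsetI)
  have cap: "A \<inter> P q = {0}" if A: "A \<subseteq> P (\<not> q)" "0 \<in> A" for A q
  proof (intro equalityI subsetI)
    fix x assume "x \<in> A \<inter> P q"
    then show "x \<in> {0}" using A(1) P_other[of x "\<not> q" q] by auto
  qed (use A in simp)
  have capC: "A \<inter> ?P q = {0}" if A: "A \<subseteq> ?P (\<not> q)" "0 \<in> A" for A q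
  proof (intro equalityI subsetI)
    fix x assume "x \<in> A \<inter> ?P q"
    then show "x \<in> {0}" using A(1) C.L.P_other[of x "\<not> q" q] by auto
  qed (use A in simp)
  have phbij: "bij_betw \<phi> (G k) (?G k)" if k: "k < 0" for k
    using negc[OF k]
  proof (elim disjE)
    assume k: "k = -1"
    have "\<phi> ` G (-1) = range \<Psi>"
    proof (intro equalityI subsetI)
      fix y assume "y \<in> range \<Psi>"
      then obtain v where v: "y = \<Psi> v" by blast
      obtain x where x: "x \<in> G (-1)" "\<forall>i<n. \<xi> x i = v i" using onto1 by blast
      then have "\<phi> x = y" unfolding v ph1[OF x(1)] by (intro C.Psi_cong) simp
      then show "y \<in> \<phi> ` G (-1)" using x by blast
    qed (auto simp: ph1)
    moreover have "inj_on \<phi> (G (-1))"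
    proof (rule inj_onI)
      fix x y assume xy: "x \<in> G (-1)" "y \<in> G (-1)" "\<phi> x = \<phi> y"
      let ?d = "sc (-1) x + y"
      have d: "?d \<in> G (-1)" using xy by (intro G_simps)
      have "\<phi> ?d = sc' (-1) (\<phi> x) + \<phi> y" using phl G_car xy by blast
      then have "\<Psi> (\<xi> ?d) = 0" using ph1[OF d] xy by simp
      then have "?d = 0" using inj1[OF d] unfolding C.Psi_0 by blast
      then show "x = y" by simp
    qed
    ultimately show ?thesis unfolding k g1 bij_betw_def by blast
  next
    assume k: "k = -2"
    have "\<phi> ` G (-2) = range (\<lambda>a. sc' a z)"
    proof (intro equalityI subsetI)
      fix y assume "y \<in> range (\<lambda>a. sc' a z)"
      then obtain a where a: "y = sc' a z" by blast
      have "\<phi> (sc a u) = y" using phl[of u 0 a] G_car[OF u(1)] ph2[OF u(1)] p0 u(3) a by simp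
      then show "y \<in> \<phi> ` G (-2)" using u(1) by (metis G_simps(5) image_eqI)
    qed (auto simp: ph2)
    moreover have "inj_on \<phi> (G (-2))"
    proof (rule inj_onI)
      fix x y assume xy: "x \<in> G (-2)" "y \<in> G (-2)" "\<phi> x = \<phi> y"
      then have "\<zeta> x = \<zeta> y" using ph2 C.z_ne C.scale_right_imp_eq by metis
      then show "x = y" using inj2 xy by metis
    qed
    ultimately show ?thesis unfolding k g2 bij_betw_def by blast
  next
    assume k: "k < -2"
    then show ?thesis using deep[OF k] g3[OF k] p0 by (simp add: bij_betw_def)
  qed
  have phP: "\<phi> ` (G k \<inter> P p) = ?G k \<inter> ?P p" if k: "k < 0" for k p
  proof -
    have im: "\<phi> ` G k = ?G k" using phbij[OF k] by (simp add: bij_betw_def)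
    have Z: "0 \<in> ?P p" "0 \<in> P p" by auto
    show ?thesis using negc[OF k]
    proof (elim disjE)
      assume k: "k = -1"
      have o: "?G (-1) \<subseteq> ?P True" unfolding g1 using C.Psi_odd by (auto simp: par_space_def sgn_par_def)
      show ?thesis
      proof (cases p)
        case True then show ?thesis using im odd1 o unfolding k by (simp add: Int_absorb2)
      next
        case False
        have "G (-1) \<inter> P False = {0}" "?G (-1) \<inter> ?P False = {0}"
          using cap[of "G (-1)" False] capC[of "?G (-1)" False] odd1 o C.subspace_0[OF C.deg_subspace] by simp_all
        then show ?thesis using False p0 unfolding k by simp
      qed
    next
      assume k: "k = -2"
      have o: "?G (-2) \<subseteq> ?P False" unfolding g2 using C.z_even by (auto simp: par_space_def sgn_par_def)
      show ?thesis
      proof (cases p)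
        case False then show ?thesis using im even2 o unfolding k by (simp add: Int_absorb2)
      next
        case True
        have "G (-2) \<inter> P True = {0}" "?G (-2) \<inter> ?P True = {0}"
          using cap[of "G (-2)" True] capC[of "?G (-2)" True] even2 o C.subspace_0[OF C.deg_subspace] by simp_all
        then show ?thesis using True p0 unfolding k by simp
      qed
    next
      assume k: "k < -2"
      show ?thesis using deep[OF k] g3[OF k] p0 Z by (simp add: Int_insert_left)
    qed
  qed
  have neg: "\<exists>a b. a \<in> G (-1) \<and> b \<in> G (-2) \<and> x = a + b" if "x \<in> negpart sc G" for x
    using that unfolding negpart_def
  proof (induction rule: span_induct_alt)
    case base show ?case by (intro exI[of _ 0]) simp
  next
    case (step c x y)
    then obtain k where k: "k < 0" "x \<in> G k" by blast
    obtain a b where ab: "a \<in> G (-1)" "b \<in> G (-2)" "y = a + b" using step.IH by blast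
    from negc[OF k(1)] show ?case
    proof (elim disjE)
      assume "k = -1"
      then show ?case using k ab by (intro exI[of _ "sc c x + a"] exI[of _ b]) (simp add: add.assoc)
    next
      assume "k = -2"
      then show ?case using k ab by (intro exI[of _ a] exI[of _ "sc c x + b"]) (simp add: algebra_simps)
    next
      assume "k < -2"
      then have "x = 0" using deep k by blast
      then show ?case using ab by auto
    qed
  qed
  have negcar: "x \<in> car P" if "x \<in> negpart sc G" for x using neg[OF that] G_car by auto
  have ext: "trans_ext sc P br G sc' ?P br' ?G \<phi>"
    unfolding trans_ext_def
  proof (intro conjI allI impI ballI C.graded trn phbij phP)
    fix x y a assume x: "x \<in> negpart sc G" and y: "y \<in> negpart sc G"
    show "\<phi> (sc a x + y) = sc' a (\<phi> x) + \<phi> y" using phl negcar x y by blast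
    obtain a b where x': "a \<in> G (-1)" "b \<in> G (-2)" "x = a + b" using neg[OF x] by blast
    obtain c d where y': "c \<in> G (-1)" "d \<in> G (-2)" "y = c + d" using neg[OF y] by blast
    note cc = G_car[OF x'(1)] G_car[OF x'(2)] G_car[OF y'(1)] G_car[OF y'(2)]
    have "br a d = 0" "br b c = 0" "br b d = 0"
      using G_zero_br[OF deep x'(1) y'(2)] G_zero_br[OF deep x'(2) y'(1)] G_zero_br[OF deep x'(2) y'(2)] by simp_all
    then have e1: "br x y = sc (Q (\<xi> a) (\<xi> c)) u" using cc x' y' by (simp add: br_add br1)
    have "\<phi> (br x y) = sc' (Q (\<xi> a) (\<xi> c)) z"
      unfolding e1 using phl[of u 0] G_car[OF u(1)] ph2[OF u(1)] p0 u(3) by simp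
    moreover have "\<phi> x = \<phi> a + \<phi> b" "\<phi> y = \<phi> c + \<phi> d" using phl[of a b 1] phl[of c d 1] cc x' y' by simp_all
    moreover have "br' z z = 0"
    proof (rule C.below[of "-4"])
      have "- sc' 2 y - sc' 2 y = - sc' 4 y" for y using C.scale_left_distrib[of 2 2 y] by (simp add: algebra_simps)
      then show "D (br' z z) = sc' (of_int (-4)) (br' z z)" by (simp add: C.D_br C.z_deg)
    qed simp
    ultimately show "\<phi> (br x y) = br' (\<phi> x) (\<phi> y)"
      using x' y' by (simp add: ph1 ph2 C.Psi_br C.br_z_Psi)
  qed
  interpret tanaka_ext sc P br G sc' ?P br' ?G \<phi> by unfold_locales (rule ext)
  show ?thesis
  proof (rule pr_infiniteI[of \<iota>])
    show "\<not> fin_dim sc' ?P" unfolding fin_dim_def C.par_space_car using C.inf by blast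
    have i0: "\<iota> 0 = (\<lambda>_. 0)" using C.iota_lin[of "-1" 0 0] by simp
    show "inj_on \<iota> (car ?P)"
    proof (rule inj_onI)
      fix x y assume "\<iota> x = \<iota> y"
      then have "\<iota> (sc' (-1) x + y) = (\<lambda>_. 0)" unfolding C.iota_lin by simp
      then have "sc' (-1) x + y = 0" by (rule C.iota_0)
      then show "x = y" by simp
    qed
  qed (rule C.iota_lin)
qed

end

section \<open>Shears along a commuting root vector\<close>

context rooted
begin

definition coef :: "'w \<Rightarrow> 'v \<Rightarrow> complex" where
  "coef w x = (SOME a. comp x w = sc a (rv w))"

lemma comp_coef: "w \<in> R \<Longrightarrow> x \<in> car P \<Longrightarrow> comp x w = sc (coef w x) (rv w)"
  unfolding coef_def by (rule someI_ex) (use rv(3) comp(1) in blast)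

lemma coef_eqI: "w \<in> R \<Longrightarrow> x \<in> car P \<Longrightarrow> comp x w = sc a (rv w) \<Longrightarrow> coef w x = a"
  using comp_coef[of w x] rv(1)[of w] scale_right_imp_eq by metis

lemma coef_lin:
  assumes "w \<in> R" "x \<in> car P" "y \<in> car P" shows "coef w (sc a x + y) = a * coef w x + coef w y"
  by (rule coef_eqI) (use assms comp_lin[OF assms(2,3)] comp_coef[OF assms(1)] in \<open>simp_all add: scale_left_distrib\<close>)

lemma coef_0: "w \<in> R \<Longrightarrow> x \<in> car P \<Longrightarrow> coef w x = 0 \<longleftrightarrow> comp x w = 0"
  using comp_coef[of w x] rv(1)[of w] by simp

lemma coef_rv: assumes "v \<in> R" "w \<in> R" shows "coef w (rv v) = (if w = v then 1 else 0)"
  by (rule coef_eqI) (use assms rv_car comp_Gw[OF rv(2)[OF assms(1)], of w] in auto)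

end

context parabolic
begin

lemma neg_induct [consumes 1, case_names base step]:
  assumes "x \<in> negpart sc Gr" "Q 0"
    and "\<And>c a b k. k < 0 \<Longrightarrow> a \<in> Gr k \<Longrightarrow> b \<in> negpart sc Gr \<Longrightarrow> Q b \<Longrightarrow> Q (sc c a + b)"
  shows "Q x"
proof -
  have "x \<in> negpart sc Gr \<and> Q x" using assms(1) unfolding negpart_def
  proof (induction rule: span_induct_alt)
    case base then show ?case using assms(2) span_zero by simp
  next
    case (step c a b)
    then obtain k where k: "k < 0" "a \<in> Gr k" by blast
    then have "a \<in> negpart sc Gr" by (rule G_neg)
    then show ?case using assms(3)[OF k] step.IH by (simp add: negpart_def span_add span_scale)
  qed
  then show ?thesis by simp
qed

lemma neg_simps:
  "0 \<in> negpart sc Gr" "x \<in> negpart sc Gr \<Longrightarrow> y \<in> negpart sc Gr \<Longrightarrow> x + y \<in> negpart sc Gr"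
  "x \<in> negpart sc Gr \<Longrightarrow> sc a x \<in> negpart sc Gr"
  unfolding negpart_def by (rule span_zero, rule span_add, assumption+, rule span_scale)

lemma neg_car: assumes "x \<in> negpart sc Gr" shows "x \<in> car P"
  using assms by (induction rule: neg_induct) (simp_all add: Gr_car)

lemma neg_comp:
  assumes "x \<in> negpart sc Gr" "w \<notin> Mm" shows "comp x w = 0"
  using assms(1)
proof (induction rule: neg_induct)
  case (step c a b k)
  have "comp a w = 0"
  proof (cases "dg w = q * k")
    case True
    then have "dg w < 0" using step.hyps(1) q_pos by (simp add: mult_less_0_iff)
    then have "w \<notin> R0" using assms(2) by (auto simp: R0_def Mm_def)
    then show ?thesis using comp(2) Gr_car step.hyps(2) by blast
  next
    case False
    then show ?thesis using Gr_comp step.hyps(2) by blast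
  qed
  then show ?case using comp_lin[OF Gr_car[OF step.hyps(2)] neg_car[OF step.hyps(3)]] step.IH by simp
qed simp

lemma neg_br: assumes "x \<in> negpart sc Gr" "y \<in> negpart sc Gr" shows "br x y \<in> negpart sc Gr"
  using assms(1)
proof (induction rule: neg_induct)
  case base then show ?case using neg_car[OF assms(2)] neg_simps by simp
next
  case (step c a b k)
  have "br a y \<in> negpart sc Gr" using assms(2)
  proof (induction rule: neg_induct)
    case base then show ?case using Gr_car[OF step.hyps(2)] neg_simps by simp
  next
    case (step c' a' b' k')
    have "br a a' \<in> negpart sc Gr" using G_neg[OF _ G_br[OF \<open>a \<in> Gr k\<close> step.hyps(2)]] \<open>k < 0\<close> step.hyps(1) by simp
    then show ?case using step.IH br_lin(2)[OF Gr_car[OF step.hyps(2)] neg_car[OF step.hyps(3)] Gr_car[OF \<open>a \<in> Gr k\<close>]]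
      by (simp add: neg_simps)
  qed
  then show ?case using step.IH br_lin(1)[OF Gr_car[OF step.hyps(2)] neg_car[OF step.hyps(3)] neg_car[OF assms(2)]]
    by (simp add: neg_simps)
qed

lemma neg_parts:
  assumes "x \<in> negpart sc Gr"
  shows "\<exists>a b. a \<in> negpart sc Gr \<and> a \<in> P False \<and> b \<in> negpart sc Gr \<and> b \<in> P True \<and> x = a + b"
  using assms
proof (induction rule: neg_induct)
  case base then show ?case using neg_simps(1) by (intro exI[of _ 0]) simp
next
  case (step c x y k)
  obtain a b where ab: "a \<in> Gr k" "a \<in> P False" "b \<in> Gr k" "b \<in> P True" "x = a + b" using G_parts[OF step.hyps(2)] by blast
  obtain a' b' where ab': "a' \<in> negpart sc Gr" "a' \<in> P False" "b' \<in> negpart sc Gr" "b' \<in> P True" "y = a' + b'" using step.IH by blast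
  have n: "a \<in> negpart sc Gr" "b \<in> negpart sc Gr" using G_neg[OF step.hyps(1)] ab by blast+
  show ?case
    using n ab ab' subspace_add[OF subspace_P] subspace_scale[OF subspace_P]
    by (intro exI[of _ "sc c a + a'"] exI[of _ "sc c b + b'"])
      (simp add: neg_simps scale_right_distrib algebra_simps)
qed

lemma Mm_dg: "b \<in> Mm \<Longrightarrow> dg b \<le> - q"
proof -
  assume b: "b \<in> Mm"
  then have "q dvd dg b" using dg_dvd by (simp add: Mm_def R0_def)
  then obtain j where j: "dg b = q * j" by (rule dvdE)
  have "q * j < 0" using b j by (simp add: Mm_def)
  then have "j \<le> -1" using q_pos by (simp add: mult_less_0_iff)
  then have "q * j \<le> q * (-1)" using q_pos by (intro mult_left_mono) auto
  then show ?thesis using j by simp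
qed

end

text \<open>\<open>monom 1 k\<close> will stand for the element \<open>D\<^sub>k\<close> of an
  infinite abelian ideal, and \<open>sh\<close> lowers its index. The coefficient dropped at index 0
  belongs to a vector of \<open>m\<close> and is treated separately.\<close>

definition sh :: "complex poly \<Rightarrow> complex poly" where "sh f = poly_shift 1 f"

lemma coeff_sh [simp]: "coeff (sh f) i = coeff f (Suc i)" by (simp add: sh_def coeff_poly_shift)

lemma sh_simps [simp]: "sh 0 = 0" "sh (f + g) = sh f + sh g" "sh (f - g) = sh f - sh g" "sh (smult a f) = smult a (sh f)"
  by (simp_all add: poly_eq_iff)

lemma sh_monom: "sh (monom c m) = (if m = 0 then 0 else monom c (m - 1))"
  by (auto simp: poly_eq_iff)

text \<open>The root vector of \<open>g0\<close> may fail to commute with that of \<open>b0\<close>.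
  This does no harm: with \<eta> the coordinate at \<open>g0\<close>, the bracket of
  \<open>x\<close> with the root vector of \<open>b0\<close> is \<eta>(x) times a fixed vector, so
  the terms that it contributes to the Jacobi identity are symmetric and cancel.\<close>

locale shear = parabolic sc P br h \<Phi> R par B sr pos co q S
  for sc :: "complex \<Rightarrow> 'v::ab_group_add \<Rightarrow> 'v" and P br h and \<Phi> :: "'w::ab_group_add \<Rightarrow> 'v \<Rightarrow> complex"
    and R par B sr pos co q S +
  fixes b0 g0 :: 'w
  assumes b0: "b0 \<in> R" "dg b0 = - q" and g0: "g0 \<in> R" "dg g0 = - q" "\<not> par g0" and ne: "b0 \<noteq> g0"
    and only: "\<And>b. b \<in> Mm \<Longrightarrow> b + b0 \<in> R \<Longrightarrow> b = g0"
begin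

abbreviation "e0 \<equiv> rv b0"
abbreviation "u0 \<equiv> rv g0"
abbreviation "\<eta> \<equiv> coef g0"
abbreviation "N \<equiv> negpart sc Gr"

lemma e0: "e0 \<in> Gr (-1)" "e0 \<in> N" "e0 \<in> car P" "e0 \<in> P (par b0)" "e0 \<noteq> 0" "\<eta> e0 = 0"
proof -
  show 1: "e0 \<in> Gr (-1)" using Gw_Gr[OF rv(2)[OF b0(1)]] b0 by simp
  show "e0 \<in> N" using G_neg[OF _ 1] by simp
  show "e0 \<in> car P" "e0 \<in> P (par b0)" "e0 \<noteq> 0" using rv_car rv Gw_par b0 by auto
  show "\<eta> e0 = 0" using coef_rv[OF b0(1) g0(1)] ne by simp
qed

lemma u0: "u0 \<in> Gr (-1)" "u0 \<in> P False" "u0 \<in> car P" "\<eta> u0 = 1"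
  using Gw_Gr[OF rv(2)[OF g0(1)]] g0 rv_car Gw_par[OF rv(2)[OF g0(1)]] coef_rv by auto

lemma l_lin: "x \<in> N \<Longrightarrow> y \<in> N \<Longrightarrow> \<eta> (sc a x + y) = a * \<eta> x + \<eta> y"
  using coef_lin[OF g0(1)] neg_car by blast

lemma l_zero: "\<eta> 0 = 0" using l_lin[of 0 0 1] neg_simps(1) by simp

lemma l_add: "x \<in> N \<Longrightarrow> y \<in> N \<Longrightarrow> \<eta> (x + y) = \<eta> x + \<eta> y" using l_lin[of x y 1] by simp

lemma l_sc: "x \<in> N \<Longrightarrow> \<eta> (sc a x) = a * \<eta> x" using l_lin[of x 0 a] neg_simps l_zero by simp

lemma l_odd: "x \<in> P True \<Longrightarrow> \<eta> x = 0"
  using comp_P[of x True g0] g0 coef_0[OF g0(1)] P_car by blast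

lemma l_deg: "x \<in> Gr k \<Longrightarrow> k \<noteq> -1 \<Longrightarrow> \<eta> x = 0"
proof -
  assume x: "x \<in> Gr k" "k \<noteq> -1"
  have "dg g0 \<noteq> q * k"
  proof
    assume "dg g0 = q * k"
    then have "q * (k + 1) = 0" using g0(2) by (simp add: algebra_simps)
    then show False using x q_pos by simp
  qed
  then show ?thesis using Gr_comp x coef_0[OF g0(1)] Gr_car by blast
qed

text \<open>\<eta> is a coordinate in degree -1, while brackets of elements of \<open>m\<close> have
  degree at most -2. So \<eta> is a character of \<open>m\<close>.\<close>

lemma l_br: assumes "x \<in> N" "y \<in> N" shows "\<eta> (br x y) = 0"
proof -
  have "br (comp x v) (comp y (g0 - v)) = 0" for v
  proof (cases "v \<in> Mm \<and> g0 - v \<in> Mm")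
    case True
    then have "dg g0 \<le> -2 * q" using Mm_dg[of v] Mm_dg[of "g0 - v"] by (simp add: dg_diff)
    then show ?thesis using g0 q_pos by simp
  next
    case False
    then have "comp x v = 0 \<or> comp y (g0 - v) = 0" using neg_comp assms by blast
    then show ?thesis using comp_car neg_car assms by auto
  qed
  then have "comp (br x y) g0 = 0" using comp_br[OF neg_car neg_car, OF assms] by simp
  then show ?thesis using coef_0[OF g0(1)] neg_car assms br_car by blast
qed

lemma br_e0:
  assumes "x \<in> N" shows "br x e0 = sc (\<eta> x) (br u0 e0)" "br e0 x = - sc (\<eta> x) (br u0 e0)"
proof -
  have z: "br (comp x v) e0 = 0 \<and> br e0 (comp x v) = 0" if v: "v \<noteq> g0" for v
  proof (cases "v \<in> Mm")
    case True
    have "v + b0 \<notin> R" using only[OF True] v by blast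
    moreover have "dg (v + b0) \<noteq> 0" using Mm_dg[OF True] b0 q_pos by (simp add: dg_add)
    then have "v + b0 \<noteq> 0" using dg_0 by metis
    ultimately have "v + b0 \<notin> R0" "b0 + v \<notin> R0" by (simp_all add: R0_def add.commute)
    then show ?thesis using br_Gw_nonroot comp(1)[OF neg_car[OF assms]] rv(2)[OF b0(1)] by blast
  next
    case False
    then show ?thesis using neg_comp[OF assms] e0 by simp
  qed
  have g: "g0 \<in> R0" using g0 by (simp add: R0_def)
  have cx: "comp x g0 = sc (\<eta> x) u0" using comp_coef g0 neg_car assms by blast
  have cc: "\<And>v. comp x v \<in> car P" using comp_car neg_car[OF assms] by blast
  have x: "x = sum (comp x) R0" using comp(3) neg_car assms by blast
  have "br x e0 = (\<Sum>v\<in>R0. br (comp x v) e0)" by (subst x) (rule br_sum(1)[OF e0(3) cc])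
  also have "\<dots> = (\<Sum>v\<in>{g0}. br (comp x v) e0)"
    using finite_R0 g z by (intro sum.mono_neutral_right) auto
  finally show 1: "br x e0 = sc (\<eta> x) (br u0 e0)" using cx br_sc(1)[OF u0(3) e0(3)] by simp
  have "br e0 x = (\<Sum>v\<in>R0. br e0 (comp x v))" by (subst x) (rule br_sum(2)[OF e0(3) cc])
  also have "\<dots> = (\<Sum>v\<in>{g0}. br e0 (comp x v))"
    using finite_R0 g z by (intro sum.mono_neutral_right) auto
  finally have "br e0 x = sc (\<eta> x) (br e0 u0)" using cx br_sc(2)[OF u0(3) e0(3)] by simp
  moreover have "br e0 u0 = - br u0 e0" using br_skew[OF e0(4) u0(2)] by simp
  ultimately show "br e0 x = - sc (\<eta> x) (br u0 e0)" by simp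
qed

text \<open>The pair \<open>(x, f)\<close> stands for \<open>x + \<Sum> f\<^sub>k D\<^sub>k\<close>, where \<open>[x, D\<^sub>k] = \<eta>(x) D\<^sub>k\<^sub>-\<^sub>1\<close> and \<open>D\<^sub>-\<^sub>1 = e0\<close>.\<close>

definition sc2 :: "complex \<Rightarrow> 'v \<times> complex poly \<Rightarrow> 'v \<times> complex poly" where
  "sc2 a = (\<lambda>(x, f). (sc a x, smult a f))"

definition br2 :: "'v \<times> complex poly \<Rightarrow> 'v \<times> complex poly \<Rightarrow> 'v \<times> complex poly" where
  "br2 = (\<lambda>(x, f) (y, g). (br x y + sc (\<eta> x * coeff g 0 - \<eta> y * coeff f 0) e0,
     smult (\<eta> x) (sh g) - smult (\<eta> y) (sh f)))"

text \<open>Since \<eta> vanishes on odd elements, every \<open>D\<^sub>k\<close> has the parity of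
  \<open>e0\<close>.\<close>

definition P2 :: "bool \<Rightarrow> ('v \<times> complex poly) set" where
  "P2 p = {(x, f). x \<in> N \<and> x \<in> P p \<and> (f = 0 \<or> p = par b0)}"

text \<open>In nonnegative degrees only the line of \<open>D\<^sub>k\<close> is present; the
  degree-zero part of \<open>g\<close> is left out, because any infinite-dimensional transitive
  extension of \<open>m\<close> will do.\<close>

definition G2 :: "int \<Rightarrow> ('v \<times> complex poly) set" where
  "G2 k = (if k < 0 then {(x, 0) | x. x \<in> Gr k} else {(0, monom c (nat k)) | c. True})"

lemma sc2_apply [simp]: "sc2 a (x, f) = (sc a x, smult a f)" by (simp add: sc2_def)
lemma br2_apply [simp]: "br2 (x, f) (y, g) = (br x y + sc (\<eta> x * coeff g 0 - \<eta> y * coeff f 0) e0,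
     smult (\<eta> x) (sh g) - smult (\<eta> y) (sh f))" by (simp add: br2_def)

lemma vs2: "vector_space sc2"
  by unfold_locales (auto simp: scale_right_distrib scale_left_distrib smult_add_left smult_add_right)

lemma car2: "car P2 = {(x, f). x \<in> N}"
proof (intro equalityI subsetI)
  fix X assume "X \<in> car P2"
  then show "X \<in> {(x, f). x \<in> N}" by (auto simp: car_def P2_def neg_simps)
next
  fix X :: "'v \<times> complex poly" assume "X \<in> {(x, f). x \<in> N}"
  then obtain x f where X: "X = (x, f)" "x \<in> N" by auto
  obtain a b where ab: "a \<in> N" "a \<in> P False" "b \<in> N" "b \<in> P True" "x = a + b" using neg_parts[OF X(2)] by blast
  have "X = (a, if par b0 then 0 else f) + (b, if par b0 then f else 0)" using X ab by simp
  moreover have "(a, if par b0 then 0 else f) \<in> P2 False" "(b, if par b0 then f else 0) \<in> P2 True" using ab by (auto simp: P2_def)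
  ultimately show "X \<in> car P2" unfolding car_def by blast
qed

lemma lie2: "lie_superalgebra sc2 P2 br2"
  unfolding lie_superalgebra_def
proof (intro conjI allI ballI)
  interpret X: vector_space sc2 by (rule vs2)
  show "vector_space sc2" by (rule vs2)
  show "X.subspace (P2 p)" for p
    using neg_simps subspace_add[OF subspace_P[of p]] subspace_scale[OF subspace_P[of p]]
    by (intro X.subspaceI) (auto simp: P2_def zero_prod_def)
  show "P2 False \<inter> P2 True = {0}" using P_disjoint neg_simps(1) by (auto simp: P2_def zero_prod_def)
next
  fix X Y W a assume "X \<in> car P2" "Y \<in> car P2" "W \<in> car P2"
  then obtain x f y g w k where e: "X = (x, f)" "Y = (y, g)" "W = (w, k)" and n: "x \<in> N" "y \<in> N" "w \<in> N"
    by (auto simp: car2)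
  note b = br_lin[OF neg_car[OF n(1)] neg_car[OF n(2)] neg_car[OF n(3)]] and l = l_lin[OF n(1,2)]
  show "br2 (sc2 a X + Y) W = sc2 a (br2 X W) + br2 Y W" "br2 W (sc2 a X + Y) = sc2 a (br2 W X) + br2 W Y"
    unfolding e sc2_apply add_Pair br2_apply b l
    by (simp_all add: smult_add_right smult_add_left smult_diff_right algebra_simps
        scale_left_distrib scale_right_distrib scale_left_diff_distrib scale_right_diff_distrib)
next
  fix p q X Y assume "X \<in> P2 p" "Y \<in> P2 q"
  then obtain x f y g where e: "X = (x, f)" "Y = (y, g)" and n: "x \<in> N" "y \<in> N" and xy: "x \<in> P p" "y \<in> P q"
    and fp: "f = 0 \<or> p = par b0" and gq: "g = 0 \<or> q = par b0" by (auto simp: P2_def)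
  have l: "\<eta> x = 0 \<or> \<not> p" "\<eta> y = 0 \<or> \<not> q" using l_odd xy by (cases p; cases q; auto)+
  have "sc (\<eta> x * coeff g 0 - \<eta> y * coeff f 0) e0 \<in> P (p \<noteq> q)"
  proof (cases "\<eta> x * coeff g 0 - \<eta> y * coeff f 0 = 0")
    case False
    then have "(\<eta> x \<noteq> 0 \<and> g \<noteq> 0) \<or> (\<eta> y \<noteq> 0 \<and> f \<noteq> 0)" by auto
    then have "(p \<noteq> q) = par b0" using l fp gq by auto
    then show ?thesis using e0(4) subspace_scale[OF subspace_P] by simp
  qed simp
  then have "br x y + sc (\<eta> x * coeff g 0 - \<eta> y * coeff f 0) e0 \<in> P (p \<noteq> q)"
    using br_P[OF xy] subspace_add[OF subspace_P] by blast
  moreover have "br x y + sc (\<eta> x * coeff g 0 - \<eta> y * coeff f 0) e0 \<in> N"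
    using n e0(2) by (intro neg_simps neg_br)
  moreover have "smult (\<eta> x) (sh g) - smult (\<eta> y) (sh f) = 0 \<or> (p \<noteq> q) = par b0"
  proof (rule disjCI)
    assume *: "(p \<noteq> q) \<noteq> par b0"
    have "smult (\<eta> x) (sh g) = 0" "smult (\<eta> y) (sh f) = 0" using * l fp gq by auto
    then show "smult (\<eta> x) (sh g) - smult (\<eta> y) (sh f) = 0" by (simp only: diff_self)
  qed
  ultimately show "br2 X Y \<in> P2 (p \<noteq> q)" by (simp add: e P2_def)
  show "br2 X Y = - sc2 (sgnp p q) (br2 Y X)"
  proof (cases "p \<and> q")
    case True
    then show ?thesis using br_skew[OF xy] l by (simp add: e sgn_par_def)
  next
    case False
    then have "sgnp p q = 1" by (auto simp: sgnp_def)
    then show ?thesis using br_skew[OF xy] by (simp add: e scale_left_diff_distrib algebra_simps)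
  qed
next
  fix p q r X Y W assume "X \<in> P2 p" "Y \<in> P2 q" "W \<in> P2 r"
  then obtain x f y g w k where e: "X = (x, f)" "Y = (y, g)" "W = (w, k)" and n: "x \<in> N" "y \<in> N" "w \<in> N"
    and xy: "x \<in> P p" "y \<in> P q" "w \<in> P r" by (auto simp: P2_def)
  note cc = neg_car[OF n(1)] neg_car[OF n(2)] neg_car[OF n(3)]
  have l: "\<eta> x = 0 \<or> \<not> p" "\<eta> y = 0 \<or> \<not> q" using l_odd xy by (cases p; cases q; auto)+
  have lz: "\<eta> (br a b + sc t e0) = 0" if "a \<in> N" "b \<in> N" for a b t
    using that l_br e0 l_add[OF neg_br[OF that] neg_simps(3)[OF e0(2)]] l_sc by simp
  have bz: "br a (br b c + sc t e0) = br a (br b c) + sc (t * \<eta> a) (br u0 e0)"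
    "br (br b c + sc t e0) a = br (br b c) a - sc (t * \<eta> a) (br u0 e0)" if "a \<in> N" "b \<in> N" "c \<in> N" for a b c t
    using that neg_car e0(3) br_e0[OF that(1)] by (simp_all add: br_add br_sc)
  have j: "br x (br y w) = br (br x y) w + sc (sgnp p q) (br y (br x w))" using jacobi xy by blast
  show "br2 X (br2 Y W) = br2 (br2 X Y) W + sc2 (sgnp p q) (br2 Y (br2 X W))"
  proof (cases "p \<and> q")
    case True
    then have "\<eta> x = 0" "\<eta> y = 0" using l by auto
    then show ?thesis
      unfolding e br2_apply lz[OF n(1,2)] lz[OF n(2,3)] lz[OF n(1,3)] bz[OF n] bz[OF n(2,1,3)] bz[OF n(3,1,2)] j
      by simp
  next
    case False
    then have s: "sgnp p q = 1" by (auto simp: sgnp_def)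
    show ?thesis unfolding e br2_apply lz[OF n(1,2)] lz[OF n(2,3)] lz[OF n(1,3)] bz[OF n] bz[OF n(2,1,3)] bz[OF n(3,1,2)] s j
      by (simp add: sh_simps coeff_sh smult_diff_right smult_add_right scale_right_distrib scale_left_diff_distrib
          scale_right_diff_distrib algebra_simps)
  qed
qed

lemma graded2: "graded_lsa sc2 P2 br2 G2"
  unfolding graded_lsa_def
proof (intro conjI allI ballI impI lie2)
  interpret X: vector_space sc2 by (rule vs2)
  show sub: "X.subspace (G2 k)" for k
  proof (cases "k < 0")
    case True
    then show ?thesis by (intro X.subspaceI) (auto simp: G2_def zero_prod_def)
  next
    case False
    then show ?thesis
      by (intro X.subspaceI) (auto simp: G2_def zero_prod_def add_monom smult_monom intro: exI[of _ 0])
  qed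
  show G2c: "G2 k \<subseteq> car P2" for k using G_neg neg_simps(1) by (auto simp: G2_def car2)
  fix k X assume X: "X \<in> G2 k"
  show "\<exists>a\<in>G2 k \<inter> P2 False. \<exists>b\<in>G2 k \<inter> P2 True. X = a + b"
  proof (cases "k < 0")
    case True
    then obtain x where x: "X = (x, 0)" "x \<in> Gr k" using X by (auto simp: G2_def)
    obtain a b where ab: "a \<in> Gr k" "a \<in> P False" "b \<in> Gr k" "b \<in> P True" "x = a + b" using G_parts[OF x(2)] by blast
    have "(a, 0) \<in> G2 k \<inter> P2 False" "(b, 0) \<in> G2 k \<inter> P2 True" "X = (a, 0) + (b, 0)"
      using ab x True G_neg[OF True] by (auto simp: G2_def P2_def)
    then show ?thesis by blast
  next
    case False
    then have z: "0 \<in> G2 k \<inter> P2 p" for p using X.subspace_0[OF sub] neg_simps(1) by (auto simp: P2_def zero_prod_def)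
    have "X \<in> P2 (par b0)" using X False neg_simps(1) by (auto simp: G2_def P2_def)
    then show ?thesis using X z by (cases "par b0") (force intro: bexI[of _ X] bexI[of _ 0])+
  qed
next
  interpret X: vector_space sc2 by (rule vs2)
  show "car P2 \<subseteq> X.span (\<Union>k. G2 k)"
  proof
    fix X assume "X \<in> car P2"
    then obtain x f where X: "X = (x, f)" "x \<in> N" by (auto simp: car2)
    have 1: "(x, 0) \<in> X.span (\<Union>k. G2 k)" using X(2)
    proof (induction rule: neg_induct)
      case base show ?case using X.span_zero[of "\<Union>k. G2 k"] by (simp add: zero_prod_def)
    next
      case (step c a b k)
      then have "(a, 0) \<in> G2 k" by (simp add: G2_def)
      then have "sc2 c (a, 0) + (b, 0) \<in> X.span (\<Union>k. G2 k)" by (intro X.span_add X.span_scale step.IH X.span_base) blast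
      then show ?case by simp
    qed
    have m: "(0, monom c i) \<in> G2 (int i)" for c i by (auto simp: G2_def)
    have "(\<Sum>i\<le>degree f. (0, monom (coeff f i) i)) \<in> X.span (\<Union>k. G2 k)"
      by (intro X.span_sum X.span_base) (use m in blast)
    moreover have "(\<Sum>i\<le>degree f. (0, monom (coeff f i) i)) = (0 :: 'v, f)"
      by (simp add: prod_eq_iff fst_sum snd_sum poly_as_sum_of_monoms)
    ultimately have "(0, f) \<in> X.span (\<Union>k. G2 k)" by simp
    then show "X \<in> X.span (\<Union>k. G2 k)" using X.span_add[OF 1] X by force
  qed
next
  fix F :: "int set" and f k assume a: "finite F \<and> (\<forall>k\<in>F. f k \<in> G2 k) \<and> sum f F = 0" and k: "k \<in> F"
  have "fst (f j) \<in> Gr j" if "j \<in> F" for j using a that by (force simp: G2_def split: if_splits)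
  moreover have "(\<Sum>j\<in>F. fst (f j)) = 0" using a by (metis fst_sum fst_zero)
  ultimately have 1: "fst (f k) = 0" using G_direct[of F "\<lambda>j. fst (f j)" k] a k by blast
  have s0: "(\<Sum>j\<in>F. snd (f j)) = 0" using a by (metis snd_sum snd_zero)
  show "f k = 0"
  proof (cases "k < 0")
    case True
    then show ?thesis using 1 a k by (force simp: G2_def zero_prod_def)
  next
    case False
    then obtain c where c: "snd (f k) = monom c (nat k)" using a k by (force simp: G2_def)
    have "coeff (snd (f j)) (nat k) = 0" if "j \<in> F" "j \<noteq> k" for j
      using a that False by (force simp: G2_def split: if_splits)
    then have "(\<Sum>j\<in>F. coeff (snd (f j)) (nat k)) = (\<Sum>j\<in>{k}. coeff (snd (f j)) (nat k))"
      using a k by (intro sum.mono_neutral_right) auto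
    moreover have "(\<Sum>j\<in>F. coeff (snd (f j)) (nat k)) = 0" using s0 by (metis coeff_sum coeff_0)
    ultimately have "c = 0" using c by simp
    then show ?thesis using 1 c by (simp add: prod_eq_iff)
  qed
next
  interpret X: vector_space sc2 by (rule vs2)
  fix i j X Y assume X: "X \<in> G2 i" and Y: "Y \<in> G2 j"
  have Z: "(0, 0) \<in> G2 k" for k
    by (cases "k < 0") (auto simp: G2_def intro: exI[of _ 0])
  have key: "(sc t e0, smult s (sh (monom c (nat k)))) \<in> G2 (i' + k)"
    if "k \<ge> 0" "i' < 0" "i' \<noteq> -1 \<longrightarrow> t = 0 \<and> s = 0" "k \<noteq> 0 \<longrightarrow> t = 0" for t s c k and i' :: int
  proof (cases "i' = -1")
    case True
    show ?thesis
    proof (cases "k = 0")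
      case True then show ?thesis using \<open>i' = -1\<close> e0(1) by (simp add: sh_monom G2_def)
    next
      case False
      then have "nat (k - 1) = nat k - 1" using that by simp
      then show ?thesis using True False that by (auto simp: sh_monom G2_def smult_monom)
    qed
  next
    case False
    then show ?thesis using that Z by simp
  qed
  show "br2 X Y \<in> G2 (i + j)"
  proof (cases "i < 0"; cases "j < 0")
    assume ij: "i < 0" "j < 0"
    then obtain x y where x: "X = (x, 0)" "x \<in> Gr i" and y: "Y = (y, 0)" "y \<in> Gr j" using X Y by (auto simp: G2_def)
    show ?thesis using ij G_br[OF x(2) y(2)] by (simp add: x y G2_def)
  next
    assume ij: "i < 0" "\<not> j < 0"
    then obtain x c where x: "X = (x, 0)" "x \<in> Gr i" and y: "Y = (0, monom c (nat j))" using X Y by (auto simp: G2_def)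
    have "(sc (\<eta> x * coeff (monom c (nat j)) 0) e0, smult (\<eta> x) (sh (monom c (nat j)))) \<in> G2 (i + j)"
      using ij l_deg[OF x(2)] by (intro key) auto
    then show ?thesis using Gr_car[OF x(2)] by (simp add: x y l_zero)
  next
    assume ij: "\<not> i < 0" "j < 0"
    then obtain x c where x: "Y = (x, 0)" "x \<in> Gr j" and y: "X = (0, monom c (nat i))" using X Y by (auto simp: G2_def)
    have "(sc (- \<eta> x * coeff (monom c (nat i)) 0) e0, smult (- \<eta> x) (sh (monom c (nat i)))) \<in> G2 (j + i)"
      using ij l_deg[OF x(2)] by (intro key) auto
    then show ?thesis using Gr_car[OF x(2)] by (simp add: x y l_zero add.commute)
  next
    assume ij: "\<not> i < 0" "\<not> j < 0"
    then obtain c d where "X = (0, monom c (nat i))" "Y = (0, monom d (nat j))" using X Y by (auto simp: G2_def)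
    then show ?thesis using Z by (simp add: l_zero)
  qed
qed

text \<open>The vector \<open>u0\<close> alone detects everything: as \<eta>(u0) = 1, bracketing
  with it lowers \<open>D\<^sub>k\<close> to \<open>D\<^sub>k\<^sub>-\<^sub>1\<close> up to sign,
  and \<open>D\<^sub>0\<close> to \<open>e0\<close>.\<close>

lemma transitive2: "transitive_gr br2 G2"
  unfolding transitive_gr_def
proof (intro allI impI ballI)
  fix k :: int and X assume k: "0 \<le> k" and X: "X \<in> G2 k" and *: "\<forall>Y\<in>G2 (-1). br2 X Y = 0"
  then obtain c where c: "X = (0, monom c (nat k))" by (auto simp: G2_def)
  have "(u0, 0) \<in> G2 (-1)" using u0(1) by (simp add: G2_def)
  then have "br2 X (u0, 0) = 0" using * by blast
  then have 1: "sc (- coeff (monom c (nat k)) 0) e0 = 0" and 2: "sh (monom c (nat k)) = 0"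
    using u0 by (simp_all add: c l_zero zero_prod_def)
  have "coeff (monom c (nat k)) i = 0" for i
  proof (cases i)
    case 0
    then show ?thesis using 1 e0(5) by simp
  next
    case (Suc m)
    then show ?thesis using arg_cong[OF 2, of "\<lambda>f. coeff f m"] by (simp add: coeff_sh del: coeff_monom)
  qed
  then have "monom c (nat k) = 0" by (intro poly_eqI) simp
  then show "X = 0" by (simp add: c zero_prod_def)
qed

theorem shear_infinite: "pr_infinite sc P br Gr"
proof -
  let ?\<phi> = "\<lambda>x :: 'v. (x, 0 :: complex poly)"
  have ext: "trans_ext sc P br Gr sc2 P2 br2 G2 ?\<phi>"
    unfolding trans_ext_def
  proof (intro conjI allI impI ballI graded2 transitive2)
    fix k :: int assume k: "k < 0"
    show "bij_betw ?\<phi> (Gr k) (G2 k)" using k by (auto simp: bij_betw_def inj_on_def G2_def)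
    show "?\<phi> ` (Gr k \<inter> P p) = G2 k \<inter> P2 p" for p using k G_neg[OF k] by (auto simp: G2_def P2_def)
  next
    fix x y a assume "x \<in> N" "y \<in> N"
    show "?\<phi> (sc a x + y) = sc2 a (?\<phi> x) + ?\<phi> y" by simp
    show "?\<phi> (br x y) = br2 (?\<phi> x) (?\<phi> y)" by simp
  qed
  interpret tanaka_ext sc P br Gr sc2 P2 br2 G2 ?\<phi> by unfold_locales (rule ext)
  obtain en where en: "bij_betw en {0..<card R} R" using ex_bij_betw_nat_finite[OF finite_R] by blast
  \<comment> \<open>Even places hold the polynomial; odd places hold the coordinates with respect to
    the root vectors, numbered by \<open>en\<close>.\<close>
  define \<iota> :: "'v \<times> complex poly \<Rightarrow> nat \<Rightarrow> complex" where
    "\<iota> X i = (if even i then coeff (snd X) (i div 2) else if i div 2 < card R then coef (en (i div 2)) (fst X) else 0)" for X i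
  have enR: "en i \<in> R" if "i < card R" for i using bij_betwE[OF en] that by simp
  have il: "\<iota> (sc2 a X + Y) = (\<lambda>i. a * \<iota> X i + \<iota> Y i)" if XY: "X \<in> car P2" "Y \<in> car P2" for a X Y
  proof -
    obtain x f y g where "X = (x, f)" "Y = (y, g)" "x \<in> N" "y \<in> N" using XY by (auto simp: car2)
    then show ?thesis by (auto simp: \<iota>_def fun_eq_iff coef_lin[OF enR neg_car neg_car])
  qed
  show ?thesis
  proof (rule pr_infiniteI[of \<iota>, OF _ il])
    show "\<not> fin_dim sc2 P2"
    proof
      assume "fin_dim sc2 P2"
      then obtain B where B: "finite B" "car P2 \<subseteq> E.span B" by (auto simp: fin_dim_def)
      define M where "M = Suc (Max (insert 0 ((\<lambda>b. degree (snd b)) ` B)))"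
      have M: "degree (snd b) < M" if "b \<in> B" for b unfolding M_def less_Suc_eq_le using B that by (intro Max_ge) auto
      have "coeff (snd X) M = 0" if "X \<in> E.span B" for X
        using that
      proof (induction rule: E.span_induct_alt)
        case (step d a b)
        then show ?case using M[of a] by (cases a) (simp add: coeff_eq_0)
      qed simp
      moreover have "(0, monom 1 M) \<in> car P2" using neg_simps(1) by (simp add: car2)
      ultimately show False using B(2) by fastforce
    qed
    show "inj_on \<iota> (car P2)"
    proof (rule inj_onI)
      fix X Y assume XY: "X \<in> car P2" "Y \<in> car P2" "\<iota> X = \<iota> Y"
      then obtain x f y g where e: "X = (x, f)" "Y = (y, g)" "x \<in> N" "y \<in> N" by (auto simp: car2)
      have "coeff f i = coeff g i" for i using fun_cong[OF XY(3), of "2 * i"] by (simp add: \<iota>_def e)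
      then have "f = g" by (rule poly_eqI)
      moreover have "comp x w = comp y w" for w
      proof (cases "w \<in> Mm")
        case True
        then have w: "w \<in> R" by (simp add: Mm_def)
        have "w \<in> en ` {0..<card R}" using en w by (simp add: bij_betw_def)
        then obtain i where i: "i < card R" "en i = w" by auto
        have "coef w x = coef w y" using fun_cong[OF XY(3), of "Suc (2 * i)"] i by (simp add: \<iota>_def e)
        then show ?thesis using comp_coef[OF w] neg_car e by simp
      next
        case False
        then show ?thesis using neg_comp e by simp
      qed
      then have "x = y" using comp_ext neg_car e by blast
      ultimately show "X = Y" using e by simp
    qed
  qed
qed

end

section \<open>Root data of the exceptional gradings\<close>

text \<open>For each root of degree -1, \<open>pl\<close> gives the position of the unique partner
  with which it adds up to \<open>zb\<close>. A position may be its own partner, as for -\<delta> in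
  G(3).\<close>

definition contact_check where
  "contact_check rl f par q bs pl zb \<longleftrightarrow>
     distinct bs \<and> list_all (\<lambda>b. b \<in> set rl \<and> f b = - q \<and> par b) bs \<and>
     list_all (\<lambda>b. (f b = - q \<longrightarrow> b \<in> set bs) \<and> (f b = - (2 * q) \<longrightarrow> b = zb) \<and> - (2 * q) \<le> f b) rl \<and>
     zb \<in> set rl \<and> f zb = - (2 * q) \<and> \<not> par zb \<and>
     list_all (\<lambda>i. pl ! i < length bs \<and> pl ! (pl ! i) = i \<and> bs ! i + bs ! (pl ! i) = zb \<and>
       list_all (\<lambda>j. bs ! i + bs ! j \<in> set rl \<longrightarrow> j = pl ! i) [0..<length bs]) [0..<length bs]"

definition shear_check where
  "shear_check rl f par q b0 g0 \<longleftrightarrow>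
     b0 \<in> set rl \<and> f b0 = - q \<and> g0 \<in> set rl \<and> f g0 = - q \<and> \<not> par g0 \<and> b0 \<noteq> g0 \<and>
     list_all (\<lambda>b. f b < 0 \<and> b + b0 \<in> set rl \<longrightarrow> b = g0) rl"

context parabolic
begin

lemma shear_check_infinite:
  assumes R: "R = set rl" and chk: "shear_check rl dg par q b0 g0"
  shows "pr_infinite sc P br Gr"
proof -
  interpret shear sc P br h \<Phi> R par B sr pos co q S b0 g0
  proof unfold_locales
    show "b = g0" if "b \<in> Mm" "b + b0 \<in> R" for b
    proof -
      have "b \<in> R \<and> dg b < 0" using that(1) unfolding Mm_def by simp
      then have "b \<in> set rl" "dg b < 0" "b + b0 \<in> set rl" using that(2) R by blast+
      then show ?thesis using chk unfolding shear_check_def list_all_iff by blast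
    qed
  qed (use chk in \<open>auto simp: shear_check_def R\<close>)
  show ?thesis by (rule shear_infinite)
qed

lemma Gr_eq_0: assumes "x \<in> Gr k" "\<And>w. w \<in> R0 \<Longrightarrow> dg w = q * k \<Longrightarrow> comp x w = 0" shows "x = 0"
proof (rule comp_ext)
  show "x \<in> car P" "0 \<in> car P" using Gr_car[OF assms(1)] by simp_all
  show "comp x w = comp 0 w" if "w \<in> R0" for w
    using assms(2)[OF that] Gr_comp[OF assms(1), of w] by (cases "dg w = q * k") simp_all
qed

lemma contact_check_infinite:
  fixes sc' :: "complex \<Rightarrow> 'c::ab_group_add \<Rightarrow> 'c"
  assumes con: "contact sc' br' \<sigma> D z (length bs) \<Psi> Q \<iota>" and trn: "transitive_gr br' (deg_space sc' D)"
    and R: "R = set rl" and chk: "contact_check rl dg par q bs pl zb"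
    and Q: "\<And>v w. Q v w = (\<Sum>i<length bs. v i * w (pl ! i))"
  shows "pr_infinite sc P br Gr"
proof -
  let ?l = "length bs"
  define \<pi> where "\<pi> i = pl ! i" for i
  note chk' = chk[unfolded contact_check_def list_all_iff]
  have dist: "distinct bs" using chk' by blast
  have bR: "bs ! i \<in> R" "dg (bs ! i) = - q" "par (bs ! i)" if "i < ?l" for i
    using chk' nth_mem[OF that] R by blast+
  have in_bs: "b \<in> set bs" if "b \<in> R" "dg b = - q" for b using chk' that R by blast
  have is_zb: "b = zb" if "b \<in> R" "dg b = - (2 * q)" for b using chk' that R by blast
  have low: "- (2 * q) \<le> dg b" if "b \<in> R" for b using chk' that R by blast
  have zb: "zb \<in> R" "dg zb = - (2 * q)" "\<not> par zb" using chk' R by blast+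
  have pair: "\<forall>i\<in>set [0..<?l]. pl ! i < ?l \<and> pl ! (pl ! i) = i \<and> bs ! i + bs ! (pl ! i) = zb \<and>
      (\<forall>j\<in>set [0..<?l]. bs ! i + bs ! j \<in> set rl \<longrightarrow> j = pl ! i)" using chk' by (elim conjE)
  have pi: "\<pi> i < ?l" "\<pi> (\<pi> i) = i" "bs ! i + bs ! \<pi> i = zb" if "i < ?l" for i
    using bspec[OF pair, of i] that unfolding \<pi>_def by simp_all
  have off: "j = \<pi> i" if "i < ?l" "j < ?l" "bs ! i + bs ! j \<in> R" for i j
    using bspec[OF pair, of i] that R unfolding \<pi>_def by simp
  let ?E = "\<lambda>i. rv (bs ! i)" and ?z = "rv zb" and ?c = "\<lambda>i. coef (bs ! i)"
  have E: "?E i \<in> Gw (bs ! i)" "?E i \<noteq> 0" "?E i \<in> car P" "?E i \<in> P True" "?E i \<in> Gr (-1)" if "i < ?l" for i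
    using rv[OF bR(1)[OF that]] rv_car[OF bR(1)[OF that]] Gw_par[OF rv(2)[OF bR(1)[OF that]]]
      Gw_Gr[OF rv(2)[OF bR(1)[OF that]], of "-1"] bR[OF that] by simp_all
  have Z: "?z \<in> Gw zb" "?z \<noteq> 0" "?z \<in> car P" "?z \<in> P False" "?z \<in> Gr (-2)"
    using rv[OF zb(1)] rv_car[OF zb(1)] Gw_par[OF rv(2)[OF zb(1)]] Gw_Gr[OF rv(2)[OF zb(1)], of "-2"] zb by simp_all
  have ex: "\<exists>a. br (?E i) (?E (\<pi> i)) = sc a ?z" if i: "i < ?l" for i
    using rv(3)[OF zb(1)] br_Gw[OF E(1)[OF i] E(1)[OF pi(1)[OF i]]] pi(3)[OF i] by simp
  define m where "m i = (SOME a. br (?E i) (?E (\<pi> i)) = sc a ?z)" for i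
  have m: "br (?E i) (?E (\<pi> i)) = sc (m i) ?z" if "i < ?l" for i unfolding m_def by (rule someI_ex[OF ex[OF that]])
  have m0: "m i \<noteq> 0" if i: "i < ?l" for i
  proof -
    have "br (?E i) (?E (\<pi> i)) \<noteq> 0"
      using br_root_nonzero[OF bR(1)[OF i] bR(1)[OF pi(1)[OF i]]] pi(3)[OF i] zb E[OF i] E[OF pi(1)[OF i]] by simp
    then show ?thesis using m[OF i] by auto
  qed
  have msym: "m (\<pi> i) = m i" if i: "i < ?l" for i
  proof -
    have "br (?E (\<pi> i)) (?E i) = br (?E i) (?E (\<pi> i))"
      using br_skew[OF E(4)[OF pi(1)[OF i]] E(4)[OF i]] by (simp add: sgn_par_def)
    then have "sc (m (\<pi> i)) ?z = sc (m i) ?z" using m[OF i] m[OF pi(1)[OF i]] pi(2)[OF i] by auto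
    then show ?thesis using Z(2) scale_right_imp_eq by blast
  qed
  \<comment> \<open>The pairing constants are invariant under \<pi>, so rescaling the coordinates by
    their square roots turns the bracket into the normal form \<open>Q\<close>. This also covers a
    self-paired position.\<close>
  define r where "r i = csqrt (m i)" for i
  have rr: "r i * r (\<pi> i) = m i" if "i < ?l" for i
    using msym[OF that] power2_csqrt[of "m i"] by (simp add: r_def power2_eq_square)
  have r0: "r i \<noteq> 0" if "i < ?l" for i using m0[OF that] by (simp add: r_def)
  have brE: "br (?E i) (?E j) = (if j = \<pi> i then sc (m i) ?z else 0)" if ij: "i < ?l" "j < ?l" for i j
  proof (cases "j = \<pi> i")
    case False
    have "dg (bs ! i + bs ! j) \<noteq> 0" using bR ij q_pos by (simp add: dg_add)
    then have "bs ! i + bs ! j \<noteq> 0" using dg_0 by metis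
    then have "bs ! i + bs ! j \<notin> R0" using off[OF ij] False by (auto simp: R0_def)
    then show ?thesis using br_Gw_nonroot[OF E(1)[OF ij(1)] E(1)[OF ij(2)]] False by simp
  qed (use m ij in simp)
  have dec: "x = (\<Sum>i<?l. sc (?c i x) (?E i))" if x: "x \<in> Gr (-1)" for x
  proof -
    note xc = Gr_car[OF x]
    have "x = sum (comp x) R0" by (rule comp(3)[OF xc])
    also have "\<dots> = sum (comp x) (set bs)"
    proof (rule sum.mono_neutral_right[OF finite_R0])
      show "set bs \<subseteq> R0" using bR by (auto simp: in_set_conv_nth R0_def)
      show "\<forall>w\<in>R0 - set bs. comp x w = 0"
      proof
        fix w assume w: "w \<in> R0 - set bs"
        have "dg w \<noteq> - q" using in_bs[of w] w q_pos dg_0 by (auto simp: R0_def)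
        then show "comp x w = 0" using Gr_comp[OF x] by simp
      qed
    qed
    also have "\<dots> = (\<Sum>i<?l. comp x (bs ! i))"
      by (rule sum.reindex_bij_betw[OF bij_betw_nth[OF dist refl refl], symmetric])
    also have "\<dots> = (\<Sum>i<?l. sc (?c i x) (?E i))" using comp_coef[OF bR(1) xc] by (intro sum.cong) auto
    finally show ?thesis .
  qed
  define \<xi> where "\<xi> x i = (if i < ?l then r i * ?c i x else 0)" for x i
  show ?thesis
  proof (rule contact_infinite[OF con trn, where \<xi> = \<xi> and \<zeta> = "coef zb" and u = ?z])
    fix k :: int assume k: "k < -2"
    have "x = 0" if x: "x \<in> Gr k" for x
    proof (rule Gr_eq_0[OF x])
      fix w assume w: "w \<in> R0" "dg w = q * k"
      have "q * k < q * (-2)" using k q_pos by (intro mult_strict_left_mono)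
      then show "comp x w = 0" using w low[of w] dg_0 q_pos by (auto simp: R0_def)
    qed
    then show "Gr k = {0}" by (auto simp: subspace_0[OF subspace_Gr])
  next
    fix a x y assume "x \<in> car P" "y \<in> car P"
    then show "\<xi> (sc a x + y) = (\<lambda>i. a * \<xi> x i + \<xi> y i)" "coef zb (sc a x + y) = a * coef zb x + coef zb y"
      using coef_lin[OF bR(1)] coef_lin[OF zb(1)] by (auto simp: \<xi>_def fun_eq_iff algebra_simps)
  next
    fix x assume x: "x \<in> Gr (-1)"
    show "coef zb x = 0" using Gr_comp[OF x, of zb] zb q_pos coef_0[OF zb(1) Gr_car[OF x]] by simp
  next
    fix x i assume x: "x \<in> Gr (-2)" and i: "i < ?l"
    have "comp x (bs ! i) = 0" using Gr_comp[OF x] bR[OF i] q_pos by simp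
    then show "\<xi> x i = 0" using coef_0[OF bR(1)[OF i] Gr_car[OF x]] by (simp add: \<xi>_def)
  next
    fix v :: "nat \<Rightarrow> complex"
    define x where "x = (\<Sum>i<?l. sc (v i / r i) (?E i))"
    have x: "x \<in> Gr (-1)" unfolding x_def using E(5) subspace_scale[OF subspace_Gr] by (intro subspace_sum[OF subspace_Gr]) auto
    have "\<xi> x j = v j" if j: "j < ?l" for j
    proof -
      have "comp x (bs ! j) = (\<Sum>i<?l. comp (sc (v i / r i) (?E i)) (bs ! j))"
        unfolding x_def using E(3) by (intro comp_sum) auto
      also have "\<dots> = (\<Sum>i<?l. if i = j then sc (v j / r j) (?E j) else 0)"
        using E(3) comp_sc comp_Gw[OF E(1)] j dist by (intro sum.cong) (auto simp: nth_eq_iff_index_eq)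
      also have "\<dots> = sc (v j / r j) (?E j)" using j by simp
      finally have "?c j x = v j / r j" using coef_eqI[OF bR(1)[OF j] Gr_car[OF x]] by blast
      then show ?thesis using j r0 by (simp add: \<xi>_def)
    qed
    then show "\<exists>x\<in>Gr (-1). \<forall>i<?l. \<xi> x i = v i" using x by blast
  next
    fix x assume x: "x \<in> Gr (-1)" and "\<And>i. i < ?l \<Longrightarrow> \<xi> x i = 0"
    then have "?c i x = 0" if "i < ?l" for i using r0 that by (fastforce simp: \<xi>_def)
    then show "x = 0" using dec[OF x] by simp
  next
    show "?z \<in> Gr (-2)" "?z \<in> P False" by (fact Z)+
    show "coef zb ?z = 1" using coef_rv[OF zb(1) zb(1)] by simp
  next
    fix x assume x: "x \<in> Gr (-2)"
    have "x - sc (coef zb x) ?z = 0"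
    proof (rule Gr_eq_0)
      show "x - sc (coef zb x) ?z \<in> Gr (-2)" using x Z(5) by simp
      fix w assume w: "w \<in> R0" "dg w = q * (-2)"
      then have "w = zb" using is_zb[of w] dg_0 q_pos by (auto simp: R0_def)
      have "comp (sc (- coef zb x) ?z + x) zb = sc (- coef zb x) (comp ?z zb) + comp x zb"
        by (rule comp_lin[OF Z(3) Gr_car[OF x]])
      also have "\<dots> = 0" using comp_Gw[OF Z(1), of zb] comp_coef[OF zb(1) Gr_car[OF x]] by simp
      finally have "comp (sc (- coef zb x) ?z + x) zb = 0" .
      moreover have "x - sc (coef zb x) ?z = sc (- coef zb x) ?z + x" by simp
      ultimately show "comp (x - sc (coef zb x) ?z) w = 0" using \<open>w = zb\<close> by (simp only:)
    qed
    then show "x = sc (coef zb x) ?z" by simp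
  next
    show "Gr (-1) \<subseteq> P True"
    proof
      fix x assume x: "x \<in> Gr (-1)"
      have "(\<Sum>i<?l. sc (?c i x) (?E i)) \<in> P True"
        using E(4) subspace_scale[OF subspace_P] by (intro subspace_sum[OF subspace_P]) auto
      then show "x \<in> P True" using dec[OF x] by simp
    qed
  next
    fix x y assume x: "x \<in> Gr (-1)" and y: "y \<in> Gr (-1)"
    have Ey: "br (?E i) y = sc (?c (\<pi> i) y * m i) ?z" if i: "i < ?l" for i
    proof -
      have "br (?E i) y = (\<Sum>j<?l. br (?E i) (sc (?c j y) (?E j)))"
        by (subst dec[OF y], rule br_sum(2)) (use E i in auto)
      also have "\<dots> = (\<Sum>j<?l. if j = \<pi> i then sc (?c (\<pi> i) y * m i) ?z else 0)"
        using brE[OF i] br_sc(2) E(3) i by (intro sum.cong) auto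
      also have "\<dots> = sc (?c (\<pi> i) y * m i) ?z" using pi(1)[OF i] by simp
      finally show ?thesis .
    qed
    have "br x y = (\<Sum>i<?l. br (sc (?c i x) (?E i)) y)"
      by (subst dec[OF x], rule br_sum(1)) (use E Gr_car[OF y] in auto)
    also have "\<dots> = (\<Sum>i<?l. sc (?c i x * (?c (\<pi> i) y * m i)) ?z)"
      using Ey br_sc(1)[OF E(3) Gr_car[OF y]] by (intro sum.cong) auto
    also have "\<dots> = sc (\<Sum>i<?l. ?c i x * (?c (\<pi> i) y * m i)) ?z" by (simp add: scale_sum_left)
    also have "(\<Sum>i<?l. ?c i x * (?c (\<pi> i) y * m i)) = Q (\<xi> x) (\<xi> y)"
      unfolding Q
    proof (rule sum.cong[OF refl])
      fix i assume "i \<in> {..<?l}"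
      then have i: "i < ?l" by simp
      have "\<xi> x i * \<xi> y (\<pi> i) = (r i * r (\<pi> i)) * (?c i x * ?c (\<pi> i) y)" using i pi(1)[OF i] by (simp add: \<xi>_def)
      then show "?c i x * (?c (\<pi> i) y * m i) = \<xi> x i * \<xi> y (pl ! i)" using rr[OF i] by (simp add: \<pi>_def)
    qed
    finally show "br x y = sc (Q (\<xi> x) (\<xi> y)) ?z" .
  qed
qed

end

text \<open>The order follows the iterated \<open>QX\<close>: the self-paired weight -\<delta>
  first, then partners side by side. \<open>odd4\<close> consists of such pairs only.\<close>

definition odd3 :: "(int \<times> int \<times> int) list" where
  "odd3 = [(- 1, 0, 0), (- 1, 1, 0), (- 1, - 1, 0), (- 1, 0, 1), (- 1, 0, - 1), (- 1, 1, 1), (- 1, - 1, - 1)]"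

definition odd4 :: "(int \<times> int \<times> int \<times> int) list" where
  "odd4 = [(- 1, 1, 1, 1), (- 1, - 1, - 1, - 1), (- 1, 1, 1, - 1), (- 1, - 1, - 1, 1),
     (- 1, 1, - 1, 1), (- 1, - 1, 1, - 1), (- 1, 1, - 1, - 1), (- 1, - 1, 1, 1)]"

lemma contact_check3: "contact_check roots3 (dot3 (1, 0, 0)) parity 1 odd3 [0, 2, 1, 4, 3, 6, 5] (- 2, 0, 0)"
  by code_simp

lemma contact_check4: "contact_check roots4 (dot4 (2, 0, 0, 0)) parity 2 odd4 [1, 0, 3, 2, 5, 4, 7, 6] (- 2, 0, 0, 0)"
  by code_simp

text \<open>The degree here is the coordinate at \<epsilon>2, common to the exceptional gradings of
  systems III and IV. The weights are \<epsilon>3 - \<epsilon>1 for \<open>e0\<close> and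
  \<epsilon>1 - \<epsilon>2 for \<open>u0\<close>; their sum is a root, so the two vectors do not
  commute.\<close>

lemma shear_check3: "shear_check roots3 (dot3 (0, 0, 1)) parity 1 (0, - 2, - 1) (0, 1, - 1)"
  by code_simp

text \<open>First the depth-one grading, with -\<delta> for \<open>e0\<close> and -\<epsilon>1 -
  \<epsilon>2 for \<open>u0\<close>. Then the exceptional grading of depth two in systems III to VI,
  with -\<epsilon>1 - \<epsilon>3 and \<epsilon>3 - \<epsilon>2.\<close>

lemma shear_check4:
  "shear_check roots4 (dot4 (1, 1, 0, 0)) parity 2 (- 2, 0, 0, 0) (0, - 2, - 2, 0)"
  "shear_check roots4 (dot4 (0, 1, 1, 0)) parity 2 (0, - 2, 0, - 2) (0, 0, - 2, 2)"
  by code_simp+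

lemma less3: "i < 3 \<longleftrightarrow> i = 0 \<or> i = 1 \<or> i = (2::nat)" and less4: "i < 4 \<longleftrightarrow> i = 0 \<or> i = 1 \<or> i = 2 \<or> i = (3::nat)"
  by auto

lemma Suc_image: "0 \<notin> S \<Longrightarrow> S = Suc ` {i. Suc i \<in> S}"
  by (auto simp: image_iff) (metis not0_implies_Suc)

lemma singleton_Suc: assumes "S = Suc ` S0" shows "S = {Suc e} \<longleftrightarrow> S0 = {e}"
  unfolding assms by (metis image_empty image_insert inj_Suc inj_image_eq_iff)

lemma QX7: "QX 5 (QX 3 (QX 1 (\<lambda>v w. v 0 * w 0))) v w = (\<Sum>i<length odd3. v i * w ([0, 2, 1, 4, 3, 6, 5] ! i))"
proof -
  have "{..<length odd3} = {0, 1, 2, 3, 4, 5, 6}" unfolding odd3_def by auto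
  then show ?thesis by (simp add: QX_def numeral_2_eq_2)
qed

lemma QX8: "QX 6 (QX 4 (QX 2 (QX 0 (\<lambda>v w. 0)))) v w = (\<Sum>i<length odd4. v i * w ([1, 0, 3, 2, 5, 4, 7, 6] ! i))"
proof -
  have "{..<length odd4} = {0, 1, 2, 3, 4, 5, 6, 7}" unfolding odd4_def by auto
  then show ?thesis by (simp add: QX_def)
qed

section \<open>Assembly of the two cases G(3) and F(4)\<close>

lemma simple_root3: assumes "\<Xi> \<in> {1, 2, 3, 4}" "i < 3"
  shows "fnl \<delta> \<epsilon> (simple_root G3 \<Xi> (Suc i)) H = Phi3 \<delta> \<epsilon> (simple3 \<Xi> ! i) H"
proof -
  have i: "i = 0 \<or> i = 1 \<or> i = 2" using assms(2) by auto
  from assms(1) consider "\<Xi> = 1" | "\<Xi> = 2" | "\<Xi> = 3" | "\<Xi> = 4" by auto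
  then show ?thesis
    by (cases; use i in \<open>elim disjE\<close>; simp add: simple_root_def simple_roots_def fnl_def cv_def Phi3_def simple3_def)
qed

lemma main_G3:
  assumes alg: "is_alg G3 sc P br h \<delta> \<epsilon>" and Xi: "\<Xi> \<in> {1, 2, 3, 4}" and S: "S \<subseteq> {1, 2, 3}" "S \<noteq> {}"
  shows "(\<not> exceptional G3 \<Xi> S \<longrightarrow> pr_equals TYPE('w::ab_group_add) sc P br (grading G3 sc P br h \<delta> \<epsilon> \<Xi> S)) \<and>
         (exceptional G3 \<Xi> S \<longrightarrow> pr_infinite sc P br (grading G3 sc P br h \<delta> \<epsilon> \<Xi> S) \<and>
            pr0_equals TYPE('w::ab_group_add) sc P br (grading G3 sc P br h \<delta> \<epsilon> \<Xi> S))"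
proof -
  define S0 where "S0 = {i. Suc i \<in> S}"
  have S0: "S = Suc ` S0" unfolding S0_def by (rule Suc_image) (use S in auto)
  have len: "length (simple3 \<Xi>) = 3" by (simp add: simple3_def)
  have bor: "borel sc P br h (Phi3 \<delta> \<epsilon>) (set roots3) parity form3 (simple3 \<Xi>) (pos3 \<Xi>) (co3 \<Xi>) 1"
    by (rule borelI[OF G3_facts(1)[OF alg] G3_facts(4)[OF alg] co3_add _ borel_check3[OF Xi, unfolded rt3_fun]]) auto
  interpret parabolic sc P br h "Phi3 \<delta> \<epsilon>" "set roots3" parity form3 "simple3 \<Xi>" "pos3 \<Xi>" "co3 \<Xi>" 1 S0
  proof (rule parabolic.intro[OF bor], unfold_locales)
    show "S0 \<subseteq> {..<length (simple3 \<Xi>)}" using S unfolding len S0_def by auto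
    show "S0 \<noteq> {}" using S S0 by auto
  qed
  have gr: "grading G3 sc P br h \<delta> \<epsilon> \<Xi> S = Gr"
  proof (rule grading_eq[OF G3_facts(2)[OF alg] G3_facts(3)[OF alg] _ _ S0])
    show "Nset G3 = Suc ` {..<length (simple3 \<Xi>)}" unfolding len Nset_def by (auto simp: image_iff lessThan_def less3)
    show "fnl \<delta> \<epsilon> (simple_root G3 \<Xi> (Suc i)) H = Phi3 \<delta> \<epsilon> (simple3 \<Xi> ! i) H" if "i < length (simple3 \<Xi>)" for i H
      using that unfolding len by (rule simple_root3[OF Xi])
  qed
  have rooted: "rooted sc P br h (Phi3 \<delta> \<epsilon>) (set roots3) parity" by (rule rooted_axioms)
  have spans: "H = 0" if "spans3 K" "H \<in> h" "\<And>\<gamma>. \<gamma> \<in> set K \<Longrightarrow> Phi3 \<delta> \<epsilon> \<gamma> H = 0" for K H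
    using spans3_sound[OF rooted that] .
  have e1: "S = {Suc 0} \<longleftrightarrow> S0 = {0}" by (rule singleton_Suc[OF S0])
  have ex: "exceptional G3 \<Xi> S \<longleftrightarrow> (\<exists>e\<in>set (exc3 \<Xi>). S0 = {e})"
  proof -
    from Xi consider "\<Xi> = 1" | "\<Xi> = 2" | "\<Xi> = 3" | "\<Xi> = 4" by auto
    then show ?thesis by cases (simp_all add: exceptional_def exc3_def e1)
  qed
  have p1: "pr_equals TYPE('w) sc P br Gr" if ne: "\<forall>e\<in>set (exc3 \<Xi>). S0 \<noteq> {e}"
  proof (rule prolongation(1)[OF all_certified3[OF Xi, unfolded rt3_fun]])
    show "H = 0" if "spans3 K" "H \<in> h" "\<And>\<gamma>. \<gamma> \<in> set K \<Longrightarrow> Phi3 \<delta> \<epsilon> \<gamma> H = 0" for K H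
      using spans[OF that(1,2)] that(3) by blast
    show "inner \<mu> Neg E" if "\<mu> \<in> set []" "wder \<mu> Neg E" for \<mu> E using that by simp
  qed (rule ne)
  have p2: "pr0_equals TYPE('w) sc P br Gr"
  proof (rule prolongation(2)[OF all_certified3[OF Xi, unfolded rt3_fun]])
    show "H = 0" if "spans3 K" "H \<in> h" "\<And>\<gamma>. \<gamma> \<in> set K \<Longrightarrow> Phi3 \<delta> \<epsilon> \<gamma> H = 0" for K H
      using spans[OF that(1,2)] that(3) by blast
    show "inner \<mu> Neg E" if "\<mu> \<in> set []" "wder \<mu> Neg E" for \<mu> E using that by simp
  qed
  have "pr_infinite sc P br Gr" if exc: "exceptional G3 \<Xi> S"
  proof -
    obtain e where e: "e \<in> set (exc3 \<Xi>)" "S0 = {e}" using exc ex by blast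
    have "e = 0" using e(1) by (simp add: exc3_def split: if_splits)
    then have S1: "S0 = {0}" using e(2) by simp
    have dg: "dg = co3 \<Xi> 0" by (rule ext, subst dg_def) (simp add: S1)
    have co3e: "co3 \<Xi> 0 = dot3 (coord3 \<Xi> ! 0)" by (rule ext) (simp only: co3_def)
    show ?thesis
    proof (cases "\<Xi> = 1")
      case True
      obtain sc' :: "complex \<Rightarrow> (complex poly \<times> complex poly) ext ext ext \<Rightarrow> _" and br' \<sigma> D z \<Psi> \<iota> where
        c: "contact sc' br' \<sigma> D z 7 \<Psi> (QX 5 (QX 3 (QX 1 (\<lambda>v w. v 0 * w 0)))) \<iota>" "transitive_gr br' (deg_space sc' D)"
        using contact_odd by blast
      have l: "7 = length odd3" by (simp add: odd3_def)
      have "dg = dot3 (1, 0, 0)" unfolding dg co3e by (simp add: True coord3_def)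
      then show ?thesis
        using contact_check_infinite[OF c(1)[unfolded l] c(2) refl _ QX7] contact_check3 by simp
    next
      case False
      have "\<Xi> \<noteq> 2" using e(1) by (auto simp: exc3_def)
      with False have "dg = dot3 (0, 0, 1)" unfolding dg co3e by (simp add: coord3_def)
      then show ?thesis using shear_check_infinite[OF refl] shear_check3 by simp
    qed
  qed
  then show ?thesis unfolding gr using p1 p2 ex by blast
qed

lemma simple_root4: assumes "\<Xi> \<in> {1, 2, 3, 4, 5, 6}" "i < 4"
  shows "fnl \<delta> \<epsilon> (simple_root F4 \<Xi> (Suc i)) H = Phi4 \<delta> \<epsilon> (simple4 \<Xi> ! i) H"
proof -
  have i: "i = 0 \<or> i = 1 \<or> i = 2 \<or> i = 3" using assms(2) by auto
  from assms(1) consider "\<Xi> = 1" | "\<Xi> = 2" | "\<Xi> = 3" | "\<Xi> = 4" | "\<Xi> = 5" | "\<Xi> = 6" by auto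
  then show ?thesis
    by (cases; use i in \<open>elim disjE\<close>; simp add: simple_root_def simple_roots_def fnl_def cv_def Phi4_def simple4_def Let_def add_divide_distrib diff_divide_distrib)
qed

lemma main_F4:
  assumes alg: "is_alg F4 sc P br h \<delta> \<epsilon>" and Xi: "\<Xi> \<in> {1, 2, 3, 4, 5, 6}" and S: "S \<subseteq> {1, 2, 3, 4}" "S \<noteq> {}"
  shows "(\<not> exceptional F4 \<Xi> S \<longrightarrow> pr_equals TYPE('w::ab_group_add) sc P br (grading F4 sc P br h \<delta> \<epsilon> \<Xi> S)) \<and>
         (exceptional F4 \<Xi> S \<longrightarrow> pr_infinite sc P br (grading F4 sc P br h \<delta> \<epsilon> \<Xi> S) \<and>
            pr0_equals TYPE('w::ab_group_add) sc P br (grading F4 sc P br h \<delta> \<epsilon> \<Xi> S))"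
proof -
  define S0 where "S0 = {i. Suc i \<in> S}"
  have S0: "S = Suc ` S0" unfolding S0_def by (rule Suc_image) (use S in auto)
  have len: "length (simple4 \<Xi>) = 4" by (simp add: simple4_def)
  have bor: "borel sc P br h (Phi4 \<delta> \<epsilon>) (set roots4) parity form4 (simple4 \<Xi>) (pos4 \<Xi>) (co4 \<Xi>) 2"
    by (rule borelI[OF F4_facts(1)[OF alg] F4_facts(4)[OF alg] co4_add _ borel_check4[OF Xi, unfolded rt4_fun]]) auto
  interpret parabolic sc P br h "Phi4 \<delta> \<epsilon>" "set roots4" parity form4 "simple4 \<Xi>" "pos4 \<Xi>" "co4 \<Xi>" 2 S0
  proof (rule parabolic.intro[OF bor], unfold_locales)
    show "S0 \<subseteq> {..<length (simple4 \<Xi>)}" using S unfolding len S0_def by auto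
    show "S0 \<noteq> {}" using S S0 by auto
  qed
  have gr: "grading F4 sc P br h \<delta> \<epsilon> \<Xi> S = Gr"
  proof (rule grading_eq[OF F4_facts(2)[OF alg] F4_facts(3)[OF alg] _ _ S0])
    show "Nset F4 = Suc ` {..<length (simple4 \<Xi>)}" unfolding len Nset_def by (auto simp: image_iff lessThan_def less4)
    show "fnl \<delta> \<epsilon> (simple_root F4 \<Xi> (Suc i)) H = Phi4 \<delta> \<epsilon> (simple4 \<Xi> ! i) H" if "i < length (simple4 \<Xi>)" for i H
      using that unfolding len by (rule simple_root4[OF Xi])
  qed
  have rooted: "rooted sc P br h (Phi4 \<delta> \<epsilon>) (set roots4) parity" by (rule rooted_axioms)
  have spans: "H = 0" if "spans4 K" "H \<in> h" "\<And>\<gamma>. \<gamma> \<in> set K \<Longrightarrow> Phi4 \<delta> \<epsilon> \<gamma> H = 0" for K H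
    using spans4_sound[OF rooted that] .
  have R0i: "w \<in> R0 \<longleftrightarrow> w = 0 \<or> rt4 w" for w by (simp add: R0_def rt4_iff)
  have special: "inner \<mu> Neg E" if mu: "\<mu> \<in> set (special4 \<Xi>)" and E: "wder \<mu> Neg E" for \<mu> E
  proof -
    have X5: "\<Xi> = 5" and m: "\<mu> = (0, - 2, 2, 2)" using mu by (auto simp: special4_def split: if_splits)
    have sr: "simple4 \<Xi> = [(2, 0, 0, 0), (- 1, 1, - 1, - 1), (0, 0, 0, 2), (0, 0, 2, - 2)]" by (simp add: X5 simple4_def)
    \<comment> \<open>The even simple roots \<epsilon>3 and \<epsilon>2 - \<epsilon>3 generate a B2,
      in which \<epsilon>2 - \<epsilon>3 plus three times \<epsilon>3 is not a root; this is the
      Serre relation used.\<close>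
    show ?thesis
    proof (rule serre_inner[OF E, of "(0, 0, 0, 2)" "(0, 0, 2, - 2)"])
      show "\<mu> - \<alpha> \<notin> R0" if "\<alpha> \<in> set (simple4 \<Xi>)" "\<alpha> \<noteq> (0, 0, 0, 2)" for \<alpha>
        using that unfolding sr R0i m by (auto simp: zero_prod_def)
    qed (simp_all add: sr m R0i parity_def zero_prod_def flip: rt4_iff)
  qed
  have e1: "S = {Suc 0} \<longleftrightarrow> S0 = {0}" "S = {3} \<longleftrightarrow> S0 = {2}" "S = {4} \<longleftrightarrow> S0 = {3}"
    using singleton_Suc[OF S0, of 0] singleton_Suc[OF S0, of 2] singleton_Suc[OF S0, of 3] by simp_all
  have ex: "exceptional F4 \<Xi> S \<longleftrightarrow> (\<exists>e\<in>set (exc4 \<Xi>). S0 = {e})"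
  proof -
    from Xi consider "\<Xi> = 1" | "\<Xi> = 2" | "\<Xi> = 3" | "\<Xi> = 4" | "\<Xi> = 5" | "\<Xi> = 6" by auto
    then show ?thesis by cases (simp_all add: exceptional_def exc4_def e1)
  qed
  have p1: "pr_equals TYPE('w) sc P br Gr" if ne: "\<forall>e\<in>set (exc4 \<Xi>). S0 \<noteq> {e}"
  proof (rule prolongation(1)[OF all_certified4[OF Xi, unfolded rt4_fun]])
    show "H = 0" if "spans4 K" "H \<in> h" "\<And>\<gamma>. \<gamma> \<in> set K \<Longrightarrow> Phi4 \<delta> \<epsilon> \<gamma> H = 0" for K H
      using spans[OF that(1,2)] that(3) by blast
    show "inner \<mu> Neg E" if "\<mu> \<in> set (special4 \<Xi>)" "wder \<mu> Neg E" for \<mu> E using special that by blast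
  qed (rule ne)
  have p2: "pr0_equals TYPE('w) sc P br Gr"
  proof (rule prolongation(2)[OF all_certified4[OF Xi, unfolded rt4_fun]])
    show "H = 0" if "spans4 K" "H \<in> h" "\<And>\<gamma>. \<gamma> \<in> set K \<Longrightarrow> Phi4 \<delta> \<epsilon> \<gamma> H = 0" for K H
      using spans[OF that(1,2)] that(3) by blast
    show "inner \<mu> Neg E" if "\<mu> \<in> set (special4 \<Xi>)" "wder \<mu> Neg E" for \<mu> E using special that by blast
  qed
  have "pr_infinite sc P br Gr" if exc: "exceptional F4 \<Xi> S"
  proof -
    obtain e where e: "e \<in> set (exc4 \<Xi>)" "S0 = {e}" using exc ex by blast
    have dg: "dg = co4 \<Xi> e" by (rule ext, subst dg_def) (simp add: e(2))
    have co4e: "co4 \<Xi> e = dot4 (coord4 \<Xi> ! e)" by (rule ext) (simp only: co4_def)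
    from Xi consider "\<Xi> = 1" | "\<Xi> = 2" | "\<Xi> = 3" | "\<Xi> = 4" | "\<Xi> = 5" | "\<Xi> = 6" by auto
    \<comment> \<open>The ten exceptional pairs share only three degree functionals: the odd contact
      grading, the depth-one grading and the depth-two grading of
      \<open>shear_check4\<close>.\<close>
    then have "coord4 \<Xi> ! e = (2, 0, 0, 0) \<or> coord4 \<Xi> ! e = (1, 1, 0, 0) \<or> coord4 \<Xi> ! e = (0, 1, 1, 0)"
      by cases (use e(1) in \<open>auto simp: exc4_def coord4_def\<close>)
    then have "dg = dot4 (2, 0, 0, 0) \<or> dg = dot4 (1, 1, 0, 0) \<or> dg = dot4 (0, 1, 1, 0)"
      unfolding dg co4e by (elim disjE) (simp_all only: simp_thms)
    then show ?thesis
    proof (elim disjE)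
      assume "dg = dot4 (2, 0, 0, 0)"
      obtain sc' :: "complex \<Rightarrow> complex poly ext ext ext ext \<Rightarrow> _" and br' \<sigma> D z \<Psi> \<iota> where
        c: "contact sc' br' \<sigma> D z 8 \<Psi> (QX 6 (QX 4 (QX 2 (QX 0 (\<lambda>v w. 0))))) \<iota>" "transitive_gr br' (deg_space sc' D)"
        using contact_even by blast
      have l: "8 = length odd4" by (simp add: odd4_def)
      show ?thesis
        using \<open>dg = dot4 (2, 0, 0, 0)\<close> contact_check_infinite[OF c(1)[unfolded l] c(2) refl _ QX8] contact_check4 by simp
    next
      assume "dg = dot4 (1, 1, 0, 0)"
      then show ?thesis using shear_check_infinite[OF refl] shear_check4(1) by simp
    next
      assume "dg = dot4 (0, 1, 1, 0)"
      then show ?thesis using shear_check_infinite[OF refl] shear_check4(2) by simp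
    qed
  qed
  then show ?thesis unfolding gr using p1 p2 ex by blast
qed

theorem theorem1p1:
  fixes T :: algtype and \<Xi> :: nat and S :: "nat set"
    and sc :: "complex \<Rightarrow> 'v::ab_group_add \<Rightarrow> 'v" and P :: "bool \<Rightarrow> 'v set"
    and br :: "'v \<Rightarrow> 'v \<Rightarrow> 'v" and h :: "'v set"
    and \<delta> :: "'v \<Rightarrow> complex" and \<epsilon> :: "nat \<Rightarrow> 'v \<Rightarrow> complex"
  assumes "is_alg T sc P br h \<delta> \<epsilon>"
    and "\<Xi> \<in> Xis T" and "S \<subseteq> Nset T" and "S \<noteq> {}"
  shows "(\<not> exceptional T \<Xi> S \<longrightarrow>
            pr_equals TYPE('w::ab_group_add) sc P br (grading T sc P br h \<delta> \<epsilon> \<Xi> S)) \<and>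
         (exceptional T \<Xi> S \<longrightarrow>
            pr_infinite sc P br (grading T sc P br h \<delta> \<epsilon> \<Xi> S) \<and>
            pr0_equals TYPE('w::ab_group_add) sc P br (grading T sc P br h \<delta> \<epsilon> \<Xi> S))"
proof (cases T)
  case G3
  show ?thesis unfolding G3
    by (rule main_G3) (use assms G3 in \<open>auto simp: Xis_def Nset_def\<close>)
next
  case F4
  show ?thesis unfolding F4
    by (rule main_F4) (use assms F4 in \<open>auto simp: Xis_def Nset_def\<close>)
qed

end
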